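(* Let $k$ be a field, let $B=kQ/I$ be a bound quiver algebra, let $F$ be a set of new arrows with no relative cycles, and let $B_F=kQ_F/\langle I\rangle_{kQ_F}$. Let $\Delta=\dim_k HH^1(B_F)-\dim_k HH^1(B)$. Then $$\Delta=\dim_k ZB_F-\dim_k ZB+\sum_{(a,\omega)\in F/\!/W_*}\dim_k\omega+\sum_{\gamma\in R_*}\dim_k\gamma\,\Bigl(\dim_k\mathrm{Ext}^1_B(I_{s(\gamma)},P_{t(\gamma)})-\dim_k\mathrm{Hom}_B(I_{s(\gamma)},P_{t(\gamma)})\Bigr).$$
   Context: A quiver $Q$ has a finite set of vertices $Q_0$, a finite set of arrows $Q_1$, and source and target maps $s,t:Q_1\to Q_0$. A path of length $n>0$ is a sequence of arrows $(a_n,\dots,a_1)$ with $s(a_{i+1})=t(a_i)$; its source is $s(a_1)$ and its target is $t(a_n)$; vertices are the paths of length $0$. $Q_n$ is the set of paths of length $n$. In the path algebra $kQ$ the product $\beta\alpha$ of two paths is their concatenation if $t(\alpha)=s(\beta)$, and $0$ otherwise; vertices are orthogonal idempotents. A bound quiver algebra is $B=kQ/I$ with $I$ a two-sided ideal which is admissible, i.e. $\langle Q_n\rangle\subset I\subset\langle Q_2\rangle$ for some $n\ge 2$. A set of new arrows is a finite set $F$ with two maps $s,t:F\to Q_0$. The quiver $Q_F$ has vertices $Q_0$ and arrows $Q_1\sqcup F$, with the evident source and target maps; $\langle I\rangle_{kQ_F}$ is the two-sided ideal of $kQ_F$ generated by $I$. A relative path of length $n>0$ is a sequence $\gamma=(a_n,\dots,a_1)$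 of elements of $F$ such that $s(a_{i+1})\,B\,t(a_i)\neq 0$ for $i=1,\dots,n-1$; put $s(\gamma)=s(a_1)$, $t(\gamma)=t(a_n)$, and $\dim_k\gamma=\prod_{i=1}^{n-1}\dim_k s(a_{i+1})Bt(a_i)$ (equal to $1$ if $n=1$). $R_*$ is the set of all relative paths of length $n>0$. A relative cycle is a relative path $\gamma$ with $s(\gamma)\,B\,t(\gamma)\neq 0$. An extended relative path of length $n>0$ is a triple $\omega=(y,\gamma,x)$ with $x,y\in Q_0$ and $\gamma$ a relative path of length $n$ such that $yBt(\gamma)\neq0$ and $s(\gamma)Bx\neq 0$; put $t(\omega)=y$, $s(\omega)=x$ and $\dim_k\omega=(\dim_k yBt(\gamma))(\dim_k\gamma)(\dim_k s(\gamma)Bx)$. An extended relative path of length $0$ is a pair $\omega=(y,x)$ of vertices with $yBx\ne0$; put $t(\omega)=y$, $s(\omega)=x$, $\dim_k\omega=\dim_k yBx$. $W_*$ is the set of all extended relative paths of length $n\ge0$, and $F/\!/W_*$ is the set of pairs $(a,\omega)\in F\times W_*$ with $s(a)=s(\omega)$ and $t(a)=t(\omega)$. $HH^1(A)=H^1(A,A)$ is the first Hochschild cohomology, $ZA$ is the center of $A$. For $x\in Q_0$, $P_x=Bx$ and $I_x=\mathrm{Hom}_k(xB,k)$ are respectively the projective cover and the injective envelope of the simple left $B$-module at $x$. *)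

theory Defs
  imports
    "HOL-Algebra.QuotRing"
    "Graph_Theory.Arc_Walk"
    "Jordan_Normal_Form.VS_Connect"
begin

text \<open>
  The ground field is the type \<open>'k::field\<close>, seen as the record \<open>class_ring\<close>. An associative algebra
  over it is a \<^typ>\<open>('k, 'b) module\<close> record whose multiplication and unit are meaningful; a plain vector
  space is such a record with irrelevant multiplication and unit. A left module over an algebra \<open>B\<close>
  with elements in \<open>'b\<close> is a \<^typ>\<open>('b, 'x) module\<close> record. Functions with a set as domain are
  extensional (\<open>undefined\<close> outside), so that equality of such functions is equality on the domain.
\<close>

section \<open>Linear algebra\<close>

text \<open>The library dimension is a natural number, meaningful for finite-dimensional spaces.\<close>
definition kdim :: "('k::field, 'x, 'm) module_scheme \<Rightarrow> nat" where
  "kdim V = vectorspace.dim class_ring V"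

text \<open>Quotient of an algebra by a two-sided ideal, or of a vector space by a subspace.\<close>
definition quot_mod :: "('k, 'x, 'm) module_scheme \<Rightarrow> 'x set \<Rightarrow> ('k, 'x set) module" where
  "quot_mod V W =
    \<lparr>carrier = carrier (V Quot W), mult = mult (V Quot W), one = one (V Quot W),
     zero = zero (V Quot W), add = add (V Quot W),
     smult = (\<lambda>c X. \<Union>x\<in>X. W +>\<^bsub>V\<^esub> (c \<odot>\<^bsub>V\<^esub> x))\<rparr>"

definition fun_space :: "'s set \<Rightarrow> ('k, 'y, 'm) module_scheme \<Rightarrow> ('k, 's \<Rightarrow> 'y) module" where
  "fun_space S V =
    \<lparr>carrier = S \<rightarrow>\<^sub>E carrier V, mult = undefined, one = undefined,
     zero = (\<lambda>x\<in>S. \<zero>\<^bsub>V\<^esub>), add = (\<lambda>f g. \<lambda>x\<in>S. f x \<oplus>\<^bsub>V\<^esub> g x),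
     smult = (\<lambda>c f. \<lambda>x\<in>S. c \<odot>\<^bsub>V\<^esub> f x)\<rparr>"

text \<open>\<open>R\<close>-linear maps; used both for the ground field and for a noncommutative algebra \<open>R\<close>.\<close>
definition lin_maps ::
  "('r, 'm) ring_scheme \<Rightarrow> ('r, 'x, 'm1) module_scheme \<Rightarrow> ('r, 'y, 'm2) module_scheme \<Rightarrow> ('x \<Rightarrow> 'y) set" where
  "lin_maps R X Y = module_hom R X Y \<inter> extensional (carrier X)"

definition ground_space :: "('k::field, 'k) module" where
  "ground_space = \<lparr>carrier = UNIV, mult = (*), one = 1, zero = 0, add = (+), smult = (*)\<rparr>"

section \<open>Homological algebra of an algebra\<close>

definition alg_center :: "('k, 'b) module \<Rightarrow> ('k, 'b) module" where
  "alg_center A = A\<lparr>carrier := {z \<in> carrier A. \<forall>a\<in>carrier A. z \<otimes>\<^bsub>A\<^esub> a = a \<otimes>\<^bsub>A\<^esub> z}\<rparr>"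

text \<open>The differentials of the Hochschild complex \<open>A \<rightarrow> Hom\<^sub>k(A, A) \<rightarrow> Hom\<^sub>k(A \<otimes> A, A)\<close>.\<close>
definition hoch_d0 :: "('k, 'b) module \<Rightarrow> 'b \<Rightarrow> 'b \<Rightarrow> 'b" where
  "hoch_d0 A a = (\<lambda>x\<in>carrier A. (x \<otimes>\<^bsub>A\<^esub> a) \<ominus>\<^bsub>A\<^esub> (a \<otimes>\<^bsub>A\<^esub> x))"

definition hoch_d1 :: "('k, 'b) module \<Rightarrow> ('b \<Rightarrow> 'b) \<Rightarrow> 'b \<Rightarrow> 'b \<Rightarrow> 'b" where
  "hoch_d1 A f x y = ((x \<otimes>\<^bsub>A\<^esub> f y) \<ominus>\<^bsub>A\<^esub> f (x \<otimes>\<^bsub>A\<^esub> y)) \<oplus>\<^bsub>A\<^esub> (f x \<otimes>\<^bsub>A\<^esub> y)"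

definition hoch_Z1 :: "('k::field, 'b) module \<Rightarrow> ('b \<Rightarrow> 'b) set" where
  "hoch_Z1 A = {f \<in> lin_maps class_ring A A. \<forall>x\<in>carrier A. \<forall>y\<in>carrier A. hoch_d1 A f x y = \<zero>\<^bsub>A\<^esub>}"

definition HH1 :: "('k::field, 'b) module \<Rightarrow> ('k, ('b \<Rightarrow> 'b) set) module" where
  "HH1 A = quot_mod ((fun_space (carrier A) A)\<lparr>carrier := hoch_Z1 A\<rparr>) (hoch_d0 A ` carrier A)"

definition underlying_space :: "('k, 'b) module \<Rightarrow> ('b, 'x) module \<Rightarrow> ('k, 'x) module" where
  "underlying_space B X =
    \<lparr>carrier = carrier X, mult = undefined, one = undefined, zero = \<zero>\<^bsub>X\<^esub>, add = add X,
     smult = (\<lambda>c x. (c \<odot>\<^bsub>B\<^esub> \<one>\<^bsub>B\<^esub>) \<odot>\<^bsub>X\<^esub> x)\<rparr>"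

definition Hom_space ::
  "('k, 'b) module \<Rightarrow> ('b, 'x) module \<Rightarrow> ('b, 'y) module \<Rightarrow> ('k, 'x \<Rightarrow> 'y) module" where
  "Hom_space B X Y = (fun_space (carrier X) (underlying_space B Y))\<lparr>carrier := lin_maps B X Y\<rparr>"

text \<open>
  \<open>Ext\<^sup>1\<^sub>B(X, Y)\<close> is the first cohomology of \<open>Hom\<^sub>B(P\<^sub>\<bullet>, Y)\<close> for the canonical free resolution \<open>P\<^sub>\<bullet>\<close> of \<open>X\<close>:
  \<open>P\<^sub>0\<close> is the free module on the set \<open>X\<close> and \<open>P\<^sub>i\<^sub>+\<^sub>1\<close> is the free module on the kernel of the previous map.
\<close>
definition free_mod :: "('k, 'b) module \<Rightarrow> 's set \<Rightarrow> ('b, 's \<Rightarrow> 'b) module" where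
  "free_mod B S =
    \<lparr>carrier = {f \<in> S \<rightarrow>\<^sub>E carrier B. finite {s \<in> S. f s \<noteq> \<zero>\<^bsub>B\<^esub>}}, mult = undefined, one = undefined,
     zero = (\<lambda>s\<in>S. \<zero>\<^bsub>B\<^esub>), add = (\<lambda>f g. \<lambda>s\<in>S. f s \<oplus>\<^bsub>B\<^esub> g s),
     smult = (\<lambda>b f. \<lambda>s\<in>S. b \<otimes>\<^bsub>B\<^esub> f s)\<rparr>"

text \<open>The canonical surjection from the free module on the set \<open>X\<close> onto the module \<open>X\<close>, and its kernel.\<close>
definition free_ev :: "('k, 'b) module \<Rightarrow> ('b, 'x) module \<Rightarrow> ('x \<Rightarrow> 'b) \<Rightarrow> 'x" where
  "free_ev B X f = (\<Oplus>\<^bsub>X\<^esub>x\<in>{x \<in> carrier X. f x \<noteq> \<zero>\<^bsub>B\<^esub>}. f x \<odot>\<^bsub>X\<^esub> x)"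

definition syzygy :: "('k, 'b) module \<Rightarrow> ('b, 'x) module \<Rightarrow> ('b, 'x \<Rightarrow> 'b) module" where
  "syzygy B X = (free_mod B (carrier X))
     \<lparr>carrier := {f \<in> carrier (free_mod B (carrier X)). free_ev B X f = \<zero>\<^bsub>X\<^esub>}\<rparr>"

definition Ext1 ::
  "('k, 'b) module \<Rightarrow> ('b, 'x) module \<Rightarrow> ('b, 'y) module \<Rightarrow> ('k, ((('x \<Rightarrow> 'b) \<Rightarrow> 'b) \<Rightarrow> 'y) set) module" where
  "Ext1 B X Y =
    (let P0 = free_mod B (carrier X);
         P1 = free_mod B (carrier (syzygy B X));
         P2 = free_mod B (carrier (syzygy B (syzygy B X)));
         d1 = free_ev B (syzygy B X);
         d2 = free_ev B (syzygy B (syzygy B X));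
         Z = {f \<in> lin_maps B P1 Y. \<forall>p\<in>carrier P2. f (d2 p) = \<zero>\<^bsub>Y\<^esub>};
         N = (\<lambda>g. \<lambda>p\<in>carrier P1. g (d1 p)) ` lin_maps B P0 Y
     in quot_mod ((Hom_space B P1 Y)\<lparr>carrier := Z\<rparr>) N)"

section \<open>Bound quiver algebras\<close>

text \<open>
  A quiver is a finite directed multigraph (\<^const>\<open>fin_digraph\<close>). The path \<open>(a\<^sub>n, \<dots>, a\<^sub>1)\<close> from \<open>u\<close> to
  \<open>v\<close> is the triple \<open>(u, [a\<^sub>1, \<dots>, a\<^sub>n], v)\<close>, arrows being listed in the order in which they are
  traversed; the vertex \<open>x\<close> is \<open>(x, [], x)\<close>.
\<close>
type_synonym ('v, 'a) path = "'v \<times> 'a list \<times> 'v"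

definition paths :: "('v, 'a) pre_digraph \<Rightarrow> ('v, 'a) path set" where
  "paths Q = {(u, p, v). pre_digraph.awalk Q u p v}"

definition paths_of_length :: "('v, 'a) pre_digraph \<Rightarrow> nat \<Rightarrow> ('v, 'a) path set" where
  "paths_of_length Q n = {(u, p, v). (u, p, v) \<in> paths Q \<and> length p = n}"

definition path_elem :: "('v, 'a) path \<Rightarrow> ('v, 'a) path \<Rightarrow> 'k::field" where
  "path_elem p = (\<lambda>r. if r = p then 1 else 0)"

text \<open>Elements are finitely supported functions on paths; in a product the right factor is traversed first.\<close>
definition path_alg :: "('v, 'a) pre_digraph \<Rightarrow> ('k::field, ('v, 'a) path \<Rightarrow> 'k) module" where
  "path_alg Q =
    \<lparr>carrier = {f. finite {r. f r \<noteq> 0} \<and> {r. f r \<noteq> 0} \<subseteq> paths Q},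
     mult = (\<lambda>f g. \<lambda>(u, r, w).
       \<Sum>(v, p, q)\<in>{(v, p, q). (u, p, v) \<in> paths Q \<and> (v, q, w) \<in> paths Q \<and> p @ q = r}.
         f (v, q, w) * g (u, p, v)),
     one = (\<lambda>r. if r \<in> paths_of_length Q 0 then 1 else 0),
     zero = (\<lambda>r. 0),
     add = (\<lambda>f g r. f r + g r),
     smult = (\<lambda>c f r. c * f r)\<rparr>"

definition path_ideal :: "('v, 'a) pre_digraph \<Rightarrow> nat \<Rightarrow> (('v, 'a) path \<Rightarrow> 'k::field) set" where
  "path_ideal Q n = genideal (path_alg Q) (path_elem ` paths_of_length Q n)"

definition admissible :: "('v, 'a) pre_digraph \<Rightarrow> (('v, 'a) path \<Rightarrow> 'k::field) set \<Rightarrow> bool" where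
  "admissible Q I \<longleftrightarrow>
     ideal I (path_alg Q) \<and> (\<exists>n\<ge>2. path_ideal Q n \<subseteq> I \<and> I \<subseteq> path_ideal Q 2)"

definition bound_alg ::
  "('v, 'a) pre_digraph \<Rightarrow> (('v, 'a) path \<Rightarrow> 'k::field) set \<Rightarrow> ('k, (('v, 'a) path \<Rightarrow> 'k) set) module" where
  "bound_alg Q I = quot_mod (path_alg Q) I"

text \<open>The idempotent of \<open>kQ/I\<close> given by a vertex.\<close>
definition idem ::
  "('v, 'a) pre_digraph \<Rightarrow> (('v, 'a) path \<Rightarrow> 'k::field) set \<Rightarrow> 'v \<Rightarrow> (('v, 'a) path \<Rightarrow> 'k) set" where
  "idem Q I x = I +>\<^bsub>path_alg Q\<^esub> path_elem (x, [], x)"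

text \<open>The vector space \<open>yBx\<close> for \<open>B = kQ/I\<close>.\<close>
definition peirce ::
  "('v, 'a) pre_digraph \<Rightarrow> (('v, 'a) path \<Rightarrow> 'k::field) set \<Rightarrow> 'v \<Rightarrow> 'v
    \<Rightarrow> ('k, (('v, 'a) path \<Rightarrow> 'k) set) module" where
  "peirce Q I y x =
    (let B = bound_alg Q I
     in B\<lparr>carrier := {idem Q I y \<otimes>\<^bsub>B\<^esub> b \<otimes>\<^bsub>B\<^esub> idem Q I x | b. b \<in> carrier B}\<rparr>)"

definition peirce_nonzero ::
  "('v, 'a) pre_digraph \<Rightarrow> (('v, 'a) path \<Rightarrow> 'k::field) set \<Rightarrow> 'v \<Rightarrow> 'v \<Rightarrow> bool" where
  "peirce_nonzero Q I y x \<longleftrightarrow> carrier (peirce Q I y x) \<noteq> {\<zero>\<^bsub>bound_alg Q I\<^esub>}"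

text \<open>The left module \<open>P\<^sub>x = Bx\<close>.\<close>
definition proj_mod ::
  "('v, 'a) pre_digraph \<Rightarrow> (('v, 'a) path \<Rightarrow> 'k::field) set \<Rightarrow> 'v
    \<Rightarrow> ((('v, 'a) path \<Rightarrow> 'k) set, (('v, 'a) path \<Rightarrow> 'k) set) module" where
  "proj_mod Q I x =
    (let B = bound_alg Q I
     in \<lparr>carrier = {b \<otimes>\<^bsub>B\<^esub> idem Q I x | b. b \<in> carrier B}, mult = undefined, one = undefined,
         zero = \<zero>\<^bsub>B\<^esub>, add = add B, smult = mult B\<rparr>)"

text \<open>The left module \<open>I\<^sub>x = Hom\<^sub>k(xB, k)\<close>, with the action \<open>(b\<phi>)(u) = \<phi>(ub)\<close>.\<close>
definition inj_mod ::
  "('v, 'a) pre_digraph \<Rightarrow> (('v, 'a) path \<Rightarrow> 'k::field) set \<Rightarrow> 'v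
    \<Rightarrow> ((('v, 'a) path \<Rightarrow> 'k) set, (('v, 'a) path \<Rightarrow> 'k) set \<Rightarrow> 'k) module" where
  "inj_mod Q I x =
    (let B = bound_alg Q I;
         xB = B\<lparr>carrier := {idem Q I x \<otimes>\<^bsub>B\<^esub> b | b. b \<in> carrier B}\<rparr>
     in \<lparr>carrier = lin_maps class_ring xB ground_space, mult = undefined, one = undefined,
         zero = (\<lambda>u\<in>carrier xB. 0), add = (\<lambda>\<phi> \<psi>. \<lambda>u\<in>carrier xB. \<phi> u + \<psi> u),
         smult = (\<lambda>b \<phi>. \<lambda>u\<in>carrier xB. \<phi> (u \<otimes>\<^bsub>B\<^esub> b))\<rparr>)"

section \<open>Adding arrows\<close>

definition new_arrows ::
  "('v, 'a) pre_digraph \<Rightarrow> 'f set \<Rightarrow> ('f \<Rightarrow> 'v) \<Rightarrow> ('f \<Rightarrow> 'v) \<Rightarrow> bool" where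
  "new_arrows Q F s t \<longleftrightarrow> finite F \<and> s \<in> F \<rightarrow> verts Q \<and> t \<in> F \<rightarrow> verts Q"

definition ext_quiver ::
  "('v, 'a) pre_digraph \<Rightarrow> 'f set \<Rightarrow> ('f \<Rightarrow> 'v) \<Rightarrow> ('f \<Rightarrow> 'v) \<Rightarrow> ('v, 'a + 'f) pre_digraph" where
  "ext_quiver Q F s t =
    \<lparr>verts = verts Q, arcs = arcs Q <+> F, tail = case_sum (tail Q) s, head = case_sum (head Q) t\<rparr>"

text \<open>The inclusion of \<open>kQ\<close> into \<open>kQ\<^sub>F\<close>.\<close>
definition path_incl :: "(('v, 'a) path \<Rightarrow> 'k::field) \<Rightarrow> ('v, 'a + 'f) path \<Rightarrow> 'k" where
  "path_incl f = (\<lambda>(u, p, v). if list_all isl p then f (u, map projl p, v) else 0)"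

definition ext_alg ::
  "('v, 'a) pre_digraph \<Rightarrow> (('v, 'a) path \<Rightarrow> 'k::field) set \<Rightarrow> 'f set \<Rightarrow> ('f \<Rightarrow> 'v) \<Rightarrow> ('f \<Rightarrow> 'v)
    \<Rightarrow> ('k, (('v, 'a + 'f) path \<Rightarrow> 'k) set) module" where
  "ext_alg Q I F s t =
    (let kQF = path_alg (ext_quiver Q F s t) in quot_mod kQF (genideal kQF (path_incl ` I)))"

text \<open>The relative path \<open>(a\<^sub>n, \<dots>, a\<^sub>1)\<close> is the list \<open>[a\<^sub>1, \<dots>, a\<^sub>n]\<close>.\<close>
definition rel_paths ::
  "('v, 'a) pre_digraph \<Rightarrow> (('v, 'a) path \<Rightarrow> 'k::field) set \<Rightarrow> 'f set \<Rightarrow> ('f \<Rightarrow> 'v) \<Rightarrow> ('f \<Rightarrow> 'v)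
    \<Rightarrow> 'f list set" where
  "rel_paths Q I F s t =
    {\<gamma>. \<gamma> \<noteq> [] \<and> set \<gamma> \<subseteq> F \<and>
       (\<forall>i. Suc i < length \<gamma> \<longrightarrow> peirce_nonzero Q I (s (\<gamma> ! Suc i)) (t (\<gamma> ! i)))}"

definition rel_src :: "('f \<Rightarrow> 'v) \<Rightarrow> 'f list \<Rightarrow> 'v" where
  "rel_src s \<gamma> = s (hd \<gamma>)"

definition rel_tgt :: "('f \<Rightarrow> 'v) \<Rightarrow> 'f list \<Rightarrow> 'v" where
  "rel_tgt t \<gamma> = t (last \<gamma>)"

definition rel_dim ::
  "('v, 'a) pre_digraph \<Rightarrow> (('v, 'a) path \<Rightarrow> 'k::field) set \<Rightarrow> ('f \<Rightarrow> 'v) \<Rightarrow> ('f \<Rightarrow> 'v)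
    \<Rightarrow> 'f list \<Rightarrow> nat" where
  "rel_dim Q I s t \<gamma> = (\<Prod>i<length \<gamma> - 1. kdim (peirce Q I (s (\<gamma> ! Suc i)) (t (\<gamma> ! i))))"

definition rel_cycles ::
  "('v, 'a) pre_digraph \<Rightarrow> (('v, 'a) path \<Rightarrow> 'k::field) set \<Rightarrow> 'f set \<Rightarrow> ('f \<Rightarrow> 'v) \<Rightarrow> ('f \<Rightarrow> 'v)
    \<Rightarrow> 'f list set" where
  "rel_cycles Q I F s t =
    {\<gamma> \<in> rel_paths Q I F s t. peirce_nonzero Q I (rel_src s \<gamma>) (rel_tgt t \<gamma>)}"

text \<open>
  An extended relative path \<open>(y, \<gamma>, x)\<close> of positive length is that triple; the pair \<open>(y, x)\<close> of
  length 0 is encoded as \<open>(y, [], x)\<close>. This is unambiguous since relative paths are nonempty.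
\<close>
definition ext_rel_paths ::
  "('v, 'a) pre_digraph \<Rightarrow> (('v, 'a) path \<Rightarrow> 'k::field) set \<Rightarrow> 'f set \<Rightarrow> ('f \<Rightarrow> 'v) \<Rightarrow> ('f \<Rightarrow> 'v)
    \<Rightarrow> ('v \<times> 'f list \<times> 'v) set" where
  "ext_rel_paths Q I F s t =
    {(y, [], x) | y x. y \<in> verts Q \<and> x \<in> verts Q \<and> peirce_nonzero Q I y x} \<union>
    {(y, \<gamma>, x) | y \<gamma> x. y \<in> verts Q \<and> x \<in> verts Q \<and> \<gamma> \<in> rel_paths Q I F s t \<and>
       peirce_nonzero Q I y (rel_tgt t \<gamma>) \<and> peirce_nonzero Q I (rel_src s \<gamma>) x}"

fun ext_rel_dim ::
  "('v, 'a) pre_digraph \<Rightarrow> (('v, 'a) path \<Rightarrow> 'k::field) set \<Rightarrow> ('f \<Rightarrow> 'v) \<Rightarrow> ('f \<Rightarrow> 'v)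
    \<Rightarrow> 'v \<times> 'f list \<times> 'v \<Rightarrow> nat" where
  "ext_rel_dim Q I s t (y, \<gamma>, x) =
    (if \<gamma> = [] then kdim (peirce Q I y x)
     else kdim (peirce Q I y (rel_tgt t \<gamma>)) * rel_dim Q I s t \<gamma> * kdim (peirce Q I (rel_src s \<gamma>) x))"

text \<open>The set \<open>F // W\<^sub>*\<close> of parallel pairs.\<close>
definition parallel_pairs ::
  "('v, 'a) pre_digraph \<Rightarrow> (('v, 'a) path \<Rightarrow> 'k::field) set \<Rightarrow> 'f set \<Rightarrow> ('f \<Rightarrow> 'v) \<Rightarrow> ('f \<Rightarrow> 'v)
    \<Rightarrow> ('f \<times> 'v \<times> 'f list \<times> 'v) set" where
  "parallel_pairs Q I F s t =
    {(a, y, \<gamma>, x). a \<in> F \<and> (y, \<gamma>, x) \<in> ext_rel_paths Q I F s t \<and> s a = x \<and> t a = y}"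

end

theory Submission
  imports Defs
begin

text \<open>
  Let \<open>B\<close> be the bound quiver algebra and \<open>T\<close> the algebra obtained by adding the new arrows. For a bimodule
  \<open>V\<close> over an algebra \<open>A\<close> put \<open>\<chi>\<^sub>A(V) = dim Der(A, V) - dim V\<close>. Three properties of this number carry the
  proof.

    \<^item> The inner derivations of \<open>A\<close> form a copy of \<open>A/ZA\<close>, hence \<open>dim HH\<^sup>1(A) = \<chi>\<^sub>A(A) + dim ZA\<close> (\<open>kdim_HH1\<close>).
    \<^item> It is additive on direct sums (\<open>chi_family\<close>).
    \<^item> For left modules \<open>X\<close> and \<open>Y\<close> it satisfies \<open>\<chi>\<^sub>B(Hom\<^sub>k(X, Y)) = dim Ext\<^sup>1\<^sub>B(X, Y) - dim Hom\<^sub>B(X, Y)\<close>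
      (\<open>chi_hom_k_eq_Ext1_Hom\<close>): a derivation of \<open>B\<close> into \<open>Hom\<^sub>k(X, Y)\<close> is the off-diagonal part of a module
      structure on \<open>Y \<oplus> X\<close>, it is inner when this extension splits, and the elements that commute with \<open>B\<close>
      are the module maps.

  By the first property it remains to compute \<open>\<chi>\<^sub>T(T) - \<chi>\<^sub>B(B)\<close>, which is done in two steps.

  First, \<open>T\<close> is freely generated over \<open>B\<close> by the new arrows, so a derivation of \<open>T\<close> is a derivation of \<open>B\<close>
  into \<open>T\<close> together with an arbitrary value in \<open>e\<^bsub>t a\<^esub> T e\<^bsub>s a\<^esub>\<close> for each new arrow \<open>a\<close> (\<open>derivs_T_dims\<close>). This
  replaces \<open>\<chi>\<^sub>T(T)\<close> by \<open>\<chi>\<^sub>B(T)\<close> at the cost of the dimensions of these spaces.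

  Second, singling out the new arrow which is traversed first decomposes the \<open>B\<close>-bimodule \<open>T\<close> as the sum of
  \<open>B\<close> and of the \<open>T a B\<close>, where \<open>T a B\<close> is \<open>T e\<^bsub>t a\<^esub> \<otimes>\<^sub>k e\<^bsub>s a\<^esub> B\<close>, that is, \<open>Hom\<^sub>k(I\<^bsub>s a\<^esub>, T e\<^bsub>t a\<^esub>)\<close> (\<open>T_dims\<close>).
  The projection to the summand of \<open>a\<close> is a derivation \<open>\<Theta> a\<close> of \<open>T\<close>, which the universal property of \<open>T\<close>
  provides. The same decomposition of \<open>T e\<^sub>x\<close> has
  the summands \<open>B e\<^sub>x\<close> and, for each \<open>a\<close>, as many copies of \<open>T e\<^bsub>t a\<^esub>\<close> as the dimension of \<open>e\<^bsub>s a\<^esub> B e\<^sub>x\<close>. It yields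
  recursions for \<open>dim e\<^sub>y T e\<^sub>x\<close> (\<open>E_dims\<close>) and for \<open>\<chi>\<^sub>B(Hom\<^sub>k(I\<^sub>y, T e\<^sub>x))\<close> (\<open>YT_dims\<close>). In the absence of relative
  cycles these recursions are wellfounded; then \<open>T\<close> is finite-dimensional, and unfolding them gives the sums over
  relative paths (\<open>path_sum\<close>).
\<close>

section \<open>Vector spaces and their dimensions\<close>

locale vect = abelian_group V for V :: "('k::field, 'v) module" (structure) +
  assumes scal_closed [simp, intro]: "x \<in> carrier V \<Longrightarrow> c \<odot> x \<in> carrier V"
    and scal_add_left: "x \<in> carrier V \<Longrightarrow> (c + d) \<odot> x = c \<odot> x \<oplus> d \<odot> x"
    and scal_add_right: "x \<in> carrier V \<Longrightarrow> y \<in> carrier V \<Longrightarrow> c \<odot> (x \<oplus> y) = c \<odot> x \<oplus> c \<odot> y"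
    and scal_mult: "x \<in> carrier V \<Longrightarrow> (c * d) \<odot> x = c \<odot> (d \<odot> x)"
    and scal_one [simp]: "x \<in> carrier V \<Longrightarrow> 1 \<odot> x = x"

lemma vect_iff_vectorspace: "vect V \<longleftrightarrow> vectorspace class_ring V"
proof
  assume "vect V"
  then interpret vect V .
  have "module class_ring V"
    by (rule moduleI)
       (auto simp: class_cring.cring_axioms abelian_group_axioms scal_add_left scal_add_right scal_mult)
  then show "vectorspace class_ring V"
    by (simp add: vectorspace_def class_field)
next
  assume "vectorspace class_ring V"
  then interpret vectorspace class_ring V .
  show "vect V"
    using smult_closed smult_l_distr smult_r_distr smult_assoc1 smult_one
    by unfold_locales auto
qed

lemma vect_vectorspace: "vect V \<Longrightarrow> vectorspace class_ring V"
  by (simp add: vect_iff_vectorspace)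

definition kfin :: "('k::field, 'v) module \<Rightarrow> bool" where
  "kfin V \<longleftrightarrow> vectorspace.fin_dim class_ring V"

definition klin :: "('k::field, 'v) module \<Rightarrow> ('k, 'w) module \<Rightarrow> ('v \<Rightarrow> 'w) \<Rightarrow> bool" where
  "klin V W f \<longleftrightarrow> (\<forall>x\<in>carrier V. f x \<in> carrier W) \<and>
     (\<forall>x\<in>carrier V. \<forall>y\<in>carrier V. f (x \<oplus>\<^bsub>V\<^esub> y) = f x \<oplus>\<^bsub>W\<^esub> f y) \<and>
     (\<forall>c. \<forall>x\<in>carrier V. f (c \<odot>\<^bsub>V\<^esub> x) = c \<odot>\<^bsub>W\<^esub> f x)"

lemma klin_iff_module_hom: "klin V W f \<longleftrightarrow> f \<in> module_hom class_ring V W"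
  by (auto simp: klin_def module_hom_def)

lemma lin_maps_iff: "f \<in> lin_maps class_ring V W \<longleftrightarrow> klin V W f \<and> f \<in> extensional (carrier V)"
  by (simp add: lin_maps_def klin_iff_module_hom)

lemma klinI:
  assumes "\<And>x. x \<in> carrier V \<Longrightarrow> f x \<in> carrier W"
    and "\<And>x y. x \<in> carrier V \<Longrightarrow> y \<in> carrier V \<Longrightarrow> f (x \<oplus>\<^bsub>V\<^esub> y) = f x \<oplus>\<^bsub>W\<^esub> f y"
    and "\<And>c x. x \<in> carrier V \<Longrightarrow> f (c \<odot>\<^bsub>V\<^esub> x) = c \<odot>\<^bsub>W\<^esub> f x"
  shows "klin V W f"
  using assms by (simp add: klin_def)

lemma klin_closed: "klin V W f \<Longrightarrow> x \<in> carrier V \<Longrightarrow> f x \<in> carrier W"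
  and klin_add: "klin V W f \<Longrightarrow> x \<in> carrier V \<Longrightarrow> y \<in> carrier V \<Longrightarrow> f (x \<oplus>\<^bsub>V\<^esub> y) = f x \<oplus>\<^bsub>W\<^esub> f y"
  and klin_scal: "klin V W f \<Longrightarrow> x \<in> carrier V \<Longrightarrow> f (c \<odot>\<^bsub>V\<^esub> x) = c \<odot>\<^bsub>W\<^esub> f x"
  by (simp_all add: klin_def)

context vect
begin

lemma scal_zero_left [simp]: "x \<in> carrier V \<Longrightarrow> 0 \<odot> x = \<zero>"
  using scal_add_left[of x 0 0] by (metis add.l_cancel_one' add_0 scal_closed)

lemma scal_zero_right [simp]: "c \<odot> \<zero> = \<zero>"
  using scal_add_right[of \<zero> \<zero> c] by (metis add.l_cancel_one' local.add.one_closed scal_closed l_zero)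

lemma minus_scal: "x \<in> carrier V \<Longrightarrow> \<ominus> x = (- 1) \<odot> x"
  using scal_add_left[of x "-1" 1] by (simp add: minus_equality)

lemma diff_scal: "x \<in> carrier V \<Longrightarrow> y \<in> carrier V \<Longrightarrow> x \<ominus> y = x \<oplus> (- 1) \<odot> y"
  by (simp add: a_minus_def minus_scal)

lemma scal_finsum:
  "finite S \<Longrightarrow> g \<in> S \<rightarrow> carrier V \<Longrightarrow> c \<odot> finsum V g S = (\<Oplus>i\<in>S. c \<odot> g i)"
proof (induction S rule: finite_induct)
  case (insert i S)
  then have "g \<in> S \<rightarrow> carrier V" "g i \<in> carrier V" "(\<lambda>i. c \<odot> g i) \<in> S \<rightarrow> carrier V" by auto
  with insert show ?case by (simp add: scal_add_right)
qed simp

end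

lemma klin_zero: "vect V \<Longrightarrow> vect W \<Longrightarrow> klin V W f \<Longrightarrow> f \<zero>\<^bsub>V\<^esub> = \<zero>\<^bsub>W\<^esub>"
proof -
  assume "vect V" "vect W" and f: "klin V W f"
  then interpret V: vect V + W: vect W by simp_all
  have "f (0 \<odot>\<^bsub>V\<^esub> \<zero>\<^bsub>V\<^esub>) = 0 \<odot>\<^bsub>W\<^esub> f \<zero>\<^bsub>V\<^esub>" using f by (rule klin_scal) simp
  moreover have "f \<zero>\<^bsub>V\<^esub> \<in> carrier W" using f by (rule klin_closed) simp
  ultimately show ?thesis by simp
qed

lemma klin_diff:
  assumes "vect V" "vect W" "klin V W f" "x \<in> carrier V" "y \<in> carrier V"
  shows "f (x \<ominus>\<^bsub>V\<^esub> y) = f x \<ominus>\<^bsub>W\<^esub> f y"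
proof -
  interpret V: vect V by fact
  interpret W: vect W by fact
  show ?thesis
    using assms(4,5) klin_closed[OF assms(3)]
    by (simp add: V.diff_scal W.diff_scal klin_add[OF assms(3)] klin_scal[OF assms(3)])
qed

lemma klin_finsum:
  assumes "vect V" "vect W" "klin V W f" "finite S" "g \<in> S \<rightarrow> carrier V"
  shows "f (finsum V g S) = (\<Oplus>\<^bsub>W\<^esub>i\<in>S. f (g i))"
  using assms(4,5)
proof (induction S rule: finite_induct)
  case empty
  interpret V: vect V by fact
  interpret W: vect W by fact
  show ?case by (simp add: klin_zero[OF assms(1-3)])
next
  case (insert i S)
  interpret V: vect V by fact
  interpret W: vect W by fact
  have "g \<in> S \<rightarrow> carrier V" "g i \<in> carrier V" "(\<lambda>i. f (g i)) \<in> S \<rightarrow> carrier W" "f (g i) \<in> carrier W"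
    using insert.prems klin_closed[OF assms(3)] by auto
  with insert show ?case by (simp add: klin_add[OF assms(3)])
qed

lemma klin_compose: "klin U V f \<Longrightarrow> klin V W g \<Longrightarrow> klin U W (\<lambda>x. g (f x))"
  by (simp add: klin_def)

lemma klin_cong:
  assumes "\<And>x. x \<in> carrier V \<Longrightarrow> f x = g x" "vect V"
  shows "klin V W f \<longleftrightarrow> klin V W g"
proof -
  interpret vect V by fact
  show ?thesis by (simp add: klin_def assms(1))
qed

lemma klin_restrict: "vect V \<Longrightarrow> klin V W (restrict f (carrier V)) \<longleftrightarrow> klin V W f"
  by (rule klin_cong) auto

definition subsp :: "('k::field, 'v) module \<Rightarrow> 'v set \<Rightarrow> bool" where
  "subsp V S \<longleftrightarrow> S \<subseteq> carrier V \<and> \<zero>\<^bsub>V\<^esub> \<in> S \<and> (\<forall>x\<in>S. \<forall>y\<in>S. x \<oplus>\<^bsub>V\<^esub> y \<in> S) \<and> (\<forall>c. \<forall>x\<in>S. c \<odot>\<^bsub>V\<^esub> x \<in> S)"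

lemma subspI:
  assumes "S \<subseteq> carrier V" "\<zero>\<^bsub>V\<^esub> \<in> S" "\<And>x y. x \<in> S \<Longrightarrow> y \<in> S \<Longrightarrow> x \<oplus>\<^bsub>V\<^esub> y \<in> S"
    "\<And>c x. x \<in> S \<Longrightarrow> c \<odot>\<^bsub>V\<^esub> x \<in> S"
  shows "subsp V S"
  using assms by (simp add: subsp_def)

lemma subsp_vect:
  assumes "vect V" "subsp V S"
  shows "vect (V\<lparr>carrier := S\<rparr>)"
proof -
  interpret vect V by fact
  have neg: "\<exists>y\<in>S. y \<oplus>\<^bsub>V\<^esub> x = \<zero>\<^bsub>V\<^esub>" if "x \<in> S" for x
    using that assms(2) scal_add_left[of x "-1" 1] by (intro bexI[of _ "(-1) \<odot>\<^bsub>V\<^esub> x"]) (auto simp: subsp_def)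
  show ?thesis
    using assms(2) neg
    by unfold_locales
       (auto simp: subsp_def Units_def subset_iff a_ac scal_add_left scal_add_right scal_mult
         intro!: bexI)
qed

lemma subsp_imp_submodule: "vect V \<Longrightarrow> subsp V S \<Longrightarrow> submodule class_ring S V"
  using vect_vectorspace[of V] unfolding submodule_def subsp_def vectorspace_def by auto

lemma klin_subsp_dom:
  assumes "klin V W f" "subsp V S"
  shows "klin (V\<lparr>carrier := S\<rparr>) W f"
  using assms by (auto simp: klin_def subsp_def subset_iff)

lemma subsp_kernel:
  assumes "vect V" "vect W" "klin V W f"
  shows "subsp V {x \<in> carrier V. f x = \<zero>\<^bsub>W\<^esub>}"
proof -
  interpret V: vect V by fact
  interpret W: vect W by fact
  show ?thesis
    by (rule subspI) (auto simp: klin_zero[OF assms] klin_add[OF assms(3)] klin_scal[OF assms(3)])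
qed

lemma subsp_image:
  assumes "vect V" "vect W" "klin V W f"
  shows "subsp W (f ` carrier V)"
proof -
  interpret V: vect V by fact
  interpret W: vect W by fact
  show ?thesis
  proof (rule subspI)
    show "\<zero>\<^bsub>W\<^esub> \<in> f ` carrier V" using klin_zero[OF assms] by (metis V.zero_closed imageI)
    show "x \<oplus>\<^bsub>W\<^esub> y \<in> f ` carrier V" if "x \<in> f ` carrier V" "y \<in> f ` carrier V" for x y
      using that klin_add[OF assms(3)] by (auto simp flip: klin_add[OF assms(3)])
    show "c \<odot>\<^bsub>W\<^esub> x \<in> f ` carrier V" if "x \<in> f ` carrier V" for c x
      using that by (auto simp flip: klin_scal[OF assms(3)])
  qed (use klin_closed[OF assms(3)] in auto)
qed

lemma linear_mapI: "vect V \<Longrightarrow> vect W \<Longrightarrow> klin V W f \<Longrightarrow> linear_map class_ring V W f"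
  unfolding linear_map_def mod_hom_def mod_hom_axioms_def
  using vect_vectorspace[of V] vect_vectorspace[of W] by (auto simp: klin_iff_module_hom vectorspace_def)

lemma rank_nullity:
  assumes "vect V" "vect W" "klin V W f" "kfin V"
  shows "kdim V = kdim (W\<lparr>carrier := f ` carrier V\<rparr>) + kdim (V\<lparr>carrier := {x \<in> carrier V. f x = \<zero>\<^bsub>W\<^esub>}\<rparr>)"
proof -
  interpret linear_map class_ring V W f by (rule linear_mapI) fact+
  show ?thesis
    using rank_nullity[OF assms(4)[unfolded kfin_def]] by (simp add: kdim_def im_def ker_def)
qed

lemma kfin_surj:
  assumes "vect V" "vect W" "klin V W f" "kfin V" "f ` carrier V = carrier W"
  shows "kfin W"
proof -
  interpret linear_map class_ring V W f by (rule linear_mapI) fact+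
  show ?thesis using rank_nullity_main(2) assms unfolding kfin_def by blast
qed

lemma kdim_zero:
  assumes "vect V" "carrier V = {\<zero>\<^bsub>V\<^esub>}"
  shows "kfin V" "kdim V = 0"
proof -
  interpret vectorspace class_ring V using assms(1) by (rule vect_vectorspace)
  have "span {} = carrier V" using span_empty assms(2) by simp
  then have b: "basis {}" unfolding basis_def
    by (metis assms(1) assms(2) empty_subsetI finite_lin_indpt2 finite.emptyI empty_iff)
  show "kfin V" unfolding kfin_def fin_dim_def using b unfolding basis_def by blast
  show "kdim V = 0" using dim_basis[OF _ b] by (simp add: kdim_def)
qed

lemma kdim_pos:
  assumes "vect V" "kfin V" "kdim V = 0"
  shows "carrier V = {\<zero>\<^bsub>V\<^esub>}"
proof -
  interpret vectorspace class_ring V using assms(1) by (rule vect_vectorspace)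
  obtain B where B: "finite B" "basis B" using finite_basis_exists assms(2) kfin_def by blast
  then have "B = {}" using dim_basis assms(3) by (simp add: kdim_def)
  then show ?thesis using B(2) span_empty unfolding basis_def by simp
qed

lemma kfin_subsp:
  assumes "vect V" "subsp V S" "kfin V"
  shows "kfin (V\<lparr>carrier := S\<rparr>)"
proof -
  interpret V: vectorspace class_ring V using assms(1) by (rule vect_vectorspace)
  interpret S: vectorspace class_ring "V\<lparr>carrier := S\<rparr>"
    using subsp_vect[OF assms(1,2)] by (rule vect_vectorspace)
  have sub: "submodule class_ring S V" by (rule subsp_imp_submodule) fact+
  have SV: "S \<subseteq> carrier V" using assms(2) by (simp add: subsp_def)
  let ?P = "\<lambda>A. A \<subseteq> carrier (V\<lparr>carrier := S\<rparr>) \<and> S.lin_indpt A"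
  have max: "finite A \<and> card A \<le> V.dim" if "?P A" for A
  proof -
    have "A \<subseteq> S" using that by simp
    then have "V.lin_indpt A" using that V.span_li_not_depend(2)[OF _ sub] by simp
    then show ?thesis using V.li_le_dim[of A] assms(3) \<open>A \<subseteq> S\<close> SV unfolding kfin_def by blast
  qed
  have "?P {}" by (simp add: S.lin_dep_def)
  from maximal_exists[of ?P, OF max this] obtain A where A: "finite A" "maximal A ?P" by auto
  then have "S.gen_set A" "A \<subseteq> S" using S.max_li_is_basis[OF A(2)] unfolding S.basis_def by auto
  then show ?thesis using A(1) unfolding kfin_def S.fin_dim_def by auto
qed

text \<open>
  The basis vectors index their own coordinate functionals.
\<close>

definition dual_basis :: "('k::field, 'v) module \<Rightarrow> 'v set \<Rightarrow> ('v \<Rightarrow> 'v \<Rightarrow> 'k) \<Rightarrow> bool" where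
  "dual_basis V A c \<longleftrightarrow> finite A \<and> A \<subseteq> carrier V \<and>
     (\<forall>p\<in>A. klin V ground_space (c p)) \<and>
     (\<forall>v\<in>carrier V. v = (\<Oplus>\<^bsub>V\<^esub>p\<in>A. c p v \<odot>\<^bsub>V\<^esub> p)) \<and>
     (\<forall>p\<in>A. \<forall>q\<in>A. c p q = (if p = q then 1 else 0))"

lemma ground_space_simps [simp]:
  "carrier ground_space = UNIV" "add ground_space = (+)" "zero ground_space = 0" "smult ground_space = (*)"
  by (simp_all add: ground_space_def)

lemma vect_ground_space: "vect ground_space"
proof -
  have "\<exists>y. y + x = (0::'k::field)" for x by (rule exI[of _ "- x"]) simp
  then show ?thesis
    by unfold_locales (auto simp: Units_def algebra_simps)
qed

lemma (in vect) finsum_delta: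
  assumes "finite A" "q \<in> A" "q \<in> carrier V" "\<And>p. p \<in> A \<Longrightarrow> g p \<in> carrier V"
  shows "(\<Oplus>p\<in>A. (if p = q then 1 else 0) \<odot> g p) = g q"
proof -
  have "(\<Oplus>p\<in>A. (if p = q then 1 else 0) \<odot> g p) = (\<Oplus>p\<in>A. if q = p then g p else \<zero>)"
    using assms by (intro finsum_cong') auto
  also have "\<dots> = g q" using assms by (intro finsum_singleton) auto
  finally show ?thesis .
qed

lemma dual_basis_exists:
  assumes "vect V" "kfin V"
  shows "\<exists>A c. dual_basis V A c \<and> card A = kdim V"
proof -
  interpret V: vect V by fact
  interpret vectorspace class_ring V using assms(1) by (rule vect_vectorspace)
  obtain A where A: "finite A" "basis A" using finite_basis_exists assms(2) kfin_def by blast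
  have AV: "A \<subseteq> carrier V" using A(2) by (simp add: basis_def)
  have ex1: "\<exists>!a. a \<in> A \<rightarrow>\<^sub>E UNIV \<and> (\<Oplus>\<^bsub>V\<^esub>p\<in>A. a p \<odot>\<^bsub>V\<^esub> p) = v" if "v \<in> carrier V" for v
    using basis_criterion[OF A(1) AV] A(2) that by (simp add: lincomb_def)
  define c where "c = (\<lambda>v. THE a. a \<in> A \<rightarrow>\<^sub>E UNIV \<and> (\<Oplus>\<^bsub>V\<^esub>p\<in>A. a p \<odot>\<^bsub>V\<^esub> p) = v)"
  have c: "c v \<in> A \<rightarrow>\<^sub>E UNIV" "(\<Oplus>\<^bsub>V\<^esub>p\<in>A. c v p \<odot>\<^bsub>V\<^esub> p) = v" if "v \<in> carrier V" for v
    using theI'[OF ex1[OF that]] by (simp_all add: c_def)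
  have uniq: "c v p = a p" if "v \<in> carrier V" "(\<Oplus>\<^bsub>V\<^esub>p\<in>A. a p \<odot>\<^bsub>V\<^esub> p) = v" "p \<in> A" for v a p
  proof -
    have "(\<Oplus>\<^bsub>V\<^esub>p\<in>A. restrict a A p \<odot>\<^bsub>V\<^esub> p) = (\<Oplus>\<^bsub>V\<^esub>p\<in>A. a p \<odot>\<^bsub>V\<^esub> p)"
      using AV by (intro V.finsum_cong') auto
    then have "restrict a A \<in> A \<rightarrow>\<^sub>E UNIV \<and> (\<Oplus>\<^bsub>V\<^esub>p\<in>A. restrict a A p \<odot>\<^bsub>V\<^esub> p) = v"
      using that(2) by simp
    then have "restrict a A = c v" using ex1[OF that(1)] c[OF that(1)] by blast
    then have "restrict a A p = c v p" by (rule fun_cong)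
    then show ?thesis using that(3) by simp
  qed
  have mem: "(\<lambda>p. a p \<odot>\<^bsub>V\<^esub> p) \<in> A \<rightarrow> carrier V" for a using AV by auto
  have lin: "klin V ground_space (\<lambda>v. c v p)" if "p \<in> A" for p
  proof (rule klinI)
    fix x y assume xy: "x \<in> carrier V" "y \<in> carrier V"
    have "(\<Oplus>\<^bsub>V\<^esub>p\<in>A. (c x p + c y p) \<odot>\<^bsub>V\<^esub> p)
        = (\<Oplus>\<^bsub>V\<^esub>p\<in>A. c x p \<odot>\<^bsub>V\<^esub> p \<oplus>\<^bsub>V\<^esub> c y p \<odot>\<^bsub>V\<^esub> p)"
      using AV by (intro V.finsum_cong') (auto simp: V.scal_add_left subset_iff)
    also have "\<dots> = x \<oplus>\<^bsub>V\<^esub> y" using V.finsum_addf[OF mem mem, of "c x" "c y"] c xy by simp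
    finally show "c (x \<oplus>\<^bsub>V\<^esub> y) p = c x p \<oplus>\<^bsub>ground_space\<^esub> c y p"
      using uniq[of "x \<oplus>\<^bsub>V\<^esub> y" "\<lambda>p. c x p + c y p" p] that xy by simp
  next
    fix k x assume x: "x \<in> carrier V"
    have "(\<Oplus>\<^bsub>V\<^esub>p\<in>A. (k * c x p) \<odot>\<^bsub>V\<^esub> p) = (\<Oplus>\<^bsub>V\<^esub>p\<in>A. k \<odot>\<^bsub>V\<^esub> (c x p \<odot>\<^bsub>V\<^esub> p))"
      using AV by (intro V.finsum_cong') (auto simp: V.scal_mult subset_iff)
    also have "\<dots> = k \<odot>\<^bsub>V\<^esub> x" using V.scal_finsum[OF A(1) mem, of k "c x"] c x by simp
    finally show "c (k \<odot>\<^bsub>V\<^esub> x) p = k \<odot>\<^bsub>ground_space\<^esub> c x p"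
      using uniq[of "k \<odot>\<^bsub>V\<^esub> x" "\<lambda>p. k * c x p" p] that x by simp
  qed simp
  have "c q p = (if p = q then 1 else 0)" if "p \<in> A" "q \<in> A" for p q
    using V.finsum_delta[OF A(1) that(2), of "\<lambda>p. p"] uniq[of q "\<lambda>p. if p = q then 1 else 0" p] that AV
    by (auto simp: subset_iff)
  then have "dual_basis V A (\<lambda>p v. c v p)"
    unfolding dual_basis_def using A(1) AV lin c(2) by auto
  then show ?thesis using dim_basis[OF A] by (auto simp: kdim_def)
qed

lemma kfinI:
  assumes "vect V" "finite A" "A \<subseteq> carrier V"
    "\<And>v. v \<in> carrier V \<Longrightarrow> \<exists>a. v = (\<Oplus>\<^bsub>V\<^esub>p\<in>A. a p \<odot>\<^bsub>V\<^esub> p)"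
  shows "kfin V"
proof -
  interpret vectorspace class_ring V using assms(1) by (rule vect_vectorspace)
  have "carrier V \<subseteq> span A" unfolding span_def lincomb_def using assms(2,4) by force
  then show ?thesis using assms(2,3) span_is_subset2[of A] unfolding kfin_def fin_dim_def by blast
qed

lemma kfin_extension:
  assumes "vect V" "vect W" and f: "klin V W f" and surj: "f ` carrier V = carrier W"
    and W: "kfin W" and K: "kfin (V\<lparr>carrier := {x \<in> carrier V. f x = \<zero>\<^bsub>W\<^esub>}\<rparr>)"
  shows "kfin V"
proof -
  let ?K = "{x \<in> carrier V. f x = \<zero>\<^bsub>W\<^esub>}"
  interpret V: vect V by fact
  interpret W: vect W by fact
  have sub: "subsp V ?K" by (rule subsp_kernel) fact+
  interpret V': vectorspace class_ring V using assms(1) by (rule vect_vectorspace)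
  interpret K': vectorspace class_ring "V\<lparr>carrier := ?K\<rparr>"
    using subsp_vect[OF assms(1) sub] by (rule vect_vectorspace)
  obtain A where A: "finite A" "A \<subseteq> ?K" "K'.span A = ?K"
    using K unfolding kfin_def K'.fin_dim_def by auto
  have Asp: "V'.span A = ?K"
    using V'.span_li_not_depend(1)[OF A(2) subsp_imp_submodule[OF assms(1) sub]] A(3) by simp
  obtain C c where C: "dual_basis W C c" using dual_basis_exists[OF assms(2) W] by blast
  then have C': "finite C" "C \<subseteq> carrier W" by (simp_all add: dual_basis_def)
  define h where "h = inv_into (carrier V) f"
  have h: "h p \<in> carrier V" "f (h p) = p" if "p \<in> C" for p
  proof -
    have "p \<in> f ` carrier V" using that C'(2) surj by blast
    then show "h p \<in> carrier V" "f (h p) = p" unfolding h_def by (auto intro: inv_into_into f_inv_into_f)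
  qed
  have "v \<in> V'.span (A \<union> h ` C)" if v: "v \<in> carrier V" for v
  proof -
    define u where "u = (\<Oplus>\<^bsub>V\<^esub>p\<in>C. c p (f v) \<odot>\<^bsub>V\<^esub> h p)"
    have mem: "(\<lambda>p. c p (f v) \<odot>\<^bsub>V\<^esub> h p) \<in> C \<rightarrow> carrier V" using h by auto
    then have u: "u \<in> carrier V" unfolding u_def by (rule V.finsum_closed)
    have sm: "submodule class_ring (V'.span (A \<union> h ` C)) V"
      using A(2) h(1) by (intro V'.span_is_submodule) auto
    have hs: "h p \<in> V'.span (A \<union> h ` C)" if "p \<in> C" for p
      using V'.in_own_span[of "A \<union> h ` C"] A(2) h(1) that by blast
    obtain S where S: "S = V'.span (A \<union> h ` C)" by simp
    note sm = sm[folded S] and hs = hs[folded S]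
    have us: "u \<in> S" unfolding u_def
      using C'(1) hs
    proof (induction C rule: finite_induct)
      case empty
      then show ?case using submodule.zero_closed[OF sm] by simp
    next
      case (insert p C)
      have "h p \<in> carrier V" "(\<lambda>p. c p (f v) \<odot>\<^bsub>V\<^esub> h p) \<in> C \<rightarrow> carrier V"
        using insert.prems submodule.subset[OF sm] by (auto simp: subset_iff)
      then show ?case using insert
        by (simp add: submodule.m_closed[OF sm] submodule.smult_closed[OF sm])
    qed
    have "f u = (\<Oplus>\<^bsub>W\<^esub>p\<in>C. f (c p (f v) \<odot>\<^bsub>V\<^esub> h p))"
      unfolding u_def by (rule klin_finsum[OF assms(1,2) f C'(1) mem])
    also have "\<dots> = (\<Oplus>\<^bsub>W\<^esub>p\<in>C. c p (f v) \<odot>\<^bsub>W\<^esub> p)"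
      using h C' by (intro W.finsum_cong') (auto simp: klin_scal[OF f])
    also have "\<dots> = f v" using C klin_closed[OF f v] by (simp add: dual_basis_def)
    finally have "f (v \<ominus>\<^bsub>V\<^esub> u) = \<zero>\<^bsub>W\<^esub>"
      using klin_diff[OF assms(1,2) f v u] klin_closed[OF f v] by (simp add: a_minus_def W.r_neg)
    then have "v \<ominus>\<^bsub>V\<^esub> u \<in> V'.span A" using Asp v u by simp
    then have "v \<ominus>\<^bsub>V\<^esub> u \<in> S" unfolding S using V'.span_is_monotone[of A "A \<union> h ` C"] by auto
    then have "(v \<ominus>\<^bsub>V\<^esub> u) \<oplus>\<^bsub>V\<^esub> u \<in> S" using us by (rule submodule.m_closed[OF sm])
    then show ?thesis using u v unfolding S[symmetric] by (simp add: a_minus_def V.a_assoc V.l_neg)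
  qed
  moreover have "A \<union> h ` C \<subseteq> carrier V" using A(2) h(1) by auto
  ultimately have "V'.gen_set (A \<union> h ` C)" using V'.span_is_subset2 by blast
  then show ?thesis using A(1) C'(1) \<open>A \<union> h ` C \<subseteq> carrier V\<close>
    unfolding kfin_def V'.fin_dim_def by (metis finite_UnI finite_imageI)
qed

lemma kdim_bij:
  assumes "vect V" "vect W" and f: "klin V W f" and inj: "\<And>x. x \<in> carrier V \<Longrightarrow> f x = \<zero>\<^bsub>W\<^esub> \<Longrightarrow> x = \<zero>\<^bsub>V\<^esub>"
    and surj: "\<And>y. y \<in> carrier W \<Longrightarrow> \<exists>x\<in>carrier V. f x = y" and "kfin V \<or> kfin W"
  shows "kfin V" "kfin W" "kdim V = kdim W"
proof -
  let ?K = "{x \<in> carrier V. f x = \<zero>\<^bsub>W\<^esub>}"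
  interpret V: vect V by fact
  have im: "f ` carrier V = carrier W" using surj klin_closed[OF f] by blast
  have K: "?K = {\<zero>\<^bsub>V\<^esub>}" using inj klin_zero[OF assms(1-3)] by auto
  have vK: "vect (V\<lparr>carrier := ?K\<rparr>)" by (intro subsp_vect subsp_kernel[OF assms(1-3)] assms(1))
  note z = kdim_zero[OF vK]
  have "kfin V" if "kfin W" using kfin_extension[OF assms(1-3) im that] z(1) K by simp
  then show kV: "kfin V" using assms(6) by blast
  show "kfin W" by (rule kfin_surj[OF assms(1-3) kV im])
  show "kdim V = kdim W" using rank_nullity[OF assms(1-3) kV] z(2) K im by simp
qed

text \<open>
  The family \<open>f\<close> identifies \<open>V\<close> with the product of the \<open>W j\<close>. In the same way the remaining members identify
  the kernel of one of them with the product of their targets, which gives an induction.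
\<close>

lemma family_dim:
  assumes "finite J" "vect V"
    and "\<And>j. j \<in> J \<Longrightarrow> vect (W j)" "\<And>j. j \<in> J \<Longrightarrow> kfin (W j)" "\<And>j. j \<in> J \<Longrightarrow> klin V (W j) (f j)"
    and "\<And>v. v \<in> carrier V \<Longrightarrow> (\<And>j. j \<in> J \<Longrightarrow> f j v = \<zero>\<^bsub>W j\<^esub>) \<Longrightarrow> v = \<zero>\<^bsub>V\<^esub>"
    and "\<And>w. (\<And>j. j \<in> J \<Longrightarrow> w j \<in> carrier (W j)) \<Longrightarrow> \<exists>v\<in>carrier V. \<forall>j\<in>J. f j v = w j"
  shows "kfin V \<and> kdim V = (\<Sum>j\<in>J. kdim (W j))"
  using assms
proof (induction J arbitrary: V rule: finite_induct)
  case empty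
  interpret vect V by fact
  have "v = \<zero>\<^bsub>V\<^esub>" if "v \<in> carrier V" for v using empty.prems(5)[OF that] by simp
  then have "carrier V = {\<zero>\<^bsub>V\<^esub>}" using zero_closed by blast
  then show ?case using kdim_zero[OF empty.prems(1)] by simp
next
  case (insert j J)
  interpret V: vect V by fact
  interpret Wj: vect "W j" using insert.prems(2) by simp
  let ?K = "{v \<in> carrier V. f j v = \<zero>\<^bsub>W j\<^esub>}"
  have fj: "klin V (W j) (f j)" and Wj: "vect (W j)" using insert.prems by auto
  have sK: "subsp V ?K" by (rule subsp_kernel[OF insert.prems(1) Wj fj])
  have IH: "kfin (V\<lparr>carrier := ?K\<rparr>) \<and> kdim (V\<lparr>carrier := ?K\<rparr>) = (\<Sum>j\<in>J. kdim (W j))"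
  proof (rule insert.IH)
    show "vect (V\<lparr>carrier := ?K\<rparr>)" by (rule subsp_vect[OF insert.prems(1) sK])
    show "\<exists>v\<in>carrier (V\<lparr>carrier := ?K\<rparr>). \<forall>i\<in>J. f i v = w i" if "\<And>i. i \<in> J \<Longrightarrow> w i \<in> carrier (W i)" for w
    proof -
      have "(w(j := \<zero>\<^bsub>W j\<^esub>)) i \<in> carrier (W i)" if "i \<in> insert j J" for i
        using that \<open>\<And>i. i \<in> J \<Longrightarrow> w i \<in> carrier (W i)\<close>[of i] by auto
      from insert.prems(6)[OF this] obtain v
        where v: "v \<in> carrier V" "\<forall>i\<in>insert j J. f i v = (w(j := \<zero>\<^bsub>W j\<^esub>)) i" by blast
      have "f i v = w i" if "i \<in> J" for i using v(2) that insert.hyps(2) by (auto split: if_splits)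
      then show ?thesis using v by (intro bexI[of _ v]) auto
    qed
    show "v = \<zero>\<^bsub>V\<lparr>carrier := ?K\<rparr>\<^esub>"
      if "v \<in> carrier (V\<lparr>carrier := ?K\<rparr>)" "\<And>i. i \<in> J \<Longrightarrow> f i v = \<zero>\<^bsub>W i\<^esub>" for v
    proof -
      have "f i v = \<zero>\<^bsub>W i\<^esub>" if "i \<in> insert j J" for i
        using that \<open>v \<in> _\<close> \<open>\<And>i. i \<in> J \<Longrightarrow> f i v = \<zero>\<^bsub>W i\<^esub>\<close>[of i] by auto
      then show ?thesis using insert.prems(5)[of v] \<open>v \<in> _\<close> by simp
    qed
    show "klin (V\<lparr>carrier := ?K\<rparr>) (W i) (f i)" if "i \<in> J" for i
      using insert.prems(4) that by (intro klin_subsp_dom[OF _ sK]) simp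
  qed (use insert.prems(2,3) in simp_all)
  have im: "f j ` carrier V = carrier (W j)"
  proof -
    have "\<exists>v\<in>carrier V. f j v = y" if "y \<in> carrier (W j)" for y
    proof -
      have "((\<lambda>i. \<zero>\<^bsub>W i\<^esub>)(j := y)) i \<in> carrier (W i)" if "i \<in> insert j J" for i
        using abelian_groupE(2)[OF vect.axioms(1)[OF insert.prems(2)[OF that]]] \<open>y \<in> _\<close> by simp
      from insert.prems(6)[OF this] show ?thesis by auto
    qed
    then show ?thesis using klin_closed[OF fj] by blast
  qed
  have kV: "kfin V" using kfin_extension[OF insert.prems(1) Wj fj im] insert.prems(3) IH by simp
  show ?case using rank_nullity[OF insert.prems(1) Wj fj kV] im kV IH insert.hyps by simp
qed

text \<open>
  The distinguished target \<open>U\<close> may live on a type of its own.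
\<close>

lemma family_dim_plus:
  assumes "finite J" "vect V" "vect U" "kfin U" "klin V U g"
    and "\<And>j. j \<in> J \<Longrightarrow> vect (W j)" "\<And>j. j \<in> J \<Longrightarrow> kfin (W j)" "\<And>j. j \<in> J \<Longrightarrow> klin V (W j) (f j)"
    and inj: "\<And>v. v \<in> carrier V \<Longrightarrow> g v = \<zero>\<^bsub>U\<^esub> \<Longrightarrow> (\<And>j. j \<in> J \<Longrightarrow> f j v = \<zero>\<^bsub>W j\<^esub>) \<Longrightarrow> v = \<zero>\<^bsub>V\<^esub>"
    and surj: "\<And>u w. u \<in> carrier U \<Longrightarrow> (\<And>j. j \<in> J \<Longrightarrow> w j \<in> carrier (W j)) \<Longrightarrow>
       \<exists>v\<in>carrier V. g v = u \<and> (\<forall>j\<in>J. f j v = w j)"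
  shows "kfin V \<and> kdim V = kdim U + (\<Sum>j\<in>J. kdim (W j))"
proof -
  interpret U: vect U by fact
  let ?K = "{v \<in> carrier V. g v = \<zero>\<^bsub>U\<^esub>}"
  have sK: "subsp V ?K" by (rule subsp_kernel) fact+
  have K: "kfin (V\<lparr>carrier := ?K\<rparr>) \<and> kdim (V\<lparr>carrier := ?K\<rparr>) = (\<Sum>j\<in>J. kdim (W j))"
  proof (rule family_dim)
    show "vect (V\<lparr>carrier := ?K\<rparr>)" by (rule subsp_vect[OF assms(2) sK])
    show "\<exists>v\<in>carrier (V\<lparr>carrier := ?K\<rparr>). \<forall>i\<in>J. f i v = w i" if "\<And>i. i \<in> J \<Longrightarrow> w i \<in> carrier (W i)" for w
      using surj[OF U.zero_closed that] by auto
    show "v = \<zero>\<^bsub>V\<lparr>carrier := ?K\<rparr>\<^esub>"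
      if "v \<in> carrier (V\<lparr>carrier := ?K\<rparr>)" "\<And>i. i \<in> J \<Longrightarrow> f i v = \<zero>\<^bsub>W i\<^esub>" for v
      using inj[OF _ _ that(2)] that(1) by simp
    show "klin (V\<lparr>carrier := ?K\<rparr>) (W i) (f i)" if "i \<in> J" for i
      using assms(8) that by (intro klin_subsp_dom[OF _ sK]) simp
  qed (use assms(1,6,7) in simp_all)
  have im: "g ` carrier V = carrier U"
  proof -
    have "\<exists>v\<in>carrier V. g v = y" if "y \<in> carrier U" for y
      using surj[OF that abelian_groupE(2)[OF vect.axioms(1)[OF assms(6)]]] by blast
    then show ?thesis using klin_closed[OF assms(5)] by blast
  qed
  have kV: "kfin V" using kfin_extension[OF assms(2,3,5) im assms(4)] K by simp
  show ?thesis using rank_nullity[OF assms(2,3,5) kV] im kV K by simp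
qed

section \<open>Spaces of linear maps and quotient spaces\<close>

lemma fun_space_simps [simp]:
  "carrier (fun_space S V) = S \<rightarrow>\<^sub>E carrier V"
  "zero (fun_space S V) = (\<lambda>x\<in>S. \<zero>\<^bsub>V\<^esub>)"
  "add (fun_space S V) = (\<lambda>f g. \<lambda>x\<in>S. f x \<oplus>\<^bsub>V\<^esub> g x)"
  "smult (fun_space S V) = (\<lambda>c f. \<lambda>x\<in>S. c \<odot>\<^bsub>V\<^esub> f x)"
  by (simp_all add: fun_space_def)

lemma vect_fun_space:
  assumes "vect V"
  shows "vect (fun_space S V)"
proof -
  interpret vect V by fact
  have inv: "\<exists>g\<in>S \<rightarrow>\<^sub>E carrier V. (\<lambda>x\<in>S. g x \<oplus>\<^bsub>V\<^esub> f x) = (\<lambda>x\<in>S. \<zero>\<^bsub>V\<^esub>) \<and> (\<lambda>x\<in>S. f x \<oplus>\<^bsub>V\<^esub> g x) = (\<lambda>x\<in>S. \<zero>\<^bsub>V\<^esub>)"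
    if "f \<in> S \<rightarrow>\<^sub>E carrier V" for f
  proof (rule bexI[of _ "\<lambda>x\<in>S. \<ominus>\<^bsub>V\<^esub> f x"])
    have "f x \<in> carrier V" if "x \<in> S" for x using \<open>f \<in> _\<close> that by auto
    then show "(\<lambda>x\<in>S. (\<lambda>x\<in>S. \<ominus>\<^bsub>V\<^esub> f x) x \<oplus>\<^bsub>V\<^esub> f x) = (\<lambda>x\<in>S. \<zero>\<^bsub>V\<^esub>) \<and>
      (\<lambda>x\<in>S. f x \<oplus>\<^bsub>V\<^esub> (\<lambda>x\<in>S. \<ominus>\<^bsub>V\<^esub> f x) x) = (\<lambda>x\<in>S. \<zero>\<^bsub>V\<^esub>)"
      by (auto simp: l_neg r_neg intro!: restrict_ext)
  qed (use that in auto)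
  have closed: "f x \<in> carrier V" if "f \<in> S \<rightarrow>\<^sub>E carrier V" "x \<in> S" for f x using that by auto
  have eqI: "(\<lambda>x\<in>S. F x) = f" if "f \<in> S \<rightarrow>\<^sub>E carrier V" "\<And>x. x \<in> S \<Longrightarrow> F x = f x" for F f
    using that by (auto simp: fun_eq_iff PiE_def extensional_def)
  show ?thesis
  proof unfold_locales
    show "carrier (add_monoid (fun_space S V)) \<subseteq> Units (add_monoid (fun_space S V))"
      using inv by (auto simp: Units_def)
  qed (auto simp: closed a_ac scal_add_left scal_add_right scal_mult
        intro!: eqI restrict_ext)
qed

lemma subsp_lin_maps:
  assumes "vect V" "vect W"
  shows "subsp (fun_space (carrier V) W) (lin_maps class_ring V W)"
proof -
  interpret V: vect V by fact
  interpret W: vect W by fact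
  show ?thesis
  proof (rule subspI)
    show "lin_maps class_ring V W \<subseteq> carrier (fun_space (carrier V) W)"
      by (auto simp: lin_maps_iff PiE_iff extensional_def klin_closed)
    show "\<zero>\<^bsub>fun_space (carrier V) W\<^esub> \<in> lin_maps class_ring V W"
      by (auto simp: lin_maps_iff intro!: klinI)
    fix f g assume f: "f \<in> lin_maps class_ring V W"
    then have f': "klin V W f" by (simp add: lin_maps_iff)
    show "c \<odot>\<^bsub>fun_space (carrier V) W\<^esub> f \<in> lin_maps class_ring V W" for c
      using f' by (auto simp: lin_maps_iff klin_closed klin_add klin_scal W.scal_add_right
            W.scal_mult[symmetric] mult.commute intro!: klinI)
    assume g: "g \<in> lin_maps class_ring V W"
    then have g': "klin V W g" by (simp add: lin_maps_iff)
    show "f \<oplus>\<^bsub>fun_space (carrier V) W\<^esub> g \<in> lin_maps class_ring V W"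
      using f' g' by (auto simp: lin_maps_iff klin_closed klin_add klin_scal W.scal_add_right W.a_ac intro!: klinI)
  qed
qed

definition hom_k :: "('k::field, 'v) module \<Rightarrow> ('k, 'w) module \<Rightarrow> ('k, 'v \<Rightarrow> 'w) module" where
  "hom_k V W = (fun_space (carrier V) W)\<lparr>carrier := lin_maps class_ring V W\<rparr>"

lemma hom_k_simps [simp]:
  "carrier (hom_k V W) = lin_maps class_ring V W"
  "zero (hom_k V W) = (\<lambda>x\<in>carrier V. \<zero>\<^bsub>W\<^esub>)"
  "add (hom_k V W) = (\<lambda>f g. \<lambda>x\<in>carrier V. f x \<oplus>\<^bsub>W\<^esub> g x)"
  "smult (hom_k V W) = (\<lambda>c f. \<lambda>x\<in>carrier V. c \<odot>\<^bsub>W\<^esub> f x)"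
  by (simp_all add: hom_k_def)

lemma vect_hom_k: "vect V \<Longrightarrow> vect W \<Longrightarrow> vect (hom_k V W)"
  unfolding hom_k_def by (intro subsp_vect vect_fun_space subsp_lin_maps)

lemma klin_eval: "vect V \<Longrightarrow> vect W \<Longrightarrow> x \<in> carrier V \<Longrightarrow> klin (hom_k V W) W (\<lambda>f. f x)"
  by (rule klinI) (auto simp: lin_maps_iff klin_closed)

lemma lin_maps_eqI:
  assumes "f \<in> lin_maps R V W" "g \<in> lin_maps R V W" "\<And>x. x \<in> carrier V \<Longrightarrow> f x = g x"
  shows "f = g"
  using assms by (intro extensionalityI[of f "carrier V" g]) (auto simp: lin_maps_def)

lemma klin_sum_coeffs:
  assumes "vect V" "vect W" "finite A" "\<And>p. p \<in> A \<Longrightarrow> klin V ground_space (c p)" "\<And>p. p \<in> A \<Longrightarrow> w p \<in> carrier W"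
  shows "klin V W (\<lambda>v. \<Oplus>\<^bsub>W\<^esub>p\<in>A. c p v \<odot>\<^bsub>W\<^esub> w p)"
proof -
  interpret V: vect V by fact
  interpret W: vect W by fact
  have mem: "(\<lambda>p. a p \<odot>\<^bsub>W\<^esub> w p) \<in> A \<rightarrow> carrier W" for a using assms(5) by auto
  show ?thesis
  proof (rule klinI)
    fix x y assume xy: "x \<in> carrier V" "y \<in> carrier V"
    have "(\<Oplus>\<^bsub>W\<^esub>p\<in>A. c p (x \<oplus>\<^bsub>V\<^esub> y) \<odot>\<^bsub>W\<^esub> w p)
        = (\<Oplus>\<^bsub>W\<^esub>p\<in>A. c p x \<odot>\<^bsub>W\<^esub> w p \<oplus>\<^bsub>W\<^esub> c p y \<odot>\<^bsub>W\<^esub> w p)"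
      using assms(5) xy by (intro W.finsum_cong') (auto simp: klin_add[OF assms(4)] W.scal_add_left)
    also have "\<dots> = (\<Oplus>\<^bsub>W\<^esub>p\<in>A. c p x \<odot>\<^bsub>W\<^esub> w p) \<oplus>\<^bsub>W\<^esub> (\<Oplus>\<^bsub>W\<^esub>p\<in>A. c p y \<odot>\<^bsub>W\<^esub> w p)"
      by (rule W.finsum_addf[OF mem mem])
    finally show "(\<Oplus>\<^bsub>W\<^esub>p\<in>A. c p (x \<oplus>\<^bsub>V\<^esub> y) \<odot>\<^bsub>W\<^esub> w p)
       = (\<Oplus>\<^bsub>W\<^esub>p\<in>A. c p x \<odot>\<^bsub>W\<^esub> w p) \<oplus>\<^bsub>W\<^esub> (\<Oplus>\<^bsub>W\<^esub>p\<in>A. c p y \<odot>\<^bsub>W\<^esub> w p)" .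
  next
    fix k x assume x: "x \<in> carrier V"
    have "(\<Oplus>\<^bsub>W\<^esub>p\<in>A. c p (k \<odot>\<^bsub>V\<^esub> x) \<odot>\<^bsub>W\<^esub> w p) = (\<Oplus>\<^bsub>W\<^esub>p\<in>A. k \<odot>\<^bsub>W\<^esub> (c p x \<odot>\<^bsub>W\<^esub> w p))"
      using assms(5) x by (intro W.finsum_cong') (auto simp: klin_scal[OF assms(4)] W.scal_mult)
    then show "(\<Oplus>\<^bsub>W\<^esub>p\<in>A. c p (k \<odot>\<^bsub>V\<^esub> x) \<odot>\<^bsub>W\<^esub> w p) = k \<odot>\<^bsub>W\<^esub> (\<Oplus>\<^bsub>W\<^esub>p\<in>A. c p x \<odot>\<^bsub>W\<^esub> w p)"
      using W.scal_finsum[OF assms(3) mem] by simp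
  qed (rule W.finsum_closed[OF mem])
qed

lemma kfin_hom_k:
  assumes "vect V" "vect W" "kfin V" "kfin W"
  shows "kfin (hom_k V W)"
proof -
  interpret V: vect V by fact
  interpret W: vect W by fact
  obtain A c where d: "dual_basis V A c" using dual_basis_exists[OF assms(1,3)] by blast
  then have A: "finite A" "A \<subseteq> carrier V"
    and c: "\<And>p. p \<in> A \<Longrightarrow> klin V ground_space (c p)" by (simp_all add: dual_basis_def)
  have vh: "vect (hom_k V W)" by (rule vect_hom_k[OF assms(1,2)])
  have "kfin (hom_k V W) \<and> kdim (hom_k V W) = (\<Sum>p\<in>A. kdim W)"
  proof (rule family_dim[OF A(1) vh assms(2,4)])
    show "klin (hom_k V W) W (\<lambda>f. f p)" if "p \<in> A" for p
      using that A(2) assms by (intro klin_eval) auto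
    show "f = \<zero>\<^bsub>hom_k V W\<^esub>" if f: "f \<in> carrier (hom_k V W)" and z: "\<And>p. p \<in> A \<Longrightarrow> f p = \<zero>\<^bsub>W\<^esub>" for f
    proof (rule lin_maps_eqI)
      show "f \<in> lin_maps class_ring V W" using f by simp
      show "\<zero>\<^bsub>hom_k V W\<^esub> \<in> lin_maps class_ring V W" using vect.axioms(1)[OF vh] abelian_groupE(2) by force
      have l: "klin V W f" using f by (simp add: lin_maps_iff)
      show "f x = \<zero>\<^bsub>hom_k V W\<^esub> x" if x: "x \<in> carrier V" for x
      proof -
        have mem: "(\<lambda>p. c p x \<odot>\<^bsub>V\<^esub> p) \<in> A \<rightarrow> carrier V" using A by auto
        have "f x = f (\<Oplus>\<^bsub>V\<^esub>p\<in>A. c p x \<odot>\<^bsub>V\<^esub> p)" using d x by (simp add: dual_basis_def)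
        also have "\<dots> = (\<Oplus>\<^bsub>W\<^esub>p\<in>A. f (c p x \<odot>\<^bsub>V\<^esub> p))" by (rule klin_finsum[OF assms(1,2) l A(1) mem])
        also have "\<dots> = (\<Oplus>\<^bsub>W\<^esub>p\<in>A. \<zero>\<^bsub>W\<^esub>)"
          using A z by (intro W.finsum_cong') (auto simp: klin_scal[OF l])
        finally show ?thesis using x by simp
      qed
    qed
    show "\<exists>f\<in>carrier (hom_k V W). \<forall>p\<in>A. f p = w p" if w: "\<And>p. p \<in> A \<Longrightarrow> w p \<in> carrier W" for w
    proof -
      let ?f = "\<lambda>v\<in>carrier V. \<Oplus>\<^bsub>W\<^esub>p\<in>A. c p v \<odot>\<^bsub>W\<^esub> w p"
      have "klin V W ?f" by (simp add: klin_restrict[OF assms(1)] klin_sum_coeffs[OF assms(1,2) A(1) c w])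
      then have "?f \<in> carrier (hom_k V W)" by (simp add: lin_maps_iff)
      moreover have "?f q = w q" if "q \<in> A" for q
      proof -
        have "(\<Oplus>\<^bsub>W\<^esub>p\<in>A. c p q \<odot>\<^bsub>W\<^esub> w p) = (\<Oplus>\<^bsub>W\<^esub>p\<in>A. if q = p then w p else \<zero>\<^bsub>W\<^esub>)"
        proof (rule W.finsum_cong')
          show "c p q \<odot>\<^bsub>W\<^esub> w p = (if q = p then w p else \<zero>\<^bsub>W\<^esub>)" if "p \<in> A" for p
            using d \<open>q \<in> A\<close> that w[OF that] by (simp add: dual_basis_def)
        qed (simp_all add: w)
        also have "\<dots> = w q" by (rule W.finsum_singleton) (use A(1) that w in simp_all)
        finally show ?thesis using that A(2) by auto
      qed
      ultimately show ?thesis by blast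
    qed
  qed
  then show ?thesis ..
qed

lemma subsp_abelian_subgroup:
  assumes "vect V" "subsp V S"
  shows "abelian_subgroup S V"
proof -
  interpret vect V by fact
  have "subgroup S (add_monoid V)"
  proof
    show "inv\<^bsub>add_monoid V\<^esub> x \<in> S" if "x \<in> S" for x
      using that assms(2) minus_scal[of x] by (auto simp: subsp_def a_inv_def subset_iff)
  qed (use assms(2) in \<open>auto simp: subsp_def\<close>)
  then show ?thesis
    by (intro abelian_subgroupI3 additive_subgroup.intro abelian_group_axioms)
qed

lemma quot_mod_simps [simp]:
  "carrier (quot_mod V S) = a_rcosets\<^bsub>V\<^esub> S"
  "zero (quot_mod V S) = S"
  "add (quot_mod V S) = set_add V"
  by (simp_all add: quot_mod_def FactRing_def)

lemma quot_mod_mult: "mult (quot_mod V S) = rcoset_mult V S"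
  and quot_mod_one: "one (quot_mod V S) = S +>\<^bsub>V\<^esub> \<one>\<^bsub>V\<^esub>"
  by (simp_all add: quot_mod_def FactRing_def)

lemma quot_mod_carrier: "carrier (quot_mod V S) = (\<lambda>x. S +>\<^bsub>V\<^esub> x) ` carrier V"
  by (auto simp: A_RCOSETS_def RCOSETS_def a_r_coset_def)

lemma quot_mod_smult:
  assumes "vect V" "subsp V S" "x \<in> carrier V"
  shows "c \<odot>\<^bsub>quot_mod V S\<^esub> (S +>\<^bsub>V\<^esub> x) = S +>\<^bsub>V\<^esub> (c \<odot>\<^bsub>V\<^esub> x)"
proof -
  interpret vect V by fact
  interpret abelian_subgroup S V by (rule subsp_abelian_subgroup) fact+
  have "S +>\<^bsub>V\<^esub> (c \<odot>\<^bsub>V\<^esub> y) = S +>\<^bsub>V\<^esub> (c \<odot>\<^bsub>V\<^esub> x)" if y: "y \<in> S +>\<^bsub>V\<^esub> x" for y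
  proof -
    obtain h where h: "h \<in> S" "y = h \<oplus>\<^bsub>V\<^esub> x" using y by (auto simp: a_r_coset_def r_coset_def)
    then have "c \<odot>\<^bsub>V\<^esub> y = c \<odot>\<^bsub>V\<^esub> h \<oplus>\<^bsub>V\<^esub> c \<odot>\<^bsub>V\<^esub> x" using assms scal_add_right by (auto simp: subsp_def)
    moreover have "c \<odot>\<^bsub>V\<^esub> h \<in> S" using h assms(2) by (simp add: subsp_def)
    ultimately have "c \<odot>\<^bsub>V\<^esub> y \<in> S +>\<^bsub>V\<^esub> (c \<odot>\<^bsub>V\<^esub> x)" by (auto simp: a_r_coset_def r_coset_def)
    from a_repr_independence[OF this scal_closed[OF assms(3)] a_subgroup] show ?thesis by (rule sym)
  qed
  then have "(\<Union>y\<in>S +>\<^bsub>V\<^esub> x. S +>\<^bsub>V\<^esub> (c \<odot>\<^bsub>V\<^esub> y)) = (\<Union>y\<in>S +>\<^bsub>V\<^esub> x. S +>\<^bsub>V\<^esub> (c \<odot>\<^bsub>V\<^esub> x))"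
    by (intro SUP_cong refl)
  also have "\<dots> = S +>\<^bsub>V\<^esub> (c \<odot>\<^bsub>V\<^esub> x)" using a_rcos_self[OF assms(3)] by (intro SUP_const) blast
  finally show ?thesis by (simp only: quot_mod_def module.simps)
qed

lemma quot_mod_add:
  assumes "vect V" "subsp V S" "x \<in> carrier V" "y \<in> carrier V"
  shows "(S +>\<^bsub>V\<^esub> x) <+>\<^bsub>V\<^esub> (S +>\<^bsub>V\<^esub> y) = S +>\<^bsub>V\<^esub> (x \<oplus>\<^bsub>V\<^esub> y)"
  by (rule abelian_subgroup.a_rcos_sum[OF subsp_abelian_subgroup[OF assms(1,2)] assms(3,4)])

lemma vect_quot_mod:
  assumes "vect V" "subsp V S"
  shows "vect (quot_mod V S)"
proof -
  interpret vect V by fact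
  note closed = a_closed and zcl = zero_closed and inv_closed = a_inv_closed
  interpret abelian_subgroup S V by (rule subsp_abelian_subgroup) fact+
  let ?q = "\<lambda>x. S +>\<^bsub>V\<^esub> x"
  have car: "X \<in> carrier (quot_mod V S) \<longleftrightarrow> (\<exists>x\<in>carrier V. X = ?q x)" for X
    unfolding quot_mod_carrier by blast
  have add: "add (quot_mod V S) (?q x) (?q y) = ?q (x \<oplus>\<^bsub>V\<^esub> y)" if "x \<in> carrier V" "y \<in> carrier V" for x y
    using that quot_mod_add[OF assms] by simp
  have zero: "\<zero>\<^bsub>quot_mod V S\<^esub> = ?q \<zero>\<^bsub>V\<^esub>" unfolding a_coset_add_zero[OF a_subset] quot_mod_simps ..
  have ag: "abelian_group (quot_mod V S)"
  proof (rule abelian_groupI)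
    show "\<exists>Y\<in>carrier (quot_mod V S). Y \<oplus>\<^bsub>quot_mod V S\<^esub> X = \<zero>\<^bsub>quot_mod V S\<^esub>" if X: "X \<in> carrier (quot_mod V S)" for X
    proof -
      obtain x where x: "x \<in> carrier V" "X = ?q x" using X unfolding car by blast
      then have "?q (\<ominus>\<^bsub>V\<^esub> x) \<in> carrier (quot_mod V S)" unfolding car by blast
      moreover have "?q (\<ominus>\<^bsub>V\<^esub> x) \<oplus>\<^bsub>quot_mod V S\<^esub> X = \<zero>\<^bsub>quot_mod V S\<^esub>"
        unfolding x(2) zero add[OF inv_closed[OF x(1)] x(1)] l_neg[OF x(1)] ..
      ultimately show ?thesis by blast
    qed
    show "\<zero>\<^bsub>quot_mod V S\<^esub> \<in> carrier (quot_mod V S)" unfolding car zero by blast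
    fix X assume X: "X \<in> carrier (quot_mod V S)"
    then obtain x where x: "x \<in> carrier V" "X = ?q x" unfolding car by blast
    show "\<zero>\<^bsub>quot_mod V S\<^esub> \<oplus>\<^bsub>quot_mod V S\<^esub> X = X" unfolding x(2) zero add[OF zcl x(1)] l_zero[OF x(1)] ..
    fix Y assume "Y \<in> carrier (quot_mod V S)"
    then obtain y where y: "y \<in> carrier V" "Y = ?q y" unfolding car by blast
    show "X \<oplus>\<^bsub>quot_mod V S\<^esub> Y \<in> carrier (quot_mod V S)"
      unfolding x(2) y(2) car add[OF x(1) y(1)] using x(1) y(1) by blast
    show "X \<oplus>\<^bsub>quot_mod V S\<^esub> Y = Y \<oplus>\<^bsub>quot_mod V S\<^esub> X"
      unfolding x(2) y(2) add[OF x(1) y(1)] add[OF y(1) x(1)] a_comm[OF x(1) y(1)] ..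
    fix Z assume "Z \<in> carrier (quot_mod V S)"
    then obtain z where z: "z \<in> carrier V" "Z = ?q z" unfolding car by blast
    show "X \<oplus>\<^bsub>quot_mod V S\<^esub> Y \<oplus>\<^bsub>quot_mod V S\<^esub> Z = X \<oplus>\<^bsub>quot_mod V S\<^esub> (Y \<oplus>\<^bsub>quot_mod V S\<^esub> Z)"
      unfolding x(2) y(2) z(2) add[OF x(1) y(1)] add[OF y(1) z(1)] add[OF closed[OF x(1) y(1)] z(1)]
        add[OF x(1) closed[OF y(1) z(1)]] a_assoc[OF x(1) y(1) z(1)] ..
  qed
  note sm = quot_mod_smult[OF assms]
  show ?thesis
  proof (intro vect.intro ag vect_axioms.intro)
    fix X c d assume "X \<in> carrier (quot_mod V S)"
    then obtain x where x: "x \<in> carrier V" "X = ?q x" unfolding car by blast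
    show "c \<odot>\<^bsub>quot_mod V S\<^esub> X \<in> carrier (quot_mod V S)" unfolding x(2) sm[OF x(1)] car using x(1) by blast
    show "(c + d) \<odot>\<^bsub>quot_mod V S\<^esub> X = c \<odot>\<^bsub>quot_mod V S\<^esub> X \<oplus>\<^bsub>quot_mod V S\<^esub> d \<odot>\<^bsub>quot_mod V S\<^esub> X"
      unfolding x(2) sm[OF x(1)] add[OF scal_closed[OF x(1)] scal_closed[OF x(1)]] scal_add_left[OF x(1)] ..
    show "(c * d) \<odot>\<^bsub>quot_mod V S\<^esub> X = c \<odot>\<^bsub>quot_mod V S\<^esub> (d \<odot>\<^bsub>quot_mod V S\<^esub> X)"
      unfolding x(2) sm[OF x(1)] sm[OF scal_closed[OF x(1)]] scal_mult[OF x(1)] ..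
    show "1 \<odot>\<^bsub>quot_mod V S\<^esub> X = X" unfolding x(2) sm[OF x(1)] scal_one[OF x(1)] ..
    fix Y assume "Y \<in> carrier (quot_mod V S)"
    then obtain y where y: "y \<in> carrier V" "Y = ?q y" unfolding car by blast
    show "c \<odot>\<^bsub>quot_mod V S\<^esub> (X \<oplus>\<^bsub>quot_mod V S\<^esub> Y) = c \<odot>\<^bsub>quot_mod V S\<^esub> X \<oplus>\<^bsub>quot_mod V S\<^esub> c \<odot>\<^bsub>quot_mod V S\<^esub> Y"
      unfolding x(2) y(2) sm[OF x(1)] sm[OF y(1)] add[OF x(1) y(1)] add[OF scal_closed[OF x(1)] scal_closed[OF y(1)]]
        sm[OF closed[OF x(1) y(1)]] scal_add_right[OF x(1) y(1)] ..
  qed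
qed

lemma quot_proj:
  assumes "vect V" "subsp V S"
  shows "klin V (quot_mod V S) (\<lambda>x. S +>\<^bsub>V\<^esub> x)"
    and "\<And>x. x \<in> carrier V \<Longrightarrow> S +>\<^bsub>V\<^esub> x = \<zero>\<^bsub>quot_mod V S\<^esub> \<longleftrightarrow> x \<in> S"
    and "(\<lambda>x. S +>\<^bsub>V\<^esub> x) ` carrier V = carrier (quot_mod V S)"
proof -
  interpret vect V by fact
  interpret abelian_subgroup S V by (rule subsp_abelian_subgroup) fact+
  show "klin V (quot_mod V S) (\<lambda>x. S +>\<^bsub>V\<^esub> x)"
  proof (rule klinI)
    show "S +>\<^bsub>V\<^esub> x \<in> carrier (quot_mod V S)" if "x \<in> carrier V" for x
      using that unfolding quot_mod_carrier by blast
    show "S +>\<^bsub>V\<^esub> (x \<oplus>\<^bsub>V\<^esub> y) = (S +>\<^bsub>V\<^esub> x) \<oplus>\<^bsub>quot_mod V S\<^esub> (S +>\<^bsub>V\<^esub> y)"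
      if "x \<in> carrier V" "y \<in> carrier V" for x y
      using that quot_mod_add[OF assms] by simp
    show "S +>\<^bsub>V\<^esub> (c \<odot>\<^bsub>V\<^esub> x) = c \<odot>\<^bsub>quot_mod V S\<^esub> (S +>\<^bsub>V\<^esub> x)" if "x \<in> carrier V" for c x
      using that quot_mod_smult[OF assms] by simp
  qed
  show "S +>\<^bsub>V\<^esub> x = \<zero>\<^bsub>quot_mod V S\<^esub> \<longleftrightarrow> x \<in> S" if x: "x \<in> carrier V" for x
    unfolding quot_mod_simps
  proof
    assume "S +>\<^bsub>V\<^esub> x = S"
    then show "x \<in> S" using a_rcos_self[OF x] by (rule subst[where P = "\<lambda>Y. x \<in> Y"])
  next
    show "x \<in> S \<Longrightarrow> S +>\<^bsub>V\<^esub> x = S" by (rule a_rcos_const)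
  qed
  show "(\<lambda>x. S +>\<^bsub>V\<^esub> x) ` carrier V = carrier (quot_mod V S)" by (rule quot_mod_carrier[symmetric])
qed

section \<open>Algebras, modules, bimodules and derivations\<close>

lemma (in vect) diff_eq_zero_iff:
  assumes x: "x \<in> carrier V" and y: "y \<in> carrier V"
  shows "x \<ominus> y = \<zero> \<longleftrightarrow> x = y"
proof
  assume "x \<ominus> y = \<zero>"
  moreover have "(x \<ominus> y) \<oplus> y = x" using x y by (simp add: a_minus_def a_assoc l_neg)
  ultimately show "x = y" using y by simp
qed (use x in \<open>simp add: a_minus_def r_neg\<close>)

locale kalg = ring A + vect A for A :: "('k::field, 'a) module" (structure) +
  assumes scal_mult_left: "x \<in> carrier A \<Longrightarrow> y \<in> carrier A \<Longrightarrow> (c \<odot> x) \<otimes> y = c \<odot> (x \<otimes> y)"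
    and scal_mult_right: "x \<in> carrier A \<Longrightarrow> y \<in> carrier A \<Longrightarrow> x \<otimes> (c \<odot> y) = c \<odot> (x \<otimes> y)"

definition alg_hom :: "('k::field, 'a) module \<Rightarrow> ('k, 'b) module \<Rightarrow> ('a \<Rightarrow> 'b) \<Rightarrow> bool" where
  "alg_hom A B f \<longleftrightarrow> klin A B f \<and> f \<one>\<^bsub>A\<^esub> = \<one>\<^bsub>B\<^esub> \<and>
     (\<forall>x\<in>carrier A. \<forall>y\<in>carrier A. f (x \<otimes>\<^bsub>A\<^esub> y) = f x \<otimes>\<^bsub>B\<^esub> f y)"

lemma alg_hom_klin: "alg_hom A B f \<Longrightarrow> klin A B f"
  and alg_hom_one: "alg_hom A B f \<Longrightarrow> f \<one>\<^bsub>A\<^esub> = \<one>\<^bsub>B\<^esub>"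
  and alg_hom_mult: "alg_hom A B f \<Longrightarrow> x \<in> carrier A \<Longrightarrow> y \<in> carrier A \<Longrightarrow> f (x \<otimes>\<^bsub>A\<^esub> y) = f x \<otimes>\<^bsub>B\<^esub> f y"
  and alg_hom_closed: "alg_hom A B f \<Longrightarrow> x \<in> carrier A \<Longrightarrow> f x \<in> carrier B"
  and alg_hom_add: "alg_hom A B f \<Longrightarrow> x \<in> carrier A \<Longrightarrow> y \<in> carrier A \<Longrightarrow> f (x \<oplus>\<^bsub>A\<^esub> y) = f x \<oplus>\<^bsub>B\<^esub> f y"
  and alg_hom_scal: "alg_hom A B f \<Longrightarrow> x \<in> carrier A \<Longrightarrow> f (c \<odot>\<^bsub>A\<^esub> x) = c \<odot>\<^bsub>B\<^esub> f x"
  by (simp_all add: alg_hom_def klin_def)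

locale lmod = A: kalg A + V: vect V
  for A :: "('k::field, 'a) module" and V :: "('k, 'v) module" and act :: "'a \<Rightarrow> 'v \<Rightarrow> 'v" +
  assumes act_closed [simp, intro]: "a \<in> carrier A \<Longrightarrow> v \<in> carrier V \<Longrightarrow> act a v \<in> carrier V"
    and act_add_left: "a \<in> carrier A \<Longrightarrow> b \<in> carrier A \<Longrightarrow> v \<in> carrier V \<Longrightarrow>
          act (a \<oplus>\<^bsub>A\<^esub> b) v = act a v \<oplus>\<^bsub>V\<^esub> act b v"
    and act_add_right: "a \<in> carrier A \<Longrightarrow> v \<in> carrier V \<Longrightarrow> w \<in> carrier V \<Longrightarrow>
          act a (v \<oplus>\<^bsub>V\<^esub> w) = act a v \<oplus>\<^bsub>V\<^esub> act a w"
    and act_scal_left: "a \<in> carrier A \<Longrightarrow> v \<in> carrier V \<Longrightarrow> act (c \<odot>\<^bsub>A\<^esub> a) v = c \<odot>\<^bsub>V\<^esub> act a v"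
    and act_scal_right: "a \<in> carrier A \<Longrightarrow> v \<in> carrier V \<Longrightarrow> act a (c \<odot>\<^bsub>V\<^esub> v) = c \<odot>\<^bsub>V\<^esub> act a v"
    and act_mult: "a \<in> carrier A \<Longrightarrow> b \<in> carrier A \<Longrightarrow> v \<in> carrier V \<Longrightarrow> act (a \<otimes>\<^bsub>A\<^esub> b) v = act a (act b v)"
    and act_one [simp]: "v \<in> carrier V \<Longrightarrow> act \<one>\<^bsub>A\<^esub> v = v"
begin

lemma klin_act: "a \<in> carrier A \<Longrightarrow> klin V V (act a)"
  by (rule klinI) (simp_all add: act_add_right act_scal_right)

lemma klin_act_arg: "v \<in> carrier V \<Longrightarrow> klin A V (\<lambda>a. act a v)"
  by (rule klinI) (simp_all add: act_add_left act_scal_left)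

lemma act_zero [simp]: "a \<in> carrier A \<Longrightarrow> act a \<zero>\<^bsub>V\<^esub> = \<zero>\<^bsub>V\<^esub>"
  using klin_zero[OF V.vect_axioms V.vect_axioms klin_act] .

end

locale bimod = lmod A V l
  for A :: "('k::field, 'a) module" and V :: "('k, 'v) module" and l :: "'a \<Rightarrow> 'v \<Rightarrow> 'v" and r :: "'v \<Rightarrow> 'a \<Rightarrow> 'v" +
  assumes ract_closed [simp, intro]: "v \<in> carrier V \<Longrightarrow> a \<in> carrier A \<Longrightarrow> r v a \<in> carrier V"
    and ract_add_left: "v \<in> carrier V \<Longrightarrow> w \<in> carrier V \<Longrightarrow> a \<in> carrier A \<Longrightarrow>
          r (v \<oplus>\<^bsub>V\<^esub> w) a = r v a \<oplus>\<^bsub>V\<^esub> r w a"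
    and ract_add_right: "v \<in> carrier V \<Longrightarrow> a \<in> carrier A \<Longrightarrow> b \<in> carrier A \<Longrightarrow>
          r v (a \<oplus>\<^bsub>A\<^esub> b) = r v a \<oplus>\<^bsub>V\<^esub> r v b"
    and ract_scal_left: "v \<in> carrier V \<Longrightarrow> a \<in> carrier A \<Longrightarrow> r (c \<odot>\<^bsub>V\<^esub> v) a = c \<odot>\<^bsub>V\<^esub> r v a"
    and ract_scal_right: "v \<in> carrier V \<Longrightarrow> a \<in> carrier A \<Longrightarrow> r v (c \<odot>\<^bsub>A\<^esub> a) = c \<odot>\<^bsub>V\<^esub> r v a"
    and ract_mult: "v \<in> carrier V \<Longrightarrow> a \<in> carrier A \<Longrightarrow> b \<in> carrier A \<Longrightarrow> r v (a \<otimes>\<^bsub>A\<^esub> b) = r (r v a) b"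
    and ract_one [simp]: "v \<in> carrier V \<Longrightarrow> r v \<one>\<^bsub>A\<^esub> = v"
    and lact_ract: "a \<in> carrier A \<Longrightarrow> v \<in> carrier V \<Longrightarrow> b \<in> carrier A \<Longrightarrow> l a (r v b) = r (l a v) b"

definition derivs :: "('k::field, 'a) module \<Rightarrow> ('k, 'v) module \<Rightarrow> ('a \<Rightarrow> 'v \<Rightarrow> 'v) \<Rightarrow> ('v \<Rightarrow> 'a \<Rightarrow> 'v) \<Rightarrow> ('a \<Rightarrow> 'v) set" where
  "derivs A V l r = {d. klin A V d \<and> d \<in> extensional (carrier A) \<and>
     (\<forall>x\<in>carrier A. \<forall>y\<in>carrier A. d (x \<otimes>\<^bsub>A\<^esub> y) = l x (d y) \<oplus>\<^bsub>V\<^esub> r (d x) y)}"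

definition der_space :: "('k::field, 'a) module \<Rightarrow> ('k, 'v) module \<Rightarrow> ('a \<Rightarrow> 'v \<Rightarrow> 'v) \<Rightarrow> ('v \<Rightarrow> 'a \<Rightarrow> 'v) \<Rightarrow> ('k, 'a \<Rightarrow> 'v) module" where
  "der_space A V l r = (fun_space (carrier A) V)\<lparr>carrier := derivs A V l r\<rparr>"

text \<open>
  The Euler characteristic of the start of the Hochschild complex with coefficients in \<open>V\<close>: its first
  cohomology minus its zeroth cohomology.
\<close>

definition chi :: "('k::field, 'a) module \<Rightarrow> ('k, 'v) module \<Rightarrow> ('a \<Rightarrow> 'v \<Rightarrow> 'v) \<Rightarrow> ('v \<Rightarrow> 'a \<Rightarrow> 'v) \<Rightarrow> int" where
  "chi A V l r = int (kdim (der_space A V l r)) - int (kdim V)"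

lemma der_space_simps [simp]:
  "carrier (der_space A V l r) = derivs A V l r"
  "zero (der_space A V l r) = (\<lambda>x\<in>carrier A. \<zero>\<^bsub>V\<^esub>)"
  "add (der_space A V l r) = (\<lambda>f g. \<lambda>x\<in>carrier A. f x \<oplus>\<^bsub>V\<^esub> g x)"
  "smult (der_space A V l r) = (\<lambda>c f. \<lambda>x\<in>carrier A. c \<odot>\<^bsub>V\<^esub> f x)"
  by (simp_all add: der_space_def)

lemma der_space_eq_hom_k: "der_space A V l r = (hom_k A V)\<lparr>carrier := derivs A V l r\<rparr>"
  by (simp add: der_space_def hom_k_def)

lemma derivs_klin: "d \<in> derivs A V l r \<Longrightarrow> klin A V d"
  and derivs_ext: "d \<in> derivs A V l r \<Longrightarrow> d \<in> extensional (carrier A)"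
  and derivs_mult: "d \<in> derivs A V l r \<Longrightarrow> x \<in> carrier A \<Longrightarrow> y \<in> carrier A \<Longrightarrow>
     d (x \<otimes>\<^bsub>A\<^esub> y) = l x (d y) \<oplus>\<^bsub>V\<^esub> r (d x) y"
  and derivs_closed: "d \<in> derivs A V l r \<Longrightarrow> x \<in> carrier A \<Longrightarrow> d x \<in> carrier V"
  by (simp_all add: derivs_def klin_def)

lemma derivs_eqI:
  assumes "d \<in> derivs A V l r" "e \<in> derivs A V l r" "\<And>x. x \<in> carrier A \<Longrightarrow> d x = e x"
  shows "d = e"
  using assms by (intro extensionalityI[OF derivs_ext derivs_ext]) auto

context bimod
begin

lemma subsp_derivs: "subsp (hom_k A V) (derivs A V l r)"
proof -
  note hk = subsp_lin_maps[OF A.vect_axioms V.vect_axioms]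
  have car: "d \<in> lin_maps class_ring A V" if "d \<in> derivs A V l r" for d
    using that by (simp add: lin_maps_iff derivs_klin derivs_ext)
  show ?thesis
  proof (rule subspI)
    show "derivs A V l r \<subseteq> carrier (hom_k A V)" using car by auto
    have "(\<lambda>x\<in>carrier A. \<zero>\<^bsub>V\<^esub>) \<in> lin_maps class_ring A V" using hk by (simp add: subsp_def)
    moreover have "r \<zero>\<^bsub>V\<^esub> y = \<zero>\<^bsub>V\<^esub>" if "y \<in> carrier A" for y
      using ract_scal_left[OF V.zero_closed that, of 0] that by simp
    ultimately show "\<zero>\<^bsub>hom_k A V\<^esub> \<in> derivs A V l r"
      by (simp add: derivs_def lin_maps_iff)
    fix d e c assume d: "d \<in> derivs A V l r"
    note dc = derivs_closed[OF d] and dm = derivs_mult[OF d]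
    have "(\<lambda>x\<in>carrier A. c \<odot>\<^bsub>V\<^esub> d x) \<in> lin_maps class_ring A V" for c
      using hk car[OF d] by (simp add: subsp_def)
    then show "c \<odot>\<^bsub>hom_k A V\<^esub> d \<in> derivs A V l r" for c
      by (simp add: derivs_def lin_maps_iff dm dc V.scal_add_right act_scal_right ract_scal_left)
    assume e: "e \<in> derivs A V l r"
    note ec = derivs_closed[OF e] and em = derivs_mult[OF e]
    have "(\<lambda>x\<in>carrier A. d x \<oplus>\<^bsub>V\<^esub> e x) \<in> lin_maps class_ring A V"
      using hk car[OF d] car[OF e] by (simp add: subsp_def)
    then show "d \<oplus>\<^bsub>hom_k A V\<^esub> e \<in> derivs A V l r"
      by (simp add: derivs_def lin_maps_iff dm dc em ec act_add_right ract_add_left V.a_ac)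
  qed
qed

lemma vect_der_space: "vect (der_space A V l r)"
  unfolding der_space_eq_hom_k by (intro subsp_vect subsp_derivs vect_hom_k A.vect_axioms V.vect_axioms)

lemma kfin_der_space: "kfin A \<Longrightarrow> kfin V \<Longrightarrow> kfin (der_space A V l r)"
  unfolding der_space_eq_hom_k
  by (intro kfin_subsp subsp_derivs vect_hom_k kfin_hom_k A.vect_axioms V.vect_axioms)

end

definition bimod_map where
  "bimod_map A V l r W l' r' f \<longleftrightarrow> klin V W f \<and>
     (\<forall>a\<in>carrier A. \<forall>v\<in>carrier V. f (l a v) = l' a (f v) \<and> f (r v a) = r' (f v) a)"

lemma derivs_postcomp:
  assumes "bimod A V l r" "bimod A W l' r'" "bimod_map A V l r W l' r' f"
  shows "klin (der_space A V l r) (der_space A W l' r') (\<lambda>d. \<lambda>x\<in>carrier A. f (d x))"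
proof -
  interpret V: bimod A V l r by fact
  interpret W: bimod A W l' r' by fact
  have f: "klin V W f" using assms(3) by (simp add: bimod_map_def)
  have fl: "f (l a v) = l' a (f v)" "f (r v a) = r' (f v) a" if "a \<in> carrier A" "v \<in> carrier V" for a v
    using assms(3) that by (simp_all add: bimod_map_def)
  have mem: "(\<lambda>x\<in>carrier A. f (d x)) \<in> derivs A W l' r'" if d: "d \<in> derivs A V l r" for d
  proof -
    have "klin A W (\<lambda>x. f (d x))" by (rule klin_compose[OF derivs_klin[OF d] f])
    then have "klin A W (\<lambda>x\<in>carrier A. f (d x))" by (simp add: klin_restrict[OF V.A.vect_axioms])
    then show ?thesis
      by (simp add: derivs_def derivs_mult[OF d] derivs_closed[OF d] klin_add[OF f] fl)
  qed
  show ?thesis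
  proof (rule klinI)
    fix d e assume d: "d \<in> carrier (der_space A V l r)" and e: "e \<in> carrier (der_space A V l r)"
    then show "(\<lambda>x\<in>carrier A. f ((d \<oplus>\<^bsub>der_space A V l r\<^esub> e) x)) =
       (\<lambda>x\<in>carrier A. f (d x)) \<oplus>\<^bsub>der_space A W l' r'\<^esub> (\<lambda>x\<in>carrier A. f (e x))"
      by (auto simp: derivs_closed klin_add[OF f] intro!: restrict_ext)
  next
    fix c d assume d: "d \<in> carrier (der_space A V l r)"
    then show "(\<lambda>x\<in>carrier A. f ((c \<odot>\<^bsub>der_space A V l r\<^esub> d) x)) =
       c \<odot>\<^bsub>der_space A W l' r'\<^esub> (\<lambda>x\<in>carrier A. f (d x))"
      by (auto simp: derivs_closed klin_scal[OF f] intro!: restrict_ext)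
  qed (simp add: mem)
qed

text \<open>
  Composition with \<open>g\<close> and with the \<open>f j\<close> identifies the derivations into \<open>V\<close> with the families of derivations
  into the targets, since a family of bimodule maps that separates points detects the Leibniz rule.
\<close>

lemma chi_family:
  assumes "finite J" "kfin A" and V: "bimod A V l r" and U: "bimod A U lU rU" and W: "\<And>j. j \<in> J \<Longrightarrow> bimod A (W j) (lW j) (rW j)"
    and fU: "kfin U" and fW: "\<And>j. j \<in> J \<Longrightarrow> kfin (W j)"
    and g: "bimod_map A V l r U lU rU g" and f: "\<And>j. j \<in> J \<Longrightarrow> bimod_map A V l r (W j) (lW j) (rW j) (f j)"
    and inj: "\<And>v. v \<in> carrier V \<Longrightarrow> g v = \<zero>\<^bsub>U\<^esub> \<Longrightarrow> (\<And>j. j \<in> J \<Longrightarrow> f j v = \<zero>\<^bsub>W j\<^esub>) \<Longrightarrow> v = \<zero>\<^bsub>V\<^esub>"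
    and surj: "\<And>u w. u \<in> carrier U \<Longrightarrow> (\<And>j. j \<in> J \<Longrightarrow> w j \<in> carrier (W j)) \<Longrightarrow>
       \<exists>v\<in>carrier V. g v = u \<and> (\<forall>j\<in>J. f j v = w j)"
  shows "kfin V \<and> chi A V l r = chi A U lU rU + (\<Sum>j\<in>J. chi A (W j) (lW j) (rW j))"
proof -
  interpret V: bimod A V l r by fact
  interpret U: bimod A U lU rU by fact
  have vW: "vect (W j)" if "j \<in> J" for j using W[OF that] unfolding bimod_def lmod_def by blast
  have gl: "klin V U g" using g by (simp add: bimod_map_def)
  have fl: "klin V (W j) (f j)" if "j \<in> J" for j using f[OF that] by (simp add: bimod_map_def)
  have dimV: "kfin V \<and> kdim V = kdim U + (\<Sum>j\<in>J. kdim (W j))"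
    by (rule family_dim_plus[OF assms(1) V.V.vect_axioms U.V.vect_axioms fU gl vW fW fl inj surj])
  have uniq: "v = w" if vw: "v \<in> carrier V" "w \<in> carrier V" "g v = g w" "\<And>j. j \<in> J \<Longrightarrow> f j v = f j w" for v w
  proof -
    have "g (v \<ominus>\<^bsub>V\<^esub> w) = \<zero>\<^bsub>U\<^esub>"
      using klin_diff[OF V.V.vect_axioms U.V.vect_axioms gl vw(1,2)] vw klin_closed[OF gl]
      by (simp add: a_minus_def U.V.r_neg)
    moreover have "f j (v \<ominus>\<^bsub>V\<^esub> w) = \<zero>\<^bsub>W j\<^esub>" if j: "j \<in> J" for j
    proof -
      interpret Wj: vect "W j" by (rule vW[OF j])
      show ?thesis
        using klin_diff[OF V.V.vect_axioms vW[OF j] fl[OF j] vw(1,2)] vw(1,2) vw(4)[OF j] klin_closed[OF fl[OF j]]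
        by (simp add: a_minus_def Wj.r_neg)
    qed
    ultimately have "v \<ominus>\<^bsub>V\<^esub> w = \<zero>\<^bsub>V\<^esub>" using inj[of "v \<ominus>\<^bsub>V\<^esub> w"] vw(1,2) by simp
    then show ?thesis using vw(1,2) by (simp add: V.V.diff_eq_zero_iff)
  qed
  have dimD: "kfin (der_space A V l r) \<and> kdim (der_space A V l r) =
      kdim (der_space A U lU rU) + (\<Sum>j\<in>J. kdim (der_space A (W j) (lW j) (rW j)))"
  proof (rule family_dim_plus[OF assms(1) V.vect_der_space U.vect_der_space U.kfin_der_space[OF assms(2) fU]
        derivs_postcomp[OF V U g] bimod.vect_der_space[OF W] bimod.kfin_der_space[OF W assms(2) fW]
        derivs_postcomp[OF V W f]])
    fix d assume d: "d \<in> carrier (der_space A V l r)" and z: "(\<lambda>x\<in>carrier A. g (d x)) = \<zero>\<^bsub>der_space A U lU rU\<^esub>"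
      and zj: "\<And>j. j \<in> J \<Longrightarrow> (\<lambda>x\<in>carrier A. f j (d x)) = \<zero>\<^bsub>der_space A (W j) (lW j) (rW j)\<^esub>"
    have "d x = \<zero>\<^bsub>V\<^esub>" if x: "x \<in> carrier A" for x
    proof (rule inj)
      show "d x \<in> carrier V" using d x by (simp add: derivs_closed)
      show "g (d x) = \<zero>\<^bsub>U\<^esub>" using fun_cong[OF z, of x] x by simp
      show "f j (d x) = \<zero>\<^bsub>W j\<^esub>" if "j \<in> J" for j using fun_cong[OF zj[OF that], of x] x by simp
    qed
    then show "d = \<zero>\<^bsub>der_space A V l r\<^esub>"
      using d by (intro extensionalityI[of _ "carrier A"]) (simp_all add: derivs_ext)
  next
    fix u w assume u: "u \<in> carrier (der_space A U lU rU)"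
      and w: "\<And>j. j \<in> J \<Longrightarrow> w j \<in> carrier (der_space A (W j) (lW j) (rW j))"
    have u': "u \<in> derivs A U lU rU" using u by simp
    have w': "w j \<in> derivs A (W j) (lW j) (rW j)" if "j \<in> J" for j using w[OF that] by simp
    have ex: "\<exists>v\<in>carrier V. g v = u x \<and> (\<forall>j\<in>J. f j v = w j x)" if x: "x \<in> carrier A" for x
      by (rule surj[OF derivs_closed[OF u' x] derivs_closed[OF w' x]])
    define d where "d = (\<lambda>x\<in>carrier A. SOME v. v \<in> carrier V \<and> g v = u x \<and> (\<forall>j\<in>J. f j v = w j x))"
    have "d x \<in> carrier V \<and> g (d x) = u x \<and> (\<forall>j\<in>J. f j (d x) = w j x)" if x: "x \<in> carrier A" for x
    proof -
      have "\<exists>v. v \<in> carrier V \<and> g v = u x \<and> (\<forall>j\<in>J. f j v = w j x)" using ex[OF x] by blast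
      from someI_ex[OF this] show ?thesis using x by (simp add: d_def)
    qed
    then have dc: "d x \<in> carrier V" and dg: "g (d x) = u x" and df: "\<And>j. j \<in> J \<Longrightarrow> f j (d x) = w j x"
      if "x \<in> carrier A" for x using that by blast+
    have "klin A V d"
    proof (rule klinI)
      fix x y assume xy: "x \<in> carrier A" "y \<in> carrier A"
      show "d (x \<oplus>\<^bsub>A\<^esub> y) = d x \<oplus>\<^bsub>V\<^esub> d y"
        by (rule uniq) (simp_all add: xy dc dg df klin_add[OF gl] klin_add[OF fl] klin_add[OF derivs_klin[OF u']] klin_add[OF derivs_klin[OF w']])
    next
      fix c x assume x: "x \<in> carrier A"
      show "d (c \<odot>\<^bsub>A\<^esub> x) = c \<odot>\<^bsub>V\<^esub> d x"
        by (rule uniq) (simp_all add: x dc dg df klin_scal[OF gl] klin_scal[OF fl] klin_scal[OF derivs_klin[OF u']] klin_scal[OF derivs_klin[OF w']])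
    qed (rule dc)
    moreover have "d (x \<otimes>\<^bsub>A\<^esub> y) = l x (d y) \<oplus>\<^bsub>V\<^esub> r (d x) y" if xy: "x \<in> carrier A" "y \<in> carrier A" for x y
    proof (rule uniq)
      show "g (d (x \<otimes>\<^bsub>A\<^esub> y)) = g (l x (d y) \<oplus>\<^bsub>V\<^esub> r (d x) y)"
        using g xy by (simp add: bimod_map_def dc dg klin_add[OF gl] derivs_mult[OF u'])
      show "f j (d (x \<otimes>\<^bsub>A\<^esub> y)) = f j (l x (d y) \<oplus>\<^bsub>V\<^esub> r (d x) y)" if j: "j \<in> J" for j
        using f[OF j] xy j by (simp add: bimod_map_def dc df[OF _ j] klin_add[OF fl[OF j]] derivs_mult[OF w'[OF j]])
    qed (simp_all add: xy dc)
    ultimately have "d \<in> derivs A V l r" by (simp add: derivs_def d_def)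
    moreover have "(\<lambda>x\<in>carrier A. g (d x)) = u"
      using dg by (intro extensionalityI[of _ "carrier A"]) (simp_all add: derivs_ext[OF u'])
    moreover have "(\<lambda>x\<in>carrier A. f j (d x)) = w j" if j: "j \<in> J" for j
      using df[OF _ j] by (intro extensionalityI[of _ "carrier A"]) (simp_all add: derivs_ext[OF w'[OF j]])
    ultimately show "\<exists>d\<in>carrier (der_space A V l r). (\<lambda>x\<in>carrier A. g (d x)) = u \<and> (\<forall>j\<in>J. (\<lambda>x\<in>carrier A. f j (d x)) = w j)"
      by (intro bexI[of _ d]) auto
  qed
  show ?thesis using dimV dimD by (simp add: chi_def sum_subtractf)
qed

definition inner_der where
  "inner_der A V l r v = (\<lambda>a\<in>carrier A. l a v \<ominus>\<^bsub>V\<^esub> r v a)"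

definition invariants where
  "invariants A V l r = {v \<in> carrier V. \<forall>a\<in>carrier A. l a v = r v a}"

lemma (in bimod) klin_inner_der: "klin V (der_space A V l r) (inner_der A V l r)"
proof (rule klinI)
  fix v assume v: "v \<in> carrier V"
  have "klin A V (\<lambda>a. l a v \<oplus>\<^bsub>V\<^esub> (- 1) \<odot>\<^bsub>V\<^esub> r v a)"
    by (rule klinI) (simp_all add: v act_add_left ract_add_right act_scal_left ract_scal_right V.scal_add_right
        V.a_ac V.scal_mult[symmetric] mult.commute)
  then have "klin A V (inner_der A V l r v)"
    unfolding inner_der_def klin_restrict[OF A.vect_axioms] using v by (subst klin_cong[OF _ A.vect_axioms]) (simp_all add: V.diff_scal)
  moreover have "l (x \<otimes>\<^bsub>A\<^esub> y) v \<ominus>\<^bsub>V\<^esub> r v (x \<otimes>\<^bsub>A\<^esub> y) =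
      l x (l y v \<ominus>\<^bsub>V\<^esub> r v y) \<oplus>\<^bsub>V\<^esub> r (l x v \<ominus>\<^bsub>V\<^esub> r v x) y" if xy: "x \<in> carrier A" "y \<in> carrier A" for x y
  proof -
    let ?a = "l x (l y v)" and ?b = "r (l x v) y" and ?c = "r (r v x) y"
    have c: "?a \<in> carrier V" "?b \<in> carrier V" "?c \<in> carrier V" using xy v by auto
    have "l x (l y v \<ominus>\<^bsub>V\<^esub> r v y) \<oplus>\<^bsub>V\<^esub> r (l x v \<ominus>\<^bsub>V\<^esub> r v x) y
       = (?a \<oplus>\<^bsub>V\<^esub> (- 1) \<odot>\<^bsub>V\<^esub> ?b) \<oplus>\<^bsub>V\<^esub> (?b \<oplus>\<^bsub>V\<^esub> (- 1) \<odot>\<^bsub>V\<^esub> ?c)"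
      using xy v by (simp add: V.diff_scal act_add_right act_scal_right ract_add_left ract_scal_left lact_ract)
    also have "\<dots> = ?a \<oplus>\<^bsub>V\<^esub> ((- 1) \<odot>\<^bsub>V\<^esub> ?b \<oplus>\<^bsub>V\<^esub> ?b) \<oplus>\<^bsub>V\<^esub> (- 1) \<odot>\<^bsub>V\<^esub> ?c"
      using c by (simp add: V.a_assoc)
    also have "(- 1) \<odot>\<^bsub>V\<^esub> ?b \<oplus>\<^bsub>V\<^esub> ?b = \<zero>\<^bsub>V\<^esub>" using V.scal_add_left[OF c(2), of "-1" 1] c by simp
    finally show ?thesis using xy v c by (simp add: V.diff_scal act_mult ract_mult)
  qed
  ultimately show "inner_der A V l r v \<in> carrier (der_space A V l r)"
    using v by (simp add: derivs_def inner_der_def)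
next
  fix v w assume vw: "v \<in> carrier V" "w \<in> carrier V"
  show "inner_der A V l r (v \<oplus>\<^bsub>V\<^esub> w) = inner_der A V l r v \<oplus>\<^bsub>der_space A V l r\<^esub> inner_der A V l r w"
    using vw by (auto simp: inner_der_def V.diff_scal act_add_right ract_add_left V.scal_add_right V.a_ac intro!: restrict_ext)
next
  fix c v assume v: "v \<in> carrier V"
  show "inner_der A V l r (c \<odot>\<^bsub>V\<^esub> v) = c \<odot>\<^bsub>der_space A V l r\<^esub> inner_der A V l r v"
    using v by (auto simp: inner_der_def V.diff_scal act_scal_right ract_scal_left V.scal_add_right
        V.scal_mult[symmetric] mult.commute intro!: restrict_ext)
qed

lemma (in bimod) inner_der_eq_zero_iff:
  "v \<in> carrier V \<Longrightarrow> inner_der A V l r v = \<zero>\<^bsub>der_space A V l r\<^esub> \<longleftrightarrow> v \<in> invariants A V l r"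
proof -
  assume v: "v \<in> carrier V"
  have "inner_der A V l r v = \<zero>\<^bsub>der_space A V l r\<^esub> \<longleftrightarrow> (\<forall>a\<in>carrier A. l a v \<ominus>\<^bsub>V\<^esub> r v a = \<zero>\<^bsub>V\<^esub>)"
    by (auto simp: inner_der_def fun_eq_iff)
  also have "\<dots> \<longleftrightarrow> (\<forall>a\<in>carrier A. l a v = r v a)"
    using v by (intro ball_cong refl V.diff_eq_zero_iff) auto
  finally show ?thesis using v by (simp add: invariants_def)
qed

text \<open>
  The kernel of \<open>inner_der\<close> consists of the invariants, so rank and nullity of \<open>inner_der\<close> and of \<open>\<psi>\<close>
  eliminate the dimension of the space of inner derivations.
\<close>

lemma (in bimod) chi_outer:
  assumes "kfin A" "kfin V" "vect E" and p: "klin (der_space A V l r) E \<psi>"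
    and surj: "\<psi> ` derivs A V l r = carrier E"
    and ker: "\<And>d. d \<in> derivs A V l r \<Longrightarrow> \<psi> d = \<zero>\<^bsub>E\<^esub> \<longleftrightarrow> d \<in> inner_der A V l r ` carrier V"
  shows "chi A V l r = int (kdim E) - int (kdim (V\<lparr>carrier := invariants A V l r\<rparr>))"
proof -
  let ?D = "der_space A V l r" and ?i = "inner_der A V l r"
  have im: "?i ` carrier V \<subseteq> derivs A V l r" using klin_closed[OF klin_inner_der] by auto
  have "{d \<in> carrier ?D. \<psi> d = \<zero>\<^bsub>E\<^esub>} = ?i ` carrier V" using ker im by auto
  then have 1: "kdim ?D = kdim E + kdim (?D\<lparr>carrier := ?i ` carrier V\<rparr>)"
    using rank_nullity[OF vect_der_space assms(3) p kfin_der_space[OF assms(1,2)]] surj by simp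
  have "{v \<in> carrier V. ?i v = \<zero>\<^bsub>?D\<^esub>} = invariants A V l r"
    using inner_der_eq_zero_iff by (auto simp: invariants_def)
  then have "kdim V = kdim (?D\<lparr>carrier := ?i ` carrier V\<rparr>) + kdim (V\<lparr>carrier := invariants A V l r\<rparr>)"
    using rank_nullity[OF V.vect_axioms vect_der_space klin_inner_der assms(2)] by simp
  then show ?thesis using 1 by (simp add: chi_def)
qed

lemma (in kalg) bimod_regular: "bimod A A (mult A) (mult A)"
  by unfold_locales (simp_all add: l_distr r_distr scal_mult_left scal_mult_right m_assoc)

lemma (in kalg) hoch_Z1_eq: "hoch_Z1 A = derivs A A (mult A) (mult A)"
proof -
  have "hoch_d1 A f x y = \<zero> \<longleftrightarrow> f (x \<otimes> y) = x \<otimes> f y \<oplus> f x \<otimes> y"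
    if "klin A A f" "x \<in> carrier A" "y \<in> carrier A" for f x y
  proof -
    have c: "f x \<in> carrier A" "f y \<in> carrier A" "f (x \<otimes> y) \<in> carrier A" using that by (simp_all add: klin_closed)
    have "hoch_d1 A f x y = (x \<otimes> f y \<oplus> f x \<otimes> y) \<ominus> f (x \<otimes> y)"
      using c that(2,3) by (simp add: hoch_d1_def a_minus_def a_ac)
    then have "hoch_d1 A f x y = \<zero> \<longleftrightarrow> (x \<otimes> f y \<oplus> f x \<otimes> y) = f (x \<otimes> y)"
      using c that(2,3) by (simp add: diff_eq_zero_iff)
    then show ?thesis by auto
  qed
  then show ?thesis by (auto simp: hoch_Z1_def derivs_def lin_maps_iff)
qed

lemma (in kalg) kdim_HH1:
  assumes "kfin A"
  shows "int (kdim (HH1 A)) = chi A A (mult A) (mult A) + int (kdim (alg_center A))"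
proof -
  interpret R: bimod A A "mult A" "mult A" by (rule bimod_regular)
  let ?D = "der_space A A (mult A) (mult A)" and ?i = "inner_der A A (mult A) (mult A)"
  have d0: "hoch_d0 A = ?i" by (intro ext) (simp add: hoch_d0_def inner_der_def)
  have H: "HH1 A = quot_mod ?D (?i ` carrier A)"
    by (simp add: HH1_def hoch_Z1_eq d0 der_space_def)
  have sub: "subsp ?D (?i ` carrier A)" by (rule subsp_image[OF vect_axioms R.vect_der_space R.klin_inner_der])
  note q = quot_proj[OF R.vect_der_space sub]
  have "invariants A A (mult A) (mult A) = {z \<in> carrier A. \<forall>a\<in>carrier A. z \<otimes> a = a \<otimes> z}"
    by (auto simp: invariants_def)
  then have "A\<lparr>carrier := invariants A A (mult A) (mult A)\<rparr> = alg_center A" by (simp add: alg_center_def)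
  moreover have "chi A A (mult A) (mult A) = int (kdim (quot_mod ?D (?i ` carrier A))) - int (kdim (A\<lparr>carrier := invariants A A (mult A) (mult A)\<rparr>))"
    by (rule R.chi_outer[OF assms assms vect_quot_mod[OF R.vect_der_space sub] q(1)])
       (use q(2,3) in \<open>simp_all del: quot_mod_simps\<close>)
  ultimately show ?thesis by (simp add: H)
qed

lemma lmod_restrict:
  assumes "kalg A'" "alg_hom A' A h" "lmod A V act"
  shows "lmod A' V (\<lambda>a. act (h a))"
proof -
  interpret A': kalg A' by fact
  interpret lmod A V act by fact
  note h = alg_hom_closed[OF assms(2)] alg_hom_add[OF assms(2)] alg_hom_scal[OF assms(2)] alg_hom_mult[OF assms(2)] alg_hom_one[OF assms(2)]
  show ?thesis
    by unfold_locales (simp_all add: h act_add_left act_add_right act_scal_left act_scal_right act_mult)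
qed

lemma bimod_restrict:
  assumes "kalg A'" "alg_hom A' A h" "bimod A V l r"
  shows "bimod A' V (\<lambda>a. l (h a)) (\<lambda>v a. r v (h a))"
proof -
  interpret bimod A V l r by fact
  interpret L: lmod A' V "\<lambda>a. l (h a)" by (rule lmod_restrict[OF assms(1,2) lmod_axioms])
  note h = alg_hom_closed[OF assms(2)] alg_hom_add[OF assms(2)] alg_hom_scal[OF assms(2)] alg_hom_mult[OF assms(2)] alg_hom_one[OF assms(2)]
  show ?thesis
    by unfold_locales (simp_all add: h ract_add_left ract_add_right ract_scal_left ract_scal_right ract_mult lact_ract)
qed

definition hom_left where
  "hom_left X actY a f = (\<lambda>x\<in>carrier X. actY a (f x))"

definition hom_right where
  "hom_right X actX f a = (\<lambda>x\<in>carrier X. f (actX a x))"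

lemma bimod_hom_k:
  assumes "lmod A X aX" "lmod A Y aY"
  shows "bimod A (hom_k X Y) (hom_left X aY) (hom_right X aX)"
proof -
  interpret X: lmod A X aX by fact
  interpret Y: lmod A Y aY by fact
  interpret H: vect "hom_k X Y" by (rule vect_hom_k[OF X.V.vect_axioms Y.V.vect_axioms])
  have k: "klin X Y f" "f \<in> extensional (carrier X)" if "f \<in> carrier (hom_k X Y)" for f
    using that by (simp_all add: lin_maps_iff)
  have hl: "hom_left X aY a f \<in> carrier (hom_k X Y)" if "a \<in> carrier A" "f \<in> carrier (hom_k X Y)" for a f
    using klin_compose[OF k(1)[OF that(2)] Y.klin_act[OF that(1)]]
    by (simp add: lin_maps_iff hom_left_def klin_restrict[OF X.V.vect_axioms])
  have hr: "hom_right X aX f a \<in> carrier (hom_k X Y)" if "a \<in> carrier A" "f \<in> carrier (hom_k X Y)" for a f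
    using klin_compose[OF X.klin_act[OF that(1)] k(1)[OF that(2)]]
    by (simp add: lin_maps_iff hom_right_def klin_restrict[OF X.V.vect_axioms])
  have eqI: "f = g" if "f \<in> extensional (carrier X)" "g \<in> extensional (carrier X)" "\<And>x. x \<in> carrier X \<Longrightarrow> f x = g x" for f g :: "'c \<Rightarrow> 'd"
    using that by (intro extensionalityI[of f "carrier X" g]) auto
  show ?thesis
  proof (intro bimod.intro lmod.intro lmod_axioms.intro bimod_axioms.intro X.A.kalg_axioms H.vect_axioms hl hr)
    fix a b c f g
    assume f: "f \<in> carrier (hom_k X Y)"
    note fc = klin_closed[OF k(1)[OF f]] and fa = klin_add[OF k(1)[OF f]] and fs = klin_scal[OF k(1)[OF f]]
    show "hom_left X aY \<one>\<^bsub>A\<^esub> f = f" "hom_right X aX f \<one>\<^bsub>A\<^esub> = f"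
      by (rule eqI; simp add: hom_left_def hom_right_def k(2)[OF f] fc)+
    assume a: "a \<in> carrier A"
    show "hom_left X aY (c \<odot>\<^bsub>A\<^esub> a) f = c \<odot>\<^bsub>hom_k X Y\<^esub> hom_left X aY a f"
      "hom_left X aY a (c \<odot>\<^bsub>hom_k X Y\<^esub> f) = c \<odot>\<^bsub>hom_k X Y\<^esub> hom_left X aY a f"
      "hom_right X aX (c \<odot>\<^bsub>hom_k X Y\<^esub> f) a = c \<odot>\<^bsub>hom_k X Y\<^esub> hom_right X aX f a"
      "hom_right X aX f (c \<odot>\<^bsub>A\<^esub> a) = c \<odot>\<^bsub>hom_k X Y\<^esub> hom_right X aX f a"
      by (rule eqI; simp add: hom_left_def hom_right_def a fc fs Y.act_scal_left Y.act_scal_right X.act_scal_left)+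
    { assume g: "g \<in> carrier (hom_k X Y)"
      note gc = klin_closed[OF k(1)[OF g]]
      show "hom_left X aY a (f \<oplus>\<^bsub>hom_k X Y\<^esub> g) = hom_left X aY a f \<oplus>\<^bsub>hom_k X Y\<^esub> hom_left X aY a g"
        "hom_right X aX (f \<oplus>\<^bsub>hom_k X Y\<^esub> g) a = hom_right X aX f a \<oplus>\<^bsub>hom_k X Y\<^esub> hom_right X aX g a"
        by (rule eqI; simp add: hom_left_def hom_right_def a fc gc Y.act_add_right)+ }
    assume b: "b \<in> carrier A"
    show "hom_left X aY (a \<oplus>\<^bsub>A\<^esub> b) f = hom_left X aY a f \<oplus>\<^bsub>hom_k X Y\<^esub> hom_left X aY b f"
      "hom_right X aX f (a \<oplus>\<^bsub>A\<^esub> b) = hom_right X aX f a \<oplus>\<^bsub>hom_k X Y\<^esub> hom_right X aX f b"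
      "hom_left X aY (a \<otimes>\<^bsub>A\<^esub> b) f = hom_left X aY a (hom_left X aY b f)"
      "hom_right X aX f (a \<otimes>\<^bsub>A\<^esub> b) = hom_right X aX (hom_right X aX f a) b"
      "hom_left X aY a (hom_right X aX f b) = hom_right X aX (hom_left X aY a f) b"
      by (rule eqI; simp add: hom_left_def hom_right_def a b fc fa Y.act_add_left X.act_add_left Y.act_mult X.act_mult)+
  qed
qed

section \<open>Extensions as outer derivations\<close>

text \<open>
  The scalar action on the underlying space of a module is through the unit of the algebra. It agrees with
  the expected one only on the carrier, which is why spaces are compared in this way.
\<close>

lemma vect_cong:
  assumes "vect V" and car: "carrier V' = carrier V" and zero: "zero V' = zero V" and add: "add V' = add V"
    and scal: "\<And>c x. x \<in> carrier V \<Longrightarrow> c \<odot>\<^bsub>V'\<^esub> x = c \<odot>\<^bsub>V\<^esub> x"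
  shows "vect V'"
proof -
  interpret vect V by fact
  have ag: "abelian_group V'"
    by (rule abelian_groupI; unfold car zero add)
       (use a_assoc a_comm l_neg in \<open>auto intro: bexI[of _ "\<ominus>\<^bsub>V\<^esub> _"]\<close>)
  show ?thesis
  proof (intro vect.intro ag vect_axioms.intro; unfold car zero add)
    fix x c d assume x: "x \<in> carrier V"
    show "c \<odot>\<^bsub>V'\<^esub> x \<in> carrier V" "(c + d) \<odot>\<^bsub>V'\<^esub> x = c \<odot>\<^bsub>V'\<^esub> x \<oplus>\<^bsub>V\<^esub> d \<odot>\<^bsub>V'\<^esub> x"
      "(c * d) \<odot>\<^bsub>V'\<^esub> x = c \<odot>\<^bsub>V'\<^esub> (d \<odot>\<^bsub>V'\<^esub> x)" "1 \<odot>\<^bsub>V'\<^esub> x = x"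
      using x by (simp_all add: scal scal_add_left scal_mult)
    fix y assume "y \<in> carrier V"
    then show "c \<odot>\<^bsub>V'\<^esub> (x \<oplus>\<^bsub>V\<^esub> y) = c \<odot>\<^bsub>V'\<^esub> x \<oplus>\<^bsub>V\<^esub> c \<odot>\<^bsub>V'\<^esub> y"
      using x by (simp add: scal scal_add_right)
  qed
qed

lemma underlying_space_simps [simp]:
  "carrier (underlying_space B X) = carrier X"
  "zero (underlying_space B X) = zero X"
  "add (underlying_space B X) = add X"
  "smult (underlying_space B X) = (\<lambda>c x. (c \<odot>\<^bsub>B\<^esub> \<one>\<^bsub>B\<^esub>) \<odot>\<^bsub>X\<^esub> x)"
  by (simp_all add: underlying_space_def)

lemma finsum_underlying: "finsum (underlying_space B X) f A = finsum X f A"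
  by (simp add: finsum_def finprod_def)

abbreviation bmod :: "('k::field, 'b) module \<Rightarrow> ('b, 'x) module \<Rightarrow> bool" where
  "bmod B X \<equiv> lmod B (underlying_space B X) (smult X)"

lemma lin_maps_bmod_iff:
  "f \<in> lin_maps B X Y \<longleftrightarrow> (\<forall>x\<in>carrier X. f x \<in> carrier Y) \<and>
     (\<forall>x\<in>carrier X. \<forall>y\<in>carrier X. f (x \<oplus>\<^bsub>X\<^esub> y) = f x \<oplus>\<^bsub>Y\<^esub> f y) \<and>
     (\<forall>b\<in>carrier B. \<forall>x\<in>carrier X. f (b \<odot>\<^bsub>X\<^esub> x) = b \<odot>\<^bsub>Y\<^esub> f x) \<and> f \<in> extensional (carrier X)"
  by (auto simp: lin_maps_def module_hom_def)

lemma lin_maps_klin: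
  assumes "kalg B" "f \<in> lin_maps B X Y"
  shows "klin (underlying_space B X) (underlying_space B Y) f"
proof -
  interpret kalg B by fact
  show ?thesis using assms(2) by (intro klinI) (simp_all add: lin_maps_bmod_iff)
qed

text \<open>
  In the bimodule of linear maps, commuting with the two actions is being \<open>B\<close>-linear.
\<close>

lemma lin_maps_eq_invariants:
  assumes "bmod B X" "bmod B Y"
  shows "lin_maps B X Y = invariants B (hom_k (underlying_space B X) (underlying_space B Y))
     (hom_left (underlying_space B X) (smult Y)) (hom_right (underlying_space B X) (smult X))"
proof -
  interpret X: lmod B "underlying_space B X" "smult X" by fact
  interpret Y: lmod B "underlying_space B Y" "smult Y" by fact
  have "f \<in> lin_maps B X Y \<longleftrightarrow> f \<in> lin_maps class_ring (underlying_space B X) (underlying_space B Y) \<and>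
     (\<forall>a\<in>carrier B. \<forall>x\<in>carrier X. a \<odot>\<^bsub>Y\<^esub> f x = f (a \<odot>\<^bsub>X\<^esub> x))" for f
    using lin_maps_klin[OF X.A.kalg_axioms, of f X Y]
    by (auto simp: lin_maps_iff lin_maps_bmod_iff klin_def)
  moreover have "hom_left (underlying_space B X) (smult Y) a f = hom_right (underlying_space B X) (smult X) f a
     \<longleftrightarrow> (\<forall>x\<in>carrier X. a \<odot>\<^bsub>Y\<^esub> f x = f (a \<odot>\<^bsub>X\<^esub> x))" for a f
    by (auto simp: hom_left_def hom_right_def fun_eq_iff restrict_def)
  ultimately show ?thesis unfolding invariants_def by auto
qed

lemma Hom_space_eq: "Hom_space B X Y =
   (hom_k (underlying_space B X) (underlying_space B Y))\<lparr>carrier := lin_maps B X Y\<rparr>"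
  by (simp add: Hom_space_def hom_k_def)

lemma subsp_invariants:
  assumes "bimod A V l r"
  shows "subsp V (invariants A V l r)"
proof -
  interpret bimod A V l r by fact
  have "invariants A V l r = {v \<in> carrier V. inner_der A V l r v = \<zero>\<^bsub>der_space A V l r\<^esub>}"
    using inner_der_eq_zero_iff by (auto simp: invariants_def)
  then show ?thesis using subsp_kernel[OF V.vect_axioms vect_der_space klin_inner_der] by simp
qed

lemma vect_Hom_space: "bmod B X \<Longrightarrow> bmod B Y \<Longrightarrow> vect (Hom_space B X Y)"
  unfolding Hom_space_eq lin_maps_eq_invariants
  by (intro subsp_vect subsp_invariants bimod_hom_k vect_hom_k) (auto simp: lmod_def)

subsection \<open>Free modules\<close>

definition gen :: "('k, 'b) module \<Rightarrow> 's set \<Rightarrow> 's \<Rightarrow> 'b \<Rightarrow> 's \<Rightarrow> 'b" where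
  "gen B S x b = (\<lambda>s\<in>S. if s = x then b else \<zero>\<^bsub>B\<^esub>)"

text \<open>
  The linear map out of the free module that is \<open>\<phi> x\<close> on the summand of \<open>x\<close>. The canonical surjection onto a
  module and the pairing of a derivation with the free cover are both of this form.
\<close>

definition fsum :: "('k, 'b) module \<Rightarrow> ('j, 'v) module \<Rightarrow> 's set \<Rightarrow> ('s \<Rightarrow> 'b \<Rightarrow> 'v) \<Rightarrow> ('s \<Rightarrow> 'b) \<Rightarrow> 'v" where
  "fsum B V S \<phi> f = (\<Oplus>\<^bsub>V\<^esub>x\<in>{x \<in> S. f x \<noteq> \<zero>\<^bsub>B\<^esub>}. \<phi> x (f x))"

lemma free_mod_simps [simp]:
  "zero (free_mod B S) = (\<lambda>s\<in>S. \<zero>\<^bsub>B\<^esub>)"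
  "add (free_mod B S) = (\<lambda>f g. \<lambda>s\<in>S. f s \<oplus>\<^bsub>B\<^esub> g s)"
  "smult (free_mod B S) = (\<lambda>b f. \<lambda>s\<in>S. b \<otimes>\<^bsub>B\<^esub> f s)"
  by (simp_all add: free_mod_def)

lemma free_mod_carrier: "f \<in> carrier (free_mod B S) \<longleftrightarrow>
   f \<in> extensional S \<and> (\<forall>s\<in>S. f s \<in> carrier B) \<and> finite {s \<in> S. f s \<noteq> \<zero>\<^bsub>B\<^esub>}"
  by (auto simp: free_mod_def PiE_iff)

lemma free_ev_eq_fsum: "free_ev B X f = fsum B (underlying_space B X) (carrier X) (\<lambda>x b. b \<odot>\<^bsub>X\<^esub> x) f"
  by (simp add: free_ev_def fsum_def finsum_underlying)

context kalg
begin

lemma scal_one_mult: "x \<in> carrier A \<Longrightarrow> (c \<odot> \<one>) \<otimes> x = c \<odot> x"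
  by (simp add: scal_mult_left)

lemma bmod_free_mod: "bmod A (free_mod A S)"
proof -
  let ?F = "free_mod A S"
  have sub: "subsp (fun_space S A) (carrier ?F)"
  proof (rule subspI)
    show "carrier ?F \<subseteq> carrier (fun_space S A)" by (auto simp: free_mod_def)
    show "\<zero>\<^bsub>fun_space S A\<^esub> \<in> carrier ?F" by (simp add: free_mod_carrier)
    fix f g c assume f: "f \<in> carrier ?F"
    have "finite {s \<in> S. (c \<odot>\<^bsub>fun_space S A\<^esub> f) s \<noteq> \<zero>}" for c
      by (rule finite_subset[of _ "{s \<in> S. f s \<noteq> \<zero>}"]) (use f in \<open>auto simp: free_mod_carrier\<close>)
    then show "c \<odot>\<^bsub>fun_space S A\<^esub> f \<in> carrier ?F" for c
      using f by (simp add: free_mod_carrier)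
    assume g: "g \<in> carrier ?F"
    have "finite {s \<in> S. (f \<oplus>\<^bsub>fun_space S A\<^esub> g) s \<noteq> \<zero>}"
      by (rule finite_subset[of _ "{s \<in> S. f s \<noteq> \<zero>} \<union> {s \<in> S. g s \<noteq> \<zero>}"])
         (use f g in \<open>auto simp: free_mod_carrier\<close>)
    then show "f \<oplus>\<^bsub>fun_space S A\<^esub> g \<in> carrier ?F"
      using f g by (simp add: free_mod_carrier)
  qed
  have mem: "f s \<in> carrier A" if "f \<in> carrier ?F" "s \<in> S" for f s using that by (simp add: free_mod_carrier)
  have "vect (underlying_space A ?F)"
  proof (rule vect_cong[OF subsp_vect[OF vect_fun_space[OF vect_axioms] sub]])
    show "c \<odot>\<^bsub>underlying_space A ?F\<^esub> f = c \<odot>\<^bsub>(fun_space S A)\<lparr>carrier := carrier ?F\<rparr>\<^esub> f"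
      if "f \<in> carrier ((fun_space S A)\<lparr>carrier := carrier ?F\<rparr>)" for c f
      using that by (auto simp: mem scal_one_mult intro!: restrict_ext)
  qed simp_all
  then interpret U: vect "underlying_space A ?F" .
  have cl: "b \<odot>\<^bsub>?F\<^esub> f \<in> carrier ?F" if b: "b \<in> carrier A" and f: "f \<in> carrier ?F" for b f
  proof -
    have "finite {s \<in> S. (b \<odot>\<^bsub>?F\<^esub> f) s \<noteq> \<zero>}"
      by (rule finite_subset[of _ "{s \<in> S. f s \<noteq> \<zero>}"]) (use b f in \<open>auto simp: free_mod_carrier\<close>)
    then show ?thesis using b f by (simp add: free_mod_carrier)
  qed
  show ?thesis
  proof (intro lmod.intro kalg_axioms U.vect_axioms lmod_axioms.intro)
    show "\<one> \<odot>\<^bsub>?F\<^esub> f = f" if "f \<in> carrier (underlying_space A ?F)" for f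
      using that by (auto simp: free_mod_carrier fun_eq_iff extensional_def restrict_def)
  qed (auto simp: cl mem l_distr r_distr m_assoc scal_mult_left scal_mult_right intro!: restrict_ext
      simp del: free_mod_simps, auto simp: mem l_distr r_distr m_assoc scal_mult_left scal_mult_right intro!: restrict_ext)
qed

lemma gen_in: "x \<in> S \<Longrightarrow> b \<in> carrier A \<Longrightarrow> gen A S x b \<in> carrier (free_mod A S)"
proof -
  assume "x \<in> S" "b \<in> carrier A"
  moreover have "{s \<in> S. gen A S x b s \<noteq> \<zero>} \<subseteq> {x}" by (auto simp: gen_def)
  then have "finite {s \<in> S. gen A S x b s \<noteq> \<zero>}" by (rule finite_subset) simp
  ultimately show ?thesis by (auto simp: free_mod_carrier gen_def)
qed

lemma fsum_superset:
  assumes "vect V" "\<And>x. x \<in> S \<Longrightarrow> klin A V (\<phi> x)" "f \<in> carrier (free_mod A S)"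
    and "finite T" "T \<subseteq> S" "{x \<in> S. f x \<noteq> \<zero>} \<subseteq> T"
  shows "fsum A V S \<phi> f = (\<Oplus>\<^bsub>V\<^esub>x\<in>T. \<phi> x (f x))"
proof -
  interpret V: vect V by fact
  have z: "\<phi> x (f x) = \<zero>\<^bsub>V\<^esub>" if "x \<in> T - {x \<in> S. f x \<noteq> \<zero>}" for x
  proof -
    have "x \<in> S" "f x = \<zero>" using that assms(5) by auto
    then show ?thesis using klin_zero[OF vect_axioms assms(1) assms(2)] by simp
  qed
  have c: "\<phi> x (f x) \<in> carrier V" if "x \<in> T" for x
  proof -
    have "x \<in> S" using that assms(5) by auto
    then show ?thesis using klin_closed[OF assms(2)] assms(3) by (simp add: free_mod_carrier)
  qed
  show ?thesis unfolding fsum_def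
    by (rule V.add.finprod_mono_neutral_cong_left[OF assms(4,6)]) (use z c in auto)
qed

lemma klin_fsum:
  assumes "vect V" and \<phi>: "\<And>x. x \<in> S \<Longrightarrow> klin A V (\<phi> x)"
  shows "klin (underlying_space A (free_mod A S)) V (fsum A V S \<phi>)"
proof -
  interpret V: vect V by fact
  interpret F: lmod A "underlying_space A (free_mod A S)" "smult (free_mod A S)" by (rule bmod_free_mod)
  have mem: "f s \<in> carrier A" if "f \<in> carrier (free_mod A S)" "s \<in> S" for f s using that by (simp add: free_mod_carrier)
  have fin: "finite {s \<in> S. f s \<noteq> \<zero>}" if "f \<in> carrier (free_mod A S)" for f using that by (simp add: free_mod_carrier)
  have pm: "(\<lambda>x. \<phi> x (f x)) \<in> T \<rightarrow> carrier V" if "T \<subseteq> S" "f \<in> carrier (free_mod A S)" for T f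
    using that mem[OF that(2)] klin_closed[OF \<phi>] by (auto simp: subset_iff)
  show ?thesis
  proof (rule klinI)
    fix f assume f: "f \<in> carrier (underlying_space A (free_mod A S))"
    then have f': "f \<in> carrier (free_mod A S)" by simp
    show "fsum A V S \<phi> f \<in> carrier V" unfolding fsum_def by (rule V.finsum_closed) (rule pm[OF _ f'], auto)
    fix g assume g: "g \<in> carrier (underlying_space A (free_mod A S))"
    then have g': "g \<in> carrier (free_mod A S)" by simp
    let ?T = "{s \<in> S. f s \<noteq> \<zero>} \<union> {s \<in> S. g s \<noteq> \<zero>}"
    have T: "finite ?T" "?T \<subseteq> S" using fin[OF f'] fin[OF g'] by auto
    have fg: "f \<oplus>\<^bsub>free_mod A S\<^esub> g \<in> carrier (free_mod A S)" using F.V.a_closed[OF f g] by simp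
    have "fsum A V S \<phi> (f \<oplus>\<^bsub>free_mod A S\<^esub> g) = (\<Oplus>\<^bsub>V\<^esub>x\<in>?T. \<phi> x ((f \<oplus>\<^bsub>free_mod A S\<^esub> g) x))"
      by (rule fsum_superset[OF assms fg T]) auto
    also have "\<dots> = (\<Oplus>\<^bsub>V\<^esub>x\<in>?T. \<phi> x (f x) \<oplus>\<^bsub>V\<^esub> \<phi> x (g x))"
    proof (rule V.finsum_cong')
      show "(\<lambda>x. \<phi> x (f x) \<oplus>\<^bsub>V\<^esub> \<phi> x (g x)) \<in> ?T \<rightarrow> carrier V" using pm[OF T(2) f'] pm[OF T(2) g'] by auto
      show "\<phi> x ((f \<oplus>\<^bsub>free_mod A S\<^esub> g) x) = \<phi> x (f x) \<oplus>\<^bsub>V\<^esub> \<phi> x (g x)" if "x \<in> ?T" for x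
      proof -
        have x: "x \<in> S" using that by auto
        then show ?thesis using klin_add[OF \<phi>[OF x] mem[OF f' x] mem[OF g' x]] by simp
      qed
    qed simp
    also have "\<dots> = (\<Oplus>\<^bsub>V\<^esub>x\<in>?T. \<phi> x (f x)) \<oplus>\<^bsub>V\<^esub> (\<Oplus>\<^bsub>V\<^esub>x\<in>?T. \<phi> x (g x))"
      by (rule V.finsum_addf[OF pm[OF T(2) f'] pm[OF T(2) g']])
    also have "(\<Oplus>\<^bsub>V\<^esub>x\<in>?T. \<phi> x (f x)) = fsum A V S \<phi> f" by (rule fsum_superset[OF assms f' T, symmetric]) auto
    also have "(\<Oplus>\<^bsub>V\<^esub>x\<in>?T. \<phi> x (g x)) = fsum A V S \<phi> g" by (rule fsum_superset[OF assms g' T, symmetric]) auto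
    finally show "fsum A V S \<phi> (f \<oplus>\<^bsub>underlying_space A (free_mod A S)\<^esub> g) = fsum A V S \<phi> f \<oplus>\<^bsub>V\<^esub> fsum A V S \<phi> g"
      unfolding underlying_space_simps .
  next
    fix c f assume f: "f \<in> carrier (underlying_space A (free_mod A S))"
    then have f': "f \<in> carrier (free_mod A S)" by simp
    let ?T = "{s \<in> S. f s \<noteq> \<zero>}"
    have T: "finite ?T" "?T \<subseteq> S" using fin[OF f'] by auto
    let ?g = "c \<odot>\<^bsub>underlying_space A (free_mod A S)\<^esub> f"
    have g: "?g \<in> carrier (free_mod A S)" using F.V.scal_closed[OF f] by simp
    have gv: "?g x = c \<odot> f x" if "x \<in> S" for x using that mem[OF f' that] by (simp add: scal_one_mult)
    have "fsum A V S \<phi> ?g = (\<Oplus>\<^bsub>V\<^esub>x\<in>?T. \<phi> x (?g x))"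
    proof (rule fsum_superset[OF assms g T])
      show "{x \<in> S. ?g x \<noteq> \<zero>} \<subseteq> ?T" using gv by force
    qed
    also have "\<dots> = (\<Oplus>\<^bsub>V\<^esub>x\<in>?T. c \<odot>\<^bsub>V\<^esub> \<phi> x (f x))"
    proof (rule V.finsum_cong')
      show "\<phi> x (?g x) = c \<odot>\<^bsub>V\<^esub> \<phi> x (f x)" if "x \<in> ?T" for x
      proof -
        have x: "x \<in> S" using that by auto
        show ?thesis unfolding gv[OF x] by (rule klin_scal[OF \<phi>[OF x] mem[OF f' x]])
      qed
    qed (use pm[OF T(2) f'] in auto)
    also have "\<dots> = c \<odot>\<^bsub>V\<^esub> fsum A V S \<phi> f" unfolding fsum_def by (rule V.scal_finsum[OF T(1) pm[OF T(2) f'], symmetric])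
    finally show "fsum A V S \<phi> ?g = c \<odot>\<^bsub>V\<^esub> fsum A V S \<phi> f" .
  qed
qed

lemma fsum_gen:
  assumes "vect V" "\<And>x. x \<in> S \<Longrightarrow> klin A V (\<phi> x)" "x \<in> S" "b \<in> carrier A"
  shows "fsum A V S \<phi> (gen A S x b) = \<phi> x b"
proof -
  interpret V: vect V by fact
  have "fsum A V S \<phi> (gen A S x b) = (\<Oplus>\<^bsub>V\<^esub>y\<in>{x}. \<phi> y (gen A S x b y))"
    by (rule fsum_superset[OF assms(1,2) gen_in[OF assms(3,4)]]) (use assms(3) in \<open>auto simp: gen_def\<close>)
  also have "\<dots> = \<phi> x b" using klin_closed[OF assms(2)[OF assms(3)] assms(4)] assms(3) by (simp add: gen_def)
  finally show ?thesis .
qed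

lemma free_mod_induct [consumes 1, case_names zero gen add]:
  assumes f: "f \<in> carrier (free_mod A S)"
    and zero: "P \<zero>\<^bsub>free_mod A S\<^esub>"
    and gen: "\<And>x b. x \<in> S \<Longrightarrow> b \<in> carrier A \<Longrightarrow> P (gen A S x b)"
    and add: "\<And>f g. f \<in> carrier (free_mod A S) \<Longrightarrow> g \<in> carrier (free_mod A S) \<Longrightarrow> P f \<Longrightarrow> P g \<Longrightarrow> P (f \<oplus>\<^bsub>free_mod A S\<^esub> g)"
  shows "P f"
proof -
  have "\<forall>f. f \<in> carrier (free_mod A S) \<longrightarrow> {s \<in> S. f s \<noteq> \<zero>} \<subseteq> T \<longrightarrow> P f" if "finite T" for T
    using that
  proof (induction T rule: finite_induct)
    case empty
    show ?case
    proof (intro allI impI)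
      fix f assume f: "f \<in> carrier (free_mod A S)" "{s \<in> S. f s \<noteq> \<zero>} \<subseteq> {}"
      then have "f = \<zero>\<^bsub>free_mod A S\<^esub>" by (auto simp: free_mod_carrier fun_eq_iff extensional_def)
      then show "P f" using zero by simp
    qed
  next
    case (insert t T)
    show ?case
    proof (intro allI impI)
      fix f assume f: "f \<in> carrier (free_mod A S)" "{s \<in> S. f s \<noteq> \<zero>} \<subseteq> insert t T"
      show "P f"
      proof (cases "t \<in> S")
        case True
        define g where "g = (\<lambda>s\<in>S. if s = t then \<zero> else f s)"
        have mem: "f s \<in> carrier A" if "s \<in> S" for s using f(1) that by (simp add: free_mod_carrier)
        have gT: "{s \<in> S. g s \<noteq> \<zero>} \<subseteq> T" using f(2) by (auto simp: g_def)
        then have "finite {s \<in> S. g s \<noteq> \<zero>}" using insert.hyps(1) by (rule finite_subset)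
        then have g: "g \<in> carrier (free_mod A S)" using mem by (auto simp: free_mod_carrier g_def)
        have "f s = (g \<oplus>\<^bsub>free_mod A S\<^esub> gen A S t (f t)) s" for s
          using mem f(1) by (cases "s \<in> S") (auto simp: g_def gen_def free_mod_carrier extensional_def)
        then have "f = g \<oplus>\<^bsub>free_mod A S\<^esub> gen A S t (f t)" by (rule ext)
        moreover have "P g" using insert.IH g gT by simp
        ultimately show ?thesis using add[OF g gen_in[OF True mem[OF True]]] gen[OF True mem[OF True]] by simp
      next
        case False
        then have "{s \<in> S. f s \<noteq> \<zero>} \<subseteq> T" using f(2) by auto
        then show ?thesis using insert.IH f(1) by simp
      qed
    qed
  qed
  from this[of "{s \<in> S. f s \<noteq> \<zero>}"] show ?thesis using f by (simp add: free_mod_carrier)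
qed

lemma free_mod_klin_eqI:
  assumes V: "vect V" and f: "klin (underlying_space A (free_mod A S)) V f" and g: "klin (underlying_space A (free_mod A S)) V g"
    and "\<And>x b. x \<in> S \<Longrightarrow> b \<in> carrier A \<Longrightarrow> f (gen A S x b) = g (gen A S x b)" "p \<in> carrier (free_mod A S)"
  shows "f p = g p"
proof -
  interpret F: lmod A "underlying_space A (free_mod A S)" "smult (free_mod A S)" by (rule bmod_free_mod)
  show ?thesis
    using assms(5)
  proof (induction p rule: free_mod_induct)
    case zero
    then show ?case using klin_zero[OF F.V.vect_axioms V f] klin_zero[OF F.V.vect_axioms V g] by (simp del: free_mod_simps)
  next
    case (add p q)
    then show ?case using klin_add[OF f, of p q] klin_add[OF g, of p q] by (simp del: free_mod_simps)
  qed (rule assms(4))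
qed

lemma gen_mult: "b \<in> carrier A \<Longrightarrow> gen A S x (b \<otimes> c) = b \<odot>\<^bsub>free_mod A S\<^esub> gen A S x c"
  by (auto simp: gen_def fun_eq_iff)

lemma fsum_act:
  assumes "lmod A V act" "\<And>x. x \<in> S \<Longrightarrow> klin A V (\<phi> x)"
    and "\<And>x c. x \<in> S \<Longrightarrow> c \<in> carrier A \<Longrightarrow> \<phi> x (b \<otimes> c) = act b (\<phi> x c)"
    and "b \<in> carrier A" "p \<in> carrier (free_mod A S)"
  shows "fsum A V S \<phi> (b \<odot>\<^bsub>free_mod A S\<^esub> p) = act b (fsum A V S \<phi> p)"
proof -
  interpret V: lmod A V act by fact
  interpret F: lmod A "underlying_space A (free_mod A S)" "smult (free_mod A S)" by (rule bmod_free_mod)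
  note k = klin_fsum[OF V.V.vect_axioms assms(2)]
  show ?thesis
  proof (rule free_mod_klin_eqI[OF V.V.vect_axioms klin_compose[OF F.klin_act[OF assms(4)] k]
        klin_compose[OF k V.klin_act[OF assms(4)]] _ assms(5)])
    fix x c assume "x \<in> S" "c \<in> carrier A"
    then show "fsum A V S \<phi> (b \<odot>\<^bsub>free_mod A S\<^esub> gen A S x c) = act b (fsum A V S \<phi> (gen A S x c))"
      using assms(4) by (simp add: gen_mult[symmetric] fsum_gen[OF V.V.vect_axioms assms(2)] assms(3) del: free_mod_simps)
  qed
qed

lemma klin_free_ev:
  assumes "bmod A X"
  shows "klin (underlying_space A (free_mod A (carrier X))) (underlying_space A X) (free_ev A X)"
proof -
  interpret X: lmod A "underlying_space A X" "smult X" by fact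
  show ?thesis unfolding free_ev_eq_fsum[abs_def]
    by (rule klin_fsum[OF X.V.vect_axioms X.klin_act_arg]) simp
qed

lemma free_ev_act:
  assumes "bmod A X" "b \<in> carrier A" "p \<in> carrier (free_mod A (carrier X))"
  shows "free_ev A X (b \<odot>\<^bsub>free_mod A (carrier X)\<^esub> p) = b \<odot>\<^bsub>X\<^esub> free_ev A X p"
proof -
  interpret X: lmod A "underlying_space A X" "smult X" by fact
  show ?thesis unfolding free_ev_eq_fsum
    by (rule fsum_act[OF assms(1) X.klin_act_arg _ assms(2,3)]) (use assms(2) X.act_mult in simp_all)
qed

lemma free_ev_gen:
  assumes "bmod A X" "x \<in> carrier X" "b \<in> carrier A"
  shows "free_ev A X (gen A (carrier X) x b) = b \<odot>\<^bsub>X\<^esub> x"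
proof -
  interpret X: lmod A "underlying_space A X" "smult X" by fact
  show ?thesis unfolding free_ev_eq_fsum
    by (rule fsum_gen[OF X.V.vect_axioms X.klin_act_arg]) (use assms in simp_all)
qed

lemma bmod_syzygy:
  assumes "bmod A X"
  shows "bmod A (syzygy A X)"
proof -
  interpret X: lmod A "underlying_space A X" "smult X" by fact
  let ?F = "free_mod A (carrier X)"
  interpret F: lmod A "underlying_space A ?F" "smult ?F" by (rule bmod_free_mod)
  have "syzygy A X = ?F\<lparr>carrier := {p \<in> carrier ?F. free_ev A X p = \<zero>\<^bsub>X\<^esub>}\<rparr>" by (simp add: syzygy_def)
  then have eq: "underlying_space A (syzygy A X) =
      (underlying_space A ?F)\<lparr>carrier := {p \<in> carrier (underlying_space A ?F). free_ev A X p = \<zero>\<^bsub>underlying_space A X\<^esub>}\<rparr>"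
    by (simp add: underlying_space_def)
  have sm: "smult (syzygy A X) = smult ?F" by (simp add: syzygy_def)
  have v: "vect (underlying_space A (syzygy A X))"
    unfolding eq by (rule subsp_vect[OF F.V.vect_axioms subsp_kernel[OF F.V.vect_axioms X.V.vect_axioms klin_free_ev[OF assms]]])
  have car: "p \<in> carrier (syzygy A X) \<longleftrightarrow> p \<in> carrier ?F \<and> free_ev A X p = \<zero>\<^bsub>X\<^esub>" for p
    by (simp add: syzygy_def)
  have F': "p \<in> carrier (underlying_space A ?F)" if "p \<in> carrier (underlying_space A (syzygy A X))" for p
    using that car by simp
  show ?thesis unfolding sm
  proof (intro lmod.intro kalg_axioms v lmod_axioms.intro)
    fix a p assume a: "a \<in> carrier A" and p: "p \<in> carrier (underlying_space A (syzygy A X))"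
    then show "a \<odot>\<^bsub>?F\<^esub> p \<in> carrier (underlying_space A (syzygy A X))"
      using F.act_closed[OF a F'[OF p]] free_ev_act[OF assms a] X.act_zero[OF a]
      by (simp add: car del: free_mod_simps)
  next
    fix a b p assume a: "a \<in> carrier A" and b: "b \<in> carrier A" and p: "p \<in> carrier (underlying_space A (syzygy A X))"
    show "(a \<oplus> b) \<odot>\<^bsub>?F\<^esub> p = a \<odot>\<^bsub>?F\<^esub> p \<oplus>\<^bsub>underlying_space A (syzygy A X)\<^esub> b \<odot>\<^bsub>?F\<^esub> p"
      using F.act_add_left[OF a b F'[OF p]] by (simp add: eq del: free_mod_simps)
    show "(a \<otimes> b) \<odot>\<^bsub>?F\<^esub> p = a \<odot>\<^bsub>?F\<^esub> (b \<odot>\<^bsub>?F\<^esub> p)"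
      using F.act_mult[OF a b F'[OF p]] by (simp del: free_mod_simps)
  next
    fix a p q assume a: "a \<in> carrier A" and p: "p \<in> carrier (underlying_space A (syzygy A X))" and q: "q \<in> carrier (underlying_space A (syzygy A X))"
    show "a \<odot>\<^bsub>?F\<^esub> (p \<oplus>\<^bsub>underlying_space A (syzygy A X)\<^esub> q) = a \<odot>\<^bsub>?F\<^esub> p \<oplus>\<^bsub>underlying_space A (syzygy A X)\<^esub> a \<odot>\<^bsub>?F\<^esub> q"
      using F.act_add_right[OF a F'[OF p] F'[OF q]] by (simp add: eq del: free_mod_simps)
  next
    fix a p c assume a: "a \<in> carrier A" and p: "p \<in> carrier (underlying_space A (syzygy A X))"
    show "(c \<odot>\<^bsub>A\<^esub> a) \<odot>\<^bsub>?F\<^esub> p = c \<odot>\<^bsub>underlying_space A (syzygy A X)\<^esub> (a \<odot>\<^bsub>?F\<^esub> p)"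
      using F.act_scal_left[OF a F'[OF p]] by (simp add: eq del: free_mod_simps underlying_space_simps)
    show "a \<odot>\<^bsub>?F\<^esub> (c \<odot>\<^bsub>underlying_space A (syzygy A X)\<^esub> p) = c \<odot>\<^bsub>underlying_space A (syzygy A X)\<^esub> (a \<odot>\<^bsub>?F\<^esub> p)"
      using F.act_scal_right[OF a F'[OF p]] by (simp add: eq del: free_mod_simps underlying_space_simps)
  next
    fix p assume p: "p \<in> carrier (underlying_space A (syzygy A X))"
    show "\<one> \<odot>\<^bsub>?F\<^esub> p = p" by (rule F.act_one[OF F'[OF p]])
  qed
qed

end

declare free_mod_simps [simp del]

lemma klin_plus:
  assumes "vect V" "vect W" "klin V W f" "klin V W g"
  shows "klin V W (\<lambda>x. f x \<oplus>\<^bsub>W\<^esub> g x)"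
proof -
  interpret W: vect W by fact
  note c = klin_closed[OF assms(3)] klin_closed[OF assms(4)]
  show ?thesis
    by (rule klinI) (simp_all add: c klin_add[OF assms(3)] klin_add[OF assms(4)] klin_scal[OF assms(3)]
        klin_scal[OF assms(4)] W.a_ac W.scal_add_right)
qed

lemma klin_times:
  assumes "vect V" "vect W" "klin V W f"
  shows "klin V W (\<lambda>x. k \<odot>\<^bsub>W\<^esub> f x)"
proof -
  interpret W: vect W by fact
  note c = klin_closed[OF assms(3)]
  show ?thesis
    by (rule klinI) (simp_all add: c klin_add[OF assms(3)] klin_scal[OF assms(3)] W.scal_add_right
        W.scal_mult[symmetric] mult.commute)
qed

locale two_bmods = kalg B + X: lmod B "underlying_space B X" "smult X" + Y: lmod B "underlying_space B Y" "smult Y"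
  for B :: "('k::field, 'b) module" (structure) and X :: "('b, 'x) module" and Y :: "('b, 'y) module"
begin

abbreviation "UX \<equiv> underlying_space B X"
abbreviation "UY \<equiv> underlying_space B Y"
abbreviation "P0 \<equiv> free_mod B (carrier X)"
abbreviation "S1 \<equiv> syzygy B X"
abbreviation "P1 \<equiv> free_mod B (carrier S1)"
abbreviation "S2 \<equiv> syzygy B S1"
abbreviation "P2 \<equiv> free_mod B (carrier S2)"
abbreviation "M \<equiv> hom_k UX UY"
abbreviation "lM \<equiv> hom_left UX (smult Y)"
abbreviation "rM \<equiv> hom_right UX (smult X)"

lemmas bX = X.lmod_axioms and bY = Y.lmod_axioms

sublocale P0: lmod B "underlying_space B P0" "smult P0" by (rule bmod_free_mod)
sublocale S1: lmod B "underlying_space B S1" "smult S1" by (rule bmod_syzygy[OF bX])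
sublocale P1: lmod B "underlying_space B P1" "smult P1" by (rule bmod_free_mod)
sublocale S2: lmod B "underlying_space B S2" "smult S2" by (rule bmod_syzygy[OF S1.lmod_axioms])
sublocale P2: lmod B "underlying_space B P2" "smult P2" by (rule bmod_free_mod)
sublocale M: bimod B M lM rM by (rule bimod_hom_k[OF bX bY])

lemma S1_simps: "carrier S1 = {p \<in> carrier P0. free_ev B X p = \<zero>\<^bsub>X\<^esub>}"
  "add S1 = add P0" "zero S1 = zero P0" "smult S1 = smult P0"
  by (simp_all add: syzygy_def)

lemma S2_simps: "carrier S2 = {p \<in> carrier P1. free_ev B S1 p = \<zero>\<^bsub>P0\<^esub>}"
  "add S2 = add P1" "zero S2 = zero P1" "smult S2 = smult P1"
  by (simp_all add: syzygy_def)

lemmas ev0 = klin_free_ev[OF bX] and ev1 = klin_free_ev[OF S1.lmod_axioms] and ev2 = klin_free_ev[OF S2.lmod_axioms]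

lemma ev1_in: "p \<in> carrier P1 \<Longrightarrow> free_ev B S1 p \<in> carrier S1"
  using klin_closed[OF ev1, of p] by simp

lemma ev1_onto: "f \<in> carrier S1 \<Longrightarrow> \<exists>p\<in>carrier P1. free_ev B S1 p = f"
  using free_ev_gen[OF S1.lmod_axioms, of f \<one>] gen_in[of f "carrier S1" \<one>] S1.act_one[of f] by auto

text \<open>
  The linear map on the free cover that will represent the class of the derivation \<open>d\<close> in \<open>Ext\<^sup>1\<close>.
\<close>

definition pair_der :: "('b \<Rightarrow> 'x \<Rightarrow> 'y) \<Rightarrow> ('x \<Rightarrow> 'b) \<Rightarrow> 'y" where
  "pair_der d = fsum B UY (carrier X) (\<lambda>x b. d b x)"

lemma klin_at: "klin B M d \<Longrightarrow> x \<in> carrier X \<Longrightarrow> klin B UY (\<lambda>b. d b x)"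
  using klin_compose[OF _ klin_eval[OF X.V.vect_axioms Y.V.vect_axioms, of x]] by simp

lemma klin_pair_der: "klin B M d \<Longrightarrow> klin (underlying_space B P0) UY (pair_der d)"
  unfolding pair_der_def by (rule klin_fsum[OF Y.V.vect_axioms klin_at])

lemma pair_der_gen: "klin B M d \<Longrightarrow> x \<in> carrier X \<Longrightarrow> b \<in> carrier B \<Longrightarrow> pair_der d (gen B (carrier X) x b) = d b x"
  unfolding pair_der_def by (rule fsum_gen[OF Y.V.vect_axioms klin_at])

lemma M_mem: "f \<in> carrier M \<Longrightarrow> klin UX UY f"
  by (simp add: lin_maps_iff)

lemma deriv_mult_at:
  assumes "d \<in> derivs B M lM rM" "b \<in> carrier B" "c \<in> carrier B" "x \<in> carrier X"
  shows "d (b \<otimes> c) x = b \<odot>\<^bsub>Y\<^esub> d c x \<oplus>\<^bsub>Y\<^esub> d b (c \<odot>\<^bsub>X\<^esub> x)"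
  using derivs_mult[OF assms(1-3)] assms(4) by (simp add: hom_left_def hom_right_def)

lemma deriv_one_at:
  assumes d: "d \<in> derivs B M lM rM" and x: "x \<in> carrier X"
  shows "d \<one> x = \<zero>\<^bsub>Y\<^esub>"
proof -
  have c: "d \<one> x \<in> carrier UY" using klin_closed[OF klin_at[OF derivs_klin[OF d] x]] by simp
  have "d \<one> x = d \<one> x \<oplus>\<^bsub>UY\<^esub> d \<one> x"
    using deriv_mult_at[OF d one_closed one_closed x] x c Y.act_one[OF c] X.act_one[of x] by simp
  then have "d \<one> x = \<zero>\<^bsub>UY\<^esub>" using Y.V.add.l_cancel_one'[OF c c] by simp
  then show ?thesis by simp
qed

lemma klin_M_closed:
  assumes "klin B M d" "b \<in> carrier B"
  shows "klin UX UY (d b)"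
  using klin_closed[OF assms] by (simp add: lin_maps_iff)

text \<open>
  The failure of \<open>pair_der d\<close> to be \<open>B\<close>-linear is measured by the image of \<open>p\<close> in \<open>X\<close>. It vanishes on the
  syzygy, so that \<open>pair_der d\<close> induces a cocycle there.
\<close>

lemma pair_der_act:
  assumes d: "d \<in> derivs B M lM rM" and b: "b \<in> carrier B" and p: "p \<in> carrier P0"
  shows "pair_der d (b \<odot>\<^bsub>P0\<^esub> p) = b \<odot>\<^bsub>Y\<^esub> pair_der d p \<oplus>\<^bsub>Y\<^esub> d b (free_ev B X p)"
proof -
  have dk: "klin B M d" by (rule derivs_klin[OF d])
  note pk = klin_pair_der[OF dk]
  have "klin (underlying_space B P0) UY (\<lambda>p. b \<odot>\<^bsub>Y\<^esub> pair_der d p \<oplus>\<^bsub>UY\<^esub> d b (free_ev B X p))"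
    by (intro klin_plus P0.V.vect_axioms Y.V.vect_axioms klin_compose[OF pk Y.klin_act[OF b]]
        klin_compose[OF ev0 klin_M_closed[OF dk b]])
  then have k: "klin (underlying_space B P0) UY (\<lambda>p. b \<odot>\<^bsub>Y\<^esub> pair_der d p \<oplus>\<^bsub>Y\<^esub> d b (free_ev B X p))" by simp
  show ?thesis
    by (rule free_mod_klin_eqI[OF Y.V.vect_axioms klin_compose[OF P0.klin_act[OF b] pk] k _ p])
       (simp add: gen_mult[OF b, symmetric] pair_der_gen[OF dk] b deriv_mult_at[OF d] free_ev_gen[OF bX])
qed

definition Z :: "((('x \<Rightarrow> 'b) \<Rightarrow> 'b) \<Rightarrow> 'y) set" where
  "Z = {f \<in> lin_maps B P1 Y. \<forall>p\<in>carrier P2. f (free_ev B S2 p) = \<zero>\<^bsub>Y\<^esub>}"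

abbreviation "ZV \<equiv> (Hom_space B P1 Y)\<lparr>carrier := Z\<rparr>"

definition pull :: "(('x \<Rightarrow> 'b) \<Rightarrow> 'y) \<Rightarrow> (('x \<Rightarrow> 'b) \<Rightarrow> 'b) \<Rightarrow> 'y" where
  [simp]: "pull g = (\<lambda>p\<in>carrier P1. g (free_ev B S1 p))"

lemma Ext1_eq: "Ext1 B X Y = quot_mod ZV (pull ` lin_maps B P0 Y)"
  by (simp add: Ext1_def Let_def Z_def pull_def[abs_def])

lemma Hom_space_simps:
  "carrier (Hom_space B P Y) = lin_maps B P Y"
  "zero (Hom_space B P Y) = (\<lambda>x\<in>carrier P. \<zero>\<^bsub>Y\<^esub>)"
  "add (Hom_space B P Y) = (\<lambda>f g. \<lambda>x\<in>carrier P. f x \<oplus>\<^bsub>Y\<^esub> g x)"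
  "smult (Hom_space B P Y) = (\<lambda>c f. \<lambda>x\<in>carrier P. c \<odot>\<^bsub>UY\<^esub> f x)"
  by (simp_all add: Hom_space_eq)

lemma ev2_in: "p \<in> carrier P2 \<Longrightarrow> free_ev B S2 p \<in> carrier S2"
  using klin_closed[OF ev2, of p] by simp

lemma subsp_Z: "subsp (Hom_space B P1 Y) Z"
proof -
  interpret H: vect "Hom_space B P1 Y" by (rule vect_Hom_space[OF P1.lmod_axioms bY])
  have e: "free_ev B S2 p \<in> carrier P1" if "p \<in> carrier P2" for p using ev2_in[OF that] by (simp add: S2_simps)
  show ?thesis
  proof (rule subspI)
    show "Z \<subseteq> carrier (Hom_space B P1 Y)" by (auto simp: Z_def Hom_space_simps)
    show "\<zero>\<^bsub>Hom_space B P1 Y\<^esub> \<in> Z" using H.zero_closed e by (simp add: Z_def Hom_space_simps)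
    fix f g c assume f: "f \<in> Z"
    then have f': "f \<in> carrier (Hom_space B P1 Y)" by (simp add: Z_def Hom_space_simps)
    show "c \<odot>\<^bsub>Hom_space B P1 Y\<^esub> f \<in> Z" for c
      using H.scal_closed[OF f', of c] f e Y.act_zero by (simp add: Z_def Hom_space_simps)
    assume g: "g \<in> Z"
    then have g': "g \<in> carrier (Hom_space B P1 Y)" by (simp add: Z_def Hom_space_simps)
    show "f \<oplus>\<^bsub>Hom_space B P1 Y\<^esub> g \<in> Z"
      using H.a_closed[OF f' g'] f g e Y.V.l_zero[OF Y.V.zero_closed] by (simp add: Z_def Hom_space_simps)
  qed
qed

lemma vect_ZV: "vect ZV"
  by (rule subsp_vect[OF vect_Hom_space[OF P1.lmod_axioms bY] subsp_Z])

lemma pull_in_Z: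
  assumes "\<And>f g. f \<in> carrier S1 \<Longrightarrow> g \<in> carrier S1 \<Longrightarrow> h (f \<oplus>\<^bsub>P0\<^esub> g) = h f \<oplus>\<^bsub>Y\<^esub> h g"
    and "\<And>b f. b \<in> carrier B \<Longrightarrow> f \<in> carrier S1 \<Longrightarrow> h (b \<odot>\<^bsub>P0\<^esub> f) = b \<odot>\<^bsub>Y\<^esub> h f"
    and "\<And>f. f \<in> carrier S1 \<Longrightarrow> h f \<in> carrier Y"
  shows "pull h \<in> Z"
proof -
  have z: "h \<zero>\<^bsub>P0\<^esub> = \<zero>\<^bsub>Y\<^esub>"
  proof -
    have c: "\<zero>\<^bsub>P0\<^esub> \<in> carrier S1" using S1.V.zero_closed by (simp add: S1_simps)
    have "h (\<zero>\<^bsub>P0\<^esub> \<oplus>\<^bsub>P0\<^esub> \<zero>\<^bsub>P0\<^esub>) = h \<zero>\<^bsub>P0\<^esub> \<oplus>\<^bsub>Y\<^esub> h \<zero>\<^bsub>P0\<^esub>" by (rule assms(1)[OF c c])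
    moreover have "\<zero>\<^bsub>P0\<^esub> \<oplus>\<^bsub>P0\<^esub> \<zero>\<^bsub>P0\<^esub> = \<zero>\<^bsub>P0\<^esub>" using P0.V.l_zero[OF P0.V.zero_closed] by simp
    ultimately show ?thesis using Y.V.add.l_cancel_one'[of "h \<zero>\<^bsub>P0\<^esub>" "h \<zero>\<^bsub>P0\<^esub>"] assms(3)[OF c] by simp
  qed
  have a: "p \<oplus>\<^bsub>P1\<^esub> q \<in> carrier P1" if "p \<in> carrier P1" "q \<in> carrier P1" for p q
    using P1.V.a_closed[of p q] that by simp
  have m: "b \<odot>\<^bsub>P1\<^esub> p \<in> carrier P1" if "b \<in> carrier B" "p \<in> carrier P1" for b p
    using P1.act_closed[of b p] that by simp
  have "pull h \<in> lin_maps B P1 Y"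
    unfolding lin_maps_bmod_iff
  proof (intro conjI ballI)
    fix p q b assume p: "p \<in> carrier P1"
    show "pull h p \<in> carrier Y" using p assms(3)[OF ev1_in[OF p]] by simp
    show "pull h (p \<oplus>\<^bsub>P1\<^esub> q) = pull h p \<oplus>\<^bsub>Y\<^esub> pull h q" if q: "q \<in> carrier P1"
      using p q a[OF p q] klin_add[OF ev1, of p q] assms(1)[OF ev1_in[OF p] ev1_in[OF q]] by (simp add: S1_simps)
    show "pull h (b \<odot>\<^bsub>P1\<^esub> p) = b \<odot>\<^bsub>Y\<^esub> pull h p" if b: "b \<in> carrier B"
      using p b m[OF b p] free_ev_act[OF S1.lmod_axioms b p] assms(2)[OF b ev1_in[OF p]] by (simp add: S1_simps)
  qed simp
  moreover have "pull h (free_ev B S2 p) = \<zero>\<^bsub>Y\<^esub>" if "p \<in> carrier P2" for p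
    using ev2_in[OF that] z by (simp add: S2_simps)
  ultimately show ?thesis by (simp add: Z_def)
qed

lemma S1_sub: "f \<in> carrier S1 \<Longrightarrow> f \<in> carrier P0"
  by (simp add: S1_simps)

lemma klin_pull: "klin (Hom_space B P0 Y) ZV pull"
proof (rule klinI)
  fix g assume g: "g \<in> carrier (Hom_space B P0 Y)"
  show "pull g \<in> carrier ZV"
    using pull_in_Z[of g] g S1_sub by (simp add: Hom_space_simps lin_maps_bmod_iff)
  fix h assume h: "h \<in> carrier (Hom_space B P0 Y)"
  show "pull (g \<oplus>\<^bsub>Hom_space B P0 Y\<^esub> h) = pull g \<oplus>\<^bsub>ZV\<^esub> pull h"
    by (auto simp: Hom_space_simps S1_sub ev1_in intro!: restrict_ext)
next
  fix c g assume g: "g \<in> carrier (Hom_space B P0 Y)"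
  show "pull (c \<odot>\<^bsub>Hom_space B P0 Y\<^esub> g) = c \<odot>\<^bsub>ZV\<^esub> pull g"
    by (auto simp: Hom_space_simps S1_sub ev1_in intro!: restrict_ext)
qed

lemma subsp_pull: "subsp ZV (pull ` lin_maps B P0 Y)"
  using subsp_image[OF vect_Hom_space[OF P0.lmod_axioms bY] vect_ZV klin_pull] by (simp add: Hom_space_simps)

lemma klin_pull_pair_der: "klin (der_space B M lM rM) ZV (\<lambda>d. pull (pair_der d))"
proof (rule klinI)
  fix d assume "d \<in> carrier (der_space B M lM rM)"
  then have d: "d \<in> derivs B M lM rM" by simp
  note dk = derivs_klin[OF d]
  note pk = klin_pair_der[OF dk]
  have "pull (pair_der d) \<in> Z"
  proof (rule pull_in_Z)
    show "pair_der d (f \<oplus>\<^bsub>P0\<^esub> g) = pair_der d f \<oplus>\<^bsub>Y\<^esub> pair_der d g" if "f \<in> carrier S1" "g \<in> carrier S1" for f g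
      using klin_add[OF pk, of f g] that by (simp add: S1_sub)
    show "pair_der d f \<in> carrier Y" if "f \<in> carrier S1" for f
      using klin_closed[OF pk, of f] that by (simp add: S1_sub)
    show "pair_der d (b \<odot>\<^bsub>P0\<^esub> f) = b \<odot>\<^bsub>Y\<^esub> pair_der d f" if b: "b \<in> carrier B" and f: "f \<in> carrier S1" for b f
    proof -
      have "d b (free_ev B X f) = \<zero>\<^bsub>UY\<^esub>"
        using klin_zero[OF X.V.vect_axioms Y.V.vect_axioms klin_M_closed[OF dk b]] f by (simp add: S1_simps)
      moreover have "b \<odot>\<^bsub>Y\<^esub> pair_der d f \<in> carrier UY"
        using klin_closed[OF pk, of f] S1_sub[OF f] Y.act_closed[OF b] by simp
      ultimately show ?thesis using pair_der_act[OF d b S1_sub[OF f]] Y.V.r_zero by simp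
    qed
  qed
  then show "pull (pair_der d) \<in> carrier ZV" by simp
  fix e assume "e \<in> carrier (der_space B M lM rM)"
  then have e: "e \<in> derivs B M lM rM" by simp
  note ek = derivs_klin[OF e]
  interpret D: vect "der_space B M lM rM" by (rule M.vect_der_space)
  have de: "d \<oplus>\<^bsub>der_space B M lM rM\<^esub> e \<in> derivs B M lM rM" using D.a_closed[of d e] d e by simp
  have "pair_der (d \<oplus>\<^bsub>der_space B M lM rM\<^esub> e) f = pair_der d f \<oplus>\<^bsub>UY\<^esub> pair_der e f" if f: "f \<in> carrier P0" for f
    by (rule free_mod_klin_eqI[OF Y.V.vect_axioms klin_pair_der[OF derivs_klin[OF de]]
          klin_plus[OF P0.V.vect_axioms Y.V.vect_axioms pk klin_pair_der[OF ek]] _ f])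
       (simp add: pair_der_gen[OF derivs_klin[OF de]] pair_der_gen[OF dk] pair_der_gen[OF ek] del: der_space_simps, simp)
  then show "pull (pair_der (d \<oplus>\<^bsub>der_space B M lM rM\<^esub> e)) = pull (pair_der d) \<oplus>\<^bsub>ZV\<^esub> pull (pair_der e)"
    by (auto simp: Hom_space_simps S1_sub ev1_in simp del: der_space_simps intro!: restrict_ext)
next
  fix c d assume "d \<in> carrier (der_space B M lM rM)"
  then have d: "d \<in> derivs B M lM rM" by simp
  note dk = derivs_klin[OF d]
  interpret D: vect "der_space B M lM rM" by (rule M.vect_der_space)
  have cd: "c \<odot>\<^bsub>der_space B M lM rM\<^esub> d \<in> derivs B M lM rM" using D.scal_closed[of d c] d by simp
  have "pair_der (c \<odot>\<^bsub>der_space B M lM rM\<^esub> d) f = c \<odot>\<^bsub>UY\<^esub> pair_der d f" if f: "f \<in> carrier P0" for f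
    by (rule free_mod_klin_eqI[OF Y.V.vect_axioms klin_pair_der[OF derivs_klin[OF cd]]
          klin_times[OF P0.V.vect_axioms Y.V.vect_axioms klin_pair_der[OF dk]] _ f])
       (simp add: pair_der_gen[OF derivs_klin[OF cd]] pair_der_gen[OF dk] del: der_space_simps, simp)
  then show "pull (pair_der (c \<odot>\<^bsub>der_space B M lM rM\<^esub> d)) = c \<odot>\<^bsub>ZV\<^esub> pull (pair_der d)"
    by (auto simp: Hom_space_simps S1_sub ev1_in simp del: der_space_simps intro!: restrict_ext)
qed

lemma pull_eq_iff: "pull f = pull g \<longleftrightarrow> (\<forall>p\<in>carrier S1. f p = g p)"
proof
  assume e: "pull f = pull g"
  show "\<forall>p\<in>carrier S1. f p = g p"
  proof
    fix p assume "p \<in> carrier S1"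
    then obtain q where q: "q \<in> carrier P1" "free_ev B S1 q = p" using ev1_onto by blast
    show "f p = g p" using fun_cong[OF e, of q] q by simp
  qed
qed (use ev1_in in \<open>auto intro!: restrict_ext\<close>)

definition ext_lin :: "('x \<Rightarrow> 'y) \<Rightarrow> ('x \<Rightarrow> 'b) \<Rightarrow> 'y" where
  "ext_lin h = fsum B UY (carrier X) (\<lambda>x b. b \<odot>\<^bsub>Y\<^esub> h x)"

lemma ext_lin:
  assumes h: "\<And>x. x \<in> carrier X \<Longrightarrow> h x \<in> carrier Y"
  shows "klin (underlying_space B P0) UY (ext_lin h)"
    and "x \<in> carrier X \<Longrightarrow> b \<in> carrier B \<Longrightarrow> ext_lin h (gen B (carrier X) x b) = b \<odot>\<^bsub>Y\<^esub> h x"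
    and "restrict (ext_lin h) (carrier P0) \<in> lin_maps B P0 Y"
proof -
  have k: "klin B UY (\<lambda>b. b \<odot>\<^bsub>Y\<^esub> h x)" if "x \<in> carrier X" for x
    using h[OF that] by (intro Y.klin_act_arg) simp
  show kl: "klin (underlying_space B P0) UY (ext_lin h)"
    unfolding ext_lin_def by (rule klin_fsum[OF Y.V.vect_axioms k])
  show "x \<in> carrier X \<Longrightarrow> b \<in> carrier B \<Longrightarrow> ext_lin h (gen B (carrier X) x b) = b \<odot>\<^bsub>Y\<^esub> h x"
    unfolding ext_lin_def by (rule fsum_gen[OF Y.V.vect_axioms k])
  have act: "ext_lin h (b \<odot>\<^bsub>P0\<^esub> p) = b \<odot>\<^bsub>Y\<^esub> ext_lin h p" if b: "b \<in> carrier B" and p: "p \<in> carrier P0" for b p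
    unfolding ext_lin_def
    by (rule fsum_act[OF bY k _ b p]) (use h Y.act_mult b in simp_all)
  have a: "p \<oplus>\<^bsub>P0\<^esub> q \<in> carrier P0" if "p \<in> carrier P0" "q \<in> carrier P0" for p q
    using P0.V.a_closed[of p q] that by simp
  have m: "b \<odot>\<^bsub>P0\<^esub> p \<in> carrier P0" if "b \<in> carrier B" "p \<in> carrier P0" for b p
    using P0.act_closed[of b p] that by simp
  show "restrict (ext_lin h) (carrier P0) \<in> lin_maps B P0 Y"
    unfolding lin_maps_bmod_iff using kl act a m by (auto simp: klin_def)
qed

lemma lin_map_P0_eq:
  assumes g: "g \<in> lin_maps B P0 Y" and x: "x \<in> carrier X" and b: "b \<in> carrier B"
  shows "g (gen B (carrier X) x b) = b \<odot>\<^bsub>Y\<^esub> g (gen B (carrier X) x \<one>)"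
proof -
  have "gen B (carrier X) x b = b \<odot>\<^bsub>P0\<^esub> gen B (carrier X) x \<one>" using gen_mult[OF b, of "carrier X" x \<one>] b by simp
  then show ?thesis using g b gen_in[OF x one_closed] by (simp add: lin_maps_bmod_iff)
qed

lemma pair_der_inner:
  assumes m: "m \<in> carrier M" and p: "p \<in> carrier S1"
  shows "pair_der (inner_der B M lM rM m) p = ext_lin m p"
proof -
  have mk: "klin UX UY m" by (rule M_mem[OF m])
  have mc: "m x \<in> carrier Y" if "x \<in> carrier X" for x using klin_closed[OF mk, of x] that by simp
  have d: "inner_der B M lM rM m \<in> derivs B M lM rM" using klin_closed[OF M.klin_inner_der m] by simp
  note dk = derivs_klin[OF d]
  have v: "inner_der B M lM rM m b x = b \<odot>\<^bsub>Y\<^esub> m x \<oplus>\<^bsub>UY\<^esub> (- 1) \<odot>\<^bsub>UY\<^esub> m (b \<odot>\<^bsub>X\<^esub> x)"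
    if b: "b \<in> carrier B" and x: "x \<in> carrier X" for b x
  proof -
    have "inner_der B M lM rM m b = lM b m \<oplus>\<^bsub>M\<^esub> (- 1) \<odot>\<^bsub>M\<^esub> rM m b"
      using b m M.V.diff_scal[OF M.act_closed[OF b m] M.ract_closed[OF m b]] by (simp add: inner_der_def)
    then show ?thesis using x by (simp add: hom_left_def hom_right_def)
  qed
  have "pair_der (inner_der B M lM rM m) p = ext_lin m p \<oplus>\<^bsub>UY\<^esub> (- 1) \<odot>\<^bsub>UY\<^esub> m (free_ev B X p)"
    by (rule free_mod_klin_eqI[OF Y.V.vect_axioms klin_pair_der[OF dk] klin_plus[OF P0.V.vect_axioms Y.V.vect_axioms
        ext_lin(1)[OF mc] klin_times[OF P0.V.vect_axioms Y.V.vect_axioms klin_compose[OF ev0 mk]]] _ S1_sub[OF p]])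
       (simp_all only: pair_der_gen[OF dk] v ext_lin(2)[OF mc] free_ev_gen[OF bX])
  moreover have "m (free_ev B X p) = \<zero>\<^bsub>UY\<^esub>" using p klin_zero[OF X.V.vect_axioms Y.V.vect_axioms mk] by (simp add: S1_simps)
  moreover have "ext_lin m p \<in> carrier UY"
    by (rule klin_closed[OF ext_lin(1)[OF mc]]) (use S1_sub[OF p] in simp_all)
  ultimately show ?thesis using Y.V.r_zero[of "ext_lin m p"] Y.V.scal_zero_right[of "-1"] by simp
qed

lemma diff_in_S1:
  assumes "p \<in> carrier P0" "q \<in> carrier P0" "free_ev B X p = free_ev B X q"
  shows "p \<ominus>\<^bsub>underlying_space B P0\<^esub> q \<in> carrier S1"
proof -
  have pq: "p \<in> carrier (underlying_space B P0)" "q \<in> carrier (underlying_space B P0)" using assms by simp_all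
  have "free_ev B X (p \<ominus>\<^bsub>underlying_space B P0\<^esub> q) = \<zero>\<^bsub>UX\<^esub>"
    using klin_diff[OF P0.V.vect_axioms X.V.vect_axioms ev0 pq] assms(3) klin_closed[OF ev0 pq(1)]
      X.V.diff_eq_zero_iff[OF klin_closed[OF ev0 pq(1)] klin_closed[OF ev0 pq(2)]] by simp
  then show ?thesis using P0.V.minus_closed[OF pq] by (simp add: S1_simps)
qed

lemma agree_diff:
  assumes g: "klin (underlying_space B P0) UY g" and d: "klin (underlying_space B P0) UY h"
    and agree: "\<And>p. p \<in> carrier S1 \<Longrightarrow> g p = h p"
    and "p \<in> carrier P0" "q \<in> carrier P0" "free_ev B X p = free_ev B X q"
  shows "g p \<ominus>\<^bsub>UY\<^esub> g q = h p \<ominus>\<^bsub>UY\<^esub> h q"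
proof -
  have pq: "p \<in> carrier (underlying_space B P0)" "q \<in> carrier (underlying_space B P0)" using assms(4,5) by simp_all
  show ?thesis
    using agree[OF diff_in_S1[OF assms(4-6)]]
      klin_diff[OF P0.V.vect_axioms Y.V.vect_axioms g pq] klin_diff[OF P0.V.vect_axioms Y.V.vect_axioms d pq]
    by simp
qed

text \<open>
  If \<open>pair_der d\<close> agrees on the syzygy with a \<open>B\<close>-linear map \<open>g\<close> on the free cover, let \<open>h x\<close> be the value of
  \<open>g\<close> on the basis vector of \<open>x\<close>. The element \<open>b [x] - [b x]\<close> of the syzygy shows that \<open>d\<close> is the inner derivation
  of \<open>h\<close>, and the elements \<open>[x] + [y] - [x + y]\<close> show that \<open>h\<close> is linear.
\<close>

lemma pull_pair_der_kernel:
  assumes d: "d \<in> derivs B M lM rM"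
  shows "pull (pair_der d) \<in> pull ` lin_maps B P0 Y \<longleftrightarrow> d \<in> inner_der B M lM rM ` carrier M"
proof
  assume "d \<in> inner_der B M lM rM ` carrier M"
  then obtain m where m: "m \<in> carrier M" "d = inner_der B M lM rM m" by blast
  have mc: "m x \<in> carrier Y" if "x \<in> carrier X" for x using klin_closed[OF M_mem[OF m(1)], of x] that by simp
  have "pull (pair_der d) = pull (restrict (ext_lin m) (carrier P0))"
    unfolding pull_eq_iff using pair_der_inner[OF m(1)] S1_sub m(2) by simp
  then show "pull (pair_der d) \<in> pull ` lin_maps B P0 Y" by (simp only:) (rule imageI[OF ext_lin(3)[OF mc]])
next
  assume "pull (pair_der d) \<in> pull ` lin_maps B P0 Y"
  then obtain g where e: "pull (pair_der d) = pull g" and g: "g \<in> lin_maps B P0 Y" by (rule imageE)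
  have eq: "pair_der d p = g p" if "p \<in> carrier S1" for p using e that unfolding pull_eq_iff by simp
  note dk = derivs_klin[OF d]
  note gk = lin_maps_klin[OF kalg_axioms g]
  have ad: "pair_der d p \<ominus>\<^bsub>UY\<^esub> pair_der d q = g p \<ominus>\<^bsub>UY\<^esub> g q"
    if "p \<in> carrier P0" "q \<in> carrier P0" "free_ev B X p = free_ev B X q" for p q
    by (rule agree_diff[OF klin_pair_der[OF dk] gk _ that]) (rule eq)
  let ?e = "\<lambda>x b. gen B (carrier X) x b"
  define h where "h = (\<lambda>x\<in>carrier X. g (?e x \<one>))"
  have hc: "h x \<in> carrier Y" if "x \<in> carrier X" for x
    using g gen_in[OF that one_closed] that by (simp add: h_def lin_maps_bmod_iff)
  have bx: "b \<odot>\<^bsub>X\<^esub> x \<in> carrier X" if "b \<in> carrier B" "x \<in> carrier X" for b x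
    using X.act_closed[of b x] that by simp
  have one: "\<one> \<odot>\<^bsub>X\<^esub> x = x" "\<one> \<odot>\<^bsub>Y\<^esub> y = y" if "x \<in> carrier X" "y \<in> carrier Y" for x y
    using X.act_one[of x] Y.act_one[of y] that by simp_all
  have key: "d b x = b \<odot>\<^bsub>Y\<^esub> h x \<ominus>\<^bsub>UY\<^esub> h (b \<odot>\<^bsub>X\<^esub> x)" if b: "b \<in> carrier B" and x: "x \<in> carrier X" for b x
  proof -
    have "pair_der d (?e x b) \<ominus>\<^bsub>UY\<^esub> pair_der d (?e (b \<odot>\<^bsub>X\<^esub> x) \<one>) = g (?e x b) \<ominus>\<^bsub>UY\<^esub> g (?e (b \<odot>\<^bsub>X\<^esub> x) \<one>)"
      by (rule ad) (use b x bx[OF b x] one in \<open>simp_all add: gen_in free_ev_gen[OF bX]\<close>)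
    moreover have "d b x \<in> carrier UY" using klin_closed[OF klin_at[OF dk x] b] .
    ultimately show ?thesis
      using b x bx[OF b x] deriv_one_at[OF d bx[OF b x]] lin_map_P0_eq[OF g x b] Y.V.diff_scal[of "d b x" "\<zero>\<^bsub>UY\<^esub>"]
        Y.V.scal_zero_right[of "-1"] Y.V.r_zero[of "d b x"] Y.V.zero_closed
      by (simp add: pair_der_gen[OF dk] h_def)
  qed
  have "klin UX UY h"
  proof (rule klinI)
    fix x y assume "x \<in> carrier UX" "y \<in> carrier UX"
    then have x: "x \<in> carrier X" and y: "y \<in> carrier X" by simp_all
    have xy: "x \<oplus>\<^bsub>X\<^esub> y \<in> carrier X" using X.V.a_closed[of x y] x y by simp
    let ?p = "?e x \<one> \<oplus>\<^bsub>P0\<^esub> ?e y \<one>" and ?q = "?e (x \<oplus>\<^bsub>X\<^esub> y) \<one>"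
    have exy: "?e x \<one> \<in> carrier (underlying_space B P0)" "?e y \<one> \<in> carrier (underlying_space B P0)"
      using x y by (simp_all add: gen_in)
    have p: "?p \<in> carrier P0" using P0.V.a_closed[OF exy] by simp
    have "pair_der d ?p \<ominus>\<^bsub>UY\<^esub> pair_der d ?q = g ?p \<ominus>\<^bsub>UY\<^esub> g ?q"
    proof (rule ad[OF p])
      show "free_ev B X ?p = free_ev B X ?q"
        using klin_add[OF ev0 exy] x y xy one by (simp add: free_ev_gen[OF bX])
    qed (simp add: gen_in xy)
    moreover have "pair_der d ?p = \<zero>\<^bsub>UY\<^esub>" "pair_der d ?q = \<zero>\<^bsub>UY\<^esub>"
      using klin_add[OF klin_pair_der[OF dk] exy] x y xy deriv_one_at[OF d] Y.V.l_zero[OF Y.V.zero_closed]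
      by (simp_all add: pair_der_gen[OF dk])
    moreover have gp: "g ?p = h x \<oplus>\<^bsub>UY\<^esub> h y" "g ?q = h (x \<oplus>\<^bsub>X\<^esub> y)"
      using klin_add[OF gk exy] x y xy by (simp_all add: h_def)
    moreover have "h x \<oplus>\<^bsub>UY\<^esub> h y \<in> carrier UY" using Y.V.a_closed[of "h x" "h y"] hc x y by simp
    ultimately show "h (x \<oplus>\<^bsub>UX\<^esub> y) = h x \<oplus>\<^bsub>UY\<^esub> h y"
      using Y.V.diff_eq_zero_iff[of "h x \<oplus>\<^bsub>UY\<^esub> h y" "h (x \<oplus>\<^bsub>X\<^esub> y)"] hc[OF xy]
        Y.V.diff_eq_zero_iff[OF Y.V.zero_closed Y.V.zero_closed] by simp
  next
    fix c x assume "x \<in> carrier UX"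
    then have x: "x \<in> carrier X" by simp
    have c: "c \<odot> \<one> \<in> carrier B" by simp
    have "d (c \<odot> \<one>) x = \<zero>\<^bsub>UY\<^esub>"
      using klin_scal[OF klin_at[OF dk x] one_closed, of c] deriv_one_at[OF d x] Y.V.scal_zero_right[of c] by simp
    then have "(c \<odot> \<one>) \<odot>\<^bsub>Y\<^esub> h x \<ominus>\<^bsub>UY\<^esub> h ((c \<odot> \<one>) \<odot>\<^bsub>X\<^esub> x) = \<zero>\<^bsub>UY\<^esub>" using key[OF c x] by simp
    then show "h (c \<odot>\<^bsub>UX\<^esub> x) = c \<odot>\<^bsub>UY\<^esub> h x"
      using Y.V.diff_eq_zero_iff[of "(c \<odot> \<one>) \<odot>\<^bsub>Y\<^esub> h x" "h ((c \<odot> \<one>) \<odot>\<^bsub>X\<^esub> x)"] hc[OF bx[OF c x]]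
        Y.act_closed[OF c, of "h x"] hc[OF x] by simp
  qed (use hc in simp)
  then have hM: "h \<in> carrier M" by (simp add: lin_maps_iff h_def)
  have "d = inner_der B M lM rM h"
  proof (rule derivs_eqI[OF d])
    show hd: "inner_der B M lM rM h \<in> derivs B M lM rM" using klin_closed[OF M.klin_inner_der hM] by simp
    fix b assume b: "b \<in> carrier B"
    have db: "d b \<in> carrier M" using derivs_closed[OF d b] .
    have ib: "inner_der B M lM rM h b \<in> carrier M" using derivs_closed[OF hd b] .
    show "d b = inner_der B M lM rM h b"
    proof (rule lin_maps_eqI)
      show "d b \<in> lin_maps class_ring UX UY" "inner_der B M lM rM h b \<in> lin_maps class_ring UX UY" using db ib by simp_all
      fix x assume "x \<in> carrier UX"
      then have x: "x \<in> carrier X" by simp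
      have "inner_der B M lM rM h b = lM b h \<oplus>\<^bsub>M\<^esub> (- 1) \<odot>\<^bsub>M\<^esub> rM h b"
        using b M.V.diff_scal[OF M.act_closed[OF b hM] M.ract_closed[OF hM b]] by (simp add: inner_der_def)
      then have "inner_der B M lM rM h b x = b \<odot>\<^bsub>Y\<^esub> h x \<oplus>\<^bsub>UY\<^esub> (- 1) \<odot>\<^bsub>UY\<^esub> h (b \<odot>\<^bsub>X\<^esub> x)"
        using x by (simp add: hom_left_def hom_right_def)
      also have "\<dots> = b \<odot>\<^bsub>Y\<^esub> h x \<ominus>\<^bsub>UY\<^esub> h (b \<odot>\<^bsub>X\<^esub> x)"
        using Y.V.diff_scal[of "b \<odot>\<^bsub>Y\<^esub> h x" "h (b \<odot>\<^bsub>X\<^esub> x)"] Y.act_closed[OF b, of "h x"] hc[OF x] hc[OF bx[OF b x]] by simp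
      finally show "d b x = inner_der B M lM rM h b x" using key[OF b x] by simp
    qed
  qed
  then show "d \<in> inner_der B M lM rM ` carrier M" using hM by blast
qed

end

context two_bmods
begin

lemma linear_section:
  assumes "kfin UX"
  obtains s where "klin UX (underlying_space B P0) s" "\<And>x. x \<in> carrier X \<Longrightarrow> free_ev B X (s x) = x"
proof -
  obtain A c where d: "dual_basis UX A c" using dual_basis_exists[OF X.V.vect_axioms assms] by blast
  then have A: "finite A" "A \<subseteq> carrier X" and c: "\<And>p. p \<in> A \<Longrightarrow> klin UX ground_space (c p)"
    and rec: "\<And>x. x \<in> carrier X \<Longrightarrow> x = (\<Oplus>\<^bsub>UX\<^esub>p\<in>A. c p x \<odot>\<^bsub>UX\<^esub> p)"
    by (simp_all add: dual_basis_def)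
  let ?g = "\<lambda>p. gen B (carrier X) p \<one>"
  define s where "s = (\<lambda>x. \<Oplus>\<^bsub>underlying_space B P0\<^esub>p\<in>A. c p x \<odot>\<^bsub>underlying_space B P0\<^esub> ?g p)"
  have g: "?g p \<in> carrier (underlying_space B P0)" if "p \<in> A" for p using that A(2) by (simp add: gen_in subset_iff)
  have mem: "(\<lambda>p. c p x \<odot>\<^bsub>underlying_space B P0\<^esub> ?g p) \<in> A \<rightarrow> carrier (underlying_space B P0)" for x
    using P0.V.scal_closed[OF g] by (simp only: Pi_iff, blast)
  have "klin UX (underlying_space B P0) s"
    unfolding s_def by (rule klin_sum_coeffs[OF X.V.vect_axioms P0.V.vect_axioms A(1) c g])
  moreover have "free_ev B X (s x) = x" if x: "x \<in> carrier X" for x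
  proof -
    have "free_ev B X (s x) = (\<Oplus>\<^bsub>UX\<^esub>p\<in>A. free_ev B X (c p x \<odot>\<^bsub>underlying_space B P0\<^esub> ?g p))"
      unfolding s_def by (rule klin_finsum[OF P0.V.vect_axioms X.V.vect_axioms ev0 A(1) mem])
    also have "\<dots> = (\<Oplus>\<^bsub>UX\<^esub>p\<in>A. c p x \<odot>\<^bsub>UX\<^esub> p)"
    proof (rule X.V.finsum_cong')
      fix p assume p: "p \<in> A"
      then have pX: "p \<in> carrier X" using A(2) by blast
      show "free_ev B X (c p x \<odot>\<^bsub>underlying_space B P0\<^esub> ?g p) = c p x \<odot>\<^bsub>UX\<^esub> p"
        using klin_scal[OF ev0 g[OF p]] free_ev_gen[OF bX pX one_closed] X.act_one[of p] pX by (simp del: underlying_space_simps(4))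
    next
      show "(\<lambda>p. c p x \<odot>\<^bsub>UX\<^esub> p) \<in> A \<rightarrow> carrier UX"
        using A(2) X.V.scal_closed by (auto simp del: underlying_space_simps(4))
    qed simp
    also have "\<dots> = x" using rec[OF x] by simp
    finally show ?thesis .
  qed
  ultimately show ?thesis by (rule that)
qed

text \<open>
  A cocycle kills the kernel of \<open>P1 \<rightarrow> S1\<close>, hence factors through the syzygy.
\<close>

lemma cocycle_induced:
  assumes "\<phi> \<in> Z"
  obtains f where "klin (underlying_space B S1) UY f" "\<And>p. p \<in> carrier P1 \<Longrightarrow> \<phi> p = f (free_ev B S1 p)"
    "\<And>b p. b \<in> carrier B \<Longrightarrow> p \<in> carrier S1 \<Longrightarrow> f (b \<odot>\<^bsub>P0\<^esub> p) = b \<odot>\<^bsub>Y\<^esub> f p"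
proof -
  let ?g = "\<lambda>p. gen B (carrier S1) p \<one>"
  have \<phi>: "\<phi> \<in> lin_maps B P1 Y" and van: "\<And>p. p \<in> carrier P2 \<Longrightarrow> \<phi> (free_ev B S2 p) = \<zero>\<^bsub>Y\<^esub>"
    using assms by (simp_all add: Z_def)
  note k = lin_maps_klin[OF kalg_axioms \<phi>]
  have van': "\<phi> q = \<zero>\<^bsub>Y\<^esub>" if q: "q \<in> carrier S2" for q
  proof -
    have "free_ev B S2 (gen B (carrier S2) q \<one>) = q"
      using free_ev_gen[OF S2.lmod_axioms q one_closed] S2.act_one[of q] q by simp
    then show ?thesis using van[OF gen_in[OF q one_closed]] by simp
  qed
  define f where "f = (\<lambda>p. \<phi> (?g p))"
  have g: "?g p \<in> carrier P1" if "p \<in> carrier S1" for p using gen_in[OF that one_closed] .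
  have eg: "free_ev B S1 (?g p) = p" if "p \<in> carrier S1" for p
    using free_ev_gen[OF S1.lmod_axioms that one_closed] S1.act_one[of p] that by simp
  have dep: "\<phi> p = \<phi> q" if p: "p \<in> carrier P1" and q: "q \<in> carrier P1" and e: "free_ev B S1 p = free_ev B S1 q" for p q
  proof -
    have pq: "p \<in> carrier (underlying_space B P1)" "q \<in> carrier (underlying_space B P1)" using p q by simp_all
    have "free_ev B S1 (p \<ominus>\<^bsub>underlying_space B P1\<^esub> q) = \<zero>\<^bsub>underlying_space B S1\<^esub>"
      using klin_diff[OF P1.V.vect_axioms S1.V.vect_axioms ev1 pq] e
        S1.V.diff_eq_zero_iff[OF klin_closed[OF ev1 pq(1)] klin_closed[OF ev1 pq(2)]] by simp
    then have "p \<ominus>\<^bsub>underlying_space B P1\<^esub> q \<in> carrier S2" using P1.V.minus_closed[OF pq] by (simp add: S2_simps S1_simps)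
    then have "\<phi> p \<ominus>\<^bsub>UY\<^esub> \<phi> q = \<zero>\<^bsub>UY\<^esub>" using van' klin_diff[OF P1.V.vect_axioms Y.V.vect_axioms k pq] by simp
    then show ?thesis using Y.V.diff_eq_zero_iff[OF klin_closed[OF k pq(1)] klin_closed[OF k pq(2)]] by simp
  qed
  have 2: "\<phi> p = f (free_ev B S1 p)" if p: "p \<in> carrier P1" for p
    unfolding f_def by (rule dep[OF p g[OF ev1_in[OF p]]]) (simp add: eg[OF ev1_in[OF p]])
  have "klin (underlying_space B S1) UY f"
  proof (rule klinI)
    fix p assume p: "p \<in> carrier (underlying_space B S1)"
    then have gp: "?g p \<in> carrier (underlying_space B P1)" using g by simp
    show "f p \<in> carrier UY" unfolding f_def by (rule klin_closed[OF k gp])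
    show "f (c \<odot>\<^bsub>underlying_space B S1\<^esub> p) = c \<odot>\<^bsub>UY\<^esub> f p" for c
    proof -
      have "f (c \<odot>\<^bsub>underlying_space B S1\<^esub> p) = f (free_ev B S1 (c \<odot>\<^bsub>underlying_space B P1\<^esub> ?g p))"
        using klin_scal[OF ev1 gp] eg p by (simp del: underlying_space_simps(4))
      also have "\<dots> = \<phi> (c \<odot>\<^bsub>underlying_space B P1\<^esub> ?g p)"
        using 2 P1.V.scal_closed[OF gp] by (simp del: underlying_space_simps(4))
      also have "\<dots> = c \<odot>\<^bsub>UY\<^esub> f p" unfolding f_def by (rule klin_scal[OF k gp])
      finally show ?thesis .
    qed
    fix q assume q: "q \<in> carrier (underlying_space B S1)"
    then have gq: "?g q \<in> carrier (underlying_space B P1)" using g by simp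
    have "f (p \<oplus>\<^bsub>underlying_space B S1\<^esub> q) = f (free_ev B S1 (?g p \<oplus>\<^bsub>underlying_space B P1\<^esub> ?g q))"
      using klin_add[OF ev1 gp gq] eg p q by (simp del: underlying_space_simps(3))
    also have "\<dots> = \<phi> (?g p \<oplus>\<^bsub>underlying_space B P1\<^esub> ?g q)"
      using 2 P1.V.a_closed[OF gp gq] by (simp del: underlying_space_simps(3))
    also have "\<dots> = f p \<oplus>\<^bsub>UY\<^esub> f q" unfolding f_def by (rule klin_add[OF k gp gq])
    finally show "f (p \<oplus>\<^bsub>underlying_space B S1\<^esub> q) = f p \<oplus>\<^bsub>UY\<^esub> f q" .
  qed
  moreover have "f (b \<odot>\<^bsub>P0\<^esub> p) = b \<odot>\<^bsub>Y\<^esub> f p" if b: "b \<in> carrier B" and p: "p \<in> carrier S1" for b p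
  proof -
    have bg: "b \<odot>\<^bsub>P1\<^esub> ?g p \<in> carrier P1" using P1.act_closed[OF b, of "?g p"] g[OF p] by simp
    have "f (b \<odot>\<^bsub>P0\<^esub> p) = f (free_ev B S1 (b \<odot>\<^bsub>P1\<^esub> ?g p))"
      using free_ev_act[OF S1.lmod_axioms b g[OF p]] eg[OF p] by (simp add: S1_simps)
    also have "\<dots> = \<phi> (b \<odot>\<^bsub>P1\<^esub> ?g p)" using 2[OF bg] by simp
    also have "\<dots> = b \<odot>\<^bsub>Y\<^esub> f p" using \<phi> b g[OF p] by (simp add: lin_maps_bmod_iff f_def)
    finally show ?thesis .
  qed
  ultimately show ?thesis using 2 by (intro that) 
qed

text \<open>
  The map on the syzygy underlying \<open>\<phi>\<close> is extended to the free cover by means of the projection \<open>r\<close> onto the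
  syzygy along a \<open>k\<close>-linear section \<open>s\<close>. The extension \<open>K\<close> is only \<open>k\<close>-linear. Its failure to be \<open>B\<close>-linear is
  a derivation \<open>d\<close>, and \<open>K\<close> differs from \<open>pair_der d\<close> by the \<open>B\<close>-linear map with the same values as \<open>K\<close> on the basis
  vectors.
\<close>

lemma cocycle_from_derivation:
  assumes "kfin UX" and "\<phi> \<in> Z"
  obtains d g where "d \<in> derivs B M lM rM" "g \<in> lin_maps B P0 Y" "\<phi> = pull (pair_der d) \<oplus>\<^bsub>ZV\<^esub> pull g"
proof -
  let ?P = "underlying_space B P0"
  obtain s where s: "klin UX ?P s" and es: "\<And>x. x \<in> carrier X \<Longrightarrow> free_ev B X (s x) = x"
    using linear_section[OF assms(1)] by blast
  obtain f where f: "klin (underlying_space B S1) UY f" and \<phi>f: "\<And>p. p \<in> carrier P1 \<Longrightarrow> \<phi> p = f (free_ev B S1 p)"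
    and fb: "\<And>b p. b \<in> carrier B \<Longrightarrow> p \<in> carrier S1 \<Longrightarrow> f (b \<odot>\<^bsub>P0\<^esub> p) = b \<odot>\<^bsub>Y\<^esub> f p"
    using cocycle_induced[OF assms(2)] by blast
  \<comment> \<open>the projection onto the syzygy along the section\<close>
  define r where "r = (\<lambda>p. p \<oplus>\<^bsub>?P\<^esub> (- 1) \<odot>\<^bsub>?P\<^esub> s (free_ev B X p))"
  have idP: "klin ?P ?P (\<lambda>p. p)" by (rule klinI) simp_all
  have se: "klin ?P ?P (\<lambda>p. s (free_ev B X p))" by (rule klin_compose[OF ev0 s])
  have rP: "klin ?P ?P r"
    unfolding r_def by (intro klin_plus klin_times P0.V.vect_axioms idP se)
  have rd: "r p = p \<ominus>\<^bsub>?P\<^esub> s (free_ev B X p)" if "p \<in> carrier P0" for p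
    unfolding r_def using that klin_closed[OF se, of p] by (intro P0.V.diff_scal[symmetric]) simp_all
  have evX: "free_ev B X p \<in> carrier X" if "p \<in> carrier P0" for p using klin_closed[OF ev0, of p] that by simp
  have sP: "s x \<in> carrier P0" if "x \<in> carrier X" for x using klin_closed[OF s, of x] that by simp
  have rS: "r p \<in> carrier S1" if p: "p \<in> carrier P0" for p
    unfolding rd[OF p] by (rule diff_in_S1[OF p sP[OF evX[OF p]]]) (simp add: es evX[OF p])
  have rPS: "klin ?P (underlying_space B S1) r"
    using rS rP by (auto simp: klin_def S1_simps)
  define K where "K = (\<lambda>p. f (r p))"
  have K: "klin ?P UY K" unfolding K_def by (rule klin_compose[OF rPS f])
  have KS: "K p = f p" if p: "p \<in> carrier S1" for p
  proof -
    have "s (free_ev B X p) = \<zero>\<^bsub>?P\<^esub>" using p klin_zero[OF X.V.vect_axioms P0.V.vect_axioms s] by (simp add: S1_simps)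
    then have "r p = p" unfolding r_def using S1_sub[OF p] P0.V.r_zero[of p] P0.V.scal_zero_right[of "-1"] by simp
    then show ?thesis by (simp add: K_def)
  qed
  have bP: "b \<odot>\<^bsub>P0\<^esub> p \<in> carrier P0" if "b \<in> carrier B" "p \<in> carrier P0" for b p
    using P0.act_closed[of b p] that by simp
  have KY: "K p \<in> carrier UY" if "p \<in> carrier P0" for p using klin_closed[OF K, of p] that by simp
  have Kact: "K (b \<odot>\<^bsub>P0\<^esub> p) = b \<odot>\<^bsub>Y\<^esub> K p \<oplus>\<^bsub>UY\<^esub> K (b \<odot>\<^bsub>P0\<^esub> s (free_ev B X p))"
    if b: "b \<in> carrier B" and p: "p \<in> carrier P0" for b p
  proof -
    let ?q = "s (free_ev B X p)"
    have q: "?q \<in> carrier P0" by (rule sP[OF evX[OF p]])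
    have pq: "p \<in> carrier ?P" "?q \<in> carrier ?P" "b \<odot>\<^bsub>P0\<^esub> p \<in> carrier ?P" "b \<odot>\<^bsub>P0\<^esub> ?q \<in> carrier ?P"
      using p q bP[OF b] by simp_all
    have "b \<odot>\<^bsub>Y\<^esub> K p = f (b \<odot>\<^bsub>P0\<^esub> r p)" unfolding K_def by (rule fb[OF b rS[OF p], symmetric])
    also have "\<dots> = K (b \<odot>\<^bsub>P0\<^esub> r p)"
      using S1.act_closed[OF b, of "r p"] rS[OF p] by (intro KS[symmetric]) (simp add: S1_simps)
    also have "b \<odot>\<^bsub>P0\<^esub> r p = b \<odot>\<^bsub>P0\<^esub> p \<ominus>\<^bsub>?P\<^esub> b \<odot>\<^bsub>P0\<^esub> ?q"
      unfolding rd[OF p] by (rule klin_diff[OF P0.V.vect_axioms P0.V.vect_axioms P0.klin_act[OF b] pq(1,2)])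
    also have "K \<dots> = K (b \<odot>\<^bsub>P0\<^esub> p) \<ominus>\<^bsub>UY\<^esub> K (b \<odot>\<^bsub>P0\<^esub> ?q)"
      by (rule klin_diff[OF P0.V.vect_axioms Y.V.vect_axioms K pq(3,4)])
    finally have "b \<odot>\<^bsub>Y\<^esub> K p \<oplus>\<^bsub>UY\<^esub> K (b \<odot>\<^bsub>P0\<^esub> ?q) =
        (K (b \<odot>\<^bsub>P0\<^esub> p) \<ominus>\<^bsub>UY\<^esub> K (b \<odot>\<^bsub>P0\<^esub> ?q)) \<oplus>\<^bsub>UY\<^esub> K (b \<odot>\<^bsub>P0\<^esub> ?q)" by simp
    also have "\<dots> = K (b \<odot>\<^bsub>P0\<^esub> p)"
      using KY[OF bP[OF b p]] KY[OF bP[OF b q]] unfolding a_minus_def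
      by (simp only: Y.V.a_assoc Y.V.a_inv_closed Y.V.l_neg Y.V.r_zero)
    finally show ?thesis by simp
  qed
  define d where "d = (\<lambda>b\<in>carrier B. \<lambda>x\<in>carrier X. K (b \<odot>\<^bsub>P0\<^esub> s x))"
  have dv: "d b x = K (b \<odot>\<^bsub>P0\<^esub> s x)" if "b \<in> carrier B" "x \<in> carrier X" for b x using that by (simp add: d_def)
  have dM: "d b \<in> carrier M" if b: "b \<in> carrier B" for b
  proof -
    have "klin UX UY (\<lambda>x. K (b \<odot>\<^bsub>P0\<^esub> s x))"
      by (rule klin_compose[OF klin_compose[OF s P0.klin_act[OF b]] K])
    then have "klin UX UY (\<lambda>x\<in>carrier UX. K (b \<odot>\<^bsub>P0\<^esub> s x))" by (simp only: klin_restrict[OF X.V.vect_axioms])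
    then show ?thesis using b by (simp add: d_def lin_maps_iff)
  qed
  have arg: "klin B UY (\<lambda>b. K (b \<odot>\<^bsub>P0\<^esub> s x))" if x: "x \<in> carrier X" for x
    by (rule klin_compose[OF P0.klin_act_arg K]) (use sP[OF x] in simp)
  have dk: "klin B M d"
  proof (rule klinI)
    fix b c assume b: "b \<in> carrier B" and c: "c \<in> carrier B"
    show "d (b \<oplus> c) = d b \<oplus>\<^bsub>M\<^esub> d c"
    proof (rule lin_maps_eqI)
      show "d (b \<oplus> c) \<in> lin_maps class_ring UX UY" "d b \<oplus>\<^bsub>M\<^esub> d c \<in> lin_maps class_ring UX UY"
        using dM[of "b \<oplus> c"] M.V.a_closed[OF dM[OF b] dM[OF c]] b c by simp_all
      show "d (b \<oplus> c) x = (d b \<oplus>\<^bsub>M\<^esub> d c) x" if "x \<in> carrier UX" for x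
        using klin_add[OF arg b c, of x] that b c by (simp add: dv)
    qed
  next
    fix k b assume b: "b \<in> carrier B"
    show "d (k \<odot> b) = k \<odot>\<^bsub>M\<^esub> d b"
    proof (rule lin_maps_eqI)
      show "d (k \<odot> b) \<in> lin_maps class_ring UX UY" "k \<odot>\<^bsub>M\<^esub> d b \<in> lin_maps class_ring UX UY"
        using dM[of "k \<odot> b"] M.V.scal_closed[OF dM[OF b], of k] b by simp_all
      show "d (k \<odot> b) x = (k \<odot>\<^bsub>M\<^esub> d b) x" if "x \<in> carrier UX" for x
        using klin_scal[OF arg b, of x k] that b by (simp add: dv)
    qed
  qed (rule dM)
  have bX': "b \<odot>\<^bsub>X\<^esub> x \<in> carrier X" if "b \<in> carrier B" "x \<in> carrier X" for b x
    using X.act_closed[of b x] that by simp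
  have d: "d \<in> derivs B M lM rM"
  proof -
    have "d (b \<otimes> c) = lM b (d c) \<oplus>\<^bsub>M\<^esub> rM (d b) c" if b: "b \<in> carrier B" and c: "c \<in> carrier B" for b c
    proof (rule lin_maps_eqI)
      show "d (b \<otimes> c) \<in> lin_maps class_ring UX UY" "lM b (d c) \<oplus>\<^bsub>M\<^esub> rM (d b) c \<in> lin_maps class_ring UX UY"
        using dM[of "b \<otimes> c"] M.V.a_closed[OF M.act_closed[OF b dM[OF c]] M.ract_closed[OF dM[OF b] c]] b c by simp_all
      fix x assume "x \<in> carrier UX"
      then have x: "x \<in> carrier X" by simp
      have "(b \<otimes> c) \<odot>\<^bsub>P0\<^esub> s x = b \<odot>\<^bsub>P0\<^esub> (c \<odot>\<^bsub>P0\<^esub> s x)" using P0.act_mult[OF b c, of "s x"] sP[OF x] by simp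
      moreover have "free_ev B X (c \<odot>\<^bsub>P0\<^esub> s x) = c \<odot>\<^bsub>X\<^esub> x"
        using free_ev_act[OF bX c sP[OF x]] es[OF x] by simp
      ultimately have "K ((b \<otimes> c) \<odot>\<^bsub>P0\<^esub> s x) = b \<odot>\<^bsub>Y\<^esub> K (c \<odot>\<^bsub>P0\<^esub> s x) \<oplus>\<^bsub>UY\<^esub> K (b \<odot>\<^bsub>P0\<^esub> s (c \<odot>\<^bsub>X\<^esub> x))"
        using Kact[OF b bP[OF c sP[OF x]]] by simp
      then show "d (b \<otimes> c) x = (lM b (d c) \<oplus>\<^bsub>M\<^esub> rM (d b) c) x"
        using b c x bX'[OF c x] by (simp add: dv hom_left_def hom_right_def)
    qed
    then show ?thesis using dk by (simp add: derivs_def d_def)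
  qed
  define h where "h = (\<lambda>x. K (gen B (carrier X) x \<one>))"
  have hY: "h x \<in> carrier Y" if "x \<in> carrier X" for x using KY[OF gen_in[OF that one_closed]] by (simp add: h_def)
  define g where "g = restrict (ext_lin h) (carrier P0)"
  have g: "g \<in> lin_maps B P0 Y" unfolding g_def by (rule ext_lin(3)[OF hY])
  have sum: "pair_der d p \<oplus>\<^bsub>UY\<^esub> ext_lin h p = K p" if p: "p \<in> carrier P0" for p
  proof (rule free_mod_klin_eqI[OF Y.V.vect_axioms klin_plus[OF P0.V.vect_axioms Y.V.vect_axioms klin_pair_der[OF dk] ext_lin(1)[OF hY]] K _ p])
    fix x b assume x: "x \<in> carrier X" and b: "b \<in> carrier B"
    let ?e = "gen B (carrier X) x \<one>"
    have e: "?e \<in> carrier P0" by (rule gen_in[OF x one_closed])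
    have "gen B (carrier X) x b = b \<odot>\<^bsub>P0\<^esub> ?e" using gen_mult[OF b, of "carrier X" x \<one>] b by simp
    then have "K (gen B (carrier X) x b) = b \<odot>\<^bsub>Y\<^esub> K ?e \<oplus>\<^bsub>UY\<^esub> K (b \<odot>\<^bsub>P0\<^esub> s x)"
      using Kact[OF b e] free_ev_gen[OF bX x one_closed] X.act_one[of x] x by simp
    also have "\<dots> = K (b \<odot>\<^bsub>P0\<^esub> s x) \<oplus>\<^bsub>UY\<^esub> b \<odot>\<^bsub>Y\<^esub> K ?e"
      by (rule Y.V.a_comm[OF Y.act_closed[OF b KY[OF e]] KY[OF bP[OF b sP[OF x]]]])
    moreover have eh: "ext_lin h (gen B (carrier X) x b) = b \<odot>\<^bsub>Y\<^esub> h x"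
      by (rule ext_lin(2)[OF _ x b]) (rule hY)
    ultimately show "pair_der d (gen B (carrier X) x b) \<oplus>\<^bsub>UY\<^esub> ext_lin h (gen B (carrier X) x b) = K (gen B (carrier X) x b)"
      unfolding pair_der_gen[OF dk x b] dv[OF b x] eh by (simp add: h_def)
  qed
  have "\<phi> = pull (pair_der d) \<oplus>\<^bsub>ZV\<^esub> pull g"
  proof (rule extensionalityI[of _ "carrier P1"])
    show "\<phi> \<in> extensional (carrier P1)" using assms(2) by (simp add: Z_def lin_maps_bmod_iff)
    show "pull (pair_der d) \<oplus>\<^bsub>ZV\<^esub> pull g \<in> extensional (carrier P1)" by (simp add: Hom_space_simps)
    fix p assume p: "p \<in> carrier P1"
    have e: "free_ev B S1 p \<in> carrier S1" by (rule ev1_in[OF p])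
    have "\<phi> p = K (free_ev B S1 p)" using \<phi>f[OF p] KS[OF e] by simp
    also have "\<dots> = pair_der d (free_ev B S1 p) \<oplus>\<^bsub>Y\<^esub> ext_lin h (free_ev B S1 p)" using sum[OF S1_sub[OF e]] by simp
    finally show "\<phi> p = (pull (pair_der d) \<oplus>\<^bsub>ZV\<^esub> pull g) p"
      using p S1_sub[OF e] by (simp add: Hom_space_simps g_def)
  qed
  with d g show ?thesis by (rule that)
qed

theorem chi_hom_k_eq_Ext1_Hom:
  assumes "kfin B" "kfin UX" "kfin UY"
  shows "chi B M lM rM = int (kdim (Ext1 B X Y)) - int (kdim (Hom_space B X Y))"
proof -
  let ?N = "pull ` lin_maps B P0 Y"
  note q = quot_proj[OF vect_ZV subsp_pull]
  let ?\<psi> = "\<lambda>d. ?N +>\<^bsub>ZV\<^esub> pull (pair_der d)"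
  have pZ: "pull (pair_der d) \<in> carrier ZV" if "d \<in> derivs B M lM rM" for d
    using klin_closed[OF klin_pull_pair_der, of d] that by (simp del: pull_def)
  have \<psi>: "klin (der_space B M lM rM) (quot_mod ZV ?N) ?\<psi>"
    by (rule klin_compose[OF klin_pull_pair_der q(1)])
  have surj: "?\<psi> ` derivs B M lM rM = carrier (quot_mod ZV ?N)"
  proof
    show "?\<psi> ` derivs B M lM rM \<subseteq> carrier (quot_mod ZV ?N)"
      using klin_closed[OF \<psi>] by (auto simp del: quot_mod_simps)
    show "carrier (quot_mod ZV ?N) \<subseteq> ?\<psi> ` derivs B M lM rM"
    proof
      fix E assume "E \<in> carrier (quot_mod ZV ?N)"
      then obtain \<phi> where \<phi>: "\<phi> \<in> Z" "E = ?N +>\<^bsub>ZV\<^esub> \<phi>" unfolding quot_mod_carrier by auto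
      obtain d g where dg: "d \<in> derivs B M lM rM" "g \<in> lin_maps B P0 Y" "\<phi> = pull (pair_der d) \<oplus>\<^bsub>ZV\<^esub> pull g"
        using cocycle_from_derivation[OF assms(2) \<phi>(1)] by blast
      have gN: "pull g \<in> ?N" using dg(2) by (rule imageI)
      have gZ: "pull g \<in> carrier ZV" using klin_closed[OF klin_pull, of g] dg(2) by (simp add: Hom_space_simps del: pull_def)
      interpret quo: vect "quot_mod ZV ?N" by (rule vect_quot_mod[OF vect_ZV subsp_pull])
      have "E = ?\<psi> d \<oplus>\<^bsub>quot_mod ZV ?N\<^esub> (?N +>\<^bsub>ZV\<^esub> pull g)"
        unfolding \<phi>(2) dg(3) by (rule klin_add[OF q(1) pZ[OF dg(1)] gZ])
      also have "?N +>\<^bsub>ZV\<^esub> pull g = \<zero>\<^bsub>quot_mod ZV ?N\<^esub>" using q(2)[OF gZ] gN by blast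
      also have "?\<psi> d \<oplus>\<^bsub>quot_mod ZV ?N\<^esub> \<zero>\<^bsub>quot_mod ZV ?N\<^esub> = ?\<psi> d"
        by (rule quo.r_zero[OF klin_closed[OF q(1) pZ[OF dg(1)]]])
      finally show "E \<in> ?\<psi> ` derivs B M lM rM" using dg(1) by blast
    qed
  qed
  have "chi B M lM rM = int (kdim (quot_mod ZV ?N)) - int (kdim (M\<lparr>carrier := invariants B M lM rM\<rparr>))"
  proof (rule M.chi_outer[OF assms(1) kfin_hom_k[OF X.V.vect_axioms Y.V.vect_axioms assms(2,3)]
      vect_quot_mod[OF vect_ZV subsp_pull] \<psi> surj])
    fix d assume d: "d \<in> derivs B M lM rM"
    show "?\<psi> d = \<zero>\<^bsub>quot_mod ZV ?N\<^esub> \<longleftrightarrow> d \<in> inner_der B M lM rM ` carrier M"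
      unfolding q(2)[OF pZ[OF d]] by (rule pull_pair_der_kernel[OF d])
  qed
  then show ?thesis by (simp only: Ext1_eq Hom_space_eq lin_maps_eq_invariants[OF bX bY])
qed

end

section \<open>Path algebras\<close>

lemma path_alg_simps [simp]:
  "carrier (path_alg G) = {f. finite {r. f r \<noteq> 0} \<and> {r. f r \<noteq> 0} \<subseteq> paths G}"
  "one (path_alg G) = (\<lambda>r. if r \<in> paths_of_length G 0 then 1 else 0)"
  "zero (path_alg G) = (\<lambda>r. 0)"
  "add (path_alg G) = (\<lambda>f g r. f r + g r)"
  "smult (path_alg G) = (\<lambda>c f r. c * f r)"
  by (simp_all add: path_alg_def)

lemma path_alg_mult: "(f \<otimes>\<^bsub>path_alg G\<^esub> g) (u, r, w) =
   (\<Sum>(v, p, q)\<in>{(v, p, q). (u, p, v) \<in> paths G \<and> (v, q, w) \<in> paths G \<and> p @ q = r}. f (v, q, w) * g (u, p, v))"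
  by (simp add: path_alg_def)

lemma paths_iff: "(u, p, v) \<in> paths G \<longleftrightarrow> pre_digraph.awalk G u p v"
  by (simp add: paths_def)

lemma paths_of_length_0: "(u, p, v) \<in> paths_of_length G 0 \<longleftrightarrow> p = [] \<and> u = v \<and> u \<in> verts G"
  by (auto simp: paths_of_length_def paths_def pre_digraph.awalk_def pre_digraph.cas.simps)

lemma path_elem_apply: "path_elem p r = (if r = p then 1 else 0)"
  by (simp add: path_elem_def)

context wf_digraph
begin

lemma path_Nil: "(u, [], v) \<in> paths G \<longleftrightarrow> u = v \<and> u \<in> verts G"
  by (simp add: paths_iff awalk_Nil_iff)

lemma path_Cons: "(u, a # p, v) \<in> paths G \<longleftrightarrow> a \<in> arcs G \<and> tail G a = u \<and> (head G a, p, v) \<in> paths G"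
  by (auto simp: paths_iff awalk_Cons_iff)

lemma path_append: "(u, p, v) \<in> paths G \<Longrightarrow> (v, q, w) \<in> paths G \<Longrightarrow> (u, p @ q, w) \<in> paths G"
  by (simp add: paths_iff)

lemma path_ends: "(u, p, v) \<in> paths G \<Longrightarrow> u \<in> verts G \<and> v \<in> verts G"
  by (auto simp: paths_iff)

lemma path_elem_in: "p \<in> paths G \<Longrightarrow> path_elem p \<in> carrier (path_alg G)"
  by (auto simp: path_elem_apply)

lemma vect_path_alg: "vect (path_alg G :: ('k::field, ('a, 'b) path \<Rightarrow> 'k) module)"
proof -
  let ?A = "path_alg G :: ('k, ('a, 'b) path \<Rightarrow> 'k) module"
  have add: "(\<lambda>r. f r + g r) \<in> carrier ?A" if f: "f \<in> carrier ?A" and g: "g \<in> carrier ?A" for f g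
  proof -
    have s: "{r. f r + g r \<noteq> 0} \<subseteq> {r. f r \<noteq> 0} \<union> {r. g r \<noteq> 0}" by auto
    have "finite {r. f r + g r \<noteq> 0}" by (rule finite_subset[OF s]) (use f g in auto)
    moreover have "{r. f r + g r \<noteq> 0} \<subseteq> paths G" using s f g unfolding path_alg_simps by blast
    ultimately show ?thesis by simp
  qed
  have scal: "(\<lambda>r. c * f r) \<in> carrier ?A" if f: "f \<in> carrier ?A" for c f
  proof -
    have s: "{r. c * f r \<noteq> 0} \<subseteq> {r. f r \<noteq> 0}" by auto
    have "finite {r. c * f r \<noteq> 0}" by (rule finite_subset[OF s]) (use f in auto)
    moreover have "{r. c * f r \<noteq> 0} \<subseteq> paths G" using s f unfolding path_alg_simps by blast
    ultimately show ?thesis by simp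
  qed
  have "abelian_group ?A"
  proof (rule abelian_groupI)
    fix f assume f: "f \<in> carrier ?A"
    show "\<exists>g\<in>carrier ?A. g \<oplus>\<^bsub>?A\<^esub> f = \<zero>\<^bsub>?A\<^esub>"
      using scal[OF f, of "-1"] by (intro bexI[of _ "\<lambda>r. (-1) * f r"]) auto
  qed (use add in \<open>auto simp: algebra_simps\<close>)
  then show ?thesis
    by (intro vect.intro vect_axioms.intro) (use scal in \<open>auto simp: algebra_simps\<close>)
qed

lemma path_alg_induct [consumes 1, case_names zero elem add]:
  assumes f: "f \<in> carrier (path_alg G)"
    and zero: "P (\<lambda>r. 0)"
    and elem: "\<And>p c. p \<in> paths G \<Longrightarrow> P (\<lambda>r. c * path_elem p r)"
    and add: "\<And>f g. f \<in> carrier (path_alg G) \<Longrightarrow> g \<in> carrier (path_alg G) \<Longrightarrow> P f \<Longrightarrow> P g \<Longrightarrow> P (\<lambda>r. f r + g r)"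
  shows "P (f :: _ \<Rightarrow> 'k::field)"
proof -
  have "\<forall>f. f \<in> carrier (path_alg G) \<longrightarrow> {r. f r \<noteq> 0} \<subseteq> T \<longrightarrow> P f" if "finite T" for T
    using that
  proof (induction T rule: finite_induct)
    case empty
    have "f = (\<lambda>r. 0)" if "{r. f r \<noteq> 0} \<subseteq> {}" for f :: "_ \<Rightarrow> 'k" using that by auto
    then show ?case using zero by (auto simp only:)
  next
    case (insert t T)
    show ?case
    proof (intro allI impI)
      fix f :: "_ \<Rightarrow> 'k" assume f: "f \<in> carrier (path_alg G)" "{r. f r \<noteq> 0} \<subseteq> insert t T"
      show "P f"
      proof (cases "f t = 0")
        case True
        then have "{r. f r \<noteq> 0} \<subseteq> T" using f(2) by auto
        then show ?thesis using insert.IH f(1) by blast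
      next
        case False
        then have t: "t \<in> paths G" using f(1) by auto
        define g where "g = (\<lambda>r. if r = t then 0 else f r)"
        have gT: "{r. g r \<noteq> 0} \<subseteq> T" using f(2) by (auto simp: g_def)
        then have "finite {r. g r \<noteq> 0}" using insert.hyps(1) by (rule finite_subset)
        then have g: "g \<in> carrier (path_alg G)" using f(1) by (auto simp: g_def)
        have t': "(\<lambda>r. f t * path_elem t r) \<in> carrier (path_alg G)" using t by (auto simp: path_elem_apply)
        have f_eq: "(\<lambda>r. g r + f t * path_elem t r) = f" by (auto simp: g_def path_elem_apply)
        have "P g" using insert.IH g gT by blast
        from add[OF g t' this elem[OF t]] show ?thesis unfolding f_eq .
      qed
    qed
  qed
  from this[of "{r. f r \<noteq> 0}"] show ?thesis using f by auto
qed

end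

lemma path_mult_add_left: "(\<lambda>r. f r + g r) \<otimes>\<^bsub>path_alg G\<^esub> h = (\<lambda>r. (f \<otimes>\<^bsub>path_alg G\<^esub> h) r + (g \<otimes>\<^bsub>path_alg G\<^esub> h) r)"
  by (intro ext) (clarify, simp add: path_alg_mult distrib_right sum.distrib case_prod_beta)

lemma path_mult_add_right: "h \<otimes>\<^bsub>path_alg G\<^esub> (\<lambda>r. f r + g r) = (\<lambda>r. (h \<otimes>\<^bsub>path_alg G\<^esub> f) r + (h \<otimes>\<^bsub>path_alg G\<^esub> g) r)"
  by (intro ext) (clarify, simp add: path_alg_mult distrib_left sum.distrib case_prod_beta)

lemma path_mult_scal_left: "(\<lambda>r. c * f r) \<otimes>\<^bsub>path_alg G\<^esub> h = (\<lambda>r. c * (f \<otimes>\<^bsub>path_alg G\<^esub> h) r)"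
  by (intro ext) (clarify, simp add: path_alg_mult sum_distrib_left mult.assoc case_prod_beta)

lemma path_mult_scal_right: "h \<otimes>\<^bsub>path_alg G\<^esub> (\<lambda>r. c * f r) = (\<lambda>r. c * (h \<otimes>\<^bsub>path_alg G\<^esub> f) r)"
  by (intro ext) (clarify, simp add: path_alg_mult sum_distrib_left mult.left_commute case_prod_beta)

lemma path_mult_zero: "(\<lambda>r. 0) \<otimes>\<^bsub>path_alg G\<^esub> h = (\<lambda>r. 0)" "h \<otimes>\<^bsub>path_alg G\<^esub> (\<lambda>r. 0) = (\<lambda>r. 0)"
  by (auto simp: path_alg_mult fun_eq_iff)

lemmas path_mult_linear = path_mult_add_left path_mult_add_right path_mult_scal_left path_mult_scal_right path_mult_zero

context fin_digraph
begin

lemma finite_splittings: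
  "finite {(v, p, q). (u, p, v) \<in> paths G \<and> (v, q, w) \<in> paths G \<and> p @ q = r}"
proof (rule finite_subset)
  show "{(v, p, q). (u, p, v) \<in> paths G \<and> (v, q, w) \<in> paths G \<and> p @ q = r}
     \<subseteq> (\<lambda>(v, i). (v, take i r, drop i r)) ` (verts G \<times> {..length r})"
  proof
    fix x assume "x \<in> {(v, p, q). (u, p, v) \<in> paths G \<and> (v, q, w) \<in> paths G \<and> p @ q = r}"
    then obtain v p q where x: "x = (v, p, q)" and p: "(u, p, v) \<in> paths G" "r = p @ q" by auto
    show "x \<in> (\<lambda>(v, i). (v, take i r, drop i r)) ` (verts G \<times> {..length r})"
      by (rule image_eqI[of _ _ "(v, length p)"]) (use x p path_ends[OF p(1)] in auto)
  qed
qed simp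

lemma path_elem_mult:
  assumes "(v, q, w) \<in> paths G" "(u, p, v') \<in> paths G"
  shows "path_elem (v, q, w) \<otimes>\<^bsub>path_alg G\<^esub> path_elem (u, p, v') =
    (if v = v' then path_elem (u, p @ q, w) else (\<lambda>r. 0 :: 'k::field))"
proof (rule ext)
  fix t :: "'a \<times> 'b list \<times> 'a"
  obtain u0 r0 w0 where t: "t = (u0, r0, w0)" by (cases t) auto
  let ?S = "{(v, p, q). (u0, p, v) \<in> paths G \<and> (v, q, w0) \<in> paths G \<and> p @ q = r0}"
  have "(path_elem (v, q, w) \<otimes>\<^bsub>path_alg G\<^esub> path_elem (u, p, v')) t =
     (\<Sum>x\<in>?S. if x = (v, p, q) then (if v = v' \<and> u0 = u \<and> w0 = w then 1 else 0) else (0 :: 'k))"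
    unfolding t path_alg_mult by (intro sum.cong refl) (auto simp: path_elem_apply split: if_splits)
  also have "\<dots> = (if (v, p, q) \<in> ?S then (if v = v' \<and> u0 = u \<and> w0 = w then 1 else 0) else 0)"
    using finite_splittings by (simp add: sum.delta')
  also have "\<dots> = (if v = v' then path_elem (u, p @ q, w) else (\<lambda>r. 0)) t"
    using assms by (auto simp: t path_elem_apply)
  finally show "(path_elem (v, q, w) \<otimes>\<^bsub>path_alg G\<^esub> path_elem (u, p, v')) t =
    (if v = v' then path_elem (u, p @ q, w) else (\<lambda>r. 0 :: 'k)) t" .
qed

lemma path_mult_closed:
  assumes "f \<in> carrier (path_alg G)" "g \<in> carrier (path_alg G)"
  shows "f \<otimes>\<^bsub>path_alg G\<^esub> g \<in> carrier (path_alg G :: ('k::field, ('a, 'b) path \<Rightarrow> 'k) module)"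
proof -
  interpret vect "path_alg G :: ('k, ('a, 'b) path \<Rightarrow> 'k) module" by (rule vect_path_alg)
  note ac = a_closed[unfolded path_alg_simps(4)] and sc = scal_closed[unfolded path_alg_simps(5)]
    and zc = zero_closed[unfolded path_alg_simps(3)]
  show ?thesis using assms(1)
  proof (induction f rule: path_alg_induct)
    case zero
    show ?case unfolding path_mult_linear by (rule zc)
  next
    case (elem p c)
    obtain v q w where p: "p = (v, q, w)" by (cases p) auto
    show ?case using assms(2)
    proof (induction g rule: path_alg_induct)
      case zero
      show ?case unfolding path_mult_zero by (rule zc)
    next
      case (elem p' d)
      obtain u q' v' where p': "p' = (u, q', v')" by (cases p') auto
      have "path_elem p \<otimes>\<^bsub>path_alg G\<^esub> path_elem p' \<in> carrier (path_alg G :: ('k, ('a, 'b) path \<Rightarrow> 'k) module)"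
      proof (cases "v = v'")
        case True
        then have "(u, q' @ q, w) \<in> paths G" using elem \<open>p \<in> paths G\<close> path_append[of u q' v' q w] by (simp add: p p')
        from path_elem_in[OF this] show ?thesis
          unfolding p p' path_elem_mult[OF \<open>p \<in> paths G\<close>[unfolded p] elem[unfolded p']] using True by (simp only: simp_thms if_True)
      next
        case False
        then show ?thesis
          unfolding p p' path_elem_mult[OF \<open>p \<in> paths G\<close>[unfolded p] elem[unfolded p']] using zc by (simp only: if_False)
      qed
      then show ?case unfolding path_mult_linear by (intro sc)
    next
      case (add f g)
      then show ?case unfolding path_mult_add_right by (intro ac)
    qed
  next
    case (add f g)
    then show ?case unfolding path_mult_linear by (intro ac)
  qed
qed

lemma path_elem_mult_assoc:
  assumes "a \<in> paths G" "b \<in> paths G" "c \<in> paths G"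
  shows "path_elem a \<otimes>\<^bsub>path_alg G\<^esub> path_elem b \<otimes>\<^bsub>path_alg G\<^esub> path_elem c =
     (path_elem a \<otimes>\<^bsub>path_alg G\<^esub> (path_elem b \<otimes>\<^bsub>path_alg G\<^esub> path_elem c) :: _ \<Rightarrow> 'k::field)"
proof -
  obtain v q w where a: "a = (v, q, w)" by (cases a) auto
  obtain v' q' w' where b: "b = (v', q', w')" by (cases b) auto
  obtain v'' q'' w'' where c: "c = (v'', q'', w'')" by (cases c) auto
  show ?thesis
    using assms path_append[of v' q' w' q w] path_append[of v'' q'' w'' q' w']
    unfolding a b c by (cases "v = w'"; cases "v' = w''") (simp_all add: path_elem_mult path_mult_zero)
qed

lemma path_mult_assoc:
  assumes "f \<in> carrier (path_alg G)" "g \<in> carrier (path_alg G)" "h \<in> carrier (path_alg G)"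
  shows "f \<otimes>\<^bsub>path_alg G\<^esub> g \<otimes>\<^bsub>path_alg G\<^esub> h = (f \<otimes>\<^bsub>path_alg G\<^esub> (g \<otimes>\<^bsub>path_alg G\<^esub> h) :: _ \<Rightarrow> 'k::field)"
  using assms(1)
proof (induction f rule: path_alg_induct)
  case (elem a c)
  show ?case using assms(2)
  proof (induction g rule: path_alg_induct)
    case (elem b d)
    show ?case using assms(3)
    proof (induction h rule: path_alg_induct)
      case (elem c e)
      show ?case
        unfolding path_mult_scal_left path_mult_scal_right
          path_elem_mult_assoc[OF \<open>a \<in> paths G\<close> \<open>b \<in> paths G\<close> \<open>c \<in> paths G\<close>] ..
    qed (simp_all only: path_mult_linear)
  qed (simp_all only: path_mult_linear)
qed (simp_all only: path_mult_linear)

lemma path_mult_one_left: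
  assumes "f \<in> carrier (path_alg G)"
  shows "\<one>\<^bsub>path_alg G\<^esub> \<otimes>\<^bsub>path_alg G\<^esub> f = (f :: _ \<Rightarrow> 'k::field)"
proof (rule ext)
  fix t :: "'a \<times> 'b list \<times> 'a"
  obtain u r w where t: "t = (u, r, w)" by (cases t) auto
  let ?S = "{(v, p, q). (u, p, v) \<in> paths G \<and> (v, q, w) \<in> paths G \<and> p @ q = r}"
  have "(\<one>\<^bsub>path_alg G\<^esub> \<otimes>\<^bsub>path_alg G\<^esub> f) t = (\<Sum>x\<in>?S. if x = (w, r, []) then f (u, r, w) else 0)"
    unfolding t path_alg_mult by (intro sum.cong refl) (auto simp: paths_of_length_0 path_ends split: if_splits)
  also have "\<dots> = (if (w, r, []) \<in> ?S then f (u, r, w) else 0)"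
    using finite_splittings by (simp add: sum.delta')
  also have "\<dots> = f t" using assms path_ends[of u r w] by (auto simp: t path_Nil)
  finally show "(\<one>\<^bsub>path_alg G\<^esub> \<otimes>\<^bsub>path_alg G\<^esub> f) t = f t" .
qed

lemma path_mult_one_right:
  assumes "f \<in> carrier (path_alg G)"
  shows "f \<otimes>\<^bsub>path_alg G\<^esub> \<one>\<^bsub>path_alg G\<^esub> = (f :: _ \<Rightarrow> 'k::field)"
proof (rule ext)
  fix t :: "'a \<times> 'b list \<times> 'a"
  obtain u r w where t: "t = (u, r, w)" by (cases t) auto
  let ?S = "{(v, p, q). (u, p, v) \<in> paths G \<and> (v, q, w) \<in> paths G \<and> p @ q = r}"
  have "(f \<otimes>\<^bsub>path_alg G\<^esub> \<one>\<^bsub>path_alg G\<^esub>) t = (\<Sum>x\<in>?S. if x = (u, [], r) then f (u, r, w) else 0)"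
    unfolding t path_alg_mult by (intro sum.cong refl) (auto simp: paths_of_length_0 path_ends split: if_splits)
  also have "\<dots> = (if (u, [], r) \<in> ?S then f (u, r, w) else 0)"
    using finite_splittings by (simp add: sum.delta')
  also have "\<dots> = f t" using assms path_ends[of u r w] by (auto simp: t path_Nil)
  finally show "(f \<otimes>\<^bsub>path_alg G\<^esub> \<one>\<^bsub>path_alg G\<^esub>) t = f t" .
qed

lemma path_one_closed: "\<one>\<^bsub>path_alg G\<^esub> \<in> carrier (path_alg G :: ('k::field, ('a, 'b) path \<Rightarrow> 'k) module)"
proof -
  have "{r :: ('a, 'b) path. (if r \<in> paths_of_length G 0 then 1 else 0 :: 'k) \<noteq> 0} = (\<lambda>x. (x, [], x)) ` verts G"
    by (auto simp: paths_of_length_0 split: if_splits)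
  then show ?thesis by (auto simp: path_Nil)
qed

lemma kalg_path_alg: "kalg (path_alg G :: ('k::field, ('a, 'b) path \<Rightarrow> 'k) module)"
proof -
  let ?A = "path_alg G :: ('k, ('a, 'b) path \<Rightarrow> 'k) module"
  interpret vect ?A by (rule vect_path_alg)
  have m: "monoid ?A"
    by (rule monoidI) (rule path_mult_closed path_one_closed path_mult_assoc path_mult_one_left path_mult_one_right; assumption?)+
  have "ring ?A"
    by (rule ringI[OF abelian_group_axioms m]) (simp_all only: path_alg_simps(4) path_mult_linear)
  then show ?thesis
    by (intro kalg.intro vect_axioms kalg_axioms.intro) (simp_all only: path_alg_simps(5) path_mult_linear)
qed

text \<open>
  A path is the product of its arrows, and every element is a combination of paths.
\<close>

lemma path_alg_generated [consumes 1, case_names vertex arrow add scal zero mult]: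
  assumes f: "f \<in> carrier (path_alg G)"
    and vertex: "\<And>x. x \<in> verts G \<Longrightarrow> P (path_elem (x, [], x))"
    and arrow: "\<And>a. a \<in> arcs G \<Longrightarrow> P (path_elem (tail G a, [a], head G a))"
    and add: "\<And>f g. f \<in> carrier (path_alg G) \<Longrightarrow> g \<in> carrier (path_alg G) \<Longrightarrow> P f \<Longrightarrow> P g \<Longrightarrow> P (f \<oplus>\<^bsub>path_alg G\<^esub> g)"
    and scal: "\<And>c f. f \<in> carrier (path_alg G) \<Longrightarrow> P f \<Longrightarrow> P (c \<odot>\<^bsub>path_alg G\<^esub> f)"
    and zero: "P \<zero>\<^bsub>path_alg G\<^esub>"
    and mult: "\<And>f g. f \<in> carrier (path_alg G) \<Longrightarrow> g \<in> carrier (path_alg G) \<Longrightarrow> P f \<Longrightarrow> P g \<Longrightarrow> P (f \<otimes>\<^bsub>path_alg G\<^esub> g)"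
  shows "P (f :: _ \<Rightarrow> 'k::field)"
proof -
  have path: "(u, p, v) \<in> paths G \<Longrightarrow> P (path_elem (u, p, v))" for u p v
  proof (induction p arbitrary: u)
    case Nil
    then have "u = v" "v \<in> verts G" by (auto simp: path_Nil)
    then show ?case using vertex by (simp only:)
  next
    case (Cons a p)
    then have a: "a \<in> arcs G" "u = tail G a" and p: "(head G a, p, v) \<in> paths G" by (auto simp: path_Cons)
    have a': "(tail G a, [a], head G a) \<in> paths G" using a path_ends[OF p] by (simp add: path_Cons path_Nil)
    have "path_elem (u, a # p, v) = path_elem (head G a, p, v) \<otimes>\<^bsub>path_alg G\<^esub> (path_elem (tail G a, [a], head G a) :: _ \<Rightarrow> 'k)"
      by (simp add: path_elem_mult[OF p a'] a)
    then show ?case using mult[OF path_elem_in[OF p] path_elem_in[OF a'] Cons.IH[OF p] arrow[OF a(1)]] by simp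
  qed
  have elem: "P (\<lambda>r. c * path_elem p r)" if "p \<in> paths G" for c p
    using scal[OF path_elem_in[OF that], of c] path that by (cases p) auto
  show ?thesis using f
  proof (induction f rule: path_alg_induct)
    case zero
    show ?case using assms(6) by simp
  next
    case (elem p c)
    then show ?case by (rule \<open>\<And>p c. p \<in> paths G \<Longrightarrow> P (\<lambda>r. c * path_elem p r)\<close>)
  next
    case (add f g)
    then show ?case using assms(4)[of f g] by simp
  qed
qed

end

text \<open>
  Data for an algebra map out of the path algebra: images of the vertices, which are orthogonal idempotents
  with sum \<open>1\<close>, and images of the arrows, which lie between the idempotents of their ends.
\<close>

locale path_images = fin_digraph G + R: kalg R
  for G :: "('v, 'a) pre_digraph" and R :: "('k::field, 'r) module" +
  fixes e :: "'v \<Rightarrow> 'r" and \<rho> :: "'a \<Rightarrow> 'r"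
  assumes e_in: "x \<in> verts G \<Longrightarrow> e x \<in> carrier R"
    and e_idem: "x \<in> verts G \<Longrightarrow> e x \<otimes>\<^bsub>R\<^esub> e x = e x"
    and e_orth: "x \<in> verts G \<Longrightarrow> y \<in> verts G \<Longrightarrow> x \<noteq> y \<Longrightarrow> e x \<otimes>\<^bsub>R\<^esub> e y = \<zero>\<^bsub>R\<^esub>"
    and e_sum: "(\<Oplus>\<^bsub>R\<^esub>x\<in>verts G. e x) = \<one>\<^bsub>R\<^esub>"
    and \<rho>_in: "a \<in> arcs G \<Longrightarrow> \<rho> a \<in> carrier R"
    and \<rho>_ends: "a \<in> arcs G \<Longrightarrow> e (head G a) \<otimes>\<^bsub>R\<^esub> \<rho> a \<otimes>\<^bsub>R\<^esub> e (tail G a) = \<rho> a"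
begin

abbreviation "kG \<equiv> path_alg G :: ('k, ('v, 'a) path \<Rightarrow> 'k) module"

sublocale kG: kalg kG by (rule kalg_path_alg)

primrec image :: "'v \<Rightarrow> 'a list \<Rightarrow> 'r" where
  "image u [] = e u"
| "image u (a # p) = image (head G a) p \<otimes>\<^bsub>R\<^esub> \<rho> a"

lemma \<rho>_left: "a \<in> arcs G \<Longrightarrow> e (head G a) \<otimes>\<^bsub>R\<^esub> \<rho> a = \<rho> a"
proof -
  assume a: "a \<in> arcs G"
  note m = \<rho>_in[OF a] e_in[OF head_in_verts[OF a]] e_in[OF tail_in_verts[OF a]]
  have "e (head G a) \<otimes>\<^bsub>R\<^esub> (e (head G a) \<otimes>\<^bsub>R\<^esub> \<rho> a \<otimes>\<^bsub>R\<^esub> e (tail G a)) = e (head G a) \<otimes>\<^bsub>R\<^esub> \<rho> a \<otimes>\<^bsub>R\<^esub> e (tail G a)"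
    using m e_idem[OF head_in_verts[OF a]] by (simp flip: R.m_assoc)
  then show ?thesis using \<rho>_ends[OF a] by simp
qed

lemma \<rho>_right: "a \<in> arcs G \<Longrightarrow> \<rho> a \<otimes>\<^bsub>R\<^esub> e (tail G a) = \<rho> a"
proof -
  assume a: "a \<in> arcs G"
  note m = \<rho>_in[OF a] e_in[OF head_in_verts[OF a]] e_in[OF tail_in_verts[OF a]]
  have "e (head G a) \<otimes>\<^bsub>R\<^esub> \<rho> a \<otimes>\<^bsub>R\<^esub> e (tail G a) \<otimes>\<^bsub>R\<^esub> e (tail G a) = e (head G a) \<otimes>\<^bsub>R\<^esub> \<rho> a \<otimes>\<^bsub>R\<^esub> e (tail G a)"
    using m e_idem[OF tail_in_verts[OF a]] by (simp add: R.m_assoc)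
  then show ?thesis using \<rho>_ends[OF a] by simp
qed

lemma image_in: "(u, p, v) \<in> paths G \<Longrightarrow> image u p \<in> carrier R"
  by (induction p arbitrary: u) (auto simp: path_Nil path_Cons e_in \<rho>_in)

lemma image_right: "(u, p, v) \<in> paths G \<Longrightarrow> image u p \<otimes>\<^bsub>R\<^esub> e u = image u p"
proof (cases p)
  case Nil
  then show "(u, p, v) \<in> paths G \<Longrightarrow> ?thesis" by (auto simp: path_Nil e_idem)
next
  case (Cons a q)
  assume "(u, p, v) \<in> paths G"
  then have a: "a \<in> arcs G" "tail G a = u" "(head G a, q, v) \<in> paths G" by (simp_all add: path_Cons Cons)
  then show ?thesis
    using \<rho>_right[OF a(1)] image_in[OF a(3)] \<rho>_in[OF a(1)] e_in[OF tail_in_verts[OF a(1)]] by (simp add: Cons R.m_assoc)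
qed

lemma image_left: "(u, p, v) \<in> paths G \<Longrightarrow> e v \<otimes>\<^bsub>R\<^esub> image u p = image u p"
proof (induction p arbitrary: u)
  case Nil
  then have "u = v" "v \<in> verts G" by (auto simp: path_Nil)
  then show ?case by (simp add: e_idem)
next
  case (Cons a p)
  then have a: "a \<in> arcs G" "(head G a, p, v) \<in> paths G" by (simp_all add: path_Cons)
  have v: "v \<in> verts G" using path_ends[OF a(2)] by simp
  have "e v \<otimes>\<^bsub>R\<^esub> (image (head G a) p \<otimes>\<^bsub>R\<^esub> \<rho> a) = (e v \<otimes>\<^bsub>R\<^esub> image (head G a) p) \<otimes>\<^bsub>R\<^esub> \<rho> a"
    by (rule R.m_assoc[symmetric, OF e_in[OF v] image_in[OF a(2)] \<rho>_in[OF a(1)]])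
  then show ?case using Cons.IH[OF a(2)] by simp
qed

lemma image_append:
  "(u, p, v) \<in> paths G \<Longrightarrow> (v, q, w) \<in> paths G \<Longrightarrow> image u (p @ q) = image v q \<otimes>\<^bsub>R\<^esub> image u p"
proof (induction p arbitrary: u)
  case Nil
  then have "u = v" by (simp add: path_Nil)
  then show ?case using image_right[OF Nil(2)] by simp
next
  case (Cons a p)
  then have a: "a \<in> arcs G" "(head G a, p, v) \<in> paths G" by (simp_all add: path_Cons)
  show ?case
    using Cons.IH[OF a(2) Cons.prems(2)] image_in[OF a(2)] image_in[OF Cons.prems(2)] \<rho>_in[OF a(1)]
    by (simp add: R.m_assoc)
qed

lemma image_orth:
  assumes "(u, p, v') \<in> paths G" "(v, q, w) \<in> paths G" "v \<noteq> v'"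
  shows "image v q \<otimes>\<^bsub>R\<^esub> image u p = \<zero>\<^bsub>R\<^esub>"
proof -
  have v: "v \<in> verts G" "v' \<in> verts G" using path_ends assms(1,2) by blast+
  note m = image_in[OF assms(1)] image_in[OF assms(2)] e_in[OF v(1)] e_in[OF v(2)]
  have "image v q \<otimes>\<^bsub>R\<^esub> image u p = (image v q \<otimes>\<^bsub>R\<^esub> e v) \<otimes>\<^bsub>R\<^esub> (e v' \<otimes>\<^bsub>R\<^esub> image u p)"
    using image_left[OF assms(1)] image_right[OF assms(2)] by simp
  also have "\<dots> = image v q \<otimes>\<^bsub>R\<^esub> (e v \<otimes>\<^bsub>R\<^esub> e v') \<otimes>\<^bsub>R\<^esub> image u p" using m by (simp add: R.m_assoc)
  finally show ?thesis using e_orth[OF v assms(3)] m by simp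
qed

definition extend :: "(('v, 'a) path \<Rightarrow> 'k) \<Rightarrow> 'r" where
  "extend f = (\<Oplus>\<^bsub>R\<^esub>r\<in>{r. f r \<noteq> 0}. f r \<odot>\<^bsub>R\<^esub> image (fst r) (fst (snd r)))"

lemma image_in': "r \<in> paths G \<Longrightarrow> image (fst r) (fst (snd r)) \<in> carrier R"
  by (cases r) (simp add: image_in)

lemma extend_superset:
  assumes "finite T" "{r. f r \<noteq> 0} \<subseteq> T" "T \<subseteq> paths G"
  shows "extend f = (\<Oplus>\<^bsub>R\<^esub>r\<in>T. f r \<odot>\<^bsub>R\<^esub> image (fst r) (fst (snd r)))"
  unfolding extend_def
proof (rule R.add.finprod_mono_neutral_cong_left[OF assms(1,2)])
  show "f r \<odot>\<^bsub>R\<^esub> image (fst r) (fst (snd r)) = \<zero>\<^bsub>R\<^esub>" if "r \<in> T - {r. f r \<noteq> 0}" for r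
    using that image_in'[of r] assms(3) by auto
  show "(\<lambda>r. f r \<odot>\<^bsub>R\<^esub> image (fst r) (fst (snd r))) \<in> T \<rightarrow> carrier R"
    using assms(3) image_in' by blast
qed simp

lemma klin_extend: "klin kG R extend"
proof (rule klinI)
  have pm: "(\<lambda>r. f r \<odot>\<^bsub>R\<^esub> image (fst r) (fst (snd r))) \<in> T \<rightarrow> carrier R" if "T \<subseteq> paths G" for f T
    using that image_in' by blast
  fix f assume f: "f \<in> carrier kG"
  let ?S = "{r. f r \<noteq> 0}"
  have S: "finite ?S" "?S \<subseteq> paths G" using f by auto
  show "extend f \<in> carrier R" unfolding extend_def by (rule R.finsum_closed[OF pm[OF S(2)]])
  show "extend (c \<odot>\<^bsub>kG\<^esub> f) = c \<odot>\<^bsub>R\<^esub> extend f" for c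
  proof -
    have "extend (c \<odot>\<^bsub>kG\<^esub> f) = (\<Oplus>\<^bsub>R\<^esub>r\<in>?S. (c * f r) \<odot>\<^bsub>R\<^esub> image (fst r) (fst (snd r)))"
      by (subst extend_superset[OF S(1) _ S(2)]) auto
    also have "\<dots> = (\<Oplus>\<^bsub>R\<^esub>r\<in>?S. c \<odot>\<^bsub>R\<^esub> (f r \<odot>\<^bsub>R\<^esub> image (fst r) (fst (snd r))))"
    proof (rule R.finsum_cong')
      show "(c * f r) \<odot>\<^bsub>R\<^esub> image (fst r) (fst (snd r)) = c \<odot>\<^bsub>R\<^esub> (f r \<odot>\<^bsub>R\<^esub> image (fst r) (fst (snd r)))" if "r \<in> ?S" for r
        using image_in'[of r] that S(2) by (intro R.scal_mult) blast
    qed (use pm[OF S(2)] in auto)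
    also have "\<dots> = c \<odot>\<^bsub>R\<^esub> extend f" unfolding extend_def by (rule R.scal_finsum[OF S(1) pm[OF S(2)], symmetric])
    finally show ?thesis .
  qed
  fix g assume g: "g \<in> carrier kG"
  let ?T = "?S \<union> {r. g r \<noteq> 0}"
  have T: "finite ?T" "?T \<subseteq> paths G" using f g by auto
  have "extend (f \<oplus>\<^bsub>kG\<^esub> g) = (\<Oplus>\<^bsub>R\<^esub>r\<in>?T. (f r + g r) \<odot>\<^bsub>R\<^esub> image (fst r) (fst (snd r)))"
    by (subst extend_superset[OF T(1) _ T(2)]) auto
  also have "\<dots> = (\<Oplus>\<^bsub>R\<^esub>r\<in>?T. f r \<odot>\<^bsub>R\<^esub> image (fst r) (fst (snd r)) \<oplus>\<^bsub>R\<^esub> g r \<odot>\<^bsub>R\<^esub> image (fst r) (fst (snd r)))"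
  proof (rule R.finsum_cong')
    show "(f r + g r) \<odot>\<^bsub>R\<^esub> image (fst r) (fst (snd r)) = f r \<odot>\<^bsub>R\<^esub> image (fst r) (fst (snd r)) \<oplus>\<^bsub>R\<^esub> g r \<odot>\<^bsub>R\<^esub> image (fst r) (fst (snd r))" if "r \<in> ?T" for r
      using image_in'[of r] that T(2) by (intro R.scal_add_left) blast
  qed (use pm[OF T(2), of f] pm[OF T(2), of g] in auto)
  also have "\<dots> = (\<Oplus>\<^bsub>R\<^esub>r\<in>?T. f r \<odot>\<^bsub>R\<^esub> image (fst r) (fst (snd r))) \<oplus>\<^bsub>R\<^esub> (\<Oplus>\<^bsub>R\<^esub>r\<in>?T. g r \<odot>\<^bsub>R\<^esub> image (fst r) (fst (snd r)))"
    by (rule R.finsum_addf[OF pm[OF T(2)] pm[OF T(2)]])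
  also have "\<dots> = extend f \<oplus>\<^bsub>R\<^esub> extend g"
    using extend_superset[OF T(1) _ T(2), of f] extend_superset[OF T(1) _ T(2), of g] by auto
  finally show "extend (f \<oplus>\<^bsub>kG\<^esub> g) = extend f \<oplus>\<^bsub>R\<^esub> extend g" .
qed

lemma extend_elem: "(u, p, v) \<in> paths G \<Longrightarrow> extend (path_elem (u, p, v)) = image u p"
  by (subst extend_superset[of "{(u, p, v)}"]) (auto simp: image_in path_elem_apply)

lemma extend_mult:
  assumes "f \<in> carrier kG" "g \<in> carrier kG"
  shows "extend (f \<otimes>\<^bsub>kG\<^esub> g) = extend f \<otimes>\<^bsub>R\<^esub> extend g"
proof -
  note ext_add = klin_add[OF klin_extend, unfolded path_alg_simps(4)] and scal = klin_scal[OF klin_extend, unfolded path_alg_simps(5)]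
    and closed = klin_closed[OF klin_extend]
  have ext0: "extend (\<lambda>r. 0) = \<zero>\<^bsub>R\<^esub>" using klin_zero[OF kG.vect_axioms R.vect_axioms klin_extend] by simp
  show ?thesis using assms(1)
  proof (induction f rule: path_alg_induct)
    case zero
    then show ?case using closed[OF assms(2)] by (simp add: path_mult_zero ext0)
  next
    case (elem a c)
    obtain v q w where a: "a = (v, q, w)" by (cases a) auto
    have aG: "path_elem a \<in> carrier kG" using elem by (rule path_elem_in)
    note paths = elem[unfolded a]
    show ?case using assms(2)
    proof (induction g rule: path_alg_induct)
      case zero
      have "(\<lambda>r. c * path_elem a r) \<in> carrier kG" using kG.scal_closed[OF aG, of c] by simp
      then show ?case using closed[of "\<lambda>r. c * path_elem a r"] by (simp add: path_mult_zero ext0 del: path_alg_simps)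
    next
      case (elem b d)
      obtain u p v' where b: "b = (u, p, v')" by (cases b) auto
      have bG: "path_elem b \<in> carrier kG" using elem by (rule path_elem_in)
      note pathb = elem[unfolded b]
      have "extend (path_elem a \<otimes>\<^bsub>kG\<^esub> path_elem b) = extend (path_elem a) \<otimes>\<^bsub>R\<^esub> extend (path_elem b)"
      proof (cases "v = v'")
        case True
        have "(u, p @ q, w) \<in> paths G" using path_append pathb paths True by blast
        then show ?thesis using pathb paths True image_append[of u p v q w] by (simp add: a b path_elem_mult extend_elem)
      next
        case False
        then show ?thesis using pathb paths image_orth by (simp add: a b path_elem_mult extend_elem ext0)
      qed
      then show ?case
        using closed[OF aG] closed[OF bG] path_mult_closed[OF aG bG] scal[OF aG] scal[OF bG] scal[OF path_mult_closed[OF aG bG]]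
          scal[OF kG.scal_closed[OF path_mult_closed[OF aG bG]]]
        unfolding path_mult_scal_left path_mult_scal_right
        by (simp add: R.scal_mult_left R.scal_mult_right del: path_alg_simps(1))
           (simp add: mult.commute R.scal_mult[symmetric] del: path_alg_simps(1))
    next
      case (add g h)
      have c: "(\<lambda>r. c * path_elem a r) \<in> carrier kG" using kG.scal_closed[OF aG, of c] by simp
      show ?case unfolding path_mult_add_right add.IH
        ext_add[OF add.hyps(1,2)] ext_add[OF path_mult_closed[OF c add.hyps(1)] path_mult_closed[OF c add.hyps(2)]]
        using closed[OF c] closed[OF add.hyps(1)] closed[OF add.hyps(2)] by (simp add: R.r_distr)
    qed
  next
    case (add f h)
    show ?case unfolding path_mult_add_left add.IH
      ext_add[OF add.hyps(1,2)] ext_add[OF path_mult_closed[OF add.hyps(1) assms(2)] path_mult_closed[OF add.hyps(2) assms(2)]]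
      using closed[OF assms(2)] closed[OF add.hyps(1)] closed[OF add.hyps(2)] by (simp add: R.l_distr)
  qed
qed

lemma extend_one: "extend \<one>\<^bsub>kG\<^esub> = \<one>\<^bsub>R\<^esub>"
proof -
  have s: "{r. \<one>\<^bsub>kG\<^esub> r \<noteq> 0} = (\<lambda>x. (x, [], x)) ` verts G"
    by (auto simp: paths_of_length_0 split: if_splits)
  have "extend \<one>\<^bsub>kG\<^esub> = (\<Oplus>\<^bsub>R\<^esub>r\<in>(\<lambda>x. (x, [], x)) ` verts G. \<one>\<^bsub>kG\<^esub> r \<odot>\<^bsub>R\<^esub> image (fst r) (fst (snd r)))"
    unfolding extend_def s ..
  also have "\<dots> = (\<Oplus>\<^bsub>R\<^esub>x\<in>verts G. \<one>\<^bsub>kG\<^esub> (x, [], x) \<odot>\<^bsub>R\<^esub> image x [])"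
    by (subst R.finsum_reindex) (auto simp: inj_on_def e_in)
  also have "\<dots> = (\<Oplus>\<^bsub>R\<^esub>x\<in>verts G. e x)"
    by (rule R.finsum_cong') (auto simp: e_in paths_of_length_0)
  finally show ?thesis using e_sum by simp
qed

lemma alg_hom_extend: "alg_hom kG R extend"
  unfolding alg_hom_def using klin_extend extend_one extend_mult by blast

end

section \<open>Quotients of algebras\<close>

context kalg
begin

lemma ideal_subsp: "ideal I A \<Longrightarrow> subsp A I"
proof -
  assume "ideal I A"
  then interpret ideal I A .
  show ?thesis
  proof (rule subspI)
    show "c \<odot> x \<in> I" if "x \<in> I" for c x
      using I_l_closed[OF that, of "c \<odot> \<one>"] a_Hcarr[OF that] by (simp add: scal_one_mult)
  qed (use a_subset in auto)
qed

lemma kalg_quot_mod: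
  assumes "ideal I A"
  shows "kalg (quot_mod A I)" "alg_hom A (quot_mod A I) (\<lambda>x. I +> x)"
proof -
  interpret I: ideal I A by fact
  note sub = ideal_subsp[OF assms]
  note proj = quot_proj[OF vect_axioms sub]
  have mult: "mult (quot_mod A I) (I +> x) (I +> y) = I +> (x \<otimes> y)" if "x \<in> carrier A" "y \<in> carrier A" for x y
    using that I.rcoset_mult_add by (simp add: quot_mod_mult)
  have one: "\<one>\<^bsub>quot_mod A I\<^esub> = I +> \<one>" by (rule quot_mod_one)
  interpret V: vect "quot_mod A I" by (rule vect_quot_mod[OF vect_axioms sub])
  have rep: "\<exists>x\<in>carrier A. X = I +> x" if "X \<in> carrier (quot_mod A I)" for X
    using that unfolding quot_mod_carrier by blast
  have in_quot: "I +> x \<in> carrier (quot_mod A I)" if "x \<in> carrier A" for x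
    by (rule klin_closed[OF proj(1) that])
  note add = klin_add[OF proj(1), symmetric]
  have "ring (quot_mod A I)"
  proof (rule ringI[OF V.abelian_group_axioms monoidI])
    show "\<one>\<^bsub>quot_mod A I\<^esub> \<in> carrier (quot_mod A I)" unfolding one by (rule in_quot) simp
    fix X assume "X \<in> carrier (quot_mod A I)"
    then obtain x where x: "x \<in> carrier A" "X = I +> x" using rep by blast
    show "\<one>\<^bsub>quot_mod A I\<^esub> \<otimes>\<^bsub>quot_mod A I\<^esub> X = X" "X \<otimes>\<^bsub>quot_mod A I\<^esub> \<one>\<^bsub>quot_mod A I\<^esub> = X"
      unfolding one x(2) mult[OF one_closed x(1)] mult[OF x(1) one_closed] using x(1) by simp_all
    fix Y assume "Y \<in> carrier (quot_mod A I)"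
    then obtain y where y: "y \<in> carrier A" "Y = I +> y" using rep by blast
    show "X \<otimes>\<^bsub>quot_mod A I\<^esub> Y \<in> carrier (quot_mod A I)"
      unfolding x(2) y(2) mult[OF x(1) y(1)] by (rule in_quot[OF m_closed[OF x(1) y(1)]])
    fix Z assume "Z \<in> carrier (quot_mod A I)"
    then obtain z where z: "z \<in> carrier A" "Z = I +> z" using rep by blast
    show "X \<otimes>\<^bsub>quot_mod A I\<^esub> Y \<otimes>\<^bsub>quot_mod A I\<^esub> Z = X \<otimes>\<^bsub>quot_mod A I\<^esub> (Y \<otimes>\<^bsub>quot_mod A I\<^esub> Z)"
      unfolding x(2) y(2) z(2) mult[OF x(1) y(1)] mult[OF y(1) z(1)] mult[OF m_closed[OF x(1) y(1)] z(1)]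
        mult[OF x(1) m_closed[OF y(1) z(1)]] m_assoc[OF x(1) y(1) z(1)] ..
    show "(X \<oplus>\<^bsub>quot_mod A I\<^esub> Y) \<otimes>\<^bsub>quot_mod A I\<^esub> Z = X \<otimes>\<^bsub>quot_mod A I\<^esub> Z \<oplus>\<^bsub>quot_mod A I\<^esub> Y \<otimes>\<^bsub>quot_mod A I\<^esub> Z"
      unfolding x(2) y(2) z(2) add[OF x(1) y(1)] mult[OF x(1) z(1)] mult[OF y(1) z(1)] mult[OF a_closed[OF x(1) y(1)] z(1)]
        add[OF m_closed[OF x(1) z(1)] m_closed[OF y(1) z(1)]] l_distr[OF x(1) y(1) z(1)] ..
    show "Z \<otimes>\<^bsub>quot_mod A I\<^esub> (X \<oplus>\<^bsub>quot_mod A I\<^esub> Y) = Z \<otimes>\<^bsub>quot_mod A I\<^esub> X \<oplus>\<^bsub>quot_mod A I\<^esub> Z \<otimes>\<^bsub>quot_mod A I\<^esub> Y"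
      unfolding x(2) y(2) z(2) add[OF x(1) y(1)] mult[OF z(1) x(1)] mult[OF z(1) y(1)] mult[OF z(1) a_closed[OF x(1) y(1)]]
        add[OF m_closed[OF z(1) x(1)] m_closed[OF z(1) y(1)]] r_distr[OF x(1) y(1) z(1)] ..
  qed
  moreover have "kalg_axioms (quot_mod A I)"
  proof
    fix X Y c assume "X \<in> carrier (quot_mod A I)" "Y \<in> carrier (quot_mod A I)"
    then obtain x y where x: "x \<in> carrier A" "X = I +> x" and y: "y \<in> carrier A" "Y = I +> y"
      unfolding quot_mod_carrier by auto
    note sm = quot_mod_smult[OF vect_axioms sub]
    show "(c \<odot>\<^bsub>quot_mod A I\<^esub> X) \<otimes>\<^bsub>quot_mod A I\<^esub> Y = c \<odot>\<^bsub>quot_mod A I\<^esub> (X \<otimes>\<^bsub>quot_mod A I\<^esub> Y)"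
      unfolding x(2) y(2) sm[OF x(1)] mult[OF x(1) y(1)] mult[OF scal_closed[OF x(1)] y(1)] sm[OF m_closed[OF x(1) y(1)]]
        scal_mult_left[OF x(1) y(1)] ..
    show "X \<otimes>\<^bsub>quot_mod A I\<^esub> (c \<odot>\<^bsub>quot_mod A I\<^esub> Y) = c \<odot>\<^bsub>quot_mod A I\<^esub> (X \<otimes>\<^bsub>quot_mod A I\<^esub> Y)"
      unfolding x(2) y(2) sm[OF y(1)] mult[OF x(1) y(1)] mult[OF x(1) scal_closed[OF y(1)]] sm[OF m_closed[OF x(1) y(1)]]
        scal_mult_right[OF x(1) y(1)] ..
  qed
  ultimately show "kalg (quot_mod A I)" by (intro kalg.intro V.vect_axioms)
  show "alg_hom A (quot_mod A I) (\<lambda>x. I +> x)"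
    unfolding alg_hom_def using proj(1) one mult by simp
qed

lemma alg_hom_factor:
  assumes I: "ideal I A" and R: "kalg R" and h: "alg_hom A R h" and z: "\<And>x. x \<in> I \<Longrightarrow> h x = \<zero>\<^bsub>R\<^esub>"
  obtains h' where "alg_hom (quot_mod A I) R h'" "\<And>x. x \<in> carrier A \<Longrightarrow> h' (I +> x) = h x"
proof -
  interpret I: ideal I A by fact
  interpret R: kalg R by fact
  note sub = ideal_subsp[OF I]
  note proj = quot_proj[OF vect_axioms sub] and qh = kalg_quot_mod(2)[OF I]
  note hk = alg_hom_klin[OF h]
  define h' where "h' = (\<lambda>X. h (SOME x. x \<in> carrier A \<and> I +> x = X))"
  have h': "h' (I +> x) = h x" if x: "x \<in> carrier A" for x
  proof -
    let ?y = "SOME y. y \<in> carrier A \<and> I +> y = I +> x"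
    have y: "?y \<in> carrier A \<and> I +> ?y = I +> x" by (rule someI[of _ x]) (simp add: x)
    interpret Q: kalg "quot_mod A I" by (rule kalg_quot_mod(1)[OF I])
    have "I +> (?y \<ominus> x) = (I +> ?y) \<ominus>\<^bsub>quot_mod A I\<^esub> (I +> x)"
      using klin_diff[OF vect_axioms Q.vect_axioms proj(1)] y x by blast
    also have "\<dots> = \<zero>\<^bsub>quot_mod A I\<^esub>"
      using y klin_closed[OF proj(1) x] Q.diff_eq_zero_iff by metis
    finally have "?y \<ominus> x \<in> I" using proj(2)[of "?y \<ominus> x"] y x minus_closed by blast
    then have "h ?y \<ominus>\<^bsub>R\<^esub> h x = \<zero>\<^bsub>R\<^esub>"
      using z klin_diff[OF vect_axioms R.vect_axioms hk] y x by fastforce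
    then show ?thesis
      using R.diff_eq_zero_iff[of "h ?y" "h x"] klin_closed[OF hk] y x by (simp add: h'_def)
  qed
  have rep: "\<exists>x\<in>carrier A. X = I +> x" if "X \<in> carrier (quot_mod A I)" for X
    using that unfolding quot_mod_carrier by blast
  have "alg_hom (quot_mod A I) R h'"
    unfolding alg_hom_def
  proof (intro conjI ballI klinI)
    show "h' \<one>\<^bsub>quot_mod A I\<^esub> = \<one>\<^bsub>R\<^esub>" using h' alg_hom_one[OF h] by (simp add: quot_mod_one)
    fix X assume "X \<in> carrier (quot_mod A I)"
    then obtain x where x: "x \<in> carrier A" "X = I +> x" using rep by blast
    show "h' X \<in> carrier R" unfolding x(2) h'[OF x(1)] by (rule klin_closed[OF hk x(1)])
    show "h' (c \<odot>\<^bsub>quot_mod A I\<^esub> X) = c \<odot>\<^bsub>R\<^esub> h' X" for c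
      unfolding x(2) alg_hom_scal[OF qh x(1), symmetric] h'[OF x(1)] h'[OF scal_closed[OF x(1)]] by (rule klin_scal[OF hk x(1)])
    fix Y assume "Y \<in> carrier (quot_mod A I)"
    then obtain y where y: "y \<in> carrier A" "Y = I +> y" using rep by blast
    show "h' (X \<oplus>\<^bsub>quot_mod A I\<^esub> Y) = h' X \<oplus>\<^bsub>R\<^esub> h' Y"
      unfolding x(2) y(2) alg_hom_add[OF qh x(1) y(1), symmetric] h'[OF x(1)] h'[OF y(1)] h'[OF a_closed[OF x(1) y(1)]]
      by (rule klin_add[OF hk x(1) y(1)])
    show "h' (X \<otimes>\<^bsub>quot_mod A I\<^esub> Y) = h' X \<otimes>\<^bsub>R\<^esub> h' Y"
      unfolding x(2) y(2) alg_hom_mult[OF qh x(1) y(1), symmetric] h'[OF x(1)] h'[OF y(1)] h'[OF m_closed[OF x(1) y(1)]]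
      by (rule alg_hom_mult[OF h x(1) y(1)])
  qed
  then show ?thesis using h' by (rule that)
qed

lemma ideal_alg_hom_kernel:
  assumes "kalg R" "alg_hom A R h"
  shows "ideal {x \<in> carrier A. h x = \<zero>\<^bsub>R\<^esub>} A"
proof -
  interpret R: kalg R by fact
  let ?K = "{x \<in> carrier A. h x = \<zero>\<^bsub>R\<^esub>}"
  note hc = alg_hom_closed[OF assms(2)]
  have "subsp A ?K" by (rule subsp_kernel[OF vect_axioms R.vect_axioms alg_hom_klin[OF assms(2)]])
  then have "abelian_subgroup ?K A" by (rule subsp_abelian_subgroup[OF vect_axioms])
  then have sg: "subgroup ?K (add_monoid A)"
    by (rule additive_subgroup.a_subgroup[OF abelian_subgroup.axioms(1)])
  show ?thesis
  proof (rule idealI[OF ring_axioms sg])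
    fix a x assume "a \<in> ?K" "x \<in> carrier A"
    then have a: "a \<in> carrier A" "h a = \<zero>\<^bsub>R\<^esub>" and x: "x \<in> carrier A" by blast+
    have "h (x \<otimes> a) = \<zero>\<^bsub>R\<^esub>" unfolding alg_hom_mult[OF assms(2) x a(1)] a(2) by (rule R.r_null[OF hc[OF x]])
    moreover have "h (a \<otimes> x) = \<zero>\<^bsub>R\<^esub>" unfolding alg_hom_mult[OF assms(2) a(1) x] a(2) by (rule R.l_null[OF hc[OF x]])
    moreover note m_closed[OF x a(1)] m_closed[OF a(1) x]
    ultimately show "x \<otimes> a \<in> ?K" "a \<otimes> x \<in> ?K" by blast+
  qed
qed

end

section \<open>Adding arrows to a bound quiver algebra\<close>

lemma path_alg_finsum: "finite S \<Longrightarrow> (\<And>i. i \<in> S \<Longrightarrow> g i \<in> carrier (path_alg G)) \<Longrightarrow> wf_digraph G \<Longrightarrow>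
   finsum (path_alg G) g S = (\<lambda>r. \<Sum>i\<in>S. g i r :: 'k::field)"
proof (induction S rule: finite_induct)
  case empty
  interpret vect "path_alg G :: ('k, _) module" by (rule wf_digraph.vect_path_alg[OF empty(2)])
  show ?case by simp
next
  case (insert i S)
  interpret vect "path_alg G :: ('k, _) module" by (rule wf_digraph.vect_path_alg[OF insert.prems(2)])
  have m: "g \<in> S \<rightarrow> carrier (path_alg G)" "g i \<in> carrier (path_alg G)" using insert.prems(1) by blast+
  have IH: "finsum (path_alg G) g S = (\<lambda>r. \<Sum>i\<in>S. g i r)" using insert.IH insert.prems by blast
  show ?case unfolding finsum_insert[OF insert.hyps m] IH using insert.hyps by simp
qed

locale bound_quiver = fin_digraph Q for Q :: "('v, 'a) pre_digraph" +
  fixes I :: "(('v, 'a) path \<Rightarrow> 'k::field) set"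
  assumes adm: "admissible Q I"
begin

abbreviation "kQ \<equiv> path_alg Q :: ('k, ('v, 'a) path \<Rightarrow> 'k) module"
abbreviation "B \<equiv> bound_alg Q I"
abbreviation "e \<equiv> idem Q I"

sublocale kQ: kalg kQ by (rule kalg_path_alg)

lemma ideal_I: "ideal I kQ"
  using adm by (simp add: admissible_def)

sublocale B: kalg B
  unfolding bound_alg_def by (rule kQ.kalg_quot_mod(1)[OF ideal_I])

definition proj :: "(('v, 'a) path \<Rightarrow> 'k) \<Rightarrow> (('v, 'a) path \<Rightarrow> 'k) set" where
  "proj f = I +>\<^bsub>kQ\<^esub> f"

lemma alg_hom_proj: "alg_hom kQ B proj"
  unfolding bound_alg_def proj_def[abs_def] by (rule kQ.kalg_quot_mod(2)[OF ideal_I])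

lemma proj_onto: "b \<in> carrier B \<Longrightarrow> \<exists>f\<in>carrier kQ. b = proj f"
  unfolding bound_alg_def proj_def[abs_def] quot_mod_carrier by blast

lemma proj_zero: "f \<in> carrier kQ \<Longrightarrow> proj f = \<zero>\<^bsub>B\<^esub> \<longleftrightarrow> f \<in> I"
  unfolding bound_alg_def proj_def[abs_def] by (rule quot_proj(2)[OF kQ.vect_axioms kQ.ideal_subsp[OF ideal_I]])

lemma e_eq: "e x = proj (path_elem (x, [], x))"
  by (simp add: idem_def proj_def)

lemma vertex_in: "x \<in> verts Q \<Longrightarrow> path_elem (x, [], x) \<in> carrier kQ"
  by (rule path_elem_in) (simp add: path_Nil)

lemma e_in: "x \<in> verts Q \<Longrightarrow> e x \<in> carrier B"
  unfolding e_eq by (rule alg_hom_closed[OF alg_hom_proj vertex_in])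

lemma e_mult: "x \<in> verts Q \<Longrightarrow> y \<in> verts Q \<Longrightarrow> e x \<otimes>\<^bsub>B\<^esub> e y = (if x = y then e x else \<zero>\<^bsub>B\<^esub>)"
proof -
  assume xy: "x \<in> verts Q" "y \<in> verts Q"
  have "e x \<otimes>\<^bsub>B\<^esub> e y = proj (path_elem (x, [], x) \<otimes>\<^bsub>kQ\<^esub> path_elem (y, [], y))"
    unfolding e_eq by (rule alg_hom_mult[OF alg_hom_proj vertex_in vertex_in, symmetric, OF xy])
  also have "path_elem (x, [], x) \<otimes>\<^bsub>kQ\<^esub> path_elem (y, [], y) = (if x = y then path_elem (y, [] @ [], x) else (\<lambda>r. 0 :: 'k))"
    by (rule path_elem_mult) (simp_all add: path_Nil xy)
  finally show ?thesis
    using klin_zero[OF kQ.vect_axioms B.vect_axioms alg_hom_klin[OF alg_hom_proj]] by (auto simp: e_eq)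
qed

lemma e_idem: "x \<in> verts Q \<Longrightarrow> e x \<otimes>\<^bsub>B\<^esub> e x = e x"
  by (simp add: e_mult)

lemma e_sum: "(\<Oplus>\<^bsub>B\<^esub>x\<in>verts Q. e x) = \<one>\<^bsub>B\<^esub>"
proof -
  have "finsum kQ (\<lambda>x. path_elem (x, [], x)) (verts Q) = (\<lambda>r. \<Sum>x\<in>verts Q. path_elem (x, [], x) r)"
    by (rule path_alg_finsum[OF _ vertex_in]) (simp_all add: wf_digraph_axioms)
  also have "\<dots> = \<one>\<^bsub>kQ\<^esub>"
  proof (rule ext)
    fix r :: "('v, 'a) path"
    obtain u p v where r: "r = (u, p, v)" by (cases r) auto
    have "(\<Sum>x\<in>verts Q. path_elem (x, [], x) r) = (\<Sum>x\<in>verts Q. if x = u then (if p = [] \<and> v = u then 1 else 0) else (0::'k))"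
      by (intro sum.cong refl) (auto simp: path_elem_apply r)
    also have "\<dots> = \<one>\<^bsub>kQ\<^esub> r" by (auto simp: r paths_of_length_0)
    finally show "(\<Sum>x\<in>verts Q. path_elem (x, [], x) r) = \<one>\<^bsub>kQ\<^esub> r" .
  qed
  finally have "proj \<one>\<^bsub>kQ\<^esub> = proj (finsum kQ (\<lambda>x. path_elem (x, [], x)) (verts Q))" by simp
  also have "\<dots> = (\<Oplus>\<^bsub>B\<^esub>x\<in>verts Q. e x)"
    unfolding e_eq by (rule klin_finsum[OF kQ.vect_axioms B.vect_axioms alg_hom_klin[OF alg_hom_proj] finite_verts])
      (use vertex_in in blast)
  finally show ?thesis using alg_hom_one[OF alg_hom_proj] by simp
qed

text \<open>
  Paths of length at least \<open>n\<close> vanish in \<open>B\<close> for a suitable \<open>n\<close>, and there are finitely many shorter ones.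
\<close>

lemma kfin_B: "kfin B"
proof -
  obtain n where n: "path_ideal Q n \<subseteq> I" using adm by (auto simp: admissible_def)
  let ?S = "{r \<in> paths Q. length (fst (snd r)) < n}"
  let ?A = "(\<lambda>r. proj (path_elem r)) ` ?S"
  have "finite {p. set p \<subseteq> arcs Q \<and> length p \<le> n}" by (rule finite_lists_length_le) simp
  then have fin: "finite (verts Q \<times> {p. set p \<subseteq> arcs Q \<and> length p \<le> n} \<times> verts Q)" by simp
  have "?S \<subseteq> verts Q \<times> {p. set p \<subseteq> arcs Q \<and> length p \<le> n} \<times> verts Q"
    using path_ends by (auto simp: paths_def pre_digraph.awalk_def)
  then have finA: "finite ?A" using fin by (intro finite_imageI) (rule finite_subset)
  note pk = alg_hom_klin[OF alg_hom_proj]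
  have A: "?A \<subseteq> carrier B" using klin_closed[OF pk path_elem_in] by auto
  have mem: "(\<lambda>p. a p \<odot>\<^bsub>B\<^esub> p) \<in> ?A \<rightarrow> carrier B" for a using A by blast
  have long: "proj (path_elem r) = \<zero>\<^bsub>B\<^esub>" if r: "r \<in> paths Q" "\<not> length (fst (snd r)) < n" for r
  proof -
    obtain u p v where upv: "r = (u, p, v)" by (cases r) auto
    have aw: "awalk u (take n p @ drop n p) v" using r(1) by (simp add: upv paths_iff)
    have w: "awalk u (take n p) w" "awalk w (drop n p) v" if "w = awlast u (take n p)" for w
      using aw that by (simp_all only: awalk_append_iff)
    obtain w where w: "awalk u (take n p) w" "awalk w (drop n p) v" using w by blast
    have 1: "(u, take n p, w) \<in> paths_of_length Q n" using w(1) r(2) by (simp add: paths_of_length_def paths_iff upv)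
    then have p1: "(u, take n p, w) \<in> paths Q" by (simp add: paths_of_length_def)
    have 2: "(w, drop n p, v) \<in> paths Q" using w(2) by (simp add: paths_iff)
    have "(path_elem (u, take n p, w) :: _ \<Rightarrow> 'k) \<in> path_ideal Q n"
      unfolding path_ideal_def
      by (rule subsetD[OF kQ.genideal_self]) (use 1 path_elem_in in \<open>auto simp: paths_of_length_def simp del: path_alg_simps\<close>)
    then have "path_elem (u, take n p, w) \<in> I" using n by blast
    then have "path_elem (w, drop n p, v) \<otimes>\<^bsub>kQ\<^esub> path_elem (u, take n p, w) \<in> I"
      using ideal.I_l_closed[OF ideal_I] path_elem_in[OF 2] by blast
    then have "path_elem r \<in> I" by (simp add: path_elem_mult[OF 2 p1] upv)
    then show ?thesis using proj_zero[OF path_elem_in[OF r(1)]] by simp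
  qed
  show ?thesis
  proof (rule kfinI[OF B.vect_axioms finA A])
    fix b assume "b \<in> carrier B"
    then obtain f where f: "f \<in> carrier kQ" "b = proj f" using proj_onto by blast
    have "\<exists>a. proj f = (\<Oplus>\<^bsub>B\<^esub>p\<in>?A. a p \<odot>\<^bsub>B\<^esub> p)" using f(1)
    proof (induction f rule: path_alg_induct)
      case zero
      have "(\<Oplus>\<^bsub>B\<^esub>p\<in>?A. 0 \<odot>\<^bsub>B\<^esub> p) = (\<Oplus>\<^bsub>B\<^esub>p\<in>?A. \<zero>\<^bsub>B\<^esub>)" using A by (intro B.finsum_cong') auto
      then show ?case using klin_zero[OF kQ.vect_axioms B.vect_axioms pk] by (intro exI[of _ "\<lambda>_. 0"]) simp
    next
      case (elem r c)
      have e: "proj (\<lambda>x. c * path_elem r x) = c \<odot>\<^bsub>B\<^esub> proj (path_elem r)"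
        using klin_scal[OF pk path_elem_in[OF elem], of c] by simp
      show ?case
      proof (cases "length (fst (snd r)) < n")
        case True
        then have rA: "proj (path_elem r) \<in> ?A" using elem by blast
        let ?p = "proj (path_elem r)"
        have "(\<Oplus>\<^bsub>B\<^esub>p\<in>?A. (if p = ?p then c else 0) \<odot>\<^bsub>B\<^esub> p) = (\<Oplus>\<^bsub>B\<^esub>p\<in>?A. if ?p = p then c \<odot>\<^bsub>B\<^esub> p else \<zero>\<^bsub>B\<^esub>)"
          using A by (intro B.finsum_cong') auto
        also have "\<dots> = c \<odot>\<^bsub>B\<^esub> ?p" using rA finA A by (intro B.finsum_singleton) auto
        finally show ?thesis unfolding e by (intro exI[of _ "\<lambda>p. if p = ?p then c else 0"]) (rule sym)
      next
        case False
        have "(\<Oplus>\<^bsub>B\<^esub>p\<in>?A. 0 \<odot>\<^bsub>B\<^esub> p) = (\<Oplus>\<^bsub>B\<^esub>p\<in>?A. \<zero>\<^bsub>B\<^esub>)" using A by (intro B.finsum_cong') auto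
        then show ?thesis using long[OF elem False] by (intro exI[of _ "\<lambda>_. 0"]) (simp add: e)
      qed
    next
      case (add f g)
      obtain a b where a: "proj f = (\<Oplus>\<^bsub>B\<^esub>p\<in>?A. a p \<odot>\<^bsub>B\<^esub> p)" and b: "proj g = (\<Oplus>\<^bsub>B\<^esub>p\<in>?A. b p \<odot>\<^bsub>B\<^esub> p)"
        using add.IH by blast
      have "proj (\<lambda>r. f r + g r) = proj f \<oplus>\<^bsub>B\<^esub> proj g" using klin_add[OF pk add.hyps(1,2)] by simp
      also have "\<dots> = (\<Oplus>\<^bsub>B\<^esub>p\<in>?A. a p \<odot>\<^bsub>B\<^esub> p \<oplus>\<^bsub>B\<^esub> b p \<odot>\<^bsub>B\<^esub> p)" unfolding a b by (rule B.finsum_addf[OF mem mem, symmetric])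
      also have "\<dots> = (\<Oplus>\<^bsub>B\<^esub>p\<in>?A. (a p + b p) \<odot>\<^bsub>B\<^esub> p)"
        by (rule B.finsum_cong'[OF refl mem]) (use A in \<open>auto simp: B.scal_add_left subset_iff\<close>)
      finally show ?case by (rule exI[of _ "\<lambda>p. a p + b p"])
    qed
    then show "\<exists>a. b = (\<Oplus>\<^bsub>B\<^esub>p\<in>?A. a p \<odot>\<^bsub>B\<^esub> p)" using f(2) by simp
  qed
qed

end

locale arrow_extension = bound_quiver Q I
  for Q :: "('v, 'a) pre_digraph" and I :: "(('v, 'a) path \<Rightarrow> 'k::field) set" +
  fixes F :: "'f set" and s t :: "'f \<Rightarrow> 'v"
  assumes new: "new_arrows Q F s t"
begin

abbreviation "QF \<equiv> ext_quiver Q F s t"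
abbreviation "kQF \<equiv> path_alg QF :: ('k, ('v, 'a + 'f) path \<Rightarrow> 'k) module"
abbreviation "T \<equiv> ext_alg Q I F s t"
abbreviation (input) mult_T (infixl "\<cdot>" 70) where "x \<cdot> y \<equiv> x \<otimes>\<^bsub>T\<^esub> y"
abbreviation "J \<equiv> genideal kQF ((path_incl :: (('v, 'a) path \<Rightarrow> 'k) \<Rightarrow> ('v, 'a + 'f) path \<Rightarrow> 'k) ` I)"

lemma finite_F [simp]: "finite F"
  and s_in [simp]: "a \<in> F \<Longrightarrow> s a \<in> verts Q"
  and t_in [simp]: "a \<in> F \<Longrightarrow> t a \<in> verts Q"
  using new by (auto simp: new_arrows_def)

lemma QF_simps [simp]: "verts QF = verts Q" "arcs QF = arcs Q <+> F"
  "(Inl b \<in> arcs Q <+> F) = (b \<in> arcs Q)" "(Inr f \<in> arcs Q <+> F) = (f \<in> F)"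
  "tail QF (Inl a) = tail Q a" "tail QF (Inr f) = s f" "head QF (Inl a) = head Q a" "head QF (Inr f) = t f"
  by (auto simp: ext_quiver_def)

abbreviation "include \<equiv> path_incl :: (('v, 'a) path \<Rightarrow> 'k) \<Rightarrow> ('v, 'a + 'f) path \<Rightarrow> 'k"

sublocale QF: fin_digraph QF
  by unfold_locales auto

sublocale kQF: kalg kQF by (rule QF.kalg_path_alg)

sublocale incl: path_images Q kQF "\<lambda>x. path_elem (x, [], x)" "\<lambda>a. path_elem (tail Q a, [Inl a], head Q a)"
proof unfold_locales
  have v: "(x, [], x) \<in> paths QF" if "x \<in> verts Q" for x using that by (simp add: QF.path_Nil)
  have a: "(tail Q a, [Inl a], head Q a) \<in> paths QF" if "a \<in> arcs Q" for a
    using that by (simp add: QF.path_Nil QF.path_Cons)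
  show "path_elem (x, [], x) \<in> carrier kQF" if "x \<in> verts Q" for x by (rule QF.path_elem_in[OF v[OF that]])
  show "path_elem (tail Q a, [Inl a], head Q a) \<in> carrier kQF" if "a \<in> arcs Q" for a by (rule QF.path_elem_in[OF a[OF that]])
  show "path_elem (x, [], x) \<otimes>\<^bsub>kQF\<^esub> path_elem (x, [], x) = path_elem (x, [], x)" if "x \<in> verts Q" for x
    by (simp add: QF.path_elem_mult[OF v[OF that] v[OF that]])
  show "path_elem (x, [], x) \<otimes>\<^bsub>kQF\<^esub> path_elem (y, [], y) = \<zero>\<^bsub>kQF\<^esub>" if "x \<in> verts Q" "y \<in> verts Q" "x \<noteq> y" for x y
    using that(3) by (simp add: QF.path_elem_mult[OF v[OF that(1)] v[OF that(2)]])
  show "path_elem (head Q a, [], head Q a) \<otimes>\<^bsub>kQF\<^esub> path_elem (tail Q a, [Inl a], head Q a) \<otimes>\<^bsub>kQF\<^esub> path_elem (tail Q a, [], tail Q a)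
      = path_elem (tail Q a, [Inl a], head Q a)" if h: "a \<in> arcs Q" for a
    by (simp add: QF.path_elem_mult[OF v[OF head_in_verts[OF h]] a[OF h]] QF.path_elem_mult[OF a[OF h] v[OF tail_in_verts[OF h]]])
  show "(\<Oplus>\<^bsub>kQF\<^esub>x\<in>verts Q. path_elem (x, [], x)) = \<one>\<^bsub>kQF\<^esub>"
  proof -
    have "finsum kQF (\<lambda>x. path_elem (x, [], x)) (verts Q) = (\<lambda>r. \<Sum>x\<in>verts Q. path_elem (x, [], x) r)"
      by (rule path_alg_finsum[OF _ QF.path_elem_in[OF v]]) (simp_all add: QF.wf_digraph_axioms)
    also have "\<dots> = \<one>\<^bsub>kQF\<^esub>"
    proof (rule ext)
      fix r :: "('v, 'a + 'f) path"
      obtain u p v where r: "r = (u, p, v)" by (cases r) auto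
      have "(\<Sum>x\<in>verts Q. path_elem (x, [], x) r) = (\<Sum>x\<in>verts Q. if x = u then (if p = [] \<and> v = u then 1 else 0) else (0::'k))"
        by (intro sum.cong refl) (auto simp: path_elem_apply r)
      also have "\<dots> = \<one>\<^bsub>kQF\<^esub> r" by (auto simp: r paths_of_length_0)
      finally show "(\<Sum>x\<in>verts Q. path_elem (x, [], x) r) = \<one>\<^bsub>kQF\<^esub> r" .
    qed
    finally show ?thesis .
  qed
qed

lemma incl_image: "(u, p, v) \<in> paths Q \<Longrightarrow> incl.image u p = path_elem (u, map Inl p, v) \<and> (u, map Inl p, v) \<in> paths QF"
proof (induction p arbitrary: u)
  case Nil
  then show ?case by (auto simp: path_Nil QF.path_Nil)
next
  case (Cons a p)
  then have a: "a \<in> arcs Q" "tail Q a = u" and p: "(head Q a, p, v) \<in> paths Q" by (simp_all add: path_Cons)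
  note IH = Cons.IH[OF p]
  have a': "(tail Q a, [Inl a], head Q a) \<in> paths QF" using a by (simp add: QF.path_Nil QF.path_Cons)
  show ?case using IH a QF.path_elem_mult[OF conjunct2[OF IH] a'] by (simp add: QF.path_Cons)
qed

lemma path_incl_elem: "include (path_elem (u, p, v)) = path_elem (u, map Inl p, v)"
proof (rule ext)
  fix r :: "('v, 'a + 'f) path"
  obtain u' q v' where r: "r = (u', q, v')" by (cases r) auto
  have "map Inl (map projl q) = q" if "list_all isl q"
    using that by (induction q) (auto simp: list_all_iff)
  moreover have "list_all isl (map Inl p :: ('a + 'f) list)" "map projl (map Inl p :: ('a + 'f) list) = p"
    by (simp_all add: list_all_iff comp_def)
  ultimately have "list_all isl q \<and> map projl q = p \<longleftrightarrow> q = map Inl p" by metis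
  then have "list_all isl q \<and> (u', map projl q, v') = (u, p, v) \<longleftrightarrow> (u', q, v') = (u, map Inl p, v)" by blast
  then show "include (path_elem (u, p, v)) r = path_elem (u, map Inl p, v) r"
    unfolding path_incl_def r path_elem_apply prod.case
    by (cases "list_all isl q"; cases "(u', q, v') = (u, map Inl p, v)"; simp only: simp_thms if_True if_False)
qed

lemma path_incl_eq: "f \<in> carrier kQ \<Longrightarrow> include f = incl.extend f"
proof (induction f rule: path_alg_induct)
  case zero
  then show ?case using klin_zero[OF kQ.vect_axioms kQF.vect_axioms incl.klin_extend] by (auto simp: path_incl_def fun_eq_iff)
next
  case (elem r c)
  obtain u p v where r: "r = (u, p, v)" by (cases r) auto
  have "include (\<lambda>x. c * path_elem r x) = (\<lambda>x. c * include (path_elem r) x)" by (auto simp: path_incl_def fun_eq_iff)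
  also have "include (path_elem r) = incl.extend (path_elem r)"
    using incl_image[OF elem[unfolded r]] incl.extend_elem[OF elem[unfolded r]] by (simp add: r path_incl_elem)
  finally show ?case using klin_scal[OF incl.klin_extend path_elem_in[OF elem], of c] by simp
next
  case (add f g)
  have "include (\<lambda>r. f r + g r) = (\<lambda>r. include f r + include g r)" by (auto simp: path_incl_def fun_eq_iff)
  then show ?case using klin_add[OF incl.klin_extend add.hyps(1,2)] add.IH by simp
qed

lemma I_sub: "I \<subseteq> carrier kQ"
  using kQ.ideal_subsp[OF ideal_I] by (simp only: subsp_def)

lemma incl_I: "include ` I \<subseteq> carrier kQF"
  using I_sub path_incl_eq klin_closed[OF incl.klin_extend] by (auto simp del: path_alg_simps)

lemma ideal_J: "ideal J kQF"
  by (rule kQF.genideal_ideal[OF incl_I])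

lemma T_eq: "T = quot_mod kQF J"
  by (simp add: ext_alg_def Let_def)

sublocale T: kalg T
  unfolding T_eq by (rule kQF.kalg_quot_mod(1)[OF ideal_J])

definition projT :: "(('v, 'a + 'f) path \<Rightarrow> 'k) \<Rightarrow> (('v, 'a + 'f) path \<Rightarrow> 'k) set" where
  "projT f = J +>\<^bsub>kQF\<^esub> f"

lemma alg_hom_projT: "alg_hom kQF T projT"
  unfolding T_eq projT_def[abs_def] by (rule kQF.kalg_quot_mod(2)[OF ideal_J])

lemma projT_onto: "x \<in> carrier T \<Longrightarrow> \<exists>f\<in>carrier kQF. x = projT f"
  unfolding T_eq projT_def[abs_def] quot_mod_carrier by blast

lemma projT_zero: "f \<in> carrier kQF \<Longrightarrow> projT f = \<zero>\<^bsub>T\<^esub> \<longleftrightarrow> f \<in> J"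
  unfolding T_eq projT_def[abs_def] by (rule quot_proj(2)[OF kQF.vect_axioms kQF.ideal_subsp[OF ideal_J]])

lemma alg_hom_compose: "alg_hom X Y f \<Longrightarrow> alg_hom Y Z g \<Longrightarrow> alg_hom X Z (\<lambda>x. g (f x))"
  by (simp add: alg_hom_def klin_def)

text \<open>
  The inclusion of path algebras sends \<open>I\<close> into the ideal that it generates, hence descends to the quotients.
\<close>

lemma iota_exists: "\<exists>h. alg_hom B T h \<and> (\<forall>f\<in>carrier kQ. h (proj f) = projT (incl.extend f))"
proof -
  have z: "projT (incl.extend f) = \<zero>\<^bsub>T\<^esub>" if f: "f \<in> I" for f
  proof -
    have fk: "f \<in> carrier kQ" using f I_sub by blast
    have "incl.extend f \<in> include ` I" using path_incl_eq[OF fk] f by (metis imageI)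
    then have "incl.extend f \<in> J" using kQF.genideal_self[OF incl_I] by blast
    then show ?thesis using projT_zero klin_closed[OF incl.klin_extend fk] by blast
  qed
  obtain h where "alg_hom (quot_mod kQ I) T h" "\<And>f. f \<in> carrier kQ \<Longrightarrow> h (I +>\<^bsub>kQ\<^esub> f) = projT (incl.extend f)"
    using kQ.alg_hom_factor[OF ideal_I T.kalg_axioms alg_hom_compose[OF incl.alg_hom_extend alg_hom_projT] z] by blast
  then show ?thesis unfolding bound_alg_def proj_def by blast
qed

definition \<iota> where "\<iota> = (SOME h. alg_hom B T h \<and> (\<forall>f\<in>carrier kQ. h (proj f) = projT (incl.extend f)))"

lemma alg_hom_iota: "alg_hom B T \<iota>"
  and iota_proj: "f \<in> carrier kQ \<Longrightarrow> \<iota> (proj f) = projT (incl.extend f)"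
  using someI_ex[OF iota_exists] by (auto simp: \<iota>_def simp del: path_alg_simps)

definition \<alpha> where "\<alpha> a = projT (path_elem (s a, [Inr a], t a))"

lemma arrow_path: "a \<in> F \<Longrightarrow> (s a, [Inr a], t a) \<in> paths QF"
  by (simp add: QF.path_Nil QF.path_Cons InrI)

lemma alpha_in [simp]: "a \<in> F \<Longrightarrow> \<alpha> a \<in> carrier T"
  unfolding \<alpha>_def by (rule alg_hom_closed[OF alg_hom_projT QF.path_elem_in[OF arrow_path]])

lemma iota_e: "x \<in> verts Q \<Longrightarrow> \<iota> (e x) = projT (path_elem (x, [], x))"
  unfolding e_eq using iota_proj[OF vertex_in] incl.extend_elem[of x "[]" x] by (simp add: path_Nil)

lemma alpha_left: "a \<in> F \<Longrightarrow> \<iota> (e (t a)) \<cdot> \<alpha> a = \<alpha> a"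
proof -
  assume a: "a \<in> F"
  have v: "(t a, [], t a) \<in> paths QF" using a by (simp add: QF.path_Nil)
  show ?thesis
    unfolding iota_e[OF t_in[OF a]] \<alpha>_def
      alg_hom_mult[OF alg_hom_projT QF.path_elem_in[OF v] QF.path_elem_in[OF arrow_path[OF a]], symmetric]
    by (simp add: QF.path_elem_mult[OF v arrow_path[OF a]])
qed

lemma alpha_right: "a \<in> F \<Longrightarrow> \<alpha> a \<cdot> \<iota> (e (s a)) = \<alpha> a"
proof -
  assume a: "a \<in> F"
  have v: "(s a, [], s a) \<in> paths QF" using a by (simp add: QF.path_Nil)
  show ?thesis
    unfolding iota_e[OF s_in[OF a]] \<alpha>_def
      alg_hom_mult[OF alg_hom_projT QF.path_elem_in[OF arrow_path[OF a]] QF.path_elem_in[OF v], symmetric]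
    by (simp add: QF.path_elem_mult[OF arrow_path[OF a] v])
qed

lemma T_generated [consumes 1, case_names base arrow add mult]:
  assumes x: "x \<in> carrier T"
    and base: "\<And>b. b \<in> carrier B \<Longrightarrow> P (\<iota> b)"
    and arrow: "\<And>a. a \<in> F \<Longrightarrow> P (\<alpha> a)"
    and add: "\<And>x y. x \<in> carrier T \<Longrightarrow> y \<in> carrier T \<Longrightarrow> P x \<Longrightarrow> P y \<Longrightarrow> P (x \<oplus>\<^bsub>T\<^esub> y)"
    and mult: "\<And>x y. x \<in> carrier T \<Longrightarrow> y \<in> carrier T \<Longrightarrow> P x \<Longrightarrow> P y \<Longrightarrow> P (x \<cdot> y)"
  shows "P x"
proof -
  obtain f where f: "f \<in> carrier kQF" "x = projT f" using projT_onto[OF x] by blast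
  note pc = alg_hom_closed[OF alg_hom_projT]
  note ic = alg_hom_closed[OF alg_hom_iota]
  have scal: "P (c \<odot>\<^bsub>T\<^esub> y)" if y: "y \<in> carrier T" "P y" for c y
  proof -
    have c: "c \<odot>\<^bsub>B\<^esub> \<one>\<^bsub>B\<^esub> \<in> carrier B" by simp
    have "\<iota> (c \<odot>\<^bsub>B\<^esub> \<one>\<^bsub>B\<^esub>) = c \<odot>\<^bsub>T\<^esub> \<one>\<^bsub>T\<^esub>" using alg_hom_scal[OF alg_hom_iota, of "\<one>\<^bsub>B\<^esub>" c] alg_hom_one[OF alg_hom_iota] by simp
    then have "\<iota> (c \<odot>\<^bsub>B\<^esub> \<one>\<^bsub>B\<^esub>) \<cdot> y = c \<odot>\<^bsub>T\<^esub> y" using T.scal_one_mult[OF y(1)] by simp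
    then show ?thesis using mult[OF ic[OF c] y(1) base[OF c] y(2)] by simp
  qed
  have "P (projT f)" using f(1)
  proof (induction f rule: QF.path_alg_generated)
    case (vertex x)
    then show ?case using base[OF e_in, of x] iota_e[of x] by simp
  next
    case (arrow a)
    show ?case
    proof (cases a)
      case (Inl b)
      then have b: "b \<in> arcs Q" using arrow by auto
      have p: "(tail Q b, [b], head Q b) \<in> paths Q" using b by (simp add: path_Cons path_Nil)
      have "\<iota> (proj (path_elem (tail Q b, [b], head Q b))) = projT (path_elem (tail Q b, [Inl b], head Q b))"
        using iota_proj[OF path_elem_in[OF p]] incl.extend_elem[OF p] incl_image[OF p] by simp
      then show ?thesis using base[OF alg_hom_closed[OF alg_hom_proj path_elem_in[OF p]]] by (simp add: Inl)
    next
      case (Inr b)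
      then have "b \<in> F" using arrow by auto
      then show ?thesis using assms(3)[of b] by (simp add: Inr \<alpha>_def)
    qed
  next
    case (add f g)
    show ?case unfolding alg_hom_add[OF alg_hom_projT add.hyps(1,2)]
      by (rule assms(4)[OF pc[OF add.hyps(1)] pc[OF add.hyps(2)] add.IH])
  next
    case (scal c f)
    show ?case unfolding alg_hom_scal[OF alg_hom_projT scal.hyps(1)]
      by (rule \<open>\<And>y c. y \<in> carrier T \<Longrightarrow> P y \<Longrightarrow> P (c \<odot>\<^bsub>T\<^esub> y)\<close>[OF pc[OF scal.hyps(1)] scal.IH])
  next
    case zero
    have "projT \<zero>\<^bsub>kQF\<^esub> = \<iota> \<zero>\<^bsub>B\<^esub>"
      using klin_zero[OF kQF.vect_axioms T.vect_axioms alg_hom_klin[OF alg_hom_projT]]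
        klin_zero[OF B.vect_axioms T.vect_axioms alg_hom_klin[OF alg_hom_iota]] by (simp only:)
    then show ?case using base[OF B.zero_closed] by simp
  next
    case (mult f g)
    show ?case unfolding alg_hom_mult[OF alg_hom_projT mult.hyps(1,2)]
      by (rule assms(5)[OF pc[OF mult.hyps(1)] pc[OF mult.hyps(2)] mult.IH])
  qed
  then show ?thesis using f(2) by simp
qed

text \<open>
  The images of the vertices and old arrows come from \<open>g\<close>, those of the new arrows from \<open>w\<close>; the map they define
  on the path algebra kills \<open>I\<close>, hence the ideal that it generates.
\<close>

lemma T_universal:
  fixes R :: "('k, 'r) module"
  assumes R: "kalg R" and g: "alg_hom B R g"
    and w: "\<And>a. a \<in> F \<Longrightarrow> w a \<in> carrier R"
    and ends: "\<And>a. a \<in> F \<Longrightarrow> g (e (t a)) \<otimes>\<^bsub>R\<^esub> w a \<otimes>\<^bsub>R\<^esub> g (e (s a)) = w a"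
  obtains h where "alg_hom T R h" "\<And>b. b \<in> carrier B \<Longrightarrow> h (\<iota> b) = g b" "\<And>a. a \<in> F \<Longrightarrow> h (\<alpha> a) = w a"
proof -
  interpret R: kalg R by fact
  note gk = alg_hom_klin[OF g] and gc = alg_hom_closed[OF g] and gm = alg_hom_mult[OF g]
  let ?arr = "\<lambda>a. proj (path_elem (tail Q a, [a], head Q a))"
  have arr: "(tail Q a, [a], head Q a) \<in> paths Q" if "a \<in> arcs Q" for a using that by (simp add: path_Cons path_Nil)
  have ain: "?arr a \<in> carrier B" if "a \<in> arcs Q" for a
    by (rule alg_hom_closed[OF alg_hom_proj path_elem_in[OF arr[OF that]]])
  have aends: "e (head Q a) \<otimes>\<^bsub>B\<^esub> ?arr a \<otimes>\<^bsub>B\<^esub> e (tail Q a) = ?arr a" if a: "a \<in> arcs Q" for a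
  proof -
    have v: "(x, [], x) \<in> paths Q" if "x \<in> verts Q" for x using that by (simp add: path_Nil)
    note h = path_elem_in[OF v[OF head_in_verts[OF a]]] and l = path_elem_in[OF v[OF tail_in_verts[OF a]]] and p = path_elem_in[OF arr[OF a]]
    show ?thesis
      unfolding e_eq alg_hom_mult[OF alg_hom_proj h p, symmetric] alg_hom_mult[OF alg_hom_proj kQ.m_closed[OF h p] l, symmetric]
      by (simp add: path_elem_mult[OF v[OF head_in_verts[OF a]] arr[OF a]] path_elem_mult[OF arr[OF a] v[OF tail_in_verts[OF a]]])
  qed
  define \<rho> where "\<rho> = case_sum (\<lambda>a. g (?arr a)) w"
  interpret P: path_images QF R "\<lambda>x. g (e x)" \<rho>
  proof unfold_locales
    show "g (e x) \<in> carrier R" if "x \<in> verts QF" for x using that e_in gc by simp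
    show "g (e x) \<otimes>\<^bsub>R\<^esub> g (e x) = g (e x)" if "x \<in> verts QF" for x
      using that gm[OF e_in e_in, of x x] e_idem by simp
    show "g (e x) \<otimes>\<^bsub>R\<^esub> g (e y) = \<zero>\<^bsub>R\<^esub>" if "x \<in> verts QF" "y \<in> verts QF" "x \<noteq> y" for x y
      using that gm[OF e_in e_in, of x y] e_mult[of x y] klin_zero[OF B.vect_axioms R.vect_axioms gk] by simp
    show "(\<Oplus>\<^bsub>R\<^esub>x\<in>verts QF. g (e x)) = \<one>\<^bsub>R\<^esub>"
      using klin_finsum[OF B.vect_axioms R.vect_axioms gk finite_verts, of e] e_in e_sum alg_hom_one[OF g] by auto
    fix a assume a: "a \<in> arcs QF"
    show "\<rho> a \<in> carrier R" using a ain gc w by (cases a) (auto simp: \<rho>_def)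
    show "g (e (head QF a)) \<otimes>\<^bsub>R\<^esub> \<rho> a \<otimes>\<^bsub>R\<^esub> g (e (tail QF a)) = \<rho> a"
    proof (cases a)
      case (Inl b)
      then have b: "b \<in> arcs Q" using a by auto
      show ?thesis
        using gm[OF e_in[OF head_in_verts[OF b]] ain[OF b]]
          gm[OF B.m_closed[OF e_in[OF head_in_verts[OF b]] ain[OF b]] e_in[OF tail_in_verts[OF b]]] aends[OF b]
        by (simp add: Inl \<rho>_def)
    next
      case (Inr b)
      then have "b \<in> F" using a by auto
      then show ?thesis using ends by (simp add: Inr \<rho>_def)
    qed
  qed
  have im: "P.image u (map Inl p) = g (proj (path_elem (u, p, v)))" if "(u, p, v) \<in> paths Q" for u p v
    using that
  proof (induction p arbitrary: u)
    case Nil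
    then have "u = v" by (simp add: path_Nil)
    then show ?case unfolding P.image.simps list.map by (simp only: e_eq)
  next
    case (Cons a p)
    then have a: "a \<in> arcs Q" "tail Q a = u" and p: "(head Q a, p, v) \<in> paths Q" by (simp_all add: path_Cons)
    have r: "\<rho> (Inl a) = g (?arr a)" by (simp add: \<rho>_def)
    have "P.image u (map Inl (a # p)) = g (proj (path_elem (head Q a, p, v))) \<otimes>\<^bsub>R\<^esub> g (?arr a)"
      using Cons.IH[OF p] by (simp add: r)
    also have "\<dots> = g (proj (path_elem (head Q a, p, v) \<otimes>\<^bsub>kQ\<^esub> path_elem (tail Q a, [a], head Q a)))"
      unfolding alg_hom_mult[OF alg_hom_proj path_elem_in[OF p] path_elem_in[OF arr[OF a(1)]]]
      by (rule gm[OF alg_hom_closed[OF alg_hom_proj path_elem_in[OF p]] ain[OF a(1)], symmetric])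
    also have "path_elem (head Q a, p, v) \<otimes>\<^bsub>kQ\<^esub> path_elem (tail Q a, [a], head Q a) = path_elem (u, a # p, v)"
      unfolding path_elem_mult[OF p arr[OF a(1)]] by (simp add: a(2))
    finally show ?case .
  qed
  have comm: "P.extend (incl.extend f) = g (proj f)" if "f \<in> carrier kQ" for f
    using that
  proof (induction f rule: path_alg_induct)
    case zero
    then show ?case
      using klin_zero[OF kQ.vect_axioms R.vect_axioms klin_compose[OF incl.klin_extend P.klin_extend]]
        klin_zero[OF kQ.vect_axioms R.vect_axioms klin_compose[OF alg_hom_klin[OF alg_hom_proj] gk]] by simp
  next
    case (elem r c)
    obtain u p v where r: "r = (u, p, v)" by (cases r) auto
    note i = incl_image[OF elem[unfolded r]]
    have "P.extend (incl.extend (path_elem r)) = g (proj (path_elem r))"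
      using i incl.extend_elem[OF elem[unfolded r]] P.extend_elem[OF conjunct2[OF i]] im[OF elem[unfolded r]] by (simp add: r)
    then show ?case
      using klin_scal[OF klin_compose[OF incl.klin_extend P.klin_extend] path_elem_in[OF elem], of c]
        klin_scal[OF klin_compose[OF alg_hom_klin[OF alg_hom_proj] gk] path_elem_in[OF elem], of c] by simp
  next
    case (add f h)
    then show ?case
      using klin_add[OF klin_compose[OF incl.klin_extend P.klin_extend] add.hyps(1,2)]
        klin_add[OF klin_compose[OF alg_hom_klin[OF alg_hom_proj] gk] add.hyps(1,2)] by simp
  qed
  have "include ` I \<subseteq> {f \<in> carrier kQF. P.extend f = \<zero>\<^bsub>R\<^esub>}"
  proof
    fix y assume "y \<in> include ` I"
    then obtain f where f: "f \<in> I" "y = include f" by blast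
    have fk: "f \<in> carrier kQ" using f(1) I_sub by blast
    have "proj f = \<zero>\<^bsub>B\<^esub>" using proj_zero[OF fk] f(1) by blast
    then have "P.extend y = \<zero>\<^bsub>R\<^esub>"
      using comm[OF fk] klin_zero[OF B.vect_axioms R.vect_axioms gk] path_incl_eq[OF fk] f(2) by simp
    moreover have "y \<in> carrier kQF" using klin_closed[OF incl.klin_extend fk] path_incl_eq[OF fk] f(2) by simp
    ultimately show "y \<in> {f \<in> carrier kQF. P.extend f = \<zero>\<^bsub>R\<^esub>}" by blast
  qed
  then have J: "J \<subseteq> {f \<in> carrier kQF. P.extend f = \<zero>\<^bsub>R\<^esub>}"
    by (rule kQF.genideal_minimal[OF kQF.ideal_alg_hom_kernel[OF R P.alg_hom_extend]])
  have z: "P.extend f = \<zero>\<^bsub>R\<^esub>" if "f \<in> J" for f using J that by blast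
  obtain h where h: "alg_hom (quot_mod kQF J) R h" "\<And>f. f \<in> carrier kQF \<Longrightarrow> h (J +>\<^bsub>kQF\<^esub> f) = P.extend f"
    using kQF.alg_hom_factor[OF ideal_J R P.alg_hom_extend z] by blast
  show ?thesis
  proof (rule that[of h])
    show "alg_hom T R h" using h(1) by (simp only: T_eq)
    show "h (\<iota> b) = g b" if b: "b \<in> carrier B" for b
    proof -
      obtain f where f: "f \<in> carrier kQ" "b = proj f" using proj_onto[OF b] by blast
      show ?thesis unfolding f(2) iota_proj[OF f(1)] projT_def h(2)[OF klin_closed[OF incl.klin_extend f(1)]] by (rule comm[OF f(1)])
    qed
    show "h (\<alpha> a) = w a" if a: "a \<in> F" for a
    proof -
      have m: "g (e (t a)) \<otimes>\<^bsub>R\<^esub> w a = w a"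
        using P.\<rho>_left[of "Inr a"] a by (simp add: \<rho>_def InrI)
      have r: "\<rho> (Inr a) = w a" by (simp add: \<rho>_def)
      show ?thesis unfolding \<alpha>_def projT_def h(2)[OF QF.path_elem_in[OF arrow_path[OF a]]] P.extend_elem[OF arrow_path[OF a]]
        using m by (simp add: r)
    qed
  qed
qed

end

text \<open>
  The trivial extension \<open>A \<oplus> V\<close> with \<open>V V = 0\<close>: the maps \<open>a \<mapsto> (a, d a)\<close> into it are algebra maps exactly
  for derivations \<open>d\<close>.
\<close>

definition sq_zero :: "('k::field, 'a) module \<Rightarrow> ('k, 'v) module \<Rightarrow> ('a \<Rightarrow> 'v \<Rightarrow> 'v) \<Rightarrow> ('v \<Rightarrow> 'a \<Rightarrow> 'v) \<Rightarrow> ('k, 'a \<times> 'v) module" where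
  "sq_zero A V l r =
    \<lparr>carrier = carrier A \<times> carrier V,
     mult = (\<lambda>(x, m) (y, n). (x \<otimes>\<^bsub>A\<^esub> y, l x n \<oplus>\<^bsub>V\<^esub> r m y)), one = (\<one>\<^bsub>A\<^esub>, \<zero>\<^bsub>V\<^esub>),
     zero = (\<zero>\<^bsub>A\<^esub>, \<zero>\<^bsub>V\<^esub>), add = (\<lambda>(x, m) (y, n). (x \<oplus>\<^bsub>A\<^esub> y, m \<oplus>\<^bsub>V\<^esub> n)),
     smult = (\<lambda>c (x, m). (c \<odot>\<^bsub>A\<^esub> x, c \<odot>\<^bsub>V\<^esub> m))\<rparr>"

lemma sq_zero_simps [simp]:
  "carrier (sq_zero A V l r) = carrier A \<times> carrier V"
  "(x, m) \<otimes>\<^bsub>sq_zero A V l r\<^esub> (y, n) = (x \<otimes>\<^bsub>A\<^esub> y, l x n \<oplus>\<^bsub>V\<^esub> r m y)"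
  "one (sq_zero A V l r) = (\<one>\<^bsub>A\<^esub>, \<zero>\<^bsub>V\<^esub>)" "zero (sq_zero A V l r) = (\<zero>\<^bsub>A\<^esub>, \<zero>\<^bsub>V\<^esub>)"
  "(x, m) \<oplus>\<^bsub>sq_zero A V l r\<^esub> (y, n) = (x \<oplus>\<^bsub>A\<^esub> y, m \<oplus>\<^bsub>V\<^esub> n)"
  "c \<odot>\<^bsub>sq_zero A V l r\<^esub> (x, m) = (c \<odot>\<^bsub>A\<^esub> x, c \<odot>\<^bsub>V\<^esub> m)"
  by (simp_all add: sq_zero_def)

context bimod
begin

lemma ract_zero [simp]: "a \<in> carrier A \<Longrightarrow> r \<zero>\<^bsub>V\<^esub> a = \<zero>\<^bsub>V\<^esub>"
  using ract_scal_left[OF V.zero_closed, of a 0] by simp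

lemma deriv_one: "d \<in> derivs A V l r \<Longrightarrow> d \<one>\<^bsub>A\<^esub> = \<zero>\<^bsub>V\<^esub>"
proof -
  assume d: "d \<in> derivs A V l r"
  have c: "d \<one>\<^bsub>A\<^esub> \<in> carrier V" by (rule derivs_closed[OF d A.one_closed])
  have "d \<one>\<^bsub>A\<^esub> = d \<one>\<^bsub>A\<^esub> \<oplus>\<^bsub>V\<^esub> d \<one>\<^bsub>A\<^esub>"
    using derivs_mult[OF d A.one_closed A.one_closed] c by simp
  then show ?thesis using V.add.l_cancel_one'[OF c c] by simp
qed

lemma kalg_sq_zero: "kalg (sq_zero A V l r)"
proof -
  let ?R = "sq_zero A V l r"
  have ag: "abelian_group ?R"
  proof (rule abelian_groupI)
    fix x assume "x \<in> carrier ?R"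
    then obtain a v where x: "x = (a, v)" "a \<in> carrier A" "v \<in> carrier V" by auto
    show "\<exists>y\<in>carrier ?R. y \<oplus>\<^bsub>?R\<^esub> x = \<zero>\<^bsub>?R\<^esub>"
      by (rule bexI[of _ "(\<ominus>\<^bsub>A\<^esub> a, \<ominus>\<^bsub>V\<^esub> v)"]) (simp_all add: x A.l_neg V.l_neg)
  qed (auto simp: A.a_ac V.a_ac)
  have mon: "monoid ?R"
  proof (rule monoidI)
    fix x y z assume "x \<in> carrier ?R" "y \<in> carrier ?R" "z \<in> carrier ?R"
    then obtain a v b w c u where x: "x = (a, v)" "a \<in> carrier A" "v \<in> carrier V"
      and y: "y = (b, w)" "b \<in> carrier A" "w \<in> carrier V" and z: "z = (c, u)" "c \<in> carrier A" "u \<in> carrier V" by auto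
    show "x \<otimes>\<^bsub>?R\<^esub> y \<otimes>\<^bsub>?R\<^esub> z = x \<otimes>\<^bsub>?R\<^esub> (y \<otimes>\<^bsub>?R\<^esub> z)"
      by (simp add: x y z A.m_assoc act_mult ract_mult act_add_right ract_add_left lact_ract V.a_assoc)
  qed (auto)
  have rng: "ring ?R"
  proof (rule ringI[OF ag mon])
    fix x y z assume "x \<in> carrier ?R" "y \<in> carrier ?R" "z \<in> carrier ?R"
    then obtain a v b w c u where x: "x = (a, v)" "a \<in> carrier A" "v \<in> carrier V"
      and y: "y = (b, w)" "b \<in> carrier A" "w \<in> carrier V" and z: "z = (c, u)" "c \<in> carrier A" "u \<in> carrier V" by auto
    show "(x \<oplus>\<^bsub>?R\<^esub> y) \<otimes>\<^bsub>?R\<^esub> z = x \<otimes>\<^bsub>?R\<^esub> z \<oplus>\<^bsub>?R\<^esub> y \<otimes>\<^bsub>?R\<^esub> z"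
      by (simp add: x y z A.l_distr act_add_left ract_add_left V.a_ac)
    show "z \<otimes>\<^bsub>?R\<^esub> (x \<oplus>\<^bsub>?R\<^esub> y) = z \<otimes>\<^bsub>?R\<^esub> x \<oplus>\<^bsub>?R\<^esub> z \<otimes>\<^bsub>?R\<^esub> y"
      by (simp add: x y z A.r_distr act_add_right ract_add_right V.a_ac)
  qed
  have "vect ?R"
    by (intro vect.intro ag vect_axioms.intro)
       (auto simp: A.scal_add_left A.scal_add_right V.scal_add_left V.scal_add_right A.scal_mult V.scal_mult)
  moreover have "kalg_axioms ?R"
    by (rule kalg_axioms.intro)
       (auto simp: A.scal_mult_left A.scal_mult_right act_scal_left act_scal_right ract_scal_left ract_scal_right V.scal_add_right)
  ultimately show ?thesis using rng by (intro kalg.intro)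
qed

end

context arrow_extension
begin

lemma alg_hom_id_if_gens:
  assumes "alg_hom T T h" "\<And>b. b \<in> carrier B \<Longrightarrow> h (\<iota> b) = \<iota> b" "\<And>a. a \<in> F \<Longrightarrow> h (\<alpha> a) = \<alpha> a" "x \<in> carrier T"
  shows "h x = x"
  using assms(4)
proof (induction x rule: T_generated)
  case (add x y)
  then show ?case using alg_hom_add[OF assms(1) add.hyps] by simp
next
  case (mult x y)
  then show ?case using alg_hom_mult[OF assms(1) mult.hyps] by simp
qed (rule assms(2,3); assumption)+

lemma ic [simp]: "b \<in> carrier B \<Longrightarrow> \<iota> b \<in> carrier T"
  by (rule alg_hom_closed[OF alg_hom_iota])

lemma deriv_unique:
  assumes "bimod T V l r" and d: "d \<in> derivs T V l r" and d': "d' \<in> derivs T V l r"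
    and "\<And>b. b \<in> carrier B \<Longrightarrow> d (\<iota> b) = d' (\<iota> b)" "\<And>a. a \<in> F \<Longrightarrow> d (\<alpha> a) = d' (\<alpha> a)"
  shows "d = d'"
proof (rule derivs_eqI[OF d d'])
  fix x assume "x \<in> carrier T"
  then show "d x = d' x"
  proof (induction x rule: T_generated)
    case (add x y)
    then show ?case using klin_add[OF derivs_klin[OF d] add.hyps] klin_add[OF derivs_klin[OF d'] add.hyps] by simp
  next
    case (mult x y)
    then show ?case using derivs_mult[OF d mult.hyps] derivs_mult[OF d' mult.hyps] by simp
  qed (rule assms(4,5); assumption)+
qed

text \<open>
  A derivation with values in \<open>V\<close> is an algebra map into the square-zero extension by \<open>V\<close>, so the universal
  property of \<open>T\<close> extends derivations, with prescribed values on the new arrows.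
\<close>

lemma deriv_extend:
  assumes "bimod T V l r" and \<delta>: "\<delta> \<in> derivs B V (\<lambda>b. l (\<iota> b)) (\<lambda>v b. r v (\<iota> b))"
    and w: "\<And>a. a \<in> F \<Longrightarrow> w a \<in> carrier V"
  obtains d where "d \<in> derivs T V l r" "\<And>b. b \<in> carrier B \<Longrightarrow> d (\<iota> b) = \<delta> b"
    "\<And>a. a \<in> F \<Longrightarrow> (\<And>b. b \<in> carrier B \<Longrightarrow> \<delta> b = \<zero>\<^bsub>V\<^esub>) \<Longrightarrow> d (\<alpha> a) = r (l (\<iota> (e (t a))) (w a)) (\<iota> (e (s a)))"
proof -
  interpret V: bimod T V l r by fact
  interpret VB: bimod B V "\<lambda>b. l (\<iota> b)" "\<lambda>v b. r v (\<iota> b)" by (rule bimod_restrict[OF B.kalg_axioms alg_hom_iota assms(1)])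
  let ?R = "sq_zero T V l r"
  interpret R: kalg ?R by (rule V.kalg_sq_zero)
  note dk = derivs_klin[OF \<delta>] and dc = derivs_closed[OF \<delta>] and dm = derivs_mult[OF \<delta>]
  define g where "g b = (\<iota> b, \<delta> b)" for b
  have g: "alg_hom B ?R g"
    unfolding alg_hom_def
  proof (intro conjI ballI klinI)
    show "g \<one>\<^bsub>B\<^esub> = \<one>\<^bsub>?R\<^esub>" using alg_hom_one[OF alg_hom_iota] VB.deriv_one[OF \<delta>] by (simp add: g_def)
    fix b c assume b: "b \<in> carrier B"
    show "g b \<in> carrier ?R" using b dc[OF b] by (simp add: g_def)
    show "g (k \<odot>\<^bsub>B\<^esub> b) = k \<odot>\<^bsub>?R\<^esub> g b" for k
      using alg_hom_scal[OF alg_hom_iota b] klin_scal[OF dk b] by (simp add: g_def)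
    assume c: "c \<in> carrier B"
    show "g (b \<oplus>\<^bsub>B\<^esub> c) = g b \<oplus>\<^bsub>?R\<^esub> g c"
      using alg_hom_add[OF alg_hom_iota b c] klin_add[OF dk b c] by (simp add: g_def)
    show "g (b \<otimes>\<^bsub>B\<^esub> c) = g b \<otimes>\<^bsub>?R\<^esub> g c"
      using alg_hom_mult[OF alg_hom_iota b c] dm[OF b c] by (simp add: g_def)
  qed
  note gc = alg_hom_closed[OF g] and gm = alg_hom_mult[OF g]
  define q where "q a = g (e (t a)) \<otimes>\<^bsub>?R\<^esub> (\<alpha> a, w a) \<otimes>\<^bsub>?R\<^esub> g (e (s a))" for a
  have aw: "(\<alpha> a, w a) \<in> carrier ?R" if "a \<in> F" for a using that w[OF that] by simp
  have ge: "g (e x) \<in> carrier ?R" if "x \<in> verts Q" for x by (rule gc[OF e_in[OF that]])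
  have gi: "g (e x) \<otimes>\<^bsub>?R\<^esub> g (e x) = g (e x)" if "x \<in> verts Q" for x
    using gm[OF e_in[OF that] e_in[OF that]] e_idem[OF that] by simp
  have qc: "q a \<in> carrier ?R" if a: "a \<in> F" for a
    unfolding q_def by (intro R.m_closed ge aw a t_in s_in)
  have qe: "g (e (t a)) \<otimes>\<^bsub>?R\<^esub> q a \<otimes>\<^bsub>?R\<^esub> g (e (s a)) = q a" if a: "a \<in> F" for a
  proof -
    note m = ge[OF t_in[OF a]] ge[OF s_in[OF a]] aw[OF a]
    have "g (e (t a)) \<otimes>\<^bsub>?R\<^esub> q a = (g (e (t a)) \<otimes>\<^bsub>?R\<^esub> g (e (t a))) \<otimes>\<^bsub>?R\<^esub> (\<alpha> a, w a) \<otimes>\<^bsub>?R\<^esub> g (e (s a))"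
      unfolding q_def by (simp only: R.m_assoc m R.m_closed)
    also have "\<dots> = q a" unfolding gi[OF t_in[OF a]] q_def ..
    finally have 1: "g (e (t a)) \<otimes>\<^bsub>?R\<^esub> q a = q a" .
    have "q a \<otimes>\<^bsub>?R\<^esub> g (e (s a)) = g (e (t a)) \<otimes>\<^bsub>?R\<^esub> (\<alpha> a, w a) \<otimes>\<^bsub>?R\<^esub> (g (e (s a)) \<otimes>\<^bsub>?R\<^esub> g (e (s a)))"
      unfolding q_def by (simp only: R.m_assoc m R.m_closed)
    also have "\<dots> = q a" unfolding gi[OF s_in[OF a]] q_def ..
    finally show ?thesis unfolding 1 .
  qed
  have fst_q: "fst (q a) = \<alpha> a" if a: "a \<in> F" for a
    using alpha_left[OF a] alpha_right[OF a] by (simp add: q_def g_def)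
  obtain h where h: "alg_hom T ?R h" and hb: "\<And>b. b \<in> carrier B \<Longrightarrow> h (\<iota> b) = g b" and ha: "\<And>a. a \<in> F \<Longrightarrow> h (\<alpha> a) = q a"
    using T_universal[OF R.kalg_axioms g qc qe] by blast
  have hc: "fst (h x) \<in> carrier T" "snd (h x) \<in> carrier V" if "x \<in> carrier T" for x
    using alg_hom_closed[OF h that] by (auto simp: mem_Times_iff)
  have split: "h x = (fst (h x), snd (h x))" for x by simp
  have add: "h (x \<oplus>\<^bsub>T\<^esub> y) = (fst (h x) \<oplus>\<^bsub>T\<^esub> fst (h y), snd (h x) \<oplus>\<^bsub>V\<^esub> snd (h y))" if "x \<in> carrier T" "y \<in> carrier T" for x y
    using alg_hom_add[OF h that] by (metis split sq_zero_simps(5))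
  have mul: "h (x \<cdot> y) = (fst (h x) \<cdot> fst (h y), l (fst (h x)) (snd (h y)) \<oplus>\<^bsub>V\<^esub> r (snd (h x)) (fst (h y)))"
    if "x \<in> carrier T" "y \<in> carrier T" for x y
    using alg_hom_mult[OF h that] by (metis split sq_zero_simps(2))
  have sca: "h (c \<odot>\<^bsub>T\<^esub> x) = (c \<odot>\<^bsub>T\<^esub> fst (h x), c \<odot>\<^bsub>V\<^esub> snd (h x))" if "x \<in> carrier T" for c x
    using alg_hom_scal[OF h that] by (metis split sq_zero_simps(6))
  have fsth: "alg_hom T T (\<lambda>x. fst (h x))"
    unfolding alg_hom_def
  proof (intro conjI ballI klinI)
    show "fst (h \<one>\<^bsub>T\<^esub>) = \<one>\<^bsub>T\<^esub>" using alg_hom_one[OF h] by simp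
  qed (simp_all add: add mul sca hc(1))
  have id: "fst (h x) = x" if "x \<in> carrier T" for x
    by (rule alg_hom_id_if_gens[OF fsth _ _ that]) (simp_all add: hb ha g_def fst_q)
  define d where "d = (\<lambda>x\<in>carrier T. snd (h x))"
  have "klin T V d"
    by (rule klinI) (simp_all add: d_def hc add sca)
  then have "d \<in> derivs T V l r"
    by (simp add: derivs_def d_def mul id)
  moreover have "d (\<iota> b) = \<delta> b" if "b \<in> carrier B" for b using that by (simp add: d_def hb g_def)
  moreover have "d (\<alpha> a) = r (l (\<iota> (e (t a))) (w a)) (\<iota> (e (s a)))"
    if a: "a \<in> F" and z: "\<And>b. b \<in> carrier B \<Longrightarrow> \<delta> b = \<zero>\<^bsub>V\<^esub>" for a
    using a w[OF a] z[OF e_in[OF t_in[OF a]]] z[OF e_in[OF s_in[OF a]]] e_in[OF t_in[OF a]] e_in[OF s_in[OF a]]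
    by (simp add: d_def ha q_def g_def)
  ultimately show ?thesis by (rule that)
qed

text \<open>
  The new arrows generate an ideal complementary to \<open>B\<close>; the retraction sends them to \<open>0\<close>.
\<close>

lemma eps_exists: "\<exists>h. alg_hom T B h \<and> (\<forall>b\<in>carrier B. h (\<iota> b) = b) \<and> (\<forall>a\<in>F. h (\<alpha> a) = \<zero>\<^bsub>B\<^esub>)"
proof -
  have id: "alg_hom B B (\<lambda>b. b)" by (simp add: alg_hom_def klin_def)
  obtain h where "alg_hom T B h" "\<And>b. b \<in> carrier B \<Longrightarrow> h (\<iota> b) = b" "\<And>a. a \<in> F \<Longrightarrow> h (\<alpha> a) = \<zero>\<^bsub>B\<^esub>"
  proof (rule T_universal[OF B.kalg_axioms id, of "\<lambda>_. \<zero>\<^bsub>B\<^esub>"])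
    show "e (t a) \<otimes>\<^bsub>B\<^esub> \<zero>\<^bsub>B\<^esub> \<otimes>\<^bsub>B\<^esub> e (s a) = \<zero>\<^bsub>B\<^esub>" if "a \<in> F" for a
      using e_in[OF t_in[OF that]] e_in[OF s_in[OF that]] by simp
  qed simp_all
  then show ?thesis by blast
qed

definition \<epsilon> where "\<epsilon> = (SOME h. alg_hom T B h \<and> (\<forall>b\<in>carrier B. h (\<iota> b) = b) \<and> (\<forall>a\<in>F. h (\<alpha> a) = \<zero>\<^bsub>B\<^esub>))"

lemma alg_hom_eps: "alg_hom T B \<epsilon>"
  and eps_iota [simp]: "b \<in> carrier B \<Longrightarrow> \<epsilon> (\<iota> b) = b"
  and eps_alpha [simp]: "a \<in> F \<Longrightarrow> \<epsilon> (\<alpha> a) = \<zero>\<^bsub>B\<^esub>"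
  using someI_ex[OF eps_exists] by (auto simp: \<epsilon>_def)

lemma ec [simp]: "x \<in> carrier T \<Longrightarrow> \<epsilon> x \<in> carrier B"
  by (rule alg_hom_closed[OF alg_hom_eps])

end

section \<open>Modules generated by an idempotent\<close>

definition col_mod :: "('k, 'a) module \<Rightarrow> 'a \<Rightarrow> ('a, 'a) module" where
  "col_mod A f = \<lparr>carrier = {b \<otimes>\<^bsub>A\<^esub> f | b. b \<in> carrier A}, mult = undefined, one = undefined,
     zero = \<zero>\<^bsub>A\<^esub>, add = add A, smult = mult A\<rparr>"

lemma col_mod_simps [simp]:
  "carrier (col_mod A f) = {b \<otimes>\<^bsub>A\<^esub> f | b. b \<in> carrier A}"
  "zero (col_mod A f) = \<zero>\<^bsub>A\<^esub>" "add (col_mod A f) = add A" "smult (col_mod A f) = mult A"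
  by (simp_all add: col_mod_def)

lemma proj_mod_eq: "proj_mod Q I x = col_mod (bound_alg Q I) (idem Q I x)"
  by (simp add: proj_mod_def col_mod_def Let_def)

context kalg
begin

lemma subsp_sandwich:
  assumes "f \<in> carrier A" "g \<in> carrier A"
  shows "subsp A {f \<otimes> b \<otimes> g | b. b \<in> carrier A}"
proof (rule subspI)
  show "\<zero> \<in> {f \<otimes> b \<otimes> g | b. b \<in> carrier A}" using assms by (intro CollectI exI[of _ \<zero>]) simp
  fix x y c assume x: "x \<in> {f \<otimes> b \<otimes> g | b. b \<in> carrier A}"
  then obtain b where b: "x = f \<otimes> b \<otimes> g" "b \<in> carrier A" by blast
  show "c \<odot> x \<in> {f \<otimes> b \<otimes> g | b. b \<in> carrier A}" for c
    using assms b by (intro CollectI exI[of _ "c \<odot> b"]) (simp add: scal_mult_left scal_mult_right)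
  assume "y \<in> {f \<otimes> b \<otimes> g | b. b \<in> carrier A}"
  then obtain b' where b': "y = f \<otimes> b' \<otimes> g" "b' \<in> carrier A" by blast
  show "x \<oplus> y \<in> {f \<otimes> b \<otimes> g | b. b \<in> carrier A}"
    using assms b b' by (intro CollectI exI[of _ "b \<oplus> b'"]) (simp add: l_distr r_distr)
qed (use assms in auto)

lemma bmod_col_mod:
  assumes f: "f \<in> carrier A"
  shows "bmod A (col_mod A f)"
proof -
  have "subsp A {\<one> \<otimes> b \<otimes> f | b. b \<in> carrier A}" by (rule subsp_sandwich[OF one_closed f])
  moreover have "{\<one> \<otimes> b \<otimes> f | b. b \<in> carrier A} = {b \<otimes> f | b. b \<in> carrier A}" by force
  ultimately have sub: "subsp A {b \<otimes> f | b. b \<in> carrier A}" by simp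
  have c: "x \<in> carrier A" if "x \<in> {b \<otimes> f | b. b \<in> carrier A}" for x using that f by auto
  have v: "vect (underlying_space A (col_mod A f))"
  proof (rule vect_cong[OF subsp_vect[OF vect_axioms sub]])
    fix k x assume "x \<in> carrier (A\<lparr>carrier := {b \<otimes> f | b. b \<in> carrier A}\<rparr>)"
    then have "x \<in> carrier A" using f by auto
    then show "k \<odot>\<^bsub>underlying_space A (col_mod A f)\<^esub> x = k \<odot>\<^bsub>A\<lparr>carrier := {b \<otimes> f | b. b \<in> carrier A}\<rparr>\<^esub> x"
      using scal_one_mult by simp
  qed simp_all
  have cl: "a \<otimes> x \<in> {b \<otimes> f | b. b \<in> carrier A}" if "a \<in> carrier A" "x \<in> {b \<otimes> f | b. b \<in> carrier A}" for a x
  proof -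
    obtain b where "x = b \<otimes> f" "b \<in> carrier A" using \<open>x \<in> _\<close> by blast
    then show ?thesis using that(1) f by (intro CollectI exI[of _ "a \<otimes> b"]) (simp add: m_assoc)
  qed
  show ?thesis
  proof (intro lmod.intro kalg_axioms v lmod_axioms.intro; unfold underlying_space_simps col_mod_simps)
    fix a b x y k
    assume x: "x \<in> {b \<otimes> f | b. b \<in> carrier A}"
    note xc = c[OF x]
    show "\<one> \<otimes> x = x" using xc by simp
    assume a: "a \<in> carrier A"
    show "a \<otimes> x \<in> {b \<otimes> f | b. b \<in> carrier A}" by (rule cl[OF a x])
    show "k \<odot> a \<otimes> x = k \<odot> \<one> \<otimes> (a \<otimes> x)" using a xc by (simp add: scal_one_mult scal_mult_left)
    show "a \<otimes> (k \<odot> \<one> \<otimes> x) = k \<odot> \<one> \<otimes> (a \<otimes> x)" using a xc by (simp add: scal_one_mult scal_mult_right)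
    { assume "y \<in> {b \<otimes> f | b. b \<in> carrier A}"
      from c[OF this] show "a \<otimes> (x \<oplus> y) = a \<otimes> x \<oplus> a \<otimes> y" using a xc by (simp add: r_distr) }
    assume b: "b \<in> carrier A"
    show "(a \<oplus> b) \<otimes> x = a \<otimes> x \<oplus> b \<otimes> x" using a b xc by (simp add: l_distr)
    show "a \<otimes> b \<otimes> x = a \<otimes> (b \<otimes> x)" using a b xc by (simp add: m_assoc)
  qed
qed

end

lemma kdim_cong:
  assumes "vect V" "vect W" "carrier W = carrier V" "\<And>x y. x \<in> carrier V \<Longrightarrow> y \<in> carrier V \<Longrightarrow> x \<oplus>\<^bsub>W\<^esub> y = x \<oplus>\<^bsub>V\<^esub> y"
    "\<And>c x. x \<in> carrier V \<Longrightarrow> c \<odot>\<^bsub>W\<^esub> x = c \<odot>\<^bsub>V\<^esub> x" "\<zero>\<^bsub>W\<^esub> = \<zero>\<^bsub>V\<^esub>"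
  shows "kfin V \<longleftrightarrow> kfin W" "kdim V = kdim W \<or> \<not> kfin V"
proof -
  have k: "klin V W (\<lambda>x. x)" using assms by (intro klinI) simp_all
  note b = kdim_bij[OF assms(1,2) k]
  show "kfin V \<longleftrightarrow> kfin W" using b(1,2) assms(3,6) by blast
  show "kdim V = kdim W \<or> \<not> kfin V" using b(3) assms(3,6) by blast
qed

context bound_quiver
begin

definition rowV :: "'v \<Rightarrow> ('k, (('v, 'a) path \<Rightarrow> 'k) set) module" where
  "rowV x = B\<lparr>carrier := {e x \<otimes>\<^bsub>B\<^esub> b | b. b \<in> carrier B}\<rparr>"

lemma rowV_simps [simp]: "zero (rowV x) = \<zero>\<^bsub>B\<^esub>" "add (rowV x) = add B" "smult (rowV x) = smult B"
  by (simp_all add: rowV_def)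

lemma rowV_carrier: "x \<in> verts Q \<Longrightarrow> u \<in> carrier (rowV x) \<longleftrightarrow> u \<in> carrier B \<and> e x \<otimes>\<^bsub>B\<^esub> u = u"
proof -
  assume x: "x \<in> verts Q"
  note ex = e_in[OF x]
  have "e x \<otimes>\<^bsub>B\<^esub> (e x \<otimes>\<^bsub>B\<^esub> b) = e x \<otimes>\<^bsub>B\<^esub> b" if "b \<in> carrier B" for b
    using ex that e_idem[OF x] by (simp flip: B.m_assoc)
  then show ?thesis unfolding rowV_def using ex by force
qed

lemma vect_rowV: "x \<in> verts Q \<Longrightarrow> vect (rowV x)"
proof -
  assume x: "x \<in> verts Q"
  have "{e x \<otimes>\<^bsub>B\<^esub> b \<otimes>\<^bsub>B\<^esub> \<one>\<^bsub>B\<^esub> | b. b \<in> carrier B} = {e x \<otimes>\<^bsub>B\<^esub> b | b. b \<in> carrier B}"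
    using e_in[OF x] by force
  then show ?thesis
    using subsp_vect[OF B.vect_axioms B.subsp_sandwich[OF e_in[OF x] B.one_closed]] by (simp add: rowV_def)
qed

lemma rowV_mult: "x \<in> verts Q \<Longrightarrow> u \<in> carrier (rowV x) \<Longrightarrow> b \<in> carrier B \<Longrightarrow> u \<otimes>\<^bsub>B\<^esub> b \<in> carrier (rowV x)"
  using e_in by (simp add: rowV_carrier flip: B.m_assoc)

lemma kfin_rowV: "x \<in> verts Q \<Longrightarrow> kfin (rowV x)"
proof -
  assume x: "x \<in> verts Q"
  have k: "klin B (rowV x) (\<lambda>b. e x \<otimes>\<^bsub>B\<^esub> b)"
  proof (rule klinI)
    show "e x \<otimes>\<^bsub>B\<^esub> b \<in> carrier (rowV x)" if "b \<in> carrier B" for b using that by (auto simp: rowV_def)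
  qed (use e_in[OF x] in \<open>simp_all add: B.r_distr B.scal_mult_right\<close>)
  show ?thesis
    by (rule kfin_surj[OF B.vect_axioms vect_rowV[OF x] k kfin_B]) (auto simp: rowV_def)
qed

abbreviation "injV x \<equiv> underlying_space B (inj_mod Q I x)"
abbreviation "inj_act x \<equiv> smult (inj_mod Q I x)"

lemma inj_mod_simps:
  "carrier (inj_mod Q I x) = lin_maps class_ring (rowV x) ground_space"
  "zero (inj_mod Q I x) = (\<lambda>u\<in>carrier (rowV x). 0)"
  "add (inj_mod Q I x) = (\<lambda>\<phi> \<psi>. \<lambda>u\<in>carrier (rowV x). \<phi> u + \<psi> u)"
  "smult (inj_mod Q I x) = (\<lambda>b \<phi>. \<lambda>u\<in>carrier (rowV x). \<phi> (u \<otimes>\<^bsub>B\<^esub> b))"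
  by (simp_all add: inj_mod_def Let_def rowV_def)

lemma injV_klin: "\<phi> \<in> carrier (injV x) \<Longrightarrow> klin (rowV x) ground_space \<phi>"
  by (simp add: inj_mod_simps lin_maps_iff)

lemma rowV_B: "x \<in> verts Q \<Longrightarrow> u \<in> carrier (rowV x) \<Longrightarrow> u \<in> carrier B"
  by (simp add: rowV_carrier)

lemma inj_scal:
  assumes x: "x \<in> verts Q" and \<phi>: "\<phi> \<in> carrier (injV x)"
  shows "c \<odot>\<^bsub>injV x\<^esub> \<phi> = c \<odot>\<^bsub>hom_k (rowV x) ground_space\<^esub> \<phi>"
proof -
  have "\<phi> (u \<otimes>\<^bsub>B\<^esub> (c \<odot>\<^bsub>B\<^esub> \<one>\<^bsub>B\<^esub>)) = c * \<phi> u" if u: "u \<in> carrier (rowV x)" for u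
    using klin_scal[OF injV_klin[OF \<phi>] u, of c] rowV_B[OF x u] by (simp add: B.scal_mult_right)
  then show ?thesis by (auto simp: inj_mod_simps intro!: restrict_ext)
qed

lemma vect_injV: "x \<in> verts Q \<Longrightarrow> vect (injV x)"
proof (rule vect_cong[OF vect_hom_k[OF vect_rowV vect_ground_space]])
  show "c \<odot>\<^bsub>injV x\<^esub> \<phi> = c \<odot>\<^bsub>hom_k (rowV x) ground_space\<^esub> \<phi>"
    if "x \<in> verts Q" "\<phi> \<in> carrier (hom_k (rowV x) ground_space)" for c \<phi>
    using inj_scal[OF that(1), of \<phi> c] that(2) by (simp only: underlying_space_simps(1) inj_mod_simps(1) hom_k_simps(1))
qed (simp_all add: inj_mod_simps)

lemma kfin_ground_space: "kfin (ground_space :: ('k, 'k) module)"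
proof (rule kfinI[OF vect_ground_space, of "{1}"])
  interpret vect "ground_space :: ('k, 'k) module" by (rule vect_ground_space)
  show "\<exists>a. v = (\<Oplus>\<^bsub>ground_space\<^esub>p\<in>{1}. a p \<odot>\<^bsub>ground_space\<^esub> p)" for v :: 'k
    by (rule exI[of _ "\<lambda>_. v"]) (simp add: finsum_insert)
qed simp_all

lemma kfin_injV: "x \<in> verts Q \<Longrightarrow> kfin (injV x)"
proof -
  assume x: "x \<in> verts Q"
  let ?H = "hom_k (rowV x) ground_space"
  have "kfin ?H" by (rule kfin_hom_k[OF vect_rowV[OF x] vect_ground_space kfin_rowV[OF x] kfin_ground_space])
  then show ?thesis
    using kdim_cong(1)[OF vect_hom_k[OF vect_rowV[OF x] vect_ground_space] vect_injV[OF x]] inj_scal[OF x]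
    by (simp add: inj_mod_simps(1-3) del: underlying_space_simps(4))
qed

lemma bmod_inj_mod: "x \<in> verts Q \<Longrightarrow> bmod B (inj_mod Q I x)"
proof -
  assume x: "x \<in> verts Q"
  note rB = rowV_B[OF x] and rm = rowV_mult[OF x]
  interpret V: vect "injV x" by (rule vect_injV[OF x])
  have kB: "klin B (rowV x) (\<lambda>b. u \<otimes>\<^bsub>B\<^esub> b)" if "u \<in> carrier (rowV x)" for u
    by (rule klinI) (use that rB[OF that] rm[OF that] in \<open>simp_all add: B.r_distr B.scal_mult_right\<close>)
  have kr: "klin (rowV x) (rowV x) (\<lambda>u. u \<otimes>\<^bsub>B\<^esub> b)" if "b \<in> carrier B" for b
    by (rule klinI) (use that rB rm in \<open>simp_all add: B.l_distr B.scal_mult_left\<close>)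
  have cl: "inj_act x b \<phi> \<in> carrier (injV x)" if b: "b \<in> carrier B" and \<phi>: "\<phi> \<in> carrier (injV x)" for b \<phi>
    using klin_compose[OF kr[OF b] injV_klin[OF \<phi>]] by (simp add: inj_mod_simps lin_maps_iff klin_restrict[OF vect_rowV[OF x]])
  have eqI: "\<phi> = \<psi>" if "\<phi> \<in> extensional (carrier (rowV x))" "\<psi> \<in> extensional (carrier (rowV x))"
    "\<And>u. u \<in> carrier (rowV x) \<Longrightarrow> \<phi> u = \<psi> u" for \<phi> \<psi> :: "(('v, 'a) path \<Rightarrow> 'k) set \<Rightarrow> 'k"
    using that by (intro extensionalityI[of \<phi> "carrier (rowV x)" \<psi>]) auto
  show ?thesis
  proof (intro lmod.intro B.kalg_axioms V.vect_axioms lmod_axioms.intro cl)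
    fix a b \<phi> \<psi> k
    assume \<phi>: "\<phi> \<in> carrier (injV x)"
    note p = injV_klin[OF \<phi>]
    have pe: "\<phi> \<in> extensional (carrier (rowV x))" using \<phi> by (simp add: inj_mod_simps lin_maps_iff)
    show "inj_act x \<one>\<^bsub>B\<^esub> \<phi> = \<phi>" by (rule eqI; simp add: inj_mod_simps pe rB)
    assume a: "a \<in> carrier B"
    show "inj_act x (k \<odot>\<^bsub>B\<^esub> a) \<phi> = k \<odot>\<^bsub>injV x\<^esub> inj_act x a \<phi>"
      unfolding inj_scal[OF x cl[OF a \<phi>]]
      by (rule eqI; simp add: inj_mod_simps klin_scal[OF klin_compose[OF kB p] a])
    show "inj_act x a (k \<odot>\<^bsub>injV x\<^esub> \<phi>) = k \<odot>\<^bsub>injV x\<^esub> inj_act x a \<phi>"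
      unfolding inj_scal[OF x cl[OF a \<phi>]] inj_scal[OF x \<phi>]
      by (rule eqI; simp add: inj_mod_simps rm a)
    { assume "\<psi> \<in> carrier (injV x)"
      then show "inj_act x a (\<phi> \<oplus>\<^bsub>injV x\<^esub> \<psi>) = inj_act x a \<phi> \<oplus>\<^bsub>injV x\<^esub> inj_act x a \<psi>"
        by (intro eqI; simp add: inj_mod_simps rm a) }
    assume b: "b \<in> carrier B"
    show "inj_act x (a \<oplus>\<^bsub>B\<^esub> b) \<phi> = inj_act x a \<phi> \<oplus>\<^bsub>injV x\<^esub> inj_act x b \<phi>"
      by (rule eqI; simp add: inj_mod_simps klin_add[OF klin_compose[OF kB p] a b])
    show "inj_act x (a \<otimes>\<^bsub>B\<^esub> b) \<phi> = inj_act x a (inj_act x b \<phi>)"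
      by (rule eqI; simp add: inj_mod_simps rm rB a b B.m_assoc)
  qed
qed

end

lemma (in lmod) act_zero_left [simp]: "v \<in> carrier V \<Longrightarrow> act \<zero>\<^bsub>A\<^esub> v = \<zero>\<^bsub>V\<^esub>"
  using klin_zero[OF A.vect_axioms V.vect_axioms klin_act_arg] .

section \<open>Splitting off the first new arrow\<close>

context arrow_extension
begin

abbreviation "YT x \<equiv> underlying_space T (col_mod T (\<iota> (e x)))"
abbreviation "actT x \<equiv> (\<lambda>z. inj_act x (\<epsilon> z))"
abbreviation "MT a \<equiv> hom_k (injV (s a)) (YT (t a))"
abbreviation "lT a \<equiv> hom_left (injV (s a)) (mult T)"
abbreviation "rT a \<equiv> hom_right (injV (s a)) (actT (s a))"

lemma ie [simp]: "x \<in> verts Q \<Longrightarrow> \<iota> (e x) \<in> carrier T"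
  by (rule ic[OF e_in])

lemma ie_idem: "x \<in> verts Q \<Longrightarrow> \<iota> (e x) \<cdot> \<iota> (e x) = \<iota> (e x)"
  using alg_hom_mult[OF alg_hom_iota e_in e_in, of x x] e_idem by simp

lemma YT_lmod: "x \<in> verts Q \<Longrightarrow> lmod T (YT x) (mult T)"
  using T.bmod_col_mod[OF ie] by simp

lemma YT_carrier: "x \<in> verts Q \<Longrightarrow> z \<in> carrier (YT x) \<longleftrightarrow> z \<in> carrier T \<and> z \<cdot> \<iota> (e x) = z"
proof
  assume x: "x \<in> verts Q"
  show "z \<in> carrier T \<and> z \<cdot> \<iota> (e x) = z" if "z \<in> carrier (YT x)"
  proof -
    from that obtain b where b: "b \<in> carrier T" "z = b \<cdot> \<iota> (e x)" by auto
    then show ?thesis using ie[OF x] ie_idem[OF x] by (simp add: T.m_assoc)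
  qed
  show "z \<in> carrier (YT x)" if "z \<in> carrier T \<and> z \<cdot> \<iota> (e x) = z"
    by simp (rule exI[of _ z], use that in simp)
qed

lemma YT_scal: "x \<in> verts Q \<Longrightarrow> z \<in> carrier (YT x) \<Longrightarrow> c \<odot>\<^bsub>YT x\<^esub> z = c \<odot>\<^bsub>T\<^esub> z"
  using YT_carrier T.scal_one_mult by simp

lemma XT_lmod: "x \<in> verts Q \<Longrightarrow> lmod T (injV x) (actT x)"
  by (rule lmod_restrict[OF T.kalg_axioms alg_hom_eps bmod_inj_mod])

lemma MT_bimod: "a \<in> F \<Longrightarrow> bimod T (MT a) (lT a) (rT a)"
  by (intro bimod_hom_k XT_lmod YT_lmod s_in t_in)

lemma rowV_e: "x \<in> verts Q \<Longrightarrow> e x \<in> carrier (rowV x)"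
  by (simp add: rowV_carrier e_in e_idem)

lemma inj_eval: "x \<in> verts Q \<Longrightarrow> u \<in> carrier (rowV x) \<Longrightarrow> klin (injV x) ground_space (\<lambda>\<phi>. \<phi> u)"
proof (rule klinI)
  fix c \<phi> assume x: "x \<in> verts Q" and u: "u \<in> carrier (rowV x)" and \<phi>: "\<phi> \<in> carrier (injV x)"
  show "(c \<odot>\<^bsub>injV x\<^esub> \<phi>) u = c \<odot>\<^bsub>ground_space\<^esub> \<phi> u"
    unfolding inj_scal[OF x \<phi>] using u by simp
qed (simp_all add: inj_mod_simps)

lemma deriv_extend_zero:
  assumes V: "bimod T V l r" and w: "w \<in> carrier V" and a: "a \<in> F"
  shows "\<exists>d. d \<in> derivs T V l r \<and> (\<forall>b\<in>carrier B. d (\<iota> b) = \<zero>\<^bsub>V\<^esub>) \<and>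
    (\<forall>f\<in>F. d (\<alpha> f) = (if f = a then r (l (\<iota> (e (t a))) w) (\<iota> (e (s a))) else \<zero>\<^bsub>V\<^esub>))"
proof -
  interpret V: bimod T V l r by (rule V)
  interpret VB: bimod B V "\<lambda>b. l (\<iota> b)" "\<lambda>v b. r v (\<iota> b)" by (rule bimod_restrict[OF B.kalg_axioms alg_hom_iota V])
  interpret D: vect "der_space B V (\<lambda>b. l (\<iota> b)) (\<lambda>v b. r v (\<iota> b))" by (rule VB.vect_der_space)
  have z: "(\<lambda>b\<in>carrier B. \<zero>\<^bsub>V\<^esub>) \<in> derivs B V (\<lambda>b. l (\<iota> b)) (\<lambda>v b. r v (\<iota> b))"
    using D.zero_closed by simp
  let ?w = "\<lambda>f. if f = a then w else \<zero>\<^bsub>V\<^esub>"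
  have wV: "?w f \<in> carrier V" for f using w by simp
  show ?thesis
  proof (rule deriv_extend[OF V z, of ?w])
    show "?w f \<in> carrier V" for f by (rule wV)
    fix d assume d: "d \<in> derivs T V l r" and di: "\<And>b. b \<in> carrier B \<Longrightarrow> d (\<iota> b) = (\<lambda>b\<in>carrier B. \<zero>\<^bsub>V\<^esub>) b"
      and da: "\<And>f. f \<in> F \<Longrightarrow> (\<And>b. b \<in> carrier B \<Longrightarrow> (\<lambda>b\<in>carrier B. \<zero>\<^bsub>V\<^esub>) b = \<zero>\<^bsub>V\<^esub>) \<Longrightarrow>
        d (\<alpha> f) = r (l (\<iota> (e (t f))) (?w f)) (\<iota> (e (s f)))"
    show ?thesis
    proof (intro exI[of _ d] conjI ballI)
      show "d \<in> derivs T V l r" by (rule d)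
      show "d (\<iota> b) = \<zero>\<^bsub>V\<^esub>" if "b \<in> carrier B" for b using di[OF that] that by simp
      show "d (\<alpha> f) = (if f = a then r (l (\<iota> (e (t a))) w) (\<iota> (e (s a))) else \<zero>\<^bsub>V\<^esub>)" if f: "f \<in> F" for f
      proof -
        have "d (\<alpha> f) = r (l (\<iota> (e (t f))) (?w f)) (\<iota> (e (s f)))" by (rule da[OF f]) simp
        then show ?thesis using V.act_zero[OF ie[OF t_in[OF f]]] V.ract_zero[OF ie[OF s_in[OF f]]] by simp
      qed
    qed
  qed
qed

lemma Theta_exists:
  assumes a: "a \<in> F"
  shows "\<exists>d. d \<in> derivs T (MT a) (lT a) (rT a) \<and> (\<forall>b\<in>carrier B. d (\<iota> b) = \<zero>\<^bsub>MT a\<^esub>) \<and>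
    (\<forall>f\<in>F. \<forall>\<phi>\<in>carrier (injV (s a)). d (\<alpha> f) \<phi> = (if f = a then \<phi> (e (s a)) \<odot>\<^bsub>T\<^esub> \<iota> (e (t a)) else \<zero>\<^bsub>T\<^esub>))"
proof -
  have sv: "s a \<in> verts Q" and tv: "t a \<in> verts Q" using a by simp_all
  interpret M: bimod T "MT a" "lT a" "rT a" by (rule MT_bimod[OF a])
  interpret Y: lmod T "YT (t a)" "mult T" by (rule YT_lmod[OF tv])
  interpret X: lmod B "injV (s a)" "inj_act (s a)" by (rule bmod_inj_mod[OF sv])
  have etY: "\<iota> (e (t a)) \<in> carrier (YT (t a))" unfolding YT_carrier[OF tv] using ie[OF tv] ie_idem[OF tv] by simp
  let ?w = "\<lambda>\<phi>\<in>carrier (injV (s a)). \<phi> (e (s a)) \<odot>\<^bsub>YT (t a)\<^esub> \<iota> (e (t a))"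
  have wM: "?w \<in> carrier (MT a)"
  proof -
    have ev: "klin (injV (s a)) ground_space (\<lambda>\<phi>. \<phi> (e (s a)))" by (rule inj_eval[OF sv rowV_e[OF sv]])
    have "klin ground_space (YT (t a)) (\<lambda>c. c \<odot>\<^bsub>YT (t a)\<^esub> \<iota> (e (t a)))"
      by (rule klinI) (use Y.V.scal_closed[OF etY] Y.V.scal_add_left[OF etY] Y.V.scal_mult[OF etY] in
          \<open>simp_all del: underlying_space_simps(4)\<close>)
    from klin_compose[OF ev this] show ?thesis
      by (simp add: lin_maps_iff klin_restrict[OF X.V.vect_axioms] del: underlying_space_simps)
  qed
  obtain d where d: "d \<in> derivs T (MT a) (lT a) (rT a)" "\<forall>b\<in>carrier B. d (\<iota> b) = \<zero>\<^bsub>MT a\<^esub>"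
    and da: "\<forall>f\<in>F. d (\<alpha> f) = (if f = a then rT a (lT a (\<iota> (e (t a))) ?w) (\<iota> (e (s a))) else \<zero>\<^bsub>MT a\<^esub>)"
    using deriv_extend_zero[OF M.bimod_axioms wM a] by blast
  have "d (\<alpha> f) \<phi> = (if f = a then \<phi> (e (s a)) \<odot>\<^bsub>T\<^esub> \<iota> (e (t a)) else \<zero>\<^bsub>T\<^esub>)" if f: "f \<in> F" and \<phi>: "\<phi> \<in> carrier (injV (s a))" for f \<phi>
  proof (cases "f = a")
    case True
    have e\<phi>: "inj_act (s a) (e (s a)) \<phi> \<in> carrier (injV (s a))" by (rule X.act_closed[OF e_in[OF sv] \<phi>])
    have v: "inj_act (s a) (e (s a)) \<phi> (e (s a)) = \<phi> (e (s a))"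
      using rowV_e[OF sv] e_idem[OF sv] by (simp add: inj_mod_simps)
    have "d (\<alpha> f) \<phi> = \<iota> (e (t a)) \<cdot> (\<phi> (e (s a)) \<odot>\<^bsub>YT (t a)\<^esub> \<iota> (e (t a)))"
      using bspec[OF da f] True \<phi> e\<phi> v e_in[OF sv] by (simp add: hom_left_def hom_right_def del: underlying_space_simps(4))
    also have "\<dots> = \<phi> (e (s a)) \<odot>\<^bsub>T\<^esub> \<iota> (e (t a))"
      unfolding YT_scal[OF tv etY] using T.scal_mult_right[OF ie[OF tv] ie[OF tv]] ie_idem[OF tv] by simp
    finally show ?thesis using True by simp
  next
    case False
    have "d (\<alpha> f) = \<zero>\<^bsub>MT a\<^esub>" using bspec[OF da f] False by simp
    then show ?thesis using False \<phi> by simp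
  qed
  then show ?thesis using d by (intro exI[of _ d]) auto
qed

text \<open>
  The algebra \<open>T\<close> acts on the injective module \<open>I\<^bsub>s a\<^esub>\<close> through the retraction \<open>\<epsilon>\<close>. The Leibniz rule therefore
  drops every term in which \<open>\<Theta> a\<close> differentiates an arrow other than the first new one, and \<open>\<Theta> a\<close> reads off
  what follows a first new arrow \<open>a\<close>.
\<close>

definition \<Theta> where
  "\<Theta> a = (SOME d. d \<in> derivs T (MT a) (lT a) (rT a) \<and> (\<forall>b\<in>carrier B. d (\<iota> b) = \<zero>\<^bsub>MT a\<^esub>) \<and>
    (\<forall>f\<in>F. \<forall>\<phi>\<in>carrier (injV (s a)). d (\<alpha> f) \<phi> = (if f = a then \<phi> (e (s a)) \<odot>\<^bsub>T\<^esub> \<iota> (e (t a)) else \<zero>\<^bsub>T\<^esub>)))"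

lemma Theta:
  assumes "a \<in> F"
  shows Theta_deriv: "\<Theta> a \<in> derivs T (MT a) (lT a) (rT a)"
    and Theta_iota: "b \<in> carrier B \<Longrightarrow> \<Theta> a (\<iota> b) = \<zero>\<^bsub>MT a\<^esub>"
    and Theta_alpha: "f \<in> F \<Longrightarrow> \<phi> \<in> carrier (injV (s a)) \<Longrightarrow>
       \<Theta> a (\<alpha> f) \<phi> = (if f = a then \<phi> (e (s a)) \<odot>\<^bsub>T\<^esub> \<iota> (e (t a)) else \<zero>\<^bsub>T\<^esub>)"
  using someI_ex[OF Theta_exists[OF assms], folded \<Theta>_def] by blast+

lemma klin_Theta: "a \<in> F \<Longrightarrow> klin T (MT a) (\<Theta> a)"
  by (rule derivs_klin[OF Theta_deriv])

lemma klin_Theta_at: "a \<in> F \<Longrightarrow> z \<in> carrier T \<Longrightarrow> klin (injV (s a)) (YT (t a)) (\<Theta> a z)"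
  using klin_closed[OF klin_Theta, of a z] by (simp add: lin_maps_iff)

lemma YT_vect: "x \<in> verts Q \<Longrightarrow> vect (YT x)"
  using YT_lmod unfolding lmod_def by blast

lemma klin_Theta_arg: "a \<in> F \<Longrightarrow> \<phi> \<in> carrier (injV (s a)) \<Longrightarrow> klin T (YT (t a)) (\<lambda>z. \<Theta> a z \<phi>)"
  by (rule klin_compose[OF klin_Theta klin_eval[OF vect_injV YT_vect]]) simp_all

lemma Theta_in: "a \<in> F \<Longrightarrow> z \<in> carrier T \<Longrightarrow> \<phi> \<in> carrier (injV (s a)) \<Longrightarrow> \<Theta> a z \<phi> \<in> carrier (YT (t a))"
  by (rule klin_closed[OF klin_Theta_at])

lemma YT_T: "x \<in> verts Q \<Longrightarrow> z \<in> carrier (YT x) \<Longrightarrow> z \<in> carrier T"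
  by (simp only: YT_carrier)

lemma Theta_mult:
  assumes "a \<in> F" "z \<in> carrier T" "w \<in> carrier T" "\<phi> \<in> carrier (injV (s a))"
  shows "\<Theta> a (z \<cdot> w) \<phi> = z \<cdot> \<Theta> a w \<phi> \<oplus>\<^bsub>T\<^esub> \<Theta> a z (inj_act (s a) (\<epsilon> w) \<phi>)"
proof -
  interpret X: lmod B "injV (s a)" "inj_act (s a)" by (rule bmod_inj_mod[OF s_in[OF assms(1)]])
  show ?thesis
    using derivs_mult[OF Theta_deriv[OF assms(1)] assms(2,3)] assms(4) by (simp add: hom_left_def hom_right_def)
qed

lemma Theta_term:
  assumes a: "a \<in> F" and f: "f \<in> F" and y: "y \<in> carrier T" and v: "v \<in> carrier (rowV (s f))" and \<phi>: "\<phi> \<in> carrier (injV (s a))"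
  shows "\<Theta> a (y \<cdot> \<alpha> f \<cdot> \<iota> v) \<phi> = (if f = a then \<phi> v \<odot>\<^bsub>T\<^esub> (y \<cdot> \<iota> (e (t a))) else \<zero>\<^bsub>T\<^esub>)"
proof -
  have sv: "s a \<in> verts Q" and tv: "t a \<in> verts Q" using a by simp_all
  interpret X: lmod B "injV (s a)" "inj_act (s a)" by (rule bmod_inj_mod[OF sv])
  interpret Y: lmod T "YT (t a)" "mult T" by (rule YT_lmod[OF tv])
  have vB: "v \<in> carrier B" and ev: "e (s f) \<otimes>\<^bsub>B\<^esub> v = v" using v f by (simp_all add: rowV_carrier)
  have c: "\<alpha> f \<in> carrier T" "\<iota> v \<in> carrier T" "\<alpha> f \<cdot> \<iota> v \<in> carrier T" using f vB by simp_all
  have v\<phi>: "inj_act (s a) v \<phi> \<in> carrier (injV (s a))" by (rule X.act_closed[OF vB \<phi>])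
  have eps0: "\<epsilon> (\<alpha> f \<cdot> \<iota> v) = \<zero>\<^bsub>B\<^esub>"
    using alg_hom_mult[OF alg_hom_eps c(1,2)] f vB by simp
  have z0: "\<Theta> a z (\<zero>\<^bsub>injV (s a)\<^esub>) = \<zero>\<^bsub>T\<^esub>" if "z \<in> carrier T" for z
    using klin_zero[OF X.V.vect_axioms Y.V.vect_axioms klin_Theta_at[OF a that]] by simp
  have "\<Theta> a (\<alpha> f \<cdot> \<iota> v) \<phi> = \<alpha> f \<cdot> \<Theta> a (\<iota> v) \<phi> \<oplus>\<^bsub>T\<^esub> \<Theta> a (\<alpha> f) (inj_act (s a) (\<epsilon> (\<iota> v)) \<phi>)"
    by (rule Theta_mult[OF a c(1,2) \<phi>])
  also have "\<Theta> a (\<iota> v) \<phi> = \<zero>\<^bsub>T\<^esub>" using Theta_iota[OF a vB] \<phi> by simp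
  also have "\<Theta> a (\<alpha> f) (inj_act (s a) (\<epsilon> (\<iota> v)) \<phi>) = (if f = a then \<phi> v \<odot>\<^bsub>T\<^esub> \<iota> (e (t a)) else \<zero>\<^bsub>T\<^esub>)"
    using Theta_alpha[OF a f v\<phi>] vB ev rowV_e[OF sv] by (auto simp: inj_mod_simps(4))
  also have "\<alpha> f \<cdot> \<zero>\<^bsub>T\<^esub> \<oplus>\<^bsub>T\<^esub> (if f = a then \<phi> v \<odot>\<^bsub>T\<^esub> \<iota> (e (t a)) else \<zero>\<^bsub>T\<^esub>) = (if f = a then \<phi> v \<odot>\<^bsub>T\<^esub> \<iota> (e (t a)) else \<zero>\<^bsub>T\<^esub>)"
    using c tv by simp
  finally have 1: "\<Theta> a (\<alpha> f \<cdot> \<iota> v) \<phi> = (if f = a then \<phi> v \<odot>\<^bsub>T\<^esub> \<iota> (e (t a)) else \<zero>\<^bsub>T\<^esub>)" .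
  have "\<Theta> a (y \<cdot> (\<alpha> f \<cdot> \<iota> v)) \<phi> = y \<cdot> \<Theta> a (\<alpha> f \<cdot> \<iota> v) \<phi> \<oplus>\<^bsub>T\<^esub> \<Theta> a y (inj_act (s a) (\<epsilon> (\<alpha> f \<cdot> \<iota> v)) \<phi>)"
    by (rule Theta_mult[OF a y c(3) \<phi>])
  also have "\<Theta> a y (inj_act (s a) (\<epsilon> (\<alpha> f \<cdot> \<iota> v)) \<phi>) = \<zero>\<^bsub>T\<^esub>"
    unfolding eps0 X.act_zero_left[OF \<phi>] by (rule z0[OF y])
  finally show ?thesis unfolding 1 using y c tv by (simp add: T.m_assoc T.scal_mult_right)
qed

text \<open>
  The spanning set in which the first new arrow is singled out. It exhausts \<open>T\<close> because it contains \<open>1\<close> and is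
  stable under right multiplication by \<open>B\<close> and by the new arrows.
\<close>

inductive spanned where
  base: "b \<in> carrier B \<Longrightarrow> spanned (\<iota> b)"
| arrow: "f \<in> F \<Longrightarrow> y \<in> carrier T \<Longrightarrow> v \<in> carrier (rowV (s f)) \<Longrightarrow> spanned (y \<cdot> \<alpha> f \<cdot> \<iota> v)"
| add: "spanned x \<Longrightarrow> spanned y \<Longrightarrow> spanned (x \<oplus>\<^bsub>T\<^esub> y)"

lemma spanned_in: "spanned x \<Longrightarrow> x \<in> carrier T"
  by (induction rule: spanned.induct) (auto simp: rowV_carrier)

lemma spanned_mult:
  assumes "y \<in> carrier T"
  shows "spanned x \<Longrightarrow> spanned (x \<cdot> y)"
  using assms
proof (induction y arbitrary: x rule: T_generated)
  case (base b)
  from base(2) show ?case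
  proof (induction rule: spanned.induct)
    case (base c)
    then show ?case using spanned.base[of "c \<otimes>\<^bsub>B\<^esub> b"] alg_hom_mult[OF alg_hom_iota base \<open>b \<in> carrier B\<close>] \<open>b \<in> carrier B\<close> by simp
  next
    case (arrow f y v)
    have vB: "v \<in> carrier B" using arrow by (simp add: rowV_carrier)
    have "y \<cdot> \<alpha> f \<cdot> \<iota> v \<cdot> \<iota> b = y \<cdot> \<alpha> f \<cdot> \<iota> (v \<otimes>\<^bsub>B\<^esub> b)"
      using arrow vB \<open>b \<in> carrier B\<close> by (simp add: alg_hom_mult[OF alg_hom_iota] T.m_assoc)
    then show ?case using spanned.arrow[OF arrow(1,2) rowV_mult[OF s_in[OF arrow(1)] arrow(3) \<open>b \<in> carrier B\<close>]] by simp
  next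
    case (add x y)
    then show ?case using spanned.add[OF add.IH] spanned_in[OF add.hyps(1)] spanned_in[OF add.hyps(2)] \<open>b \<in> carrier B\<close>
      by (simp add: T.l_distr)
  qed
next
  case (arrow a)
  have "x \<cdot> \<alpha> a = x \<cdot> \<alpha> a \<cdot> \<iota> (e (s a))"
    using alpha_right[OF arrow(1)] spanned_in[OF arrow(2)] arrow(1) by (simp add: T.m_assoc)
  then show ?case using spanned.arrow[OF arrow(1) spanned_in[OF arrow(2)] rowV_e[OF s_in[OF arrow(1)]]] by simp
next
  case (add y z)
  then show ?case using spanned.add[OF add.IH(1)[OF add.prems] add.IH(2)[OF add.prems]] spanned_in[OF add.prems]
    by (simp add: T.r_distr)
next
  case (mult y z)
  then show ?case using mult.IH(2)[OF mult.IH(1)[OF mult.prems]] spanned_in[OF mult.prems] by (simp add: T.m_assoc)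
qed

lemma spanned_all: "x \<in> carrier T \<Longrightarrow> spanned x"
  using spanned_mult[of x "\<one>\<^bsub>T\<^esub>"] spanned.base[OF B.one_closed] alg_hom_one[OF alg_hom_iota] by simp

text \<open>
  The space \<open>e\<^bsub>s a\<^esub> B f\<close> for an idempotent \<open>f\<close> of \<open>B\<close>. The case \<open>f = 1\<close> serves to split \<open>T\<close> as a bimodule, the case
  \<open>f = e x\<close> to split the left module \<open>T e\<^sub>x\<close>.
\<close>

definition cornerV where
  "cornerV a f = B\<lparr>carrier := {e (s a) \<otimes>\<^bsub>B\<^esub> b \<otimes>\<^bsub>B\<^esub> f | b. b \<in> carrier B}\<rparr>"

lemma cornerV_simps [simp]: "zero (cornerV a f) = \<zero>\<^bsub>B\<^esub>" "add (cornerV a f) = add B" "smult (cornerV a f) = smult B"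
  by (simp_all add: cornerV_def)

lemma vect_cornerV: "a \<in> F \<Longrightarrow> f \<in> carrier B \<Longrightarrow> vect (cornerV a f)"
  unfolding cornerV_def by (intro subsp_vect B.vect_axioms B.subsp_sandwich e_in s_in)

lemma kfin_cornerV: "a \<in> F \<Longrightarrow> f \<in> carrier B \<Longrightarrow> kfin (cornerV a f)"
  unfolding cornerV_def by (intro kfin_subsp B.vect_axioms B.subsp_sandwich e_in s_in kfin_B)

definition basis_coords where
  "basis_coords a f = (SOME x. dual_basis (cornerV a f) (fst x) (snd x) \<and> card (fst x) = kdim (cornerV a f))"

definition bas where "bas a f = fst (basis_coords a f)"
definition crd where "crd a f = snd (basis_coords a f)"

lemma bas_crd:
  assumes "a \<in> F" "f \<in> carrier B"
  shows "dual_basis (cornerV a f) (bas a f) (crd a f)" "card (bas a f) = kdim (cornerV a f)"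
proof -
  have "\<exists>x. dual_basis (cornerV a f) (fst x) (snd x) \<and> card (fst x) = kdim (cornerV a f)"
    using dual_basis_exists[OF vect_cornerV[OF assms] kfin_cornerV[OF assms]] by auto
  from someI_ex[OF this] show "dual_basis (cornerV a f) (bas a f) (crd a f)" "card (bas a f) = kdim (cornerV a f)"
    by (simp_all add: bas_def crd_def basis_coords_def)
qed

lemma bas_facts:
  assumes "a \<in> F" "f \<in> carrier B" "f \<otimes>\<^bsub>B\<^esub> f = f"
  shows finite_bas: "finite (bas a f)"
    and bas_row: "p \<in> bas a f \<Longrightarrow> p \<in> carrier (rowV (s a))"
    and bas_f: "p \<in> bas a f \<Longrightarrow> p \<otimes>\<^bsub>B\<^esub> f = p"
    and crd_rec: "u \<in> carrier (rowV (s a)) \<Longrightarrow> u \<otimes>\<^bsub>B\<^esub> f = (\<Oplus>\<^bsub>B\<^esub>p\<in>bas a f. crd a f p (u \<otimes>\<^bsub>B\<^esub> f) \<odot>\<^bsub>B\<^esub> p)"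
    and crd_delta: "p \<in> bas a f \<Longrightarrow> q \<in> bas a f \<Longrightarrow> crd a f p q = (if p = q then 1 else 0)"
proof -
  note d = bas_crd(1)[OF assms(1,2)]
  have ev: "e (s a) \<in> carrier B" using e_in assms(1) by simp
  show "finite (bas a f)" using d by (simp add: dual_basis_def)
  show "crd a f p q = (if p = q then 1 else 0)" if "p \<in> bas a f" "q \<in> bas a f" using d that by (simp add: dual_basis_def)
  have rep: "\<exists>b\<in>carrier B. p = e (s a) \<otimes>\<^bsub>B\<^esub> b \<otimes>\<^bsub>B\<^esub> f" if "p \<in> bas a f" for p
    using d that by (auto simp: dual_basis_def cornerV_def)
  show "p \<in> carrier (rowV (s a))" if p: "p \<in> bas a f"
    using rep[OF p] ev assms e_idem[of "s a"] by (auto simp: rowV_carrier simp flip: B.m_assoc)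
  show "p \<otimes>\<^bsub>B\<^esub> f = p" if p: "p \<in> bas a f"
    using rep[OF p] ev assms by (auto simp: B.m_assoc)
  show "u \<otimes>\<^bsub>B\<^esub> f = (\<Oplus>\<^bsub>B\<^esub>p\<in>bas a f. crd a f p (u \<otimes>\<^bsub>B\<^esub> f) \<odot>\<^bsub>B\<^esub> p)" if u: "u \<in> carrier (rowV (s a))"
  proof -
    have uB: "u \<in> carrier B" "e (s a) \<otimes>\<^bsub>B\<^esub> u = u" using u assms(1) by (simp_all add: rowV_carrier)
    then have uf: "u \<otimes>\<^bsub>B\<^esub> f \<in> carrier (cornerV a f)"
      unfolding cornerV_def by (simp, intro exI[of _ u]) simp
    have mem: "(\<lambda>p. crd a f p (u \<otimes>\<^bsub>B\<^esub> f) \<odot>\<^bsub>B\<^esub> p) \<in> bas a f \<rightarrow> carrier (cornerV a f)"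
      using d vect.scal_closed[OF vect_cornerV[OF assms(1,2)]] by (auto simp: dual_basis_def subset_iff)
    have k: "klin (cornerV a f) B (\<lambda>x. x)"
    proof (rule klinI)
      show "x \<in> carrier B" if "x \<in> carrier (cornerV a f)" for x using that ev assms(2) by (auto simp: cornerV_def)
    qed simp_all
    have "u \<otimes>\<^bsub>B\<^esub> f = (\<Oplus>\<^bsub>cornerV a f\<^esub>p\<in>bas a f. crd a f p (u \<otimes>\<^bsub>B\<^esub> f) \<odot>\<^bsub>cornerV a f\<^esub> p)"
      using d uf unfolding dual_basis_def by blast
    also have "\<dots> = (\<Oplus>\<^bsub>B\<^esub>p\<in>bas a f. crd a f p (u \<otimes>\<^bsub>B\<^esub> f) \<odot>\<^bsub>B\<^esub> p)"
      using klin_finsum[OF vect_cornerV[OF assms(1,2)] B.vect_axioms k _ mem] d by (simp add: dual_basis_def)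
    finally show ?thesis .
  qed
qed

text \<open>
  The coordinates of \<open>u f\<close>, as elements of the injective module \<open>I\<^bsub>s a\<^esub>\<close> of functionals on \<open>e\<^bsub>s a\<^esub> B\<close>.
\<close>

definition cfun where
  "cfun a f p = (\<lambda>u\<in>carrier (rowV (s a)). crd a f p (u \<otimes>\<^bsub>B\<^esub> f))"

lemma cfun_in:
  assumes "a \<in> F" "f \<in> carrier B" "p \<in> bas a f"
  shows "cfun a f p \<in> carrier (injV (s a))"
proof -
  have sv: "s a \<in> verts Q" using assms(1) by simp
  have "klin (rowV (s a)) (cornerV a f) (\<lambda>u. u \<otimes>\<^bsub>B\<^esub> f)"
  proof (rule klinI)
    show "u \<otimes>\<^bsub>B\<^esub> f \<in> carrier (cornerV a f)" if "u \<in> carrier (rowV (s a))" for u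
      using that sv unfolding cornerV_def by (simp add: rowV_carrier, intro exI[of _ u]) simp
  qed (use rowV_B[OF sv] assms(2) in \<open>simp_all add: B.l_distr B.scal_mult_left\<close>)
  moreover have "klin (cornerV a f) ground_space (crd a f p)"
    using bas_crd(1)[OF assms(1,2)] assms(3) by (simp add: dual_basis_def)
  ultimately show ?thesis
    using klin_compose by (simp add: inj_mod_simps(1) lin_maps_iff cfun_def klin_restrict[OF vect_rowV[OF sv]])
qed

text \<open>
  The element of \<open>T f\<close> with given component \<open>b\<close> in \<open>B f\<close> and given coefficients \<open>w a p\<close>: the inverse of the map
  that sends \<open>z\<close> to \<open>\<epsilon> z\<close> and to the values of the \<open>\<Theta> a z\<close> on the coordinate functionals.
\<close>

definition assemble where
  "assemble f b w = \<iota> b \<oplus>\<^bsub>T\<^esub> (\<Oplus>\<^bsub>T\<^esub>a\<in>F. \<Oplus>\<^bsub>T\<^esub>p\<in>bas a f. w a p \<cdot> \<alpha> a \<cdot> \<iota> p)"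

context
  fixes f
  assumes f: "f \<in> carrier B" and ff: "f \<otimes>\<^bsub>B\<^esub> f = f"
begin

lemma bas_B: "a \<in> F \<Longrightarrow> p \<in> bas a f \<Longrightarrow> p \<in> carrier B"
  using bas_row[OF _ f ff] rowV_B s_in by blast

lemma inner_mem:
  assumes "a \<in> F" "\<And>p. p \<in> bas a f \<Longrightarrow> w p \<in> carrier T"
  shows "(\<lambda>p. w p \<cdot> \<alpha> a \<cdot> \<iota> p) \<in> bas a f \<rightarrow> carrier T"
  using assms bas_B by simp

text \<open>
  Both sides are linear in \<open>z\<close>, so that it suffices to consider the spanning elements. For \<open>y a v\<close> the
  claim is the expansion of \<open>v f\<close> in the basis \<open>bas a f\<close>.
\<close>

lemma reconstruct:
  assumes "z \<in> carrier T"
  shows "z \<cdot> \<iota> f = assemble f (\<epsilon> z \<otimes>\<^bsub>B\<^esub> f) (\<lambda>a p. \<Theta> a z (cfun a f p))"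
proof -
  have th: "\<Theta> a z (cfun a f p) \<in> carrier T" if "a \<in> F" "p \<in> bas a f" "z \<in> carrier T" for a p z
    using YT_T[OF t_in[OF that(1)] Theta_in[OF that(1,3) cfun_in[OF that(1) f that(2)]]] .
  have im: "(\<lambda>p. \<Theta> a z (cfun a f p) \<cdot> \<alpha> a \<cdot> \<iota> p) \<in> bas a f \<rightarrow> carrier T" if "a \<in> F" "z \<in> carrier T" for a z
    by (rule inner_mem[OF that(1) th[OF that(1) _ that(2)]])
  let ?S = "\<lambda>z. \<Oplus>\<^bsub>T\<^esub>a\<in>F. \<Oplus>\<^bsub>T\<^esub>p\<in>bas a f. \<Theta> a z (cfun a f p) \<cdot> \<alpha> a \<cdot> \<iota> p"
  have om: "(\<lambda>a. \<Oplus>\<^bsub>T\<^esub>p\<in>bas a f. \<Theta> a z (cfun a f p) \<cdot> \<alpha> a \<cdot> \<iota> p) \<in> F \<rightarrow> carrier T" if "z \<in> carrier T" for z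
    by (rule Pi_I) (rule T.finsum_closed[OF im[OF _ that]])
  from spanned_all[OF assms] show ?thesis unfolding assemble_def
  proof (induction rule: spanned.induct)
    case (base b)
    have "?S (\<iota> b) = (\<Oplus>\<^bsub>T\<^esub>a\<in>F. \<zero>\<^bsub>T\<^esub>)"
    proof (rule T.finsum_cong'[OF refl])
      fix a assume a: "a \<in> F"
      have "(\<Oplus>\<^bsub>T\<^esub>p\<in>bas a f. \<Theta> a (\<iota> b) (cfun a f p) \<cdot> \<alpha> a \<cdot> \<iota> p) = (\<Oplus>\<^bsub>T\<^esub>p\<in>bas a f. \<zero>\<^bsub>T\<^esub>)"
      proof (rule T.finsum_cong'[OF refl])
        fix p assume p: "p \<in> bas a f"
        have "\<Theta> a (\<iota> b) (cfun a f p) = \<zero>\<^bsub>T\<^esub>" using Theta_iota[OF a base] cfun_in[OF a f p] by simp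
        then show "\<Theta> a (\<iota> b) (cfun a f p) \<cdot> \<alpha> a \<cdot> \<iota> p = \<zero>\<^bsub>T\<^esub>" using a bas_B[OF a p] by simp
      qed simp
      then show "(\<Oplus>\<^bsub>T\<^esub>p\<in>bas a f. \<Theta> a (\<iota> b) (cfun a f p) \<cdot> \<alpha> a \<cdot> \<iota> p) = \<zero>\<^bsub>T\<^esub>" by simp
    qed simp
    then show ?case using base f alg_hom_mult[OF alg_hom_iota base f] by simp
  next
    case (arrow g y v)
    have vB: "v \<in> carrier B" using arrow by (simp add: rowV_carrier)
    have tg: "t g \<in> verts Q" using arrow by simp
    let ?z = "y \<cdot> \<alpha> g \<cdot> \<iota> v"
    have zT: "?z \<in> carrier T" using arrow vB by simp
    have e0: "\<epsilon> ?z = \<zero>\<^bsub>B\<^esub>"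
      using arrow vB by (simp add: alg_hom_mult[OF alg_hom_eps])
    let ?G = "y \<cdot> \<alpha> g \<cdot> \<iota> (v \<otimes>\<^bsub>B\<^esub> f)"
    have vf: "v \<otimes>\<^bsub>B\<^esub> f \<in> carrier B" using vB f by simp
    have bg: "bas g f \<subseteq> carrier B" using bas_B[OF arrow(1)] by blast
    have inner: "(\<Oplus>\<^bsub>T\<^esub>p\<in>bas a f. \<Theta> a ?z (cfun a f p) \<cdot> \<alpha> a \<cdot> \<iota> p) = (if g = a then ?G else \<zero>\<^bsub>T\<^esub>)" if a: "a \<in> F" for a
    proof (cases "g = a")
      case False
      have "(\<Oplus>\<^bsub>T\<^esub>p\<in>bas a f. \<Theta> a ?z (cfun a f p) \<cdot> \<alpha> a \<cdot> \<iota> p) = (\<Oplus>\<^bsub>T\<^esub>p\<in>bas a f. \<zero>\<^bsub>T\<^esub>)"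
      proof (rule T.finsum_cong'[OF refl])
        fix p assume p: "p \<in> bas a f"
        have "\<Theta> a ?z (cfun a f p) = \<zero>\<^bsub>T\<^esub>" using Theta_term[OF a arrow(1-3) cfun_in[OF a f p]] False by simp
        then show "\<Theta> a ?z (cfun a f p) \<cdot> \<alpha> a \<cdot> \<iota> p = \<zero>\<^bsub>T\<^esub>" using a bas_B[OF a p] by simp
      qed simp
      then show ?thesis using False by simp
    next
      case True
      have k: "klin B T (\<lambda>b. y \<cdot> \<alpha> g \<cdot> \<iota> b)"
        using arrow by (intro klinI) (simp_all add: alg_hom_add[OF alg_hom_iota] alg_hom_scal[OF alg_hom_iota] T.r_distr T.scal_mult_right)
      have "(\<Oplus>\<^bsub>T\<^esub>p\<in>bas g f. \<Theta> g ?z (cfun g f p) \<cdot> \<alpha> g \<cdot> \<iota> p)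
          = (\<Oplus>\<^bsub>T\<^esub>p\<in>bas g f. y \<cdot> \<alpha> g \<cdot> \<iota> (crd g f p (v \<otimes>\<^bsub>B\<^esub> f) \<odot>\<^bsub>B\<^esub> p))"
      proof (rule T.finsum_cong'[OF refl])
        show "(\<lambda>p. y \<cdot> \<alpha> g \<cdot> \<iota> (crd g f p (v \<otimes>\<^bsub>B\<^esub> f) \<odot>\<^bsub>B\<^esub> p)) \<in> bas g f \<rightarrow> carrier T"
          using bg arrow by (auto simp: subset_iff)
        fix p assume p: "p \<in> bas g f"
        have pB: "p \<in> carrier B" using bg p by blast
        have "\<Theta> g ?z (cfun g f p) = crd g f p (v \<otimes>\<^bsub>B\<^esub> f) \<odot>\<^bsub>T\<^esub> (y \<cdot> \<iota> (e (t g)))"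
          using Theta_term[OF arrow(1) arrow(1-3) cfun_in[OF arrow(1) f p]] arrow(3) by (simp add: cfun_def)
        then show "\<Theta> g ?z (cfun g f p) \<cdot> \<alpha> g \<cdot> \<iota> p = y \<cdot> \<alpha> g \<cdot> \<iota> (crd g f p (v \<otimes>\<^bsub>B\<^esub> f) \<odot>\<^bsub>B\<^esub> p)"
          using arrow(1,2) tg pB alpha_left[OF arrow(1)]
          by (simp add: alg_hom_scal[OF alg_hom_iota] T.scal_mult_left T.scal_mult_right T.m_assoc)
      qed
      also have "\<dots> = y \<cdot> \<alpha> g \<cdot> \<iota> (\<Oplus>\<^bsub>B\<^esub>p\<in>bas g f. crd g f p (v \<otimes>\<^bsub>B\<^esub> f) \<odot>\<^bsub>B\<^esub> p)"
        by (rule klin_finsum[OF B.vect_axioms T.vect_axioms k finite_bas[OF arrow(1) f ff], symmetric]) (use bg in auto)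
      also have "\<dots> = ?G" using crd_rec[OF arrow(1) f ff arrow(3)] by simp
      finally show ?thesis using True by simp
    qed
    have GT: "?G \<in> carrier T" using arrow vf by simp
    have "?S ?z = (\<Oplus>\<^bsub>T\<^esub>a\<in>F. if g = a then ?G else \<zero>\<^bsub>T\<^esub>)"
      by (rule T.finsum_cong'[OF refl]) (use inner GT in auto)
    also have "\<dots> = ?G" by (rule T.finsum_singleton) (use arrow(1) GT in auto)
    finally have S: "?S ?z = ?G" .
    have "?z \<cdot> \<iota> f = ?G" using arrow vB f by (simp add: alg_hom_mult[OF alg_hom_iota] T.m_assoc)
    moreover have "\<iota> (\<epsilon> ?z \<otimes>\<^bsub>B\<^esub> f) = \<zero>\<^bsub>T\<^esub>"
      using e0 f klin_zero[OF B.vect_axioms T.vect_axioms alg_hom_klin[OF alg_hom_iota]] by simp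
    ultimately show ?case unfolding S using GT by simp
  next
    case (add x y)
    have xy: "x \<in> carrier T" "y \<in> carrier T" using add spanned_in by blast+
    have "?S (x \<oplus>\<^bsub>T\<^esub> y) = (\<Oplus>\<^bsub>T\<^esub>a\<in>F. (\<Oplus>\<^bsub>T\<^esub>p\<in>bas a f. \<Theta> a x (cfun a f p) \<cdot> \<alpha> a \<cdot> \<iota> p) \<oplus>\<^bsub>T\<^esub>
        (\<Oplus>\<^bsub>T\<^esub>p\<in>bas a f. \<Theta> a y (cfun a f p) \<cdot> \<alpha> a \<cdot> \<iota> p))"
    proof (rule T.finsum_cong'[OF refl])
      show "(\<lambda>a. (\<Oplus>\<^bsub>T\<^esub>p\<in>bas a f. \<Theta> a x (cfun a f p) \<cdot> \<alpha> a \<cdot> \<iota> p) \<oplus>\<^bsub>T\<^esub>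
        (\<Oplus>\<^bsub>T\<^esub>p\<in>bas a f. \<Theta> a y (cfun a f p) \<cdot> \<alpha> a \<cdot> \<iota> p)) \<in> F \<rightarrow> carrier T"
        using om[OF xy(1)] om[OF xy(2)] by (auto simp: Pi_iff)
      fix a assume a: "a \<in> F"
      have "(\<Oplus>\<^bsub>T\<^esub>p\<in>bas a f. \<Theta> a (x \<oplus>\<^bsub>T\<^esub> y) (cfun a f p) \<cdot> \<alpha> a \<cdot> \<iota> p) =
        (\<Oplus>\<^bsub>T\<^esub>p\<in>bas a f. \<Theta> a x (cfun a f p) \<cdot> \<alpha> a \<cdot> \<iota> p \<oplus>\<^bsub>T\<^esub> \<Theta> a y (cfun a f p) \<cdot> \<alpha> a \<cdot> \<iota> p)"
      proof (rule T.finsum_cong'[OF refl])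
        show "(\<lambda>p. \<Theta> a x (cfun a f p) \<cdot> \<alpha> a \<cdot> \<iota> p \<oplus>\<^bsub>T\<^esub> \<Theta> a y (cfun a f p) \<cdot> \<alpha> a \<cdot> \<iota> p) \<in> bas a f \<rightarrow> carrier T"
          using im[OF a xy(1)] im[OF a xy(2)] by (auto simp: Pi_iff)
        fix p assume p: "p \<in> bas a f"
        have "\<Theta> a (x \<oplus>\<^bsub>T\<^esub> y) (cfun a f p) = \<Theta> a x (cfun a f p) \<oplus>\<^bsub>T\<^esub> \<Theta> a y (cfun a f p)"
          using klin_add[OF klin_Theta_arg[OF a cfun_in[OF a f p]] xy] by simp
        then show "\<Theta> a (x \<oplus>\<^bsub>T\<^esub> y) (cfun a f p) \<cdot> \<alpha> a \<cdot> \<iota> p =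
          \<Theta> a x (cfun a f p) \<cdot> \<alpha> a \<cdot> \<iota> p \<oplus>\<^bsub>T\<^esub> \<Theta> a y (cfun a f p) \<cdot> \<alpha> a \<cdot> \<iota> p"
          using th[OF a p xy(1)] th[OF a p xy(2)] a bas_B[OF a p] by (simp add: T.l_distr)
      qed
      also have "\<dots> = (\<Oplus>\<^bsub>T\<^esub>p\<in>bas a f. \<Theta> a x (cfun a f p) \<cdot> \<alpha> a \<cdot> \<iota> p) \<oplus>\<^bsub>T\<^esub>
        (\<Oplus>\<^bsub>T\<^esub>p\<in>bas a f. \<Theta> a y (cfun a f p) \<cdot> \<alpha> a \<cdot> \<iota> p)"
        by (rule T.finsum_addf[OF im[OF a xy(1)] im[OF a xy(2)]])
      finally show "(\<Oplus>\<^bsub>T\<^esub>p\<in>bas a f. \<Theta> a (x \<oplus>\<^bsub>T\<^esub> y) (cfun a f p) \<cdot> \<alpha> a \<cdot> \<iota> p) =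
        (\<Oplus>\<^bsub>T\<^esub>p\<in>bas a f. \<Theta> a x (cfun a f p) \<cdot> \<alpha> a \<cdot> \<iota> p) \<oplus>\<^bsub>T\<^esub>
        (\<Oplus>\<^bsub>T\<^esub>p\<in>bas a f. \<Theta> a y (cfun a f p) \<cdot> \<alpha> a \<cdot> \<iota> p)" .
    qed
    also have "\<dots> = ?S x \<oplus>\<^bsub>T\<^esub> ?S y" by (rule T.finsum_addf[OF om[OF xy(1)] om[OF xy(2)]])
    finally have S: "?S (x \<oplus>\<^bsub>T\<^esub> y) = ?S x \<oplus>\<^bsub>T\<^esub> ?S y" .
    have Sc: "?S x \<in> carrier T" "?S y \<in> carrier T" using T.finsum_closed[OF om[OF xy(1)]] T.finsum_closed[OF om[OF xy(2)]] by blast+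
    have "\<iota> (\<epsilon> (x \<oplus>\<^bsub>T\<^esub> y) \<otimes>\<^bsub>B\<^esub> f) = \<iota> (\<epsilon> x \<otimes>\<^bsub>B\<^esub> f) \<oplus>\<^bsub>T\<^esub> \<iota> (\<epsilon> y \<otimes>\<^bsub>B\<^esub> f)"
      using xy f by (simp add: alg_hom_add[OF alg_hom_eps] B.l_distr alg_hom_add[OF alg_hom_iota])
    moreover have "(x \<oplus>\<^bsub>T\<^esub> y) \<cdot> \<iota> f = x \<cdot> \<iota> f \<oplus>\<^bsub>T\<^esub> y \<cdot> \<iota> f" using xy f by (simp add: T.l_distr)
    moreover have "\<iota> (\<epsilon> x \<otimes>\<^bsub>B\<^esub> f) \<in> carrier T" "\<iota> (\<epsilon> y \<otimes>\<^bsub>B\<^esub> f) \<in> carrier T" using xy f by simp_all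
    ultimately show ?case unfolding S add.IH using Sc by (simp add: T.a_ac)
  qed
qed

lemma split_inj:
  assumes z: "z \<in> carrier T" "z \<cdot> \<iota> f = z" and eps: "\<epsilon> z = \<zero>\<^bsub>B\<^esub>"
    and th: "\<And>a p. a \<in> F \<Longrightarrow> p \<in> bas a f \<Longrightarrow> \<Theta> a z (cfun a f p) = \<zero>\<^bsub>T\<^esub>"
  shows "z = \<zero>\<^bsub>T\<^esub>"
proof -
  have "(\<Oplus>\<^bsub>T\<^esub>a\<in>F. \<Oplus>\<^bsub>T\<^esub>p\<in>bas a f. \<Theta> a z (cfun a f p) \<cdot> \<alpha> a \<cdot> \<iota> p) = (\<Oplus>\<^bsub>T\<^esub>a\<in>F. \<Oplus>\<^bsub>T\<^esub>p\<in>bas a f. \<zero>\<^bsub>T\<^esub>)"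
  proof (rule T.finsum_cong'[OF refl])
    fix a assume a: "a \<in> F"
    show "(\<Oplus>\<^bsub>T\<^esub>p\<in>bas a f. \<Theta> a z (cfun a f p) \<cdot> \<alpha> a \<cdot> \<iota> p) = (\<Oplus>\<^bsub>T\<^esub>p\<in>bas a f. \<zero>\<^bsub>T\<^esub>)"
    proof (rule T.finsum_cong'[OF refl])
      show "\<Theta> a z (cfun a f p) \<cdot> \<alpha> a \<cdot> \<iota> p = \<zero>\<^bsub>T\<^esub>" if p: "p \<in> bas a f" for p
        unfolding th[OF a p] using a bas_B[OF a p] by simp
    qed simp
  qed simp
  then show ?thesis
    using reconstruct[OF z(1)] z(2) eps f klin_zero[OF B.vect_axioms T.vect_axioms alg_hom_klin[OF alg_hom_iota]]
    by (simp add: assemble_def)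
qed

lemma assemble_facts:
  assumes b: "b \<in> carrier B" and w: "\<And>a p. a \<in> F \<Longrightarrow> p \<in> bas a f \<Longrightarrow> w a p \<in> carrier (YT (t a))"
  shows assemble_in: "assemble f b w \<in> carrier T"
    and assemble_right: "b \<otimes>\<^bsub>B\<^esub> f = b \<Longrightarrow> assemble f b w \<cdot> \<iota> f = assemble f b w"
    and assemble_eps: "\<epsilon> (assemble f b w) = b"
    and assemble_Theta: "a \<in> F \<Longrightarrow> \<phi> \<in> carrier (injV (s a)) \<Longrightarrow>
       \<Theta> a (assemble f b w) \<phi> = (\<Oplus>\<^bsub>T\<^esub>p\<in>bas a f. \<phi> p \<odot>\<^bsub>T\<^esub> w a p)"
    and assemble_Theta_cfun: "a \<in> F \<Longrightarrow> q \<in> bas a f \<Longrightarrow> \<Theta> a (assemble f b w) (cfun a f q) = w a q"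
proof -
  have wT: "w a p \<in> carrier T" if "a \<in> F" "p \<in> bas a f" for a p by (rule YT_T[OF t_in[OF that(1)] w[OF that]])
  have im: "(\<lambda>p. w a p \<cdot> \<alpha> a \<cdot> \<iota> p) \<in> bas a f \<rightarrow> carrier T" if "a \<in> F" for a
    by (rule inner_mem[OF that wT[OF that]])
  let ?I = "\<lambda>a. \<Oplus>\<^bsub>T\<^esub>p\<in>bas a f. w a p \<cdot> \<alpha> a \<cdot> \<iota> p"
  have om: "?I \<in> F \<rightarrow> carrier T" using T.finsum_closed[OF im] by blast
  have S: "finsum T ?I F \<in> carrier T" by (rule T.finsum_closed[OF om])
  show in_T: "assemble f b w \<in> carrier T" using S b by (simp add: assemble_def)
  have push: "h (assemble f b w) = h (\<iota> b) \<oplus>\<^bsub>W\<^esub> (\<Oplus>\<^bsub>W\<^esub>a\<in>F. \<Oplus>\<^bsub>W\<^esub>p\<in>bas a f. h (w a p \<cdot> \<alpha> a \<cdot> \<iota> p))"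
    if W: "vect W" and h: "klin T W h" for W :: "('k, 'z) module" and h
  proof -
    interpret W: vect W by fact
    have "h (finsum T ?I F) = (\<Oplus>\<^bsub>W\<^esub>a\<in>F. h (?I a))" by (rule klin_finsum[OF T.vect_axioms W h finite_F om])
    also have "\<dots> = (\<Oplus>\<^bsub>W\<^esub>a\<in>F. \<Oplus>\<^bsub>W\<^esub>p\<in>bas a f. h (w a p \<cdot> \<alpha> a \<cdot> \<iota> p))"
    proof (rule W.finsum_cong'[OF refl])
      have hm: "(\<lambda>p. h (w a p \<cdot> \<alpha> a \<cdot> \<iota> p)) \<in> bas a f \<rightarrow> carrier W" if "a \<in> F" for a
        using im[OF that] klin_closed[OF h] by blast
      show "(\<lambda>a. \<Oplus>\<^bsub>W\<^esub>p\<in>bas a f. h (w a p \<cdot> \<alpha> a \<cdot> \<iota> p)) \<in> F \<rightarrow> carrier W"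
        using W.finsum_closed[OF hm] by blast
      show "h (?I a) = (\<Oplus>\<^bsub>W\<^esub>p\<in>bas a f. h (w a p \<cdot> \<alpha> a \<cdot> \<iota> p))" if a: "a \<in> F" for a
        by (rule klin_finsum[OF T.vect_axioms W h finite_bas[OF a f ff] im[OF a]])
    qed
    finally show ?thesis unfolding assemble_def using klin_add[OF h ic[OF b] S] by simp
  qed
  show "\<epsilon> (assemble f b w) = b"
  proof -
    have "(\<Oplus>\<^bsub>B\<^esub>a\<in>F. \<Oplus>\<^bsub>B\<^esub>p\<in>bas a f. \<epsilon> (w a p \<cdot> \<alpha> a \<cdot> \<iota> p)) = (\<Oplus>\<^bsub>B\<^esub>a\<in>F. \<Oplus>\<^bsub>B\<^esub>p\<in>bas a f. \<zero>\<^bsub>B\<^esub>)"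
    proof (rule B.finsum_cong'[OF refl])
      fix a assume a: "a \<in> F"
      show "(\<Oplus>\<^bsub>B\<^esub>p\<in>bas a f. \<epsilon> (w a p \<cdot> \<alpha> a \<cdot> \<iota> p)) = (\<Oplus>\<^bsub>B\<^esub>p\<in>bas a f. \<zero>\<^bsub>B\<^esub>)"
      proof (rule B.finsum_cong'[OF refl])
        show "\<epsilon> (w a p \<cdot> \<alpha> a \<cdot> \<iota> p) = \<zero>\<^bsub>B\<^esub>" if p: "p \<in> bas a f" for p
          using a wT[OF a p] bas_B[OF a p] by (simp add: alg_hom_mult[OF alg_hom_eps])
      qed simp
    qed simp
    then show ?thesis using push[OF B.vect_axioms alg_hom_klin[OF alg_hom_eps]] b by simp
  qed
  show "assemble f b w \<cdot> \<iota> f = assemble f b w" if bf: "b \<otimes>\<^bsub>B\<^esub> f = b"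
  proof -
    have k: "klin T T (\<lambda>z. z \<cdot> \<iota> f)"
      by (rule klinI) (use f in \<open>simp_all add: T.l_distr T.scal_mult_left\<close>)
    have "(\<Oplus>\<^bsub>T\<^esub>a\<in>F. \<Oplus>\<^bsub>T\<^esub>p\<in>bas a f. w a p \<cdot> \<alpha> a \<cdot> \<iota> p \<cdot> \<iota> f) = finsum T ?I F"
    proof (rule T.finsum_cong'[OF refl om])
      fix a assume a: "a \<in> F"
      show "(\<Oplus>\<^bsub>T\<^esub>p\<in>bas a f. w a p \<cdot> \<alpha> a \<cdot> \<iota> p \<cdot> \<iota> f) = ?I a"
      proof (rule T.finsum_cong'[OF refl im[OF a]])
        fix p assume p: "p \<in> bas a f"
        have "\<iota> p \<cdot> \<iota> f = \<iota> p" using alg_hom_mult[OF alg_hom_iota bas_B[OF a p] f] bas_f[OF a f ff p] by simp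
        then show "w a p \<cdot> \<alpha> a \<cdot> \<iota> p \<cdot> \<iota> f = w a p \<cdot> \<alpha> a \<cdot> \<iota> p"
          using a wT[OF a p] bas_B[OF a p] f by (simp add: T.m_assoc)
      qed
    qed
    moreover have "\<iota> b \<cdot> \<iota> f = \<iota> b" using alg_hom_mult[OF alg_hom_iota b f] bf by simp
    ultimately show ?thesis using push[OF T.vect_axioms k] by (simp add: assemble_def)
  qed
  show main: "\<Theta> a (assemble f b w) \<phi> = (\<Oplus>\<^bsub>T\<^esub>p\<in>bas a f. \<phi> p \<odot>\<^bsub>T\<^esub> w a p)" if a: "a \<in> F" and \<phi>: "\<phi> \<in> carrier (injV (s a))" for a \<phi>
  proof -
    have tv: "t a \<in> verts Q" using a by simp
    have k: "klin T T (\<lambda>z. \<Theta> a z \<phi>)"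
      using klin_Theta_arg[OF a \<phi>] YT_T[OF tv] YT_scal[OF tv] by (auto simp: klin_def simp del: underlying_space_simps(1,4))
    have m: "(\<lambda>p. \<phi> p \<odot>\<^bsub>T\<^esub> w a p) \<in> bas a f \<rightarrow> carrier T" using wT[OF a] by blast
    let ?G = "\<Oplus>\<^bsub>T\<^esub>p\<in>bas a f. \<phi> p \<odot>\<^bsub>T\<^esub> w a p"
    have G: "?G \<in> carrier T" by (rule T.finsum_closed[OF m])
    have "(\<Oplus>\<^bsub>T\<^esub>g\<in>F. \<Oplus>\<^bsub>T\<^esub>p\<in>bas g f. \<Theta> a (w g p \<cdot> \<alpha> g \<cdot> \<iota> p) \<phi>) = (\<Oplus>\<^bsub>T\<^esub>g\<in>F. if a = g then ?G else \<zero>\<^bsub>T\<^esub>)"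
    proof (rule T.finsum_cong'[OF refl])
      show "(\<lambda>g. if a = g then ?G else \<zero>\<^bsub>T\<^esub>) \<in> F \<rightarrow> carrier T" using G by auto
      fix g assume g: "g \<in> F"
      show "(\<Oplus>\<^bsub>T\<^esub>p\<in>bas g f. \<Theta> a (w g p \<cdot> \<alpha> g \<cdot> \<iota> p) \<phi>) = (if a = g then ?G else \<zero>\<^bsub>T\<^esub>)"
      proof (cases "a = g")
        case True
        have "(\<Oplus>\<^bsub>T\<^esub>p\<in>bas a f. \<Theta> a (w a p \<cdot> \<alpha> a \<cdot> \<iota> p) \<phi>) = ?G"
        proof (rule T.finsum_cong'[OF refl m])
          fix p assume p: "p \<in> bas a f"
          have "w a p \<cdot> \<iota> (e (t a)) = w a p" using w[OF a p] by (simp only: YT_carrier[OF tv])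
          then show "\<Theta> a (w a p \<cdot> \<alpha> a \<cdot> \<iota> p) \<phi> = \<phi> p \<odot>\<^bsub>T\<^esub> w a p"
            using Theta_term[OF a a wT[OF a p] bas_row[OF a f ff p] \<phi>] by simp
        qed
        then show ?thesis using True by simp
      next
        case False
        have "(\<Oplus>\<^bsub>T\<^esub>p\<in>bas g f. \<Theta> a (w g p \<cdot> \<alpha> g \<cdot> \<iota> p) \<phi>) = (\<Oplus>\<^bsub>T\<^esub>p\<in>bas g f. \<zero>\<^bsub>T\<^esub>)"
        proof (rule T.finsum_cong'[OF refl])
          show "\<Theta> a (w g p \<cdot> \<alpha> g \<cdot> \<iota> p) \<phi> = \<zero>\<^bsub>T\<^esub>" if p: "p \<in> bas g f" for p
            using Theta_term[OF a g wT[OF g p] bas_row[OF g f ff p] \<phi>] False by simp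
        qed simp
        then show ?thesis using False by simp
      qed
    qed
    also have "\<dots> = ?G" by (rule T.finsum_singleton) (use a G in auto)
    finally have "(\<Oplus>\<^bsub>T\<^esub>g\<in>F. \<Oplus>\<^bsub>T\<^esub>p\<in>bas g f. \<Theta> a (w g p \<cdot> \<alpha> g \<cdot> \<iota> p) \<phi>) = ?G" .
    moreover have "\<Theta> a (\<iota> b) \<phi> = \<zero>\<^bsub>T\<^esub>" using Theta_iota[OF a b] \<phi> by simp
    ultimately show ?thesis using push[OF T.vect_axioms k] G by simp
  qed
  show "\<Theta> a (assemble f b w) (cfun a f q) = w a q" if a: "a \<in> F" and q: "q \<in> bas a f" for a q
  proof -
    have "(\<Oplus>\<^bsub>T\<^esub>p\<in>bas a f. cfun a f q p \<odot>\<^bsub>T\<^esub> w a p) = (\<Oplus>\<^bsub>T\<^esub>p\<in>bas a f. if q = p then w a p else \<zero>\<^bsub>T\<^esub>)"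
    proof (rule T.finsum_cong'[OF refl])
      fix p assume p: "p \<in> bas a f"
      have "cfun a f q p = (if q = p then 1 else 0)"
        using bas_row[OF a f ff p] bas_f[OF a f ff p] crd_delta[OF a f ff q p] by (simp add: cfun_def)
      then show "cfun a f q p \<odot>\<^bsub>T\<^esub> w a p = (if q = p then w a p else \<zero>\<^bsub>T\<^esub>)" using wT[OF a p] by simp
    qed (use wT[OF a] in simp)
    also have "\<dots> = w a q" by (rule T.finsum_singleton[OF q finite_bas[OF a f ff]]) (use wT[OF a] in simp)
    finally show ?thesis using main[OF a cfun_in[OF a f q]] by simp
  qed
qed

end

end

section \<open>Dimension counts along the splitting\<close>

text \<open>
  The functor \<open>Hom\<^sub>k(X, -)\<close> preserves products of modules, here given by a jointly bijective family.
\<close>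

lemma chi_hom_k_family:
  fixes A :: "('k::field, 'a) module"
  assumes J: "finite J" and kA: "kfin A" and X: "lmod A X aX" and kX: "kfin X"
    and Y: "lmod A Y aY" and U: "lmod A U aU" and W: "\<And>j. j \<in> J \<Longrightarrow> lmod A (W j) (aW j)"
    and kU: "kfin U" and kW: "\<And>j. j \<in> J \<Longrightarrow> kfin (W j)"
    and g: "klin Y U g" "\<And>b y. b \<in> carrier A \<Longrightarrow> y \<in> carrier Y \<Longrightarrow> g (aY b y) = aU b (g y)"
    and f: "\<And>j. j \<in> J \<Longrightarrow> klin Y (W j) (f j)"
      "\<And>j b y. j \<in> J \<Longrightarrow> b \<in> carrier A \<Longrightarrow> y \<in> carrier Y \<Longrightarrow> f j (aY b y) = aW j b (f j y)"
    and inj: "\<And>v. v \<in> carrier Y \<Longrightarrow> g v = \<zero>\<^bsub>U\<^esub> \<Longrightarrow> (\<And>j. j \<in> J \<Longrightarrow> f j v = \<zero>\<^bsub>W j\<^esub>) \<Longrightarrow> v = \<zero>\<^bsub>Y\<^esub>"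
    and surj: "\<And>u w. u \<in> carrier U \<Longrightarrow> (\<And>j. j \<in> J \<Longrightarrow> w j \<in> carrier (W j)) \<Longrightarrow>
       \<exists>v\<in>carrier Y. g v = u \<and> (\<forall>j\<in>J. f j v = w j)"
  shows "kfin Y \<and> chi A (hom_k X Y) (hom_left X aY) (hom_right X aX) =
      chi A (hom_k X U) (hom_left X aU) (hom_right X aX) +
      (\<Sum>j\<in>J. chi A (hom_k X (W j)) (hom_left X (aW j)) (hom_right X aX))"
proof -
  interpret X: lmod A X aX by (rule X)
  interpret Y: lmod A Y aY by (rule Y)
  interpret U: lmod A U aU by (rule U)
  have vW: "vect (W j)" if "j \<in> J" for j using W[OF that] unfolding lmod_def by blast
  have kY: "kfin Y"
    using family_dim_plus[OF J Y.V.vect_axioms U.V.vect_axioms kU g(1) vW kW f(1) inj surj] by blast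
  have uniq: "v = w" if vw: "v \<in> carrier Y" "w \<in> carrier Y" "g v = g w" "\<And>j. j \<in> J \<Longrightarrow> f j v = f j w" for v w
  proof -
    have "v \<ominus>\<^bsub>Y\<^esub> w = \<zero>\<^bsub>Y\<^esub>"
    proof (rule inj)
      show "v \<ominus>\<^bsub>Y\<^esub> w \<in> carrier Y" using vw by simp
      show "g (v \<ominus>\<^bsub>Y\<^esub> w) = \<zero>\<^bsub>U\<^esub>"
        using klin_diff[OF Y.V.vect_axioms U.V.vect_axioms g(1) vw(1,2)] vw(1-3) klin_closed[OF g(1)]
        by (simp add: a_minus_def U.V.r_neg)
      fix j assume j: "j \<in> J"
      interpret Wj: vect "W j" by (rule vW[OF j])
      show "f j (v \<ominus>\<^bsub>Y\<^esub> w) = \<zero>\<^bsub>W j\<^esub>"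
        using klin_diff[OF Y.V.vect_axioms vW[OF j] f(1)[OF j] vw(1,2)] vw(1,2) vw(4)[OF j] klin_closed[OF f(1)[OF j]]
        by (simp add: a_minus_def Wj.r_neg)
    qed
    then show ?thesis using vw(1,2) Y.V.diff_eq_zero_iff by simp
  qed
  have post: "bimod_map A (hom_k X Y) (hom_left X aY) (hom_right X aX) (hom_k X Z) (hom_left X aZ) (hom_right X aX)
      (\<lambda>\<phi>. \<lambda>x\<in>carrier X. h (\<phi> x))"
    if Z: "lmod A Z aZ" and h: "klin Y Z h" "\<And>b y. b \<in> carrier A \<Longrightarrow> y \<in> carrier Y \<Longrightarrow> h (aY b y) = aZ b (h y)"
    for Z :: "('k, 'z) module" and aZ h
  proof -
    interpret Z: lmod A Z aZ by (rule Z)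
    have c: "\<phi> x \<in> carrier Y" if "\<phi> \<in> lin_maps class_ring X Y" "x \<in> carrier X" for \<phi> x
      using that klin_closed[of X Y \<phi> x] by (simp add: lin_maps_iff)
    show ?thesis
      unfolding bimod_map_def
    proof (intro conjI ballI klinI; unfold hom_k_simps)
      fix \<phi> assume \<phi>: "\<phi> \<in> lin_maps class_ring X Y"
      show "(\<lambda>x\<in>carrier X. h (\<phi> x)) \<in> lin_maps class_ring X Z"
        using klin_compose[OF _ h(1), of X \<phi>] \<phi> by (simp add: lin_maps_iff klin_restrict[OF X.V.vect_axioms])
      show "(\<lambda>x\<in>carrier X. h ((\<lambda>x\<in>carrier X. d \<odot>\<^bsub>Y\<^esub> \<phi> x) x)) = (\<lambda>x\<in>carrier X. d \<odot>\<^bsub>Z\<^esub> (\<lambda>x\<in>carrier X. h (\<phi> x)) x)" for d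
        by (rule restrict_ext) (use c[OF \<phi>] klin_scal[OF h(1)] in simp)
      show "(\<lambda>x\<in>carrier X. h ((\<lambda>x\<in>carrier X. \<phi> x \<oplus>\<^bsub>Y\<^esub> \<psi> x) x)) =
          (\<lambda>x\<in>carrier X. (\<lambda>x\<in>carrier X. h (\<phi> x)) x \<oplus>\<^bsub>Z\<^esub> (\<lambda>x\<in>carrier X. h (\<psi> x)) x)" if "\<psi> \<in> lin_maps class_ring X Y" for \<psi>
        by (rule restrict_ext) (use c[OF \<phi>] c[OF that] klin_add[OF h(1)] in simp)
      fix b assume b: "b \<in> carrier A"
      show "(\<lambda>x\<in>carrier X. h (hom_left X aY b \<phi> x)) = hom_left X aZ b (\<lambda>x\<in>carrier X. h (\<phi> x))"
        unfolding hom_left_def by (rule restrict_ext) (use c[OF \<phi>] h(2)[OF b] in simp)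
      show "(\<lambda>x\<in>carrier X. h (hom_right X aX \<phi> b x)) = hom_right X aX (\<lambda>x\<in>carrier X. h (\<phi> x)) b"
        unfolding hom_right_def by (rule restrict_ext) (use X.act_closed[OF b] in simp)
    qed
  qed
  have "kfin (hom_k X Y) \<and> chi A (hom_k X Y) (hom_left X aY) (hom_right X aX) =
      chi A (hom_k X U) (hom_left X aU) (hom_right X aX) +
      (\<Sum>j\<in>J. chi A (hom_k X (W j)) (hom_left X (aW j)) (hom_right X aX))"
  proof (rule chi_family[OF J kA])
    show "bimod A (hom_k X Y) (hom_left X aY) (hom_right X aX)" by (rule bimod_hom_k[OF X Y])
    show "bimod A (hom_k X U) (hom_left X aU) (hom_right X aX)" by (rule bimod_hom_k[OF X U])
    show "bimod A (hom_k X (W j)) (hom_left X (aW j)) (hom_right X aX)" if "j \<in> J" for j by (rule bimod_hom_k[OF X W[OF that]])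
    show "kfin (hom_k X U)" by (rule kfin_hom_k[OF X.V.vect_axioms U.V.vect_axioms kX kU])
    show "kfin (hom_k X (W j))" if "j \<in> J" for j by (rule kfin_hom_k[OF X.V.vect_axioms vW[OF that] kX kW[OF that]])
    show "bimod_map A (hom_k X Y) (hom_left X aY) (hom_right X aX) (hom_k X U) (hom_left X aU) (hom_right X aX)
      (\<lambda>\<phi>. \<lambda>x\<in>carrier X. g (\<phi> x))" by (rule post[OF U g])
    show "bimod_map A (hom_k X Y) (hom_left X aY) (hom_right X aX) (hom_k X (W j)) (hom_left X (aW j)) (hom_right X aX)
      (\<lambda>\<phi>. \<lambda>x\<in>carrier X. f j (\<phi> x))" if "j \<in> J" for j by (rule post[OF W[OF that] f(1)[OF that] f(2)[OF that]])
    show "\<phi> = \<zero>\<^bsub>hom_k X Y\<^esub>" if \<phi>: "\<phi> \<in> carrier (hom_k X Y)" and 1: "(\<lambda>x\<in>carrier X. g (\<phi> x)) = \<zero>\<^bsub>hom_k X U\<^esub>"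
      and 2: "\<And>j. j \<in> J \<Longrightarrow> (\<lambda>x\<in>carrier X. f j (\<phi> x)) = \<zero>\<^bsub>hom_k X (W j)\<^esub>" for \<phi>
    proof -
      have k: "klin X Y \<phi>" "\<phi> \<in> extensional (carrier X)" using \<phi> by (simp_all add: lin_maps_iff)
      have "\<phi> x = \<zero>\<^bsub>Y\<^esub>" if x: "x \<in> carrier X" for x
      proof (rule inj[OF klin_closed[OF k(1) x]])
        show "g (\<phi> x) = \<zero>\<^bsub>U\<^esub>" using fun_cong[OF 1, of x] x by simp
        show "f j (\<phi> x) = \<zero>\<^bsub>W j\<^esub>" if "j \<in> J" for j using fun_cong[OF 2[OF that], of x] x by simp
      qed
      then show ?thesis using k(2) by (auto simp: extensional_def)
    qed
    show "\<exists>\<phi>\<in>carrier (hom_k X Y). (\<lambda>x\<in>carrier X. g (\<phi> x)) = u \<and> (\<forall>j\<in>J. (\<lambda>x\<in>carrier X. f j (\<phi> x)) = w j)"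
      if u: "u \<in> carrier (hom_k X U)" and w: "\<And>j. j \<in> J \<Longrightarrow> w j \<in> carrier (hom_k X (W j))" for u w
    proof -
      have ku: "klin X U u" "u \<in> extensional (carrier X)" using u by (simp_all add: lin_maps_iff)
      have kw: "klin X (W j) (w j)" "w j \<in> extensional (carrier X)" if "j \<in> J" for j using w[OF that] by (simp_all add: lin_maps_iff)
      define \<phi> where "\<phi> = (\<lambda>x\<in>carrier X. SOME v. v \<in> carrier Y \<and> g v = u x \<and> (\<forall>j\<in>J. f j v = w j x))"
      have ex: "\<phi> x \<in> carrier Y \<and> g (\<phi> x) = u x \<and> (\<forall>j\<in>J. f j (\<phi> x) = w j x)" if x: "x \<in> carrier X" for x
      proof -
        have "\<exists>v. v \<in> carrier Y \<and> g v = u x \<and> (\<forall>j\<in>J. f j v = w j x)"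
          using surj[OF klin_closed[OF ku(1) x] klin_closed[OF kw(1) x]] by blast
        from someI_ex[OF this] show ?thesis using x by (simp add: \<phi>_def)
      qed
      have \<phi>c: "\<phi> x \<in> carrier Y" and \<phi>g: "g (\<phi> x) = u x" if "x \<in> carrier X" for x using ex[OF that] by blast+
      have \<phi>f: "f j (\<phi> x) = w j x" if "x \<in> carrier X" "j \<in> J" for x j using ex[OF that(1)] that(2) by blast
      have "klin X Y \<phi>"
      proof (rule klinI)
        fix x y assume x: "x \<in> carrier X"
        show "\<phi> x \<in> carrier Y" by (rule \<phi>c[OF x])
        show "\<phi> (d \<odot>\<^bsub>X\<^esub> x) = d \<odot>\<^bsub>Y\<^esub> \<phi> x" for d
        proof (rule uniq)
          show "g (\<phi> (d \<odot>\<^bsub>X\<^esub> x)) = g (d \<odot>\<^bsub>Y\<^esub> \<phi> x)"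
            using \<phi>g[of "d \<odot>\<^bsub>X\<^esub> x"] \<phi>g[OF x] klin_scal[OF g(1) \<phi>c[OF x]] klin_scal[OF ku(1) x] x by simp
          show "f j (\<phi> (d \<odot>\<^bsub>X\<^esub> x)) = f j (d \<odot>\<^bsub>Y\<^esub> \<phi> x)" if j: "j \<in> J" for j
            using \<phi>f[of "d \<odot>\<^bsub>X\<^esub> x" j] \<phi>f[OF x j] klin_scal[OF f(1)[OF j] \<phi>c[OF x]] klin_scal[OF kw(1)[OF j] x] x j by simp
        qed (use \<phi>c x in simp_all)
        assume y: "y \<in> carrier X"
        show "\<phi> (x \<oplus>\<^bsub>X\<^esub> y) = \<phi> x \<oplus>\<^bsub>Y\<^esub> \<phi> y"
        proof (rule uniq)
          show "g (\<phi> (x \<oplus>\<^bsub>X\<^esub> y)) = g (\<phi> x \<oplus>\<^bsub>Y\<^esub> \<phi> y)"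
            using \<phi>g[of "x \<oplus>\<^bsub>X\<^esub> y"] \<phi>g[OF x] \<phi>g[OF y] klin_add[OF g(1) \<phi>c[OF x] \<phi>c[OF y]] klin_add[OF ku(1) x y] x y by simp
          show "f j (\<phi> (x \<oplus>\<^bsub>X\<^esub> y)) = f j (\<phi> x \<oplus>\<^bsub>Y\<^esub> \<phi> y)" if j: "j \<in> J" for j
            using \<phi>f[of "x \<oplus>\<^bsub>X\<^esub> y" j] \<phi>f[OF x j] \<phi>f[OF y j] klin_add[OF f(1)[OF j] \<phi>c[OF x] \<phi>c[OF y]] klin_add[OF kw(1)[OF j] x y] x y j by simp
        qed (use \<phi>c x y in simp_all)
      qed
      then have "\<phi> \<in> carrier (hom_k X Y)" by (simp add: lin_maps_iff \<phi>_def)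
      moreover have "(\<lambda>x\<in>carrier X. g (\<phi> x)) = u" by (rule extensionalityI[OF restrict_extensional ku(2)]) (simp add: \<phi>g)
      moreover have "(\<lambda>x\<in>carrier X. f j (\<phi> x)) = w j" if "j \<in> J" for j
        by (rule extensionalityI[OF restrict_extensional kw(2)[OF that]]) (simp add: \<phi>f that)
      ultimately show ?thesis by blast
    qed
  qed
  then show ?thesis using kY by blast
qed

context arrow_extension
begin

abbreviation "UB x \<equiv> underlying_space B (col_mod B (e x))"

abbreviation "\<J> x \<equiv> Sigma F (\<lambda>a. bas a (e x))"

abbreviation "\<theta> x j z \<equiv> \<Theta> (fst j) z (cfun (fst j) (e x) (snd j))"

lemma YB_lmod: "x \<in> verts Q \<Longrightarrow> lmod B (YT x) (\<lambda>b. mult T (\<iota> b))"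
  by (rule lmod_restrict[OF B.kalg_axioms alg_hom_iota YT_lmod])

lemma UB_lmod: "x \<in> verts Q \<Longrightarrow> lmod B (UB x) (mult B)"
  using B.bmod_col_mod[OF e_in] by simp

lemma UB_carrier: "x \<in> verts Q \<Longrightarrow> z \<in> carrier (UB x) \<longleftrightarrow> z \<in> carrier B \<and> z \<otimes>\<^bsub>B\<^esub> e x = z"
proof
  assume x: "x \<in> verts Q"
  show "z \<in> carrier B \<and> z \<otimes>\<^bsub>B\<^esub> e x = z" if "z \<in> carrier (UB x)"
  proof -
    from that obtain b where b: "b \<in> carrier B" "z = b \<otimes>\<^bsub>B\<^esub> e x" by auto
    then show ?thesis using e_in[OF x] e_idem[OF x] by (simp add: B.m_assoc)
  qed
  show "z \<in> carrier (UB x)" if "z \<in> carrier B \<and> z \<otimes>\<^bsub>B\<^esub> e x = z"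
    by simp (rule exI[of _ z], use that in simp)
qed

lemma UB_scal: "x \<in> verts Q \<Longrightarrow> z \<in> carrier (UB x) \<Longrightarrow> c \<odot>\<^bsub>UB x\<^esub> z = c \<odot>\<^bsub>B\<^esub> z"
  using UB_carrier B.scal_one_mult by simp

lemma UB_vect: "x \<in> verts Q \<Longrightarrow> vect (UB x)"
  using UB_lmod unfolding lmod_def by blast

lemma kfin_UB: "x \<in> verts Q \<Longrightarrow> kfin (UB x)"
proof (rule kfin_surj[OF B.vect_axioms UB_vect _ kfin_B])
  assume x: "x \<in> verts Q"
  have c: "b \<otimes>\<^bsub>B\<^esub> e x \<in> carrier (UB x)" if "b \<in> carrier B" for b using that by auto
  show "klin B (UB x) (\<lambda>b. b \<otimes>\<^bsub>B\<^esub> e x)"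
    by (rule klinI) (use c e_in[OF x] UB_scal[OF x c] in \<open>simp_all add: B.l_distr B.scal_mult_left del: underlying_space_simps(1,4) col_mod_simps(1,4)\<close>)
  show "(\<lambda>b. b \<otimes>\<^bsub>B\<^esub> e x) ` carrier B = carrier (UB x)" by auto
qed

lemma eps_iota_mult: "b \<in> carrier B \<Longrightarrow> z \<in> carrier T \<Longrightarrow> \<epsilon> (\<iota> b \<cdot> z) = b \<otimes>\<^bsub>B\<^esub> \<epsilon> z"
  by (simp add: alg_hom_mult[OF alg_hom_eps])

lemma eps_mult_iota: "b \<in> carrier B \<Longrightarrow> z \<in> carrier T \<Longrightarrow> \<epsilon> (z \<cdot> \<iota> b) = \<epsilon> z \<otimes>\<^bsub>B\<^esub> b"
  by (simp add: alg_hom_mult[OF alg_hom_eps])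

lemma eps_YT: "x \<in> verts Q \<Longrightarrow> z \<in> carrier (YT x) \<Longrightarrow> \<epsilon> z \<in> carrier (UB x)"
  unfolding YT_carrier UB_carrier using eps_mult_iota[OF e_in, of x z] by simp

lemma klin_eps_YT: "x \<in> verts Q \<Longrightarrow> klin (YT x) (UB x) \<epsilon>"
proof (rule klinI)
  assume x: "x \<in> verts Q"
  fix z w assume z: "z \<in> carrier (YT x)"
  show "\<epsilon> z \<in> carrier (UB x)" by (rule eps_YT[OF x z])
  show "\<epsilon> (c \<odot>\<^bsub>YT x\<^esub> z) = c \<odot>\<^bsub>UB x\<^esub> \<epsilon> z" for c
    unfolding YT_scal[OF x z] UB_scal[OF x eps_YT[OF x z]] by (rule alg_hom_scal[OF alg_hom_eps YT_T[OF x z]])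
  assume w: "w \<in> carrier (YT x)"
  show "\<epsilon> (z \<oplus>\<^bsub>YT x\<^esub> w) = \<epsilon> z \<oplus>\<^bsub>UB x\<^esub> \<epsilon> w"
    using alg_hom_add[OF alg_hom_eps YT_T[OF x z] YT_T[OF x w]] by simp
qed

lemma klin_YT_T: "x \<in> verts Q \<Longrightarrow> klin (YT x) T (\<lambda>z. z)"
  by (rule klinI) (use YT_T YT_scal in \<open>simp_all del: underlying_space_simps(1,4)\<close>)

lemma Theta_iota_mult:
  assumes "a \<in> F" "b \<in> carrier B" "z \<in> carrier T" "\<phi> \<in> carrier (injV (s a))"
  shows "\<Theta> a (\<iota> b \<cdot> z) \<phi> = \<iota> b \<cdot> \<Theta> a z \<phi>"
proof -
  interpret X: lmod B "injV (s a)" "inj_act (s a)" by (rule bmod_inj_mod[OF s_in[OF assms(1)]])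
  have c: "\<Theta> a z \<phi> \<in> carrier T" by (rule YT_T[OF t_in[OF assms(1)] Theta_in[OF assms(1,3,4)]])
  have "inj_act (s a) (\<epsilon> z) \<phi> \<in> carrier (injV (s a))" by (rule X.act_closed[OF ec[OF assms(3)] assms(4)])
  then have "\<Theta> a (\<iota> b) (inj_act (s a) (\<epsilon> z) \<phi>) = \<zero>\<^bsub>T\<^esub>"
    unfolding Theta_iota[OF assms(1,2)] by simp
  then show ?thesis
    using Theta_mult[OF assms(1) ic[OF assms(2)] assms(3,4)] c ic[OF assms(2)] by simp
qed

lemma Theta_mult_iota:
  assumes "a \<in> F" "b \<in> carrier B" "z \<in> carrier T" "\<phi> \<in> carrier (injV (s a))"
  shows "\<Theta> a (z \<cdot> \<iota> b) \<phi> = \<Theta> a z (inj_act (s a) b \<phi>)"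
proof -
  interpret X: lmod B "injV (s a)" "inj_act (s a)" by (rule bmod_inj_mod[OF s_in[OF assms(1)]])
  have "\<Theta> a z (inj_act (s a) b \<phi>) \<in> carrier T"
    by (rule YT_T[OF t_in[OF assms(1)] Theta_in[OF assms(1,3) X.act_closed[OF assms(2,4)]]])
  moreover have "\<Theta> a (\<iota> b) \<phi> = \<zero>\<^bsub>T\<^esub>" unfolding Theta_iota[OF assms(1,2)] using assms(4) by simp
  ultimately show ?thesis using Theta_mult[OF assms(1,3) ic[OF assms(2)] assms(4)] assms(2,3) by simp
qed

lemma cfun_e_in: "x \<in> verts Q \<Longrightarrow> j \<in> \<J> x \<Longrightarrow> cfun (fst j) (e x) (snd j) \<in> carrier (injV (s (fst j)))"
  by (cases j) (simp only: mem_Sigma_iff fst_conv snd_conv cfun_in[OF _ e_in])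

lemma J_F: "j \<in> \<J> x \<Longrightarrow> fst j \<in> F"
  by auto

lemma finite_J: "x \<in> verts Q \<Longrightarrow> finite (\<J> x)"
  by (intro finite_SigmaI finite_F finite_bas e_in e_idem)

lemma klin_theta: "x \<in> verts Q \<Longrightarrow> j \<in> \<J> x \<Longrightarrow> klin (YT x) (YT (t (fst j))) (\<theta> x j)"
  by (rule klin_compose[OF klin_YT_T klin_Theta_arg[OF J_F cfun_e_in]])

lemma theta_iota_mult: "x \<in> verts Q \<Longrightarrow> j \<in> \<J> x \<Longrightarrow> b \<in> carrier B \<Longrightarrow> z \<in> carrier T \<Longrightarrow>
    \<theta> x j (\<iota> b \<cdot> z) = \<iota> b \<cdot> \<theta> x j z"
  by (rule Theta_iota_mult[OF J_F _ _ cfun_e_in])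

lemma theta_inj:
  assumes x: "x \<in> verts Q" and z: "z \<in> carrier (YT x)" "\<epsilon> z = \<zero>\<^bsub>B\<^esub>" and th: "\<And>j. j \<in> \<J> x \<Longrightarrow> \<theta> x j z = \<zero>\<^bsub>T\<^esub>"
  shows "z = \<zero>\<^bsub>T\<^esub>"
proof (rule split_inj[OF e_in[OF x] e_idem[OF x]])
  show "z \<in> carrier T" by (rule YT_T[OF x z(1)])
  show "z \<cdot> \<iota> (e x) = z" using z(1) unfolding YT_carrier[OF x] by blast
  show "\<Theta> a z (cfun a (e x) p) = \<zero>\<^bsub>T\<^esub>" if "a \<in> F" "p \<in> bas a (e x)" for a p
    using th[of "(a, p)"] that by simp
qed fact

lemma theta_surj:
  assumes x: "x \<in> verts Q" and u: "u \<in> carrier (UB x)" and w: "\<And>j. j \<in> \<J> x \<Longrightarrow> w j \<in> carrier (YT (t (fst j)))"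
  shows "\<exists>z\<in>carrier (YT x). \<epsilon> z = u \<and> (\<forall>j\<in>\<J> x. \<theta> x j z = w j)"
proof -
  have u': "u \<in> carrier B" "u \<otimes>\<^bsub>B\<^esub> e x = u" using u unfolding UB_carrier[OF x] by blast+
  have w': "w (a, p) \<in> carrier (YT (t a))" if "a \<in> F" "p \<in> bas a (e x)" for a p
    using w[of "(a, p)"] that by (simp del: underlying_space_simps)
  note af = assemble_facts[OF e_in[OF x] e_idem[OF x] u'(1), of "\<lambda>a p. w (a, p)", OF w']
  let ?z = "assemble (e x) u (\<lambda>a p. w (a, p))"
  have "?z \<in> carrier T" by (rule af(1))
  moreover have "?z \<cdot> \<iota> (e x) = ?z" by (rule af(2)[OF _ _ u'(2)])
  ultimately have 1: "?z \<in> carrier (YT x)" unfolding YT_carrier[OF x] by blast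
  have 2: "\<epsilon> ?z = u" by (rule af(3))
  have "\<theta> x j ?z = w j" if j: "j \<in> \<J> x" for j
  proof -
    obtain a p where ap: "j = (a, p)" "a \<in> F" "p \<in> bas a (e x)" using j by blast
    show ?thesis unfolding ap(1) fst_conv snd_conv by (rule af(5)[OF _ _ ap(2,3)])
  qed
  then show ?thesis using 1 2 by blast
qed

lemma cornerV_eq: "cornerV a (e x) = peirce Q I (s a) x"
  by (simp add: cornerV_def peirce_def Let_def)

abbreviation "\<d> y x \<equiv> kdim (peirce Q I y x)"

lemma card_bas: "a \<in> F \<Longrightarrow> x \<in> verts Q \<Longrightarrow> card (bas a (e x)) = \<d> (s a) x"
  using bas_crd(2)[OF _ e_in] cornerV_eq by simp

lemma peirce_dim_zero_iff:
  assumes "y \<in> verts Q" "x \<in> verts Q"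
  shows "\<d> y x = 0 \<longleftrightarrow> \<not> peirce_nonzero Q I y x"
proof -
  have sub: "subsp B {e y \<otimes>\<^bsub>B\<^esub> b \<otimes>\<^bsub>B\<^esub> e x | b. b \<in> carrier B}" by (rule B.subsp_sandwich[OF e_in[OF assms(1)] e_in[OF assms(2)]])
  have v: "vect (peirce Q I y x)" "kfin (peirce Q I y x)"
    unfolding peirce_def Let_def by (rule subsp_vect[OF B.vect_axioms sub], rule kfin_subsp[OF B.vect_axioms sub kfin_B])
  have z: "\<zero>\<^bsub>peirce Q I y x\<^esub> = \<zero>\<^bsub>B\<^esub>" by (simp add: peirce_def Let_def)
  show ?thesis
    using kdim_zero(2)[OF v(1)] kdim_pos[OF v] unfolding peirce_nonzero_def z by blast
qed

lemma sum_J: "x \<in> verts Q \<Longrightarrow> (\<Sum>j\<in>\<J> x. h (fst j)) = (\<Sum>a\<in>F. int (\<d> (s a) x) * (h a :: int))"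
proof -
  assume x: "x \<in> verts Q"
  have "(\<Sum>j\<in>\<J> x. h (fst j)) = (\<Sum>j\<in>\<J> x. (\<lambda>(a, p). h a) j)" by (rule sum.cong) auto
  also have "\<dots> = (\<Sum>a\<in>F. \<Sum>p\<in>bas a (e x). h a)"
    by (rule sum.Sigma[symmetric]) (use finite_bas[OF _ e_in[OF x] e_idem[OF x]] in simp_all)
  also have "\<dots> = (\<Sum>a\<in>F. int (\<d> (s a) x) * h a)" by (rule sum.cong) (use card_bas x in simp_all)
  finally show ?thesis .
qed

abbreviation "\<chi> y x \<equiv> chi B (hom_k (injV y) (YT x)) (hom_left (injV y) (\<lambda>b. mult T (\<iota> b))) (hom_right (injV y) (inj_act y))"

abbreviation "\<chi>\<^sub>0 y x \<equiv> chi B (hom_k (injV y) (UB x)) (hom_left (injV y) (mult B)) (hom_right (injV y) (inj_act y))"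

text \<open>
  As a left \<open>B\<close>-module, \<open>T e\<^sub>x\<close> is the sum of \<open>B e\<^sub>x\<close> and of one copy of \<open>T e\<^bsub>t a\<^esub>\<close> for each vector in a basis
  of \<open>e\<^bsub>s a\<^esub> B e\<^sub>x\<close>.
\<close>

lemma YT_dims:
  assumes x: "x \<in> verts Q" and y: "y \<in> verts Q" and k: "\<And>j. j \<in> \<J> x \<Longrightarrow> kfin (YT (t (fst j)))"
  shows "kfin (YT x) \<and> \<chi> y x = \<chi>\<^sub>0 y x + (\<Sum>a\<in>F. int (\<d> (s a) x) * \<chi> y (t a))"
proof -
  have tv: "t (fst j) \<in> verts Q" if "j \<in> \<J> x" for j by (rule t_in[OF J_F[OF that]])
  have z: "\<zero>\<^bsub>YT v\<^esub> = \<zero>\<^bsub>T\<^esub>" "\<zero>\<^bsub>UB v\<^esub> = \<zero>\<^bsub>B\<^esub>" for v by simp_all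
  have "kfin (YT x) \<and> \<chi> y x = \<chi>\<^sub>0 y x + (\<Sum>j\<in>\<J> x. \<chi> y (t (fst j)))"
  proof (rule chi_hom_k_family[OF finite_J[OF x] kfin_B bmod_inj_mod[OF y] kfin_injV[OF y] YB_lmod[OF x] UB_lmod[OF x]
        YB_lmod[OF tv] kfin_UB[OF x] k klin_eps_YT[OF x] _ klin_theta[OF x]])
    show "\<epsilon> (\<iota> b \<cdot> v) = b \<otimes>\<^bsub>B\<^esub> \<epsilon> v" if "b \<in> carrier B" "v \<in> carrier (YT x)" for b v
      by (rule eps_iota_mult[OF that(1) YT_T[OF x that(2)]])
    show "\<theta> x j (\<iota> b \<cdot> v) = \<iota> b \<cdot> \<theta> x j v" if "j \<in> \<J> x" "b \<in> carrier B" "v \<in> carrier (YT x)" for j b v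
      by (rule theta_iota_mult[OF x that(1,2) YT_T[OF x that(3)]])
    show "v = \<zero>\<^bsub>YT x\<^esub>" if "v \<in> carrier (YT x)" "\<epsilon> v = \<zero>\<^bsub>UB x\<^esub>" "\<And>j. j \<in> \<J> x \<Longrightarrow> \<theta> x j v = \<zero>\<^bsub>YT (t (fst j))\<^esub>" for v
      unfolding z by (rule theta_inj[OF x that[unfolded z]])
    show "\<exists>v\<in>carrier (YT x). \<epsilon> v = u \<and> (\<forall>j\<in>\<J> x. \<theta> x j v = w j)"
      if "u \<in> carrier (UB x)" "\<And>j. j \<in> \<J> x \<Longrightarrow> w j \<in> carrier (YT (t (fst j)))" for u w
      by (rule theta_surj[OF x that])
  qed
  then show ?thesis unfolding sum_J[OF x, of "\<lambda>a. \<chi> y (t a)"] .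
qed

abbreviation "E y x \<equiv> T\<lparr>carrier := {\<iota> (e y) \<cdot> z \<cdot> \<iota> (e x) | z. z \<in> carrier T}\<rparr>"

lemma E_vect: "x \<in> verts Q \<Longrightarrow> y \<in> verts Q \<Longrightarrow> vect (E y x)"
  by (intro subsp_vect T.vect_axioms T.subsp_sandwich ie)

lemma E_carrier:
  assumes "x \<in> verts Q" "y \<in> verts Q"
  shows "z \<in> carrier (E y x) \<longleftrightarrow> z \<in> carrier (YT x) \<and> \<iota> (e y) \<cdot> z = z"
proof
  note c = ie[OF assms(1)] ie[OF assms(2)] ie_idem[OF assms(1)] ie_idem[OF assms(2)]
  show "z \<in> carrier (YT x) \<and> \<iota> (e y) \<cdot> z = z" if zE: "z \<in> carrier (E y x)"
  proof -
    obtain w where w: "z = \<iota> (e y) \<cdot> w \<cdot> \<iota> (e x)" "w \<in> carrier T" using zE by auto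
    have "\<iota> (e y) \<cdot> (\<iota> (e y) \<cdot> (w \<cdot> \<iota> (e x))) = \<iota> (e y) \<cdot> (w \<cdot> \<iota> (e x))"
      using c w(2) by (simp flip: T.m_assoc)
    then show ?thesis unfolding YT_carrier[OF assms(1)] w(1) using c w(2) by (simp add: T.m_assoc)
  qed
  show "z \<in> carrier (E y x)" if "z \<in> carrier (YT x) \<and> \<iota> (e y) \<cdot> z = z"
    using that unfolding YT_carrier[OF assms(1)] by simp (rule exI[of _ z], simp)
qed

text \<open>
  The splitting of \<open>T e\<^sub>x\<close> is \<open>B\<close>-linear, hence restricts to the images of left multiplication by \<open>e\<^sub>y\<close>.
\<close>

lemma E_dims:
  assumes x: "x \<in> verts Q" and y: "y \<in> verts Q" and k: "\<And>v. v \<in> verts Q \<Longrightarrow> kfin (YT v)"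
  shows "kfin (E y x) \<and> int (kdim (E y x)) = int (\<d> y x) + (\<Sum>a\<in>F. int (\<d> (s a) x) * int (kdim (E y (t a))))"
proof -
  have tv: "t (fst j) \<in> verts Q" if "j \<in> \<J> x" for j by (rule t_in[OF J_F[OF that]])
  have kE: "kfin (E y v)" if v: "v \<in> verts Q" for v
  proof (rule kfin_surj[OF YT_vect[OF v] E_vect[OF v y] _ k[OF v]])
    have c: "\<iota> (e y) \<cdot> z \<in> carrier (E y v)" if "z \<in> carrier (YT v)" for z
      using that ie[OF y] ie_idem[OF y] ie[OF v] unfolding E_carrier[OF v y] YT_carrier[OF v]
      by (simp add: T.m_assoc) (simp flip: T.m_assoc)
    have cT: "z \<in> carrier T" if "z \<in> carrier (YT v)" for z by (rule YT_T[OF v that])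
    show "klin (YT v) (E y v) (\<lambda>z. \<iota> (e y) \<cdot> z)"
    proof (rule klinI)
      fix z w assume z: "z \<in> carrier (YT v)"
      show "\<iota> (e y) \<cdot> z \<in> carrier (E y v)" by (rule c[OF z])
      show "\<iota> (e y) \<cdot> (d \<odot>\<^bsub>YT v\<^esub> z) = d \<odot>\<^bsub>E y v\<^esub> (\<iota> (e y) \<cdot> z)" for d
        unfolding YT_scal[OF v z] using T.scal_mult_right[OF ie[OF y] cT[OF z]] by simp
      assume w: "w \<in> carrier (YT v)"
      show "\<iota> (e y) \<cdot> (z \<oplus>\<^bsub>YT v\<^esub> w) = \<iota> (e y) \<cdot> z \<oplus>\<^bsub>E y v\<^esub> \<iota> (e y) \<cdot> w"
        using T.r_distr[OF cT[OF z] cT[OF w] ie[OF y]] by simp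
    qed
    show "(\<lambda>z. \<iota> (e y) \<cdot> z) ` carrier (YT v) = carrier (E y v)"
    proof
      show "(\<lambda>z. \<iota> (e y) \<cdot> z) ` carrier (YT v) \<subseteq> carrier (E y v)" using c by blast
      show "carrier (E y v) \<subseteq> (\<lambda>z. \<iota> (e y) \<cdot> z) ` carrier (YT v)"
      proof
        fix z assume "z \<in> carrier (E y v)"
        then have "z \<in> carrier (YT v)" "\<iota> (e y) \<cdot> z = z" unfolding E_carrier[OF v y] by blast+
        then show "z \<in> (\<lambda>z. \<iota> (e y) \<cdot> z) ` carrier (YT v)" by (metis imageI)
      qed
    qed
  qed
  let ?P = "peirce Q I y x"
  have sub: "subsp B {e y \<otimes>\<^bsub>B\<^esub> b \<otimes>\<^bsub>B\<^esub> e x | b. b \<in> carrier B}" by (rule B.subsp_sandwich[OF e_in[OF y] e_in[OF x]])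
  have P: "vect ?P" "kfin ?P"
    unfolding peirce_def Let_def by (rule subsp_vect[OF B.vect_axioms sub], rule kfin_subsp[OF B.vect_axioms sub kfin_B])
  have Pz [simp]: "\<zero>\<^bsub>?P\<^esub> = \<zero>\<^bsub>B\<^esub>" "add ?P = add B" "smult ?P = smult B" by (simp_all add: peirce_def Let_def)
  have P_car: "u \<in> carrier ?P \<longleftrightarrow> u \<in> carrier (UB x) \<and> e y \<otimes>\<^bsub>B\<^esub> u = u" for u
  proof
    note c = e_in[OF x] e_in[OF y] e_idem[OF x] e_idem[OF y]
    show "u \<in> carrier (UB x) \<and> e y \<otimes>\<^bsub>B\<^esub> u = u" if uP: "u \<in> carrier ?P"
    proof -
      obtain w where w: "u = e y \<otimes>\<^bsub>B\<^esub> w \<otimes>\<^bsub>B\<^esub> e x" "w \<in> carrier B" using uP by (auto simp: peirce_def Let_def)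
      have "e y \<otimes>\<^bsub>B\<^esub> (e y \<otimes>\<^bsub>B\<^esub> (w \<otimes>\<^bsub>B\<^esub> e x)) = e y \<otimes>\<^bsub>B\<^esub> (w \<otimes>\<^bsub>B\<^esub> e x)"
        using c w(2) by (simp flip: B.m_assoc)
      then show ?thesis unfolding UB_carrier[OF x] w(1) using c w(2) by (simp add: B.m_assoc)
    qed
    show "u \<in> carrier ?P" if "u \<in> carrier (UB x) \<and> e y \<otimes>\<^bsub>B\<^esub> u = u"
      using that unfolding UB_carrier[OF x] peirce_def Let_def by simp (rule exI[of _ u], simp)
  qed
  have ET: "z \<in> carrier T" "z \<in> carrier (YT v)" "\<iota> (e y) \<cdot> z = z" if "v \<in> verts Q" "z \<in> carrier (E y v)" for v z
    using that(2) YT_T[OF that(1)] unfolding E_carrier[OF that(1) y] by blast+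
  have kEY: "klin (E y x) (YT x) (\<lambda>z. z)"
  proof (rule klinI)
    fix z w assume z: "z \<in> carrier (E y x)"
    show "z \<in> carrier (YT x)" by (rule ET(2)[OF x z])
    show "d \<odot>\<^bsub>E y x\<^esub> z = d \<odot>\<^bsub>YT x\<^esub> z" for d unfolding YT_scal[OF x ET(2)[OF x z]] by simp
    show "z \<oplus>\<^bsub>E y x\<^esub> w = z \<oplus>\<^bsub>YT x\<^esub> w" by simp
  qed
  have "kfin (E y x) \<and> kdim (E y x) = kdim ?P + (\<Sum>j\<in>\<J> x. kdim (E y (t (fst j))))"
  proof (rule family_dim_plus[OF finite_J[OF x] E_vect[OF x y] P])
    show "klin (E y x) ?P \<epsilon>"
    proof (rule klinI)
      fix z w assume z: "z \<in> carrier (E y x)"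
      show "\<epsilon> z \<in> carrier ?P" unfolding P_car using eps_YT[OF x ET(2)[OF x z]] eps_iota_mult[OF e_in[OF y] ET(1)[OF x z]] ET(3)[OF x z] by simp
      show "\<epsilon> (d \<odot>\<^bsub>E y x\<^esub> z) = d \<odot>\<^bsub>?P\<^esub> \<epsilon> z" for d using alg_hom_scal[OF alg_hom_eps ET(1)[OF x z]] by simp
      assume w: "w \<in> carrier (E y x)"
      show "\<epsilon> (z \<oplus>\<^bsub>E y x\<^esub> w) = \<epsilon> z \<oplus>\<^bsub>?P\<^esub> \<epsilon> w" using alg_hom_add[OF alg_hom_eps ET(1)[OF x z] ET(1)[OF x w]] by simp
    qed
    fix j assume j: "j \<in> \<J> x"
    show "vect (E y (t (fst j)))" by (rule E_vect[OF tv[OF j] y])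
    show "kfin (E y (t (fst j)))" by (rule kE[OF tv[OF j]])
    have kl: "klin (E y x) (YT (t (fst j))) (\<theta> x j)" by (rule klin_compose[OF kEY klin_theta[OF x j]])
    show "klin (E y x) (E y (t (fst j))) (\<theta> x j)"
    proof (rule klinI)
      fix z w assume z: "z \<in> carrier (E y x)"
      note tY = klin_closed[OF kl z]
      show "\<theta> x j z \<in> carrier (E y (t (fst j)))"
        unfolding E_carrier[OF tv[OF j] y] using tY theta_iota_mult[OF x j e_in[OF y] ET(1)[OF x z]] ET(3)[OF x z] by simp
      show "\<theta> x j (d \<odot>\<^bsub>E y x\<^esub> z) = d \<odot>\<^bsub>E y (t (fst j))\<^esub> \<theta> x j z" for d
        using klin_scal[OF kl z, of d] unfolding YT_scal[OF tv[OF j] tY] by simp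
      assume w: "w \<in> carrier (E y x)"
      show "\<theta> x j (z \<oplus>\<^bsub>E y x\<^esub> w) = \<theta> x j z \<oplus>\<^bsub>E y (t (fst j))\<^esub> \<theta> x j w"
        using klin_add[OF kl z w] by simp
    qed
  next
    show "z = \<zero>\<^bsub>E y x\<^esub>" if "z \<in> carrier (E y x)" "\<epsilon> z = \<zero>\<^bsub>?P\<^esub>" "\<And>j. j \<in> \<J> x \<Longrightarrow> \<theta> x j z = \<zero>\<^bsub>E y (t (fst j))\<^esub>" for z
    proof -
      have "\<theta> x j z = \<zero>\<^bsub>T\<^esub>" if "j \<in> \<J> x" for j using \<open>\<And>j. j \<in> \<J> x \<Longrightarrow> \<theta> x j z = \<zero>\<^bsub>E y (t (fst j))\<^esub>\<close>[OF that] by simp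
      then have "z = \<zero>\<^bsub>T\<^esub>" by (rule theta_inj[OF x ET(2)[OF x that(1)] that(2)[unfolded Pz]])
      then show ?thesis by simp
    qed
    show "\<exists>z\<in>carrier (E y x). \<epsilon> z = u \<and> (\<forall>j\<in>\<J> x. \<theta> x j z = w j)"
      if u: "u \<in> carrier ?P" and w: "\<And>j. j \<in> \<J> x \<Longrightarrow> w j \<in> carrier (E y (t (fst j)))" for u w
    proof -
      have u': "u \<in> carrier (UB x)" "e y \<otimes>\<^bsub>B\<^esub> u = u" using u unfolding P_car by blast+
      obtain z where z: "z \<in> carrier (YT x)" "\<epsilon> z = u" "\<forall>j\<in>\<J> x. \<theta> x j z = w j"
        using theta_surj[OF x u'(1) ET(2)[OF tv w]] by blast
      have zT: "z \<in> carrier T" "z \<cdot> \<iota> (e x) = z" using z(1) unfolding YT_carrier[OF x] by blast+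
      have "\<iota> (e y) \<cdot> z \<in> carrier (E y x)"
        using zT ie[OF y] ie[OF x] ie_idem[OF y] unfolding E_carrier[OF x y] YT_carrier[OF x]
        by (simp add: T.m_assoc) (simp flip: T.m_assoc)
      moreover have "\<epsilon> (\<iota> (e y) \<cdot> z) = u" using eps_iota_mult[OF e_in[OF y] zT(1)] z(2) u'(2) by simp
      moreover have "\<theta> x j (\<iota> (e y) \<cdot> z) = w j" if j: "j \<in> \<J> x" for j
        using theta_iota_mult[OF x j e_in[OF y] zT(1)] bspec[OF z(3) j] ET(3)[OF tv[OF j] w[OF j]] by simp
      ultimately show ?thesis by blast
    qed
  qed
  then show ?thesis using sum_J[OF x, of "\<lambda>a. int (kdim (E y (t a)))"] by simp
qed

end

section \<open>Derivations and the bimodule of the extended algebra\<close>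

context arrow_extension
begin

lemma T_bimod: "bimod B T (\<lambda>b. mult T (\<iota> b)) (\<lambda>z b. z \<cdot> \<iota> b)"
  by (rule bimod_restrict[OF B.kalg_axioms alg_hom_iota T.bimod_regular])

text \<open>
  The coordinate functionals form the basis of \<open>I\<^bsub>s a\<^esub>\<close> that is dual to \<open>bas a 1\<close>.
\<close>

lemma cfun_expand:
  assumes a: "a \<in> F" and \<phi>: "\<phi> \<in> carrier (injV (s a))"
  shows "(\<Oplus>\<^bsub>injV (s a)\<^esub>p\<in>bas a \<one>\<^bsub>B\<^esub>. \<phi> p \<odot>\<^bsub>injV (s a)\<^esub> cfun a \<one>\<^bsub>B\<^esub> p) = \<phi>"
proof -
  have sv: "s a \<in> verts Q" using a by simp
  interpret X: vect "injV (s a)" by (rule vect_injV[OF sv])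
  interpret R: vect "rowV (s a)" by (rule vect_rowV[OF sv])
  note o = B.one_closed
  have oo: "\<one>\<^bsub>B\<^esub> \<otimes>\<^bsub>B\<^esub> \<one>\<^bsub>B\<^esub> = \<one>\<^bsub>B\<^esub>" by simp
  note fin = finite_bas[OF a o oo] and row = bas_row[OF a o oo]
  have mem: "(\<lambda>p. \<phi> p \<odot>\<^bsub>injV (s a)\<^esub> cfun a \<one>\<^bsub>B\<^esub> p) \<in> bas a \<one>\<^bsub>B\<^esub> \<rightarrow> carrier (injV (s a))"
    by (rule Pi_I, rule X.scal_closed, rule cfun_in[OF a o])
  have kR: "klin (rowV (s a)) B (\<lambda>u. u)" by (rule klinI) (use rowV_B[OF sv] in simp_all)
  have ext: "\<psi> \<in> extensional (carrier (rowV (s a)))" if "\<psi> \<in> carrier (injV (s a))" for \<psi>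
    using that by (simp add: inj_mod_simps lin_maps_iff)
  show ?thesis
  proof (rule extensionalityI[OF ext[OF X.finsum_closed[OF mem]] ext[OF \<phi>]])
    fix u assume u: "u \<in> carrier (rowV (s a))"
    have uB: "u \<in> carrier B" by (rule rowV_B[OF sv u])
    have gm: "(\<lambda>p. crd a \<one>\<^bsub>B\<^esub> p u \<odot>\<^bsub>rowV (s a)\<^esub> p) \<in> bas a \<one>\<^bsub>B\<^esub> \<rightarrow> carrier (rowV (s a))"
      by (rule Pi_I, rule R.scal_closed, rule row)
    have "u = (\<Oplus>\<^bsub>B\<^esub>p\<in>bas a \<one>\<^bsub>B\<^esub>. crd a \<one>\<^bsub>B\<^esub> p u \<odot>\<^bsub>B\<^esub> p)"
      using crd_rec[OF a o oo u] uB by simp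
    also have "\<dots> = (\<Oplus>\<^bsub>rowV (s a)\<^esub>p\<in>bas a \<one>\<^bsub>B\<^esub>. crd a \<one>\<^bsub>B\<^esub> p u \<odot>\<^bsub>rowV (s a)\<^esub> p)"
      using klin_finsum[OF R.vect_axioms B.vect_axioms kR fin gm] by simp
    finally have "\<phi> u = \<phi> (\<Oplus>\<^bsub>rowV (s a)\<^esub>p\<in>bas a \<one>\<^bsub>B\<^esub>. crd a \<one>\<^bsub>B\<^esub> p u \<odot>\<^bsub>rowV (s a)\<^esub> p)" by simp
    also have "\<dots> = (\<Oplus>\<^bsub>ground_space\<^esub>p\<in>bas a \<one>\<^bsub>B\<^esub>. \<phi> (crd a \<one>\<^bsub>B\<^esub> p u \<odot>\<^bsub>rowV (s a)\<^esub> p))"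
      by (rule klin_finsum[OF R.vect_axioms vect_ground_space injV_klin[OF \<phi>] fin gm])
    also have "\<dots> = (\<Oplus>\<^bsub>ground_space\<^esub>p\<in>bas a \<one>\<^bsub>B\<^esub>. (\<phi> p \<odot>\<^bsub>injV (s a)\<^esub> cfun a \<one>\<^bsub>B\<^esub> p) u)"
    proof (rule abelian_monoid.finsum_cong'[OF abelian_group.axioms(1)[OF vect.axioms(1)[OF vect_ground_space]] refl])
      fix p assume p: "p \<in> bas a \<one>\<^bsub>B\<^esub>"
      have "(\<phi> p \<odot>\<^bsub>injV (s a)\<^esub> cfun a \<one>\<^bsub>B\<^esub> p) u = \<phi> p * crd a \<one>\<^bsub>B\<^esub> p u"
        unfolding inj_scal[OF sv cfun_in[OF a o p]] using u uB by (simp add: cfun_def)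
      moreover have "\<phi> (crd a \<one>\<^bsub>B\<^esub> p u \<odot>\<^bsub>rowV (s a)\<^esub> p) = crd a \<one>\<^bsub>B\<^esub> p u * \<phi> p"
        using klin_scal[OF injV_klin[OF \<phi>] row[OF p]] by simp
      ultimately show "\<phi> (crd a \<one>\<^bsub>B\<^esub> p u \<odot>\<^bsub>rowV (s a)\<^esub> p) = (\<phi> p \<odot>\<^bsub>injV (s a)\<^esub> cfun a \<one>\<^bsub>B\<^esub> p) u"
        by (simp add: mult.commute)
    qed simp
    also have "\<dots> = (\<Oplus>\<^bsub>injV (s a)\<^esub>p\<in>bas a \<one>\<^bsub>B\<^esub>. \<phi> p \<odot>\<^bsub>injV (s a)\<^esub> cfun a \<one>\<^bsub>B\<^esub> p) u"
      by (rule klin_finsum[OF X.vect_axioms vect_ground_space inj_eval[OF sv u] fin mem, symmetric])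
    finally show "(\<Oplus>\<^bsub>injV (s a)\<^esub>p\<in>bas a \<one>\<^bsub>B\<^esub>. \<phi> p \<odot>\<^bsub>injV (s a)\<^esub> cfun a \<one>\<^bsub>B\<^esub> p) u = \<phi> u" by simp
  qed
qed

text \<open>
  The maps \<open>\<epsilon>\<close> and \<open>\<Theta> a\<close> are \<open>B\<close>-bilinear and jointly bijective. Since \<open>I\<^bsub>s a\<^esub>\<close> is the dual of the finite-dimensional
  space \<open>e\<^bsub>s a\<^esub> B\<close>, the space of linear maps out of it is \<open>T e\<^bsub>t a\<^esub> \<otimes>\<^sub>k e\<^bsub>s a\<^esub> B\<close>.
\<close>

lemma T_dims:
  assumes k: "\<And>a. a \<in> F \<Longrightarrow> kfin (YT (t a))"
  shows "kfin T \<and> chi B T (\<lambda>b. mult T (\<iota> b)) (\<lambda>z b. z \<cdot> \<iota> b) =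
    chi B B (mult B) (mult B) + (\<Sum>a\<in>F. \<chi> (s a) (t a))"
proof (rule chi_family[OF finite_F kfin_B T_bimod B.bimod_regular])
  note o = B.one_closed
  have oo: "\<one>\<^bsub>B\<^esub> \<otimes>\<^bsub>B\<^esub> \<one>\<^bsub>B\<^esub> = \<one>\<^bsub>B\<^esub>" by simp
  show "kfin B" by (rule kfin_B)
  show "bimod_map B T (\<lambda>b. mult T (\<iota> b)) (\<lambda>z b. z \<cdot> \<iota> b) B (mult B) (mult B) \<epsilon>"
    unfolding bimod_map_def using alg_hom_klin[OF alg_hom_eps] eps_iota_mult eps_mult_iota by simp
  { fix a assume a: "a \<in> F"
    have sv: "s a \<in> verts Q" and tv: "t a \<in> verts Q" using a by simp_all
    interpret X: lmod B "injV (s a)" "inj_act (s a)" by (rule bmod_inj_mod[OF sv])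
    show "bimod B (MT a) (hom_left (injV (s a)) (\<lambda>b. mult T (\<iota> b))) (hom_right (injV (s a)) (inj_act (s a)))"
      by (rule bimod_hom_k[OF X.lmod_axioms YB_lmod[OF tv]])
    show "kfin (MT a)" by (rule kfin_hom_k[OF X.V.vect_axioms YT_vect[OF tv] kfin_injV[OF sv] k[OF a]])
    have ext: "\<Theta> a z \<in> extensional (carrier (injV (s a)))" if "z \<in> carrier T" for z
      using klin_closed[OF klin_Theta[OF a] that] by (simp add: lin_maps_iff)
    show "bimod_map B T (\<lambda>b. mult T (\<iota> b)) (\<lambda>z b. z \<cdot> \<iota> b) (MT a)
        (hom_left (injV (s a)) (\<lambda>b. mult T (\<iota> b))) (hom_right (injV (s a)) (inj_act (s a))) (\<Theta> a)"
      unfolding bimod_map_def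
    proof (intro conjI ballI klin_Theta[OF a])
      fix b z assume b: "b \<in> carrier B" and z: "z \<in> carrier T"
      show "\<Theta> a (\<iota> b \<cdot> z) = hom_left (injV (s a)) (\<lambda>b. mult T (\<iota> b)) b (\<Theta> a z)"
        unfolding hom_left_def
        by (rule extensionalityI[OF ext restrict_extensional]) (use Theta_iota_mult[OF a b z] ic[OF b] z in \<open>simp_all del: underlying_space_simps\<close>)
      show "\<Theta> a (z \<cdot> \<iota> b) = hom_right (injV (s a)) (inj_act (s a)) (\<Theta> a z) b"
        unfolding hom_right_def
        by (rule extensionalityI[OF ext restrict_extensional]) (use Theta_mult_iota[OF a b z] ic[OF b] z in \<open>simp_all del: underlying_space_simps\<close>)
    qed
  }
  show "z = \<zero>\<^bsub>T\<^esub>" if z: "z \<in> carrier T" "\<epsilon> z = \<zero>\<^bsub>B\<^esub>" and th: "\<And>a. a \<in> F \<Longrightarrow> \<Theta> a z = \<zero>\<^bsub>MT a\<^esub>" for z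
  proof (rule split_inj[OF o oo z(1) _ z(2)])
    show "z \<cdot> \<iota> \<one>\<^bsub>B\<^esub> = z" using z(1) by (simp add: alg_hom_one[OF alg_hom_iota])
    show "\<Theta> a z (cfun a \<one>\<^bsub>B\<^esub> p) = \<zero>\<^bsub>T\<^esub>" if a: "a \<in> F" and p: "p \<in> bas a \<one>\<^bsub>B\<^esub>" for a p
      unfolding th[OF a] using cfun_in[OF a o p] by (simp del: underlying_space_simps(1))
  qed
  show "\<exists>z\<in>carrier T. \<epsilon> z = u \<and> (\<forall>a\<in>F. \<Theta> a z = w a)"
    if u: "u \<in> carrier B" and w: "\<And>a. a \<in> F \<Longrightarrow> w a \<in> carrier (MT a)" for u w
  proof -
    have kw: "klin (injV (s a)) (YT (t a)) (w a)" "w a \<in> extensional (carrier (injV (s a)))" if "a \<in> F" for a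
      using w[OF that] by (simp_all add: lin_maps_iff)
    have w': "w a (cfun a \<one>\<^bsub>B\<^esub> p) \<in> carrier (YT (t a))" if "a \<in> F" "p \<in> bas a \<one>\<^bsub>B\<^esub>" for a p
      by (rule klin_closed[OF kw(1)[OF that(1)] cfun_in[OF that(1) o that(2)]])
    note af = assemble_facts[OF o oo u, of "\<lambda>a p. w a (cfun a \<one>\<^bsub>B\<^esub> p)", OF w']
    let ?z = "assemble \<one>\<^bsub>B\<^esub> u (\<lambda>a p. w a (cfun a \<one>\<^bsub>B\<^esub> p))"
    have z: "?z \<in> carrier T" "\<epsilon> ?z = u" by (rule af(1), assumption+, rule af(3), assumption+)
    have "\<Theta> a ?z = w a" if a: "a \<in> F" for a
    proof (rule extensionalityI[OF _ kw(2)[OF a]])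
      have sv: "s a \<in> verts Q" and tv: "t a \<in> verts Q" using a by simp_all
      interpret X: vect "injV (s a)" by (rule vect_injV[OF sv])
      interpret Y: vect "YT (t a)" by (rule YT_vect[OF tv])
      show "\<Theta> a ?z \<in> extensional (carrier (injV (s a)))"
        using klin_closed[OF klin_Theta[OF a] z(1)] by (simp add: lin_maps_iff)
      fix \<phi> assume \<phi>: "\<phi> \<in> carrier (injV (s a))"
      note fin = finite_bas[OF a o oo]
      have mem: "(\<lambda>p. \<phi> p \<odot>\<^bsub>injV (s a)\<^esub> cfun a \<one>\<^bsub>B\<^esub> p) \<in> bas a \<one>\<^bsub>B\<^esub> \<rightarrow> carrier (injV (s a))"
        by (rule Pi_I, rule X.scal_closed, rule cfun_in[OF a o])
      have mY: "(\<lambda>p. \<phi> p \<odot>\<^bsub>YT (t a)\<^esub> w a (cfun a \<one>\<^bsub>B\<^esub> p)) \<in> bas a \<one>\<^bsub>B\<^esub> \<rightarrow> carrier (YT (t a))"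
        by (rule Pi_I, rule Y.scal_closed, rule w'[OF a])
      have "w a \<phi> = w a (\<Oplus>\<^bsub>injV (s a)\<^esub>p\<in>bas a \<one>\<^bsub>B\<^esub>. \<phi> p \<odot>\<^bsub>injV (s a)\<^esub> cfun a \<one>\<^bsub>B\<^esub> p)"
        unfolding cfun_expand[OF a \<phi>] ..
      also have "\<dots> = (\<Oplus>\<^bsub>YT (t a)\<^esub>p\<in>bas a \<one>\<^bsub>B\<^esub>. w a (\<phi> p \<odot>\<^bsub>injV (s a)\<^esub> cfun a \<one>\<^bsub>B\<^esub> p))"
        by (rule klin_finsum[OF X.vect_axioms Y.vect_axioms kw(1)[OF a] fin mem])
      also have "\<dots> = (\<Oplus>\<^bsub>YT (t a)\<^esub>p\<in>bas a \<one>\<^bsub>B\<^esub>. \<phi> p \<odot>\<^bsub>YT (t a)\<^esub> w a (cfun a \<one>\<^bsub>B\<^esub> p))"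
        by (rule Y.finsum_cong'[OF refl mY]) (rule klin_scal[OF kw(1)[OF a] cfun_in[OF a o]])
      also have "\<dots> = (\<Oplus>\<^bsub>T\<^esub>p\<in>bas a \<one>\<^bsub>B\<^esub>. \<phi> p \<odot>\<^bsub>YT (t a)\<^esub> w a (cfun a \<one>\<^bsub>B\<^esub> p))"
        by (rule klin_finsum[OF Y.vect_axioms T.vect_axioms klin_YT_T[OF tv] fin mY])
      also have "\<dots> = (\<Oplus>\<^bsub>T\<^esub>p\<in>bas a \<one>\<^bsub>B\<^esub>. \<phi> p \<odot>\<^bsub>T\<^esub> w a (cfun a \<one>\<^bsub>B\<^esub> p))"
        by (rule T.finsum_cong'[OF refl]) (use YT_T[OF tv w'[OF a]] YT_scal[OF tv w'[OF a]] in \<open>simp_all del: underlying_space_simps\<close>)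
      also have "\<dots> = \<Theta> a ?z \<phi>"
        by (rule af(4)[symmetric, OF _ _ a \<phi>])
      finally show "\<Theta> a ?z \<phi> = w a \<phi>" by simp
    qed
    then show ?thesis using z by blast
  qed
qed

abbreviation "\<D>T \<equiv> der_space T T (mult T) (mult T)"
abbreviation "\<D>B \<equiv> der_space B T (\<lambda>b. mult T (\<iota> b)) (\<lambda>z b. z \<cdot> \<iota> b)"

text \<open>
  A derivation of \<open>T\<close> is determined by its restriction to \<open>B\<close> and its values on the new arrows. The restriction
  is arbitrary, and it determines the value on \<open>a = e\<^bsub>t a\<^esub> a e\<^bsub>s a\<^esub>\<close> up to the component in \<open>e\<^bsub>t a\<^esub> T e\<^bsub>s a\<^esub>\<close>, which is
  again arbitrary.
\<close>

lemma derivs_T_dims: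
  assumes kT: "kfin T"
  shows "chi T T (mult T) (mult T) = chi B T (\<lambda>b. mult T (\<iota> b)) (\<lambda>z b. z \<cdot> \<iota> b) +
    (\<Sum>a\<in>F. int (kdim (E (t a) (s a))))"
proof -
  interpret TT: bimod T T "mult T" "mult T" by (rule T.bimod_regular)
  interpret BT: bimod B T "\<lambda>b. mult T (\<iota> b)" "\<lambda>z b. z \<cdot> \<iota> b" by (rule T_bimod)
  interpret DT: vect \<D>T by (rule TT.vect_der_space)
  interpret DB: vect \<D>B by (rule BT.vect_der_space)
  let ?g = "\<lambda>d. \<lambda>b\<in>carrier B. d (\<iota> b)"
  let ?f = "\<lambda>a d. \<iota> (e (t a)) \<cdot> d (\<alpha> a) \<cdot> \<iota> (e (s a))"
  note cl = derivs_closed[of _ T T "mult T" "mult T"]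
  have kg: "klin \<D>T \<D>B ?g"
  proof (rule klinI; unfold der_space_simps)
    fix d d' assume d: "d \<in> derivs T T (mult T) (mult T)"
    show "?g d \<in> derivs B T (\<lambda>b. mult T (\<iota> b)) (\<lambda>z b. z \<cdot> \<iota> b)"
      unfolding derivs_def
    proof (intro CollectI conjI ballI)
      show "klin B T (?g d)"
        using klin_compose[OF alg_hom_klin[OF alg_hom_iota] derivs_klin[OF d]] by (simp add: klin_restrict[OF B.vect_axioms])
      show "?g d (x \<otimes>\<^bsub>B\<^esub> y) = \<iota> x \<cdot> ?g d y \<oplus>\<^bsub>T\<^esub> ?g d x \<cdot> \<iota> y" if "x \<in> carrier B" "y \<in> carrier B" for x y
        using that derivs_mult[OF d ic[OF that(1)] ic[OF that(2)]] alg_hom_mult[OF alg_hom_iota that] by simp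
    qed simp
    show "?g (\<lambda>x\<in>carrier T. c \<odot>\<^bsub>T\<^esub> d x) = (\<lambda>x\<in>carrier B. c \<odot>\<^bsub>T\<^esub> ?g d x)" for c
      by (rule restrict_ext) simp
    assume d': "d' \<in> derivs T T (mult T) (mult T)"
    show "?g (\<lambda>x\<in>carrier T. d x \<oplus>\<^bsub>T\<^esub> d' x) = (\<lambda>x\<in>carrier B. ?g d x \<oplus>\<^bsub>T\<^esub> ?g d' x)"
      by (rule restrict_ext) simp
  qed
  have kf: "klin \<D>T (E (t a) (s a)) (?f a)" if a: "a \<in> F" for a
  proof (rule klinI)
    fix d d' assume "d \<in> carrier \<D>T"
    then have d: "d (\<alpha> a) \<in> carrier T" using cl[OF _ alpha_in[OF a]] by simp
    show "?f a d \<in> carrier (E (t a) (s a))" using d by (simp, intro exI[of _ "d (\<alpha> a)"]) simp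
    show "?f a (c \<odot>\<^bsub>\<D>T\<^esub> d) = c \<odot>\<^bsub>E (t a) (s a)\<^esub> ?f a d" for c
      using d a ie[OF s_in[OF a]] ie[OF t_in[OF a]] by (simp add: T.scal_mult_left T.scal_mult_right)
    assume "d' \<in> carrier \<D>T"
    then have d': "d' (\<alpha> a) \<in> carrier T" using cl[OF _ alpha_in[OF a]] by simp
    show "?f a (d \<oplus>\<^bsub>\<D>T\<^esub> d') = ?f a d \<oplus>\<^bsub>E (t a) (s a)\<^esub> ?f a d'"
      using d d' a ie[OF s_in[OF a]] ie[OF t_in[OF a]] by (simp add: T.l_distr T.r_distr)
  qed
  have fix_alpha: "d (\<alpha> a) = \<zero>\<^bsub>T\<^esub>"
    if d: "d \<in> derivs T T (mult T) (mult T)" and z: "\<And>b. b \<in> carrier B \<Longrightarrow> d (\<iota> b) = \<zero>\<^bsub>T\<^esub>" and a: "a \<in> F" and f0: "?f a d = \<zero>\<^bsub>T\<^esub>" for d a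
  proof -
    note c = alpha_in[OF a] ie[OF s_in[OF a]] ie[OF t_in[OF a]] cl[OF d alpha_in[OF a]]
    have "d (\<alpha> a) = d (\<iota> (e (t a)) \<cdot> (\<alpha> a \<cdot> \<iota> (e (s a))))"
      unfolding alpha_right[OF a] alpha_left[OF a] ..
    also have "\<dots> = \<iota> (e (t a)) \<cdot> d (\<alpha> a \<cdot> \<iota> (e (s a))) \<oplus>\<^bsub>T\<^esub> d (\<iota> (e (t a))) \<cdot> (\<alpha> a \<cdot> \<iota> (e (s a)))"
      by (rule derivs_mult[OF d c(3) T.m_closed[OF c(1,2)]])
    also have "d (\<alpha> a \<cdot> \<iota> (e (s a))) = \<alpha> a \<cdot> d (\<iota> (e (s a))) \<oplus>\<^bsub>T\<^esub> d (\<alpha> a) \<cdot> \<iota> (e (s a))"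
      by (rule derivs_mult[OF d c(1,2)])
    also have "\<iota> (e (t a)) \<cdot> (\<alpha> a \<cdot> d (\<iota> (e (s a))) \<oplus>\<^bsub>T\<^esub> d (\<alpha> a) \<cdot> \<iota> (e (s a))) \<oplus>\<^bsub>T\<^esub>
        d (\<iota> (e (t a))) \<cdot> (\<alpha> a \<cdot> \<iota> (e (s a))) = ?f a d"
      using c z[OF e_in[OF s_in[OF a]]] z[OF e_in[OF t_in[OF a]]] by (simp add: T.m_assoc)
    finally have "d (\<alpha> a) = ?f a d" .
    then show ?thesis using f0 by simp
  qed
  have "kfin \<D>T \<and> kdim \<D>T = kdim \<D>B + (\<Sum>a\<in>F. kdim (E (t a) (s a)))"
  proof (rule family_dim_plus[OF finite_F DT.vect_axioms DB.vect_axioms BT.kfin_der_space[OF kfin_B kT] kg])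
    fix a assume a: "a \<in> F"
    show "vect (E (t a) (s a))" by (rule E_vect[OF s_in[OF a] t_in[OF a]])
    show "kfin (E (t a) (s a))"
      by (rule kfin_subsp[OF T.vect_axioms T.subsp_sandwich[OF ie[OF t_in[OF a]] ie[OF s_in[OF a]]] kT])
    show "klin \<D>T (E (t a) (s a)) (?f a)" by (rule kf[OF a])
  next
    show "d = \<zero>\<^bsub>\<D>T\<^esub>" if d: "d \<in> carrier \<D>T" and g0: "?g d = \<zero>\<^bsub>\<D>B\<^esub>" and f0: "\<And>a. a \<in> F \<Longrightarrow> ?f a d = \<zero>\<^bsub>E (t a) (s a)\<^esub>" for d
    proof (rule deriv_unique[OF T.bimod_regular])
      show d': "d \<in> derivs T T (mult T) (mult T)" using d by simp
      show "\<zero>\<^bsub>\<D>T\<^esub> \<in> derivs T T (mult T) (mult T)" using DT.zero_closed unfolding der_space_simps(1) .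
      have z: "d (\<iota> b) = \<zero>\<^bsub>T\<^esub>" if "b \<in> carrier B" for b using fun_cong[OF g0, of b] that by simp
      show "d (\<iota> b) = \<zero>\<^bsub>\<D>T\<^esub> (\<iota> b)" if "b \<in> carrier B" for b using z[OF that] that by simp
      show "d (\<alpha> a) = \<zero>\<^bsub>\<D>T\<^esub> (\<alpha> a)" if a: "a \<in> F" for a
      proof -
        have "d (\<alpha> a) = \<zero>\<^bsub>T\<^esub>" by (rule fix_alpha[OF d' z a]) (use f0[OF a] in simp_all)
        then show ?thesis using a by simp
      qed
    qed
    show "\<exists>d\<in>carrier \<D>T. ?g d = u \<and> (\<forall>a\<in>F. ?f a d = w a)"
      if u: "u \<in> carrier \<D>B" and w: "\<And>a. a \<in> F \<Longrightarrow> w a \<in> carrier (E (t a) (s a))" for u w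
    proof -
      have u': "u \<in> derivs B T (\<lambda>b. mult T (\<iota> b)) (\<lambda>v b. v \<cdot> \<iota> b)" using u by simp
      obtain d1 where d1: "d1 \<in> derivs T T (mult T) (mult T)" "\<And>b. b \<in> carrier B \<Longrightarrow> d1 (\<iota> b) = u b"
        by (rule deriv_extend[OF T.bimod_regular u', of "\<lambda>a. \<zero>\<^bsub>T\<^esub>"]) simp_all
      \<comment> \<open>\<open>d1\<close> has the right restriction; \<open>v a\<close> is the correction of its component at \<open>a\<close>\<close>
      define v where "v a = w a \<ominus>\<^bsub>T\<^esub> ?f a d1" for a
      have wT: "w a \<in> carrier T" "\<iota> (e (t a)) \<cdot> w a = w a" "w a \<cdot> \<iota> (e (s a)) = w a" if "a \<in> F" for a
        using w[OF that] unfolding E_carrier[OF s_in[OF that] t_in[OF that]] YT_carrier[OF s_in[OF that]] by blast+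
      have fT: "?f a d1 \<in> carrier T" if a: "a \<in> F" for a using cl[OF d1(1) alpha_in[OF a]] a by simp
      have ff: "\<iota> (e (t a)) \<cdot> ?f a d = ?f a d" "?f a d \<cdot> \<iota> (e (s a)) = ?f a d"
        if a: "a \<in> F" and d: "d \<in> derivs T T (mult T) (mult T)" for a d
        using klin_closed[OF kf[OF a], of d] d unfolding E_carrier[OF s_in[OF a] t_in[OF a]] YT_carrier[OF s_in[OF a]] der_space_simps by blast+
      have vT: "v a \<in> carrier T" "\<iota> (e (t a)) \<cdot> v a = v a" "v a \<cdot> \<iota> (e (s a)) = v a" if a: "a \<in> F" for a
      proof -
        have kl: "klin T T (\<lambda>z. \<iota> (e (t a)) \<cdot> z)"
          by (rule klinI) (use ie[OF t_in[OF a]] in \<open>simp_all add: T.r_distr T.scal_mult_right\<close>)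
        have kr: "klin T T (\<lambda>z. z \<cdot> \<iota> (e (s a)))"
          by (rule klinI) (use ie[OF s_in[OF a]] in \<open>simp_all add: T.l_distr T.scal_mult_left\<close>)
        show "v a \<in> carrier T" unfolding v_def by (rule T.minus_closed[OF wT(1)[OF a] fT[OF a]])
        show "\<iota> (e (t a)) \<cdot> v a = v a"
          unfolding v_def klin_diff[OF T.vect_axioms T.vect_axioms kl wT(1)[OF a] fT[OF a]] wT(2)[OF a] ff(1)[OF a d1(1)] ..
        show "v a \<cdot> \<iota> (e (s a)) = v a"
          unfolding v_def klin_diff[OF T.vect_axioms T.vect_axioms kr wT(1)[OF a] fT[OF a]] wT(3)[OF a] ff(2)[OF a d1(1)] ..
      qed
      let ?v = "\<lambda>a. if a \<in> F then v a else \<zero>\<^bsub>T\<^esub>"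
      have z: "\<zero>\<^bsub>\<D>B\<^esub> \<in> derivs B T (\<lambda>b. mult T (\<iota> b)) (\<lambda>v b. v \<cdot> \<iota> b)"
        using DB.zero_closed unfolding der_space_simps(1) .
      have "\<exists>d2. d2 \<in> derivs T T (mult T) (mult T) \<and> (\<forall>b\<in>carrier B. d2 (\<iota> b) = \<zero>\<^bsub>T\<^esub>) \<and> (\<forall>a\<in>F. d2 (\<alpha> a) = v a)"
      proof (rule deriv_extend[OF T.bimod_regular z, of v])
        show "v a \<in> carrier T" if "a \<in> F" for a by (rule vT(1)[OF that])
        fix d assume d: "d \<in> derivs T T (mult T) (mult T)" and di: "\<And>b. b \<in> carrier B \<Longrightarrow> d (\<iota> b) = \<zero>\<^bsub>\<D>B\<^esub> b"
          and da: "\<And>a. a \<in> F \<Longrightarrow> (\<And>b. b \<in> carrier B \<Longrightarrow> \<zero>\<^bsub>\<D>B\<^esub> b = \<zero>\<^bsub>T\<^esub>) \<Longrightarrow>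
            d (\<alpha> a) = \<iota> (e (t a)) \<cdot> v a \<cdot> \<iota> (e (s a))"
        show ?thesis
        proof (intro exI[of _ d] conjI ballI d)
          show "d (\<iota> b) = \<zero>\<^bsub>T\<^esub>" if "b \<in> carrier B" for b using di[OF that] that by simp
          show "d (\<alpha> a) = v a" if a: "a \<in> F" for a
          proof -
            have "d (\<alpha> a) = \<iota> (e (t a)) \<cdot> v a \<cdot> \<iota> (e (s a))" by (rule da[OF a]) simp
            then show ?thesis unfolding vT(2,3)[OF a] .
          qed
        qed
      qed
      then obtain d2 where d2: "d2 \<in> derivs T T (mult T) (mult T)" "\<forall>b\<in>carrier B. d2 (\<iota> b) = \<zero>\<^bsub>T\<^esub>"
        "\<forall>a\<in>F. d2 (\<alpha> a) = v a" by blast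
      have c: "d1 \<in> carrier \<D>T" "d2 \<in> carrier \<D>T" using d1(1) d2(1) by simp_all
      have g1: "?g d1 = u" by (rule extensionalityI[OF restrict_extensional derivs_ext[OF u']]) (simp add: d1(2))
      have g2: "?g d2 = \<zero>\<^bsub>\<D>B\<^esub>" using d2(2) by (auto intro: restrict_ext)
      have "?g (d1 \<oplus>\<^bsub>\<D>T\<^esub> d2) = u" unfolding klin_add[OF kg c] g1 g2 by (rule DB.r_zero[OF u])
      moreover have "?f a (d1 \<oplus>\<^bsub>\<D>T\<^esub> d2) = w a" if a: "a \<in> F" for a
      proof -
        have "?f a (d1 \<oplus>\<^bsub>\<D>T\<^esub> d2) = ?f a d1 \<oplus>\<^bsub>T\<^esub> ?f a d2" using klin_add[OF kf[OF a] c] by simp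
        also have "?f a d2 = v a" using bspec[OF d2(3) a] vT(2,3)[OF a] by simp
        finally show ?thesis unfolding v_def a_minus_def using wT(1)[OF a] fT[OF a] by (simp add: T.a_lcomm T.r_neg)
      qed
      ultimately show ?thesis using DT.a_closed[OF c] by blast
    qed
  qed
  then show ?thesis by (simp add: chi_def)
qed

end

section \<open>Relative paths\<close>

context arrow_extension
begin

abbreviation "\<R> \<equiv> rel_paths Q I F s t"
abbreviation "nz \<equiv> peirce_nonzero Q I"
abbreviation "\<rho> \<equiv> rel_dim Q I s t"

lemma rel_paths_Cons: "a # \<gamma> \<in> \<R> \<longleftrightarrow> a \<in> F \<and> (\<gamma> = [] \<or> \<gamma> \<in> \<R> \<and> nz (s (hd \<gamma>)) (t a))"
proof (cases \<gamma>)
  case Nil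
  then show ?thesis by (simp add: rel_paths_def)
next
  case (Cons b \<delta>)
  have all: "(\<forall>i. P i) \<longleftrightarrow> P 0 \<and> (\<forall>i. P (Suc i))" for P :: "nat \<Rightarrow> bool" by (metis not0_implies_Suc)
  show ?thesis
    using all[of "\<lambda>i. Suc i < length (a # b # \<delta>) \<longrightarrow> nz (s ((a # b # \<delta>) ! Suc i)) (t ((a # b # \<delta>) ! i))"] Cons
    by (auto simp: rel_paths_def)
qed

lemma rel_paths_set: "\<gamma> \<in> \<R> \<Longrightarrow> \<gamma> \<noteq> [] \<and> set \<gamma> \<subseteq> F"
  by (simp add: rel_paths_def)

lemma rel_paths_ends: "\<gamma> \<in> \<R> \<Longrightarrow> hd \<gamma> \<in> F" "\<gamma> \<in> \<R> \<Longrightarrow> last \<gamma> \<in> F"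
  using rel_paths_set hd_in_set last_in_set by blast+

lemma rel_dim_Cons: "\<gamma> \<noteq> [] \<Longrightarrow> \<rho> (a # \<gamma>) = \<d> (s (hd \<gamma>)) (t a) * \<rho> \<gamma>"
  by (cases \<gamma>) (simp_all add: rel_dim_def prod.lessThan_Suc_shift del: prod.lessThan_Suc)

text \<open>
  Oriented so that wellfounded induction at \<open>a\<close> may use the new arrows that can follow \<open>a\<close> in a relative path.
\<close>

definition link where "link = {(a', a). a \<in> F \<and> a' \<in> F \<and> nz (s a') (t a)}"

lemma trancl_link: "(b, a) \<in> link\<^sup>+ \<Longrightarrow> \<exists>\<gamma>. \<gamma> \<in> \<R> \<and> hd \<gamma> = a \<and> nz (s b) (t (last \<gamma>))"
proof (induction rule: trancl_induct)
  case (base a)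
  then show ?case by (intro exI[of _ "[a]"]) (simp add: rel_paths_Cons link_def)
next
  case (step c a)
  then obtain \<gamma> where \<gamma>: "\<gamma> \<in> \<R>" "hd \<gamma> = c" "nz (s b) (t (last \<gamma>))" by blast
  then show ?case using step.hyps(2) rel_paths_set[OF \<gamma>(1)]
    by (intro exI[of _ "a # \<gamma>"]) (simp add: rel_paths_Cons link_def)
qed

end

locale acyclic_arrow_extension = arrow_extension Q I F s t
  for Q :: "('v, 'a) pre_digraph" and I :: "(('v, 'a) path \<Rightarrow> 'k::field) set" and F :: "'f set" and s t :: "'f \<Rightarrow> 'v" +
  assumes no_cycles: "rel_cycles Q I F s t = {}"
begin

text \<open>
  A cycle of this relation would give a relative cycle.
\<close>

lemma wf_link: "wf link"
proof (rule finite_acyclic_wf)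
  show "finite link" by (rule finite_subset[of _ "F \<times> F"]) (auto simp: link_def)
  have "(a, a) \<notin> link\<^sup>+" for a
  proof
    assume "(a, a) \<in> link\<^sup>+"
    from trancl_link[OF this] obtain \<gamma> where "\<gamma> \<in> \<R>" "hd \<gamma> = a" "nz (s a) (t (last \<gamma>))" by blast
    then have "\<gamma> \<in> rel_cycles Q I F s t" by (simp add: rel_cycles_def rel_src_def rel_tgt_def)
    then show False using no_cycles by simp
  qed
  then show "acyclic link" by (simp add: acyclic_def)
qed

lemma J_link: "a \<in> F \<Longrightarrow> j \<in> \<J> (t a) \<Longrightarrow> (fst j, a) \<in> link"
proof -
  assume a: "a \<in> F" and j: "j \<in> \<J> (t a)"
  note jF = J_F[OF j] and tv = t_in[OF a]
  have "snd j \<in> bas (fst j) (e (t a))" using j by auto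
  then have "card (bas (fst j) (e (t a))) \<noteq> 0" using finite_bas[OF jF e_in[OF tv] e_idem[OF tv]] by auto
  then have "nz (s (fst j)) (t a)" using peirce_dim_zero_iff[OF s_in[OF jF] tv] card_bas[OF jF tv] by simp
  then show ?thesis using a jF by (simp add: link_def)
qed

lemma kfin_YT_t: "a \<in> F \<Longrightarrow> kfin (YT (t a))"
proof (induction a rule: wf_induct_rule[OF wf_link])
  case (1 a)
  have "kfin (YT (t (fst j)))" if "j \<in> \<J> (t a)" for j
    by (rule 1(1)[OF J_link[OF 1(2) that] J_F[OF that]])
  from YT_dims[OF t_in[OF 1(2)] t_in[OF 1(2)] this] show ?case by blast
qed

lemma kfin_YT: "x \<in> verts Q \<Longrightarrow> kfin (YT x)"
  using YT_dims[of x x] kfin_YT_t[OF J_F] by blast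

lemma chi_rec: "x \<in> verts Q \<Longrightarrow> y \<in> verts Q \<Longrightarrow> \<chi> y x = \<chi>\<^sub>0 y x + (\<Sum>a\<in>F. int (\<d> (s a) x) * \<chi> y (t a))"
  using YT_dims[of x y] kfin_YT_t[OF J_F] by blast

text \<open>
  A relative path that starts with \<open>a\<close> is either \<open>[a]\<close> or \<open>a\<close> followed by a relative path that starts with a
  successor of \<open>a\<close>, so wellfounded induction unfolds the recursion.
\<close>

lemma path_sum:
  fixes G w :: "'f \<Rightarrow> int"
  assumes rec: "\<And>a. a \<in> F \<Longrightarrow> G a = w a + (\<Sum>a'\<in>F. int (\<d> (s a') (t a)) * G a')" and a: "a \<in> F"
  shows "finite {\<gamma>. \<gamma> \<in> \<R> \<and> hd \<gamma> = a} \<and> G a = (\<Sum>\<gamma> | \<gamma> \<in> \<R> \<and> hd \<gamma> = a. int (\<rho> \<gamma>) * w (last \<gamma>))"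
  using a
proof (induction a rule: wf_induct_rule[OF wf_link])
  case (1 a)
  let ?R = "\<lambda>a. {\<gamma>. \<gamma> \<in> \<R> \<and> hd \<gamma> = a}" and ?N = "{a' \<in> F. nz (s a') (t a)}"
  let ?h = "\<lambda>\<gamma>. int (\<rho> \<gamma>) * w (last \<gamma>)"
  have IH: "finite (?R a')" "G a' = (\<Sum>\<gamma>\<in>?R a'. ?h \<gamma>)" if "a' \<in> ?N" for a'
    using 1(1)[of a'] that 1(2) by (simp_all add: link_def)
  have R_eq: "?R a = insert [a] (\<Union>a'\<in>?N. (#) a ` ?R a')"
  proof (intro equalityI subsetI)
    fix \<gamma> assume \<gamma>: "\<gamma> \<in> ?R a"
    then obtain \<delta> where \<delta>: "\<gamma> = a # \<delta>" using rel_paths_set[of \<gamma>] by (cases \<gamma>) auto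
    show "\<gamma> \<in> insert [a] (\<Union>a'\<in>?N. (#) a ` ?R a')"
    proof (cases "\<delta> = []")
      case False
      then have "\<delta> \<in> \<R>" "nz (s (hd \<delta>)) (t a)" using \<gamma> \<delta> rel_paths_Cons by auto
      then show ?thesis using \<delta> rel_paths_ends(1) by auto
    qed (use \<delta> in simp)
  next
    fix \<gamma> assume "\<gamma> \<in> insert [a] (\<Union>a'\<in>?N. (#) a ` ?R a')"
    then show "\<gamma> \<in> ?R a" using 1(2) by (auto simp: rel_paths_Cons)
  qed
  have fN: "finite ?N" by simp
  have fU: "finite (\<Union>a'\<in>?N. (#) a ` ?R a')" using fN IH(1) by blast
  have na: "[a] \<notin> (\<Union>a'\<in>?N. (#) a ` ?R a')" using rel_paths_set by auto
  have "(\<Sum>\<gamma>\<in>?R a. ?h \<gamma>) = ?h [a] + (\<Sum>\<gamma>\<in>(\<Union>a'\<in>?N. (#) a ` ?R a'). ?h \<gamma>)"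
    unfolding R_eq by (rule sum.insert[OF fU na])
  also have "?h [a] = w a" by (simp add: rel_dim_def)
  also have "(\<Sum>\<gamma>\<in>(\<Union>a'\<in>?N. (#) a ` ?R a'). ?h \<gamma>) = (\<Sum>a'\<in>?N. \<Sum>\<gamma>\<in>(#) a ` ?R a'. ?h \<gamma>)"
    by (rule sum.UNION_disjoint[OF fN]) (use IH(1) in auto)
  also have "\<dots> = (\<Sum>a'\<in>?N. int (\<d> (s a') (t a)) * G a')"
  proof (rule sum.cong[OF refl])
    fix a' assume a': "a' \<in> ?N"
    have "(\<Sum>\<gamma>\<in>(#) a ` ?R a'. ?h \<gamma>) = (\<Sum>\<gamma>\<in>?R a'. ?h (a # \<gamma>))" by (subst sum.reindex) simp_all
    also have "\<dots> = (\<Sum>\<gamma>\<in>?R a'. int (\<d> (s a') (t a)) * ?h \<gamma>)"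
      by (rule sum.cong[OF refl]) (use rel_paths_set in \<open>auto simp: rel_dim_Cons\<close>)
    also have "\<dots> = int (\<d> (s a') (t a)) * G a'" unfolding IH(2)[OF a'] by (simp add: sum_distrib_left)
    finally show "(\<Sum>\<gamma>\<in>(#) a ` ?R a'. ?h \<gamma>) = int (\<d> (s a') (t a)) * G a'" .
  qed
  also have "\<dots> = (\<Sum>a'\<in>F. int (\<d> (s a') (t a)) * G a')"
    by (rule sum.mono_neutral_left) (use peirce_dim_zero_iff[OF s_in t_in[OF 1(2)]] in auto)
  finally have sum: "(\<Sum>\<gamma>\<in>?R a. ?h \<gamma>) = w a + (\<Sum>a'\<in>F. int (\<d> (s a') (t a)) * G a')" .
  have "finite (?R a)" unfolding R_eq using fU by simp
  then show ?case by (rule conjI) (rule trans[OF rec[OF 1(2)] sum[symmetric]])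
qed

lemma finite_rel_paths: "finite \<R>"
proof -
  \<comment> \<open>finiteness is extracted from the recursion with \<open>w = 0\<close>, which \<open>0\<close> solves\<close>
  have "\<exists>G::'f \<Rightarrow> int. \<forall>a\<in>F. G a = 0 + (\<Sum>a'\<in>F. int (\<d> (s a') (t a)) * G a')" by (rule exI[of _ "\<lambda>_. 0"]) simp
  then obtain G :: "'f \<Rightarrow> int" where G: "\<forall>a\<in>F. G a = 0 + (\<Sum>a'\<in>F. int (\<d> (s a') (t a)) * G a')" by blast
  have "finite {\<gamma>. \<gamma> \<in> \<R> \<and> hd \<gamma> = a}" if "a \<in> F" for a
    using path_sum[of G "\<lambda>_. 0", OF bspec[OF G] that] by blast
  moreover have "\<R> = (\<Union>a\<in>F. {\<gamma>. \<gamma> \<in> \<R> \<and> hd \<gamma> = a})" using rel_paths_ends(1) by blast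
  ultimately show ?thesis by (metis (no_types, lifting) finite_F finite_UN_I)
qed

lemma sum_rel_paths: "(\<Sum>a\<in>F. \<Sum>\<gamma> | \<gamma> \<in> \<R> \<and> hd \<gamma> = a. h \<gamma>) = (\<Sum>\<gamma>\<in>\<R>. h \<gamma>)"
  by (rule sum.group) (use finite_rel_paths rel_paths_ends(1) in auto)

lemma chi_paths: "(\<Sum>a\<in>F. \<chi> (s a) (t a)) = (\<Sum>\<gamma>\<in>\<R>. int (\<rho> \<gamma>) * \<chi>\<^sub>0 (rel_src s \<gamma>) (rel_tgt t \<gamma>))"
proof -
  have "\<chi> (s a) (t a) = (\<Sum>\<gamma> | \<gamma> \<in> \<R> \<and> hd \<gamma> = a. int (\<rho> \<gamma>) * \<chi>\<^sub>0 (rel_src s \<gamma>) (rel_tgt t \<gamma>))" if a: "a \<in> F" for a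
  proof -
    have "\<chi> (s a) (t a) = (\<Sum>\<gamma> | \<gamma> \<in> \<R> \<and> hd \<gamma> = a. int (\<rho> \<gamma>) * \<chi>\<^sub>0 (s a) (t (last \<gamma>)))"
      by (rule conjunct2[OF path_sum[of "\<lambda>b. \<chi> (s a) (t b)" "\<lambda>b. \<chi>\<^sub>0 (s a) (t b)", OF chi_rec[OF t_in s_in[OF a]] a]])
    also have "\<dots> = (\<Sum>\<gamma> | \<gamma> \<in> \<R> \<and> hd \<gamma> = a. int (\<rho> \<gamma>) * \<chi>\<^sub>0 (rel_src s \<gamma>) (rel_tgt t \<gamma>))"
      by (rule sum.cong[OF refl]) (auto simp: rel_src_def rel_tgt_def)
    finally show ?thesis .
  qed
  then have "(\<Sum>a\<in>F. \<chi> (s a) (t a)) = (\<Sum>a\<in>F. \<Sum>\<gamma> | \<gamma> \<in> \<R> \<and> hd \<gamma> = a. int (\<rho> \<gamma>) * \<chi>\<^sub>0 (rel_src s \<gamma>) (rel_tgt t \<gamma>))"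
    by (rule sum.cong[OF refl])
  then show ?thesis unfolding sum_rel_paths .
qed

lemma chi0_Ext: "x \<in> verts Q \<Longrightarrow> y \<in> verts Q \<Longrightarrow>
  \<chi>\<^sub>0 y x = int (kdim (Ext1 B (inj_mod Q I y) (proj_mod Q I x))) - int (kdim (Hom_space B (inj_mod Q I y) (proj_mod Q I x)))"
proof -
  assume x: "x \<in> verts Q" and y: "y \<in> verts Q"
  have "two_bmods B (inj_mod Q I y) (col_mod B (e x))"
    by (rule two_bmods.intro[OF B.kalg_axioms bmod_inj_mod[OF y] B.bmod_col_mod[OF e_in[OF x]]])
  from two_bmods.chi_hom_k_eq_Ext1_Hom[OF this kfin_B kfin_injV[OF y] kfin_UB[OF x]]
  show ?thesis unfolding proj_mod_eq col_mod_simps(4) .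
qed

lemma E_paths:
  assumes x: "x \<in> verts Q" and y: "y \<in> verts Q"
  shows "int (kdim (E y x)) = int (\<d> y x) + (\<Sum>\<gamma>\<in>\<R>. int (\<d> y (rel_tgt t \<gamma>) * \<rho> \<gamma> * \<d> (rel_src s \<gamma>) x))"
proof -
  have E: "int (kdim (E y v)) = int (\<d> y v) + (\<Sum>a\<in>F. int (\<d> (s a) v) * int (kdim (E y (t a))))" if "v \<in> verts Q" for v
    using E_dims[OF that y kfin_YT] by blast
  have "int (\<d> (s a) x) * int (kdim (E y (t a))) =
      (\<Sum>\<gamma> | \<gamma> \<in> \<R> \<and> hd \<gamma> = a. int (\<d> y (rel_tgt t \<gamma>) * \<rho> \<gamma> * \<d> (rel_src s \<gamma>) x))" if a: "a \<in> F" for a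
  proof -
    have "int (kdim (E y (t a))) = (\<Sum>\<gamma> | \<gamma> \<in> \<R> \<and> hd \<gamma> = a. int (\<rho> \<gamma>) * int (\<d> y (t (last \<gamma>))))"
      by (rule conjunct2[OF path_sum[of "\<lambda>b. int (kdim (E y (t b)))" "\<lambda>b. int (\<d> y (t b))", OF E[OF t_in] a]])
    then have "int (\<d> (s a) x) * int (kdim (E y (t a))) =
      (\<Sum>\<gamma> | \<gamma> \<in> \<R> \<and> hd \<gamma> = a. int (\<d> (s a) x) * (int (\<rho> \<gamma>) * int (\<d> y (t (last \<gamma>)))))" by (simp only: sum_distrib_left)
    also have "\<dots> = (\<Sum>\<gamma> | \<gamma> \<in> \<R> \<and> hd \<gamma> = a. int (\<d> y (rel_tgt t \<gamma>) * \<rho> \<gamma> * \<d> (rel_src s \<gamma>) x))"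
      by (rule sum.cong[OF refl]) (auto simp: rel_src_def rel_tgt_def)
    finally show ?thesis .
  qed
  then have "(\<Sum>a\<in>F. int (\<d> (s a) x) * int (kdim (E y (t a)))) =
      (\<Sum>a\<in>F. \<Sum>\<gamma> | \<gamma> \<in> \<R> \<and> hd \<gamma> = a. int (\<d> y (rel_tgt t \<gamma>) * \<rho> \<gamma> * \<d> (rel_src s \<gamma>) x))"
    by (rule sum.cong[OF refl])
  then show ?thesis unfolding sum_rel_paths using E[OF x] by simp
qed

text \<open>
  For relative paths that do not extend to \<open>(y, \<gamma>, x)\<close> the product of dimensions is \<open>0\<close>, so the sum may run
  over all relative paths.
\<close>

lemma ext_rel_paths_sum:
  assumes x: "x \<in> verts Q" and y: "y \<in> verts Q"
  shows "(\<Sum>\<gamma> | (y, \<gamma>, x) \<in> ext_rel_paths Q I F s t. int (ext_rel_dim Q I s t (y, \<gamma>, x))) = int (kdim (E y x))"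
proof -
  let ?P = "{\<gamma>. (y, \<gamma>, x) \<in> ext_rel_paths Q I F s t}"
  have n: "[] \<notin> \<R>" by (simp add: rel_paths_def)
  have v: "rel_src s \<gamma> \<in> verts Q" "rel_tgt t \<gamma> \<in> verts Q" if "\<gamma> \<in> \<R>" for \<gamma>
    using rel_paths_ends[OF that] by (simp_all add: rel_src_def rel_tgt_def)
  have P: "\<gamma> \<in> ?P \<longleftrightarrow> (\<gamma> = [] \<and> nz y x) \<or> (\<gamma> \<in> \<R> \<and> nz y (rel_tgt t \<gamma>) \<and> nz (rel_src s \<gamma>) x)" for \<gamma>
    using x y by (auto simp: ext_rel_paths_def)
  have "(\<Sum>\<gamma>\<in>?P. int (ext_rel_dim Q I s t (y, \<gamma>, x))) = (\<Sum>\<gamma>\<in>insert [] \<R>. int (ext_rel_dim Q I s t (y, \<gamma>, x)))"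
  proof (rule sum.mono_neutral_left)
    show "finite (insert [] \<R>)" using finite_rel_paths by simp
    show "?P \<subseteq> insert [] \<R>" using P by blast
    show "\<forall>\<gamma>\<in>insert [] \<R> - ?P. int (ext_rel_dim Q I s t (y, \<gamma>, x)) = 0"
    proof
      fix \<gamma> assume \<gamma>: "\<gamma> \<in> insert [] \<R> - ?P"
      show "int (ext_rel_dim Q I s t (y, \<gamma>, x)) = 0"
      proof (cases "\<gamma> = []")
        case True
        then show ?thesis using \<gamma> P peirce_dim_zero_iff[OF y x] by simp
      next
        case False
        then have g: "\<gamma> \<in> \<R>" "\<not> (nz y (rel_tgt t \<gamma>) \<and> nz (rel_src s \<gamma>) x)" using \<gamma> P by blast+
        then show ?thesis
          using False peirce_dim_zero_iff[OF y v(2)[OF g(1)]] peirce_dim_zero_iff[OF v(1)[OF g(1)] x] by auto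
      qed
    qed
  qed
  also have "\<dots> = int (\<d> y x) + (\<Sum>\<gamma>\<in>\<R>. int (ext_rel_dim Q I s t (y, \<gamma>, x)))"
    by (rule sum.insert[OF finite_rel_paths n, THEN trans]) simp
  also have "(\<Sum>\<gamma>\<in>\<R>. int (ext_rel_dim Q I s t (y, \<gamma>, x))) = (\<Sum>\<gamma>\<in>\<R>. int (\<d> y (rel_tgt t \<gamma>) * \<rho> \<gamma> * \<d> (rel_src s \<gamma>) x))"
    by (rule sum.cong[OF refl]) (use n in auto)
  finally show ?thesis unfolding E_paths[OF x y] .
qed

lemma parallel_pairs_sum:
  "(\<Sum>(a, \<omega>)\<in>parallel_pairs Q I F s t. int (ext_rel_dim Q I s t \<omega>)) = (\<Sum>a\<in>F. int (kdim (E (t a) (s a))))"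
proof -
  let ?P = "\<lambda>a. {\<gamma>. (t a, \<gamma>, s a) \<in> ext_rel_paths Q I F s t}"
  let ?h = "\<lambda>(a, \<gamma>). (a, t a, \<gamma>, s a)"
  have fin: "finite (?P a)" for a
    by (rule finite_subset[of _ "insert [] \<R>"]) (use finite_rel_paths in \<open>auto simp: ext_rel_paths_def\<close>)
  have "parallel_pairs Q I F s t = ?h ` Sigma F ?P"
    by (auto simp: parallel_pairs_def image_iff)
  moreover have "inj_on ?h (Sigma F ?P)" by (auto simp: inj_on_def)
  ultimately have "(\<Sum>(a, \<omega>)\<in>parallel_pairs Q I F s t. int (ext_rel_dim Q I s t \<omega>)) =
      (\<Sum>j\<in>Sigma F ?P. (\<lambda>(a, \<omega>). int (ext_rel_dim Q I s t \<omega>)) (?h j))"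
    by (simp only: sum.reindex o_def)
  also have "\<dots> = (\<Sum>(a, \<gamma>)\<in>Sigma F ?P. int (ext_rel_dim Q I s t (t a, \<gamma>, s a)))"
    by (rule sum.cong[OF refl]) (simp add: case_prod_beta del: ext_rel_dim.simps)
  also have "\<dots> = (\<Sum>a\<in>F. \<Sum>\<gamma>\<in>?P a. int (ext_rel_dim Q I s t (t a, \<gamma>, s a)))"
    by (rule sum.Sigma[symmetric]) (use fin in simp_all)
  also have "\<dots> = (\<Sum>a\<in>F. int (kdim (E (t a) (s a))))"
    by (rule sum.cong[OF refl]) (rule ext_rel_paths_sum[OF s_in t_in])
  finally show ?thesis .
qed

theorem HH1_difference:
  "int (kdim (HH1 T)) - int (kdim (HH1 B)) = int (kdim (alg_center T)) - int (kdim (alg_center B))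
    + (\<Sum>(a, \<omega>)\<in>parallel_pairs Q I F s t. int (ext_rel_dim Q I s t \<omega>))
    + (\<Sum>\<gamma>\<in>\<R>. int (\<rho> \<gamma>) *
        (int (kdim (Ext1 B (inj_mod Q I (rel_src s \<gamma>)) (proj_mod Q I (rel_tgt t \<gamma>))))
         - int (kdim (Hom_space B (inj_mod Q I (rel_src s \<gamma>)) (proj_mod Q I (rel_tgt t \<gamma>))))))"
proof -
  have T: "kfin T" "chi B T (\<lambda>b. mult T (\<iota> b)) (\<lambda>z b. z \<cdot> \<iota> b) = chi B B (mult B) (mult B) + (\<Sum>a\<in>F. \<chi> (s a) (t a))"
    using T_dims[OF kfin_YT_t] by blast+
  have "(\<Sum>\<gamma>\<in>\<R>. int (\<rho> \<gamma>) * \<chi>\<^sub>0 (rel_src s \<gamma>) (rel_tgt t \<gamma>)) = (\<Sum>\<gamma>\<in>\<R>. int (\<rho> \<gamma>) *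
        (int (kdim (Ext1 B (inj_mod Q I (rel_src s \<gamma>)) (proj_mod Q I (rel_tgt t \<gamma>))))
         - int (kdim (Hom_space B (inj_mod Q I (rel_src s \<gamma>)) (proj_mod Q I (rel_tgt t \<gamma>))))))" (is "_ = ?R")
    by (rule sum.cong[OF refl]) (use rel_paths_ends in \<open>simp add: chi0_Ext rel_src_def rel_tgt_def\<close>)
  then have "(\<Sum>a\<in>F. \<chi> (s a) (t a)) = ?R" unfolding chi_paths .
  then show ?thesis
    using T.kdim_HH1[OF T(1)] B.kdim_HH1[OF kfin_B] derivs_T_dims[OF T(1)] T(2) parallel_pairs_sum by linarith
qed

end

theorem theorem4p2:
  fixes Q :: "('v, 'a) pre_digraph"
    and I :: "(('v, 'a) path \<Rightarrow> 'k::field) set"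
    and F :: "'f set" and s t :: "'f \<Rightarrow> 'v"
  assumes "fin_digraph Q"
    and "admissible Q I"
    and "new_arrows Q F s t"
    and "rel_cycles Q I F s t = {}"
  shows "let B = bound_alg Q I; B\<^sub>F = ext_alg Q I F s t in
    int (kdim (HH1 B\<^sub>F)) - int (kdim (HH1 B)) =
      int (kdim (alg_center B\<^sub>F)) - int (kdim (alg_center B))
      + (\<Sum>(a, \<omega>)\<in>parallel_pairs Q I F s t. int (ext_rel_dim Q I s t \<omega>))
      + (\<Sum>\<gamma>\<in>rel_paths Q I F s t. int (rel_dim Q I s t \<gamma>) *
          (int (kdim (Ext1 B (inj_mod Q I (rel_src s \<gamma>)) (proj_mod Q I (rel_tgt t \<gamma>))))
           - int (kdim (Hom_space B (inj_mod Q I (rel_src s \<gamma>)) (proj_mod Q I (rel_tgt t \<gamma>))))))"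
proof -
  interpret acyclic_arrow_extension Q I F s t
    by (intro acyclic_arrow_extension.intro arrow_extension.intro bound_quiver.intro
        bound_quiver_axioms.intro arrow_extension_axioms.intro acyclic_arrow_extension_axioms.intro assms)
  show ?thesis unfolding Let_def by (rule HH1_difference)
qed

end
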